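(* Let $G_1$ be a $2$-edge-connected graph such that $L(G_1)$ contains at least two circuits. Let $G_2$ be a graph with $L(G_1)=L(G_2)$. Then at least one of the following holds. (1) $G_1$ and $G_2$ are $2$-isomorphic. (2) There are graphs $H_1$ and $H_2$, each a subdivision of $K_4$, such that $G_i$ is $2$-isomorphic to $H_i$ for each $i\in\{1,2\}$, and the edge set of each ear of $H_1$ is also the edge set of an ear of $H_2$. (3) For some $m\in\{1,2\}$ and some $n\ge 2$ there are graphs $H_1$ and $H_2$, each a subdivision of $K_3^{m,2,n}$, such that $G_i$ is $2$-isomorphic to $H_i$ for each $i\in\{1,2\}$, and the edge set of each ear of $H_1$ is also the edge set of an ear of $H_2$. Moreover, when $n\ge 3$, the $n$ ears of $H_1$ having the same ends (those replacing the $n$ parallel edges of $K_3^{m,2,n}$) also have the same ends in $H_2$. (4) There is an exceptional pair $\{H_1,H_2\}$ of graphs (of type (a), (b) or (c), as defined in the context) such that $G_i$ is $2$-isomorphic to $H_i$ for each $i\in\{1,2\}$.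
   Context: Graphs are finite and may have loops and parallel edges; edges are labelled, and graphs on the same edge set are compared with their edge labels. For $X\subseteq E(G)$, $G|X$ is the subgraph of $G$ with edge set $X$ and no isolated vertices. A set $X\subseteq E(G)$ is a cycle if $G|X$ is a connected $2$-regular graph (so a loop is a cycle, and so is a pair of parallel edges). The bicircular lift matroid $L(G)$ is the matroid on $E(G)$ whose circuits are the edge sets of those subgraphs of $G$ that contain at least two cycles and are minimal with respect to this property. The equality $L(G_1)=L(G_2)$ means equality as matroids on the common edge set $E(G_1)=E(G_2)$. A graph is $2$-edge-connected if each of its edges is contained in some cycle. Whitney switching: if $(X_1,X_2)$ is a partition of $E(G)$ with $V(G|X_1)\cap V(G|X_2)=\{u_1,u_2\}$, then $G'$ is obtained by a Whitney switching on $\{u_1,u_2\}$ if $G'$ is obtained by identifying the vertices $u_1,u_2$ of $G|X_1$ with the vertices $u_2,u_1$ of $G|X_2$, respectively. A graph $G'$ is $2$-isomorphic to $G$ if it is obtained from $G$ by a sequence of the operations: Whitney switchings, identifying two vertices from distinct components, or partitioning a graph into components each of which is a block of the original graph. Edge labels are kept; by Whitney's theorem, $G$ and $G'$ are $2$-isomorphic in this sense exactly when they have the same edge set and the same cycles. $K_4$ is the complete graph on four vertices. $K_3^{k,l,m}$ is the graph obtained from the triangle $K_3$ by replacing its three edges by $k$, $l$, $m$ parallel edges, respectively. A subdivision of $G$ is a graph obtained from $G$ by replacing some (possibly no) edges by internally disjoint paths. An ear of a connected graph $G$ is a path $P$ of $G$ such that each internal vertex of $P$ has degree two in $G$, each end-vertex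 of $P$ has degree at least three in $G$, and $P$ is contained in a cycle. Exceptional pairs: an unordered pair of graphs $\{H_1,H_2\}$ with common edge set $E$ is exceptional if it is of one of the following types (all parts of partitions are nonempty). Type (a): for some $n\ge 3$ there is a partition $(P_0,P_1,\dots,P_n)$ of $E$ such that one of the two graphs is the union of $n+1$ internally disjoint paths joining two distinct vertices, with edge sets $P_0,P_1,\dots,P_n$; and the other is the union of $n$ internally disjoint paths joining two distinct vertices, with edge sets $P_1,\dots,P_n$, together with a cycle with edge set $P_0$ meeting the union of the paths in exactly one vertex. Type (b): for some $n\ge 3$ there is a partition $(P_0,P_1,\dots,P_n)$ of $E$ such that one of the two graphs is the union of $n$ internally disjoint paths joining two distinct vertices, with edge sets $P_1,\dots,P_n$, together with a cycle with edge set $P_0$ meeting the union of the paths in exactly one vertex; and the other is the union of $n$ internally disjoint paths joining two distinct vertices, with edge sets $P_0,P_1,\dots,P_{n-1}$, together with a cycle with edge set $P_n$ meeting the union of the paths in exactly one vertex. Type (c): for some $n\ge 2$ there is a partition $(A_1,A_2,A_3,A_4,A_5,P_1,\dots,P_n)$ of $E$ such that each of the two graphs is a union of $n+5$ internally disjoint paths, with these edge sets, joining pairs of four distinct vertices $x,y,a,b$. In one of the two graphs, $P_1,\dots,P_n$ each join $x$ and $y$, $A_1$ joins $x$ and $a$, $A_3$ joins $y$ and $a$, $A_2$ joins $x$ and $b$, $A_4$ joins $y$ and $b$, and $A_5$ joins $a$ and $b$. The other graph is described in the same way with $A_2$ and $A_4$ exchanged, that is, $A_4$ joins $x$ and $b$,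 $A_2$ joins $y$ and $b$, and all other paths join the same pairs as before. *)

theory Defs
  imports "HOL-Library.Disjoint_Sets" "HOL-Combinatorics.Transposition"
begin

section \<open>Multigraphs with labelled edges\<close>

text \<open>Edges are labels; an edge with one end is a loop, and distinct edges may have the same
  set of ends. The value of \<open>ends\<close> outside the edge set is irrelevant.\<close>

record ('v, 'e) mgraph =
  verts :: "'v set"
  edges :: "'e set"
  ends :: "'e \<Rightarrow> 'v set"

definition graph :: "('v, 'e) mgraph \<Rightarrow> bool" where
  "graph G \<longleftrightarrow> finite (verts G) \<and> finite (edges G) \<and>
     (\<forall>e\<in>edges G. ends G e \<subseteq> verts G \<and> (card (ends G e) = 1 \<or> card (ends G e) = 2))"

definition subgraph :: "('v, 'e) mgraph \<Rightarrow> ('v, 'e) mgraph \<Rightarrow> bool" where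
  "subgraph H G \<longleftrightarrow> verts H \<subseteq> verts G \<and> edges H \<subseteq> edges G \<and> ends H = ends G \<and>
     (\<forall>e\<in>edges H. ends H e \<subseteq> verts H)"

definition edge_restrict :: "('v, 'e) mgraph \<Rightarrow> 'e set \<Rightarrow> ('v, 'e) mgraph"
    (infixl \<open>\<restriction>\<close> 100) where
  "G \<restriction> X = \<lparr>verts = (\<Union>e\<in>X. ends G e), edges = X, ends = ends G\<rparr>"

text \<open>A loop contributes two to the degree of its end.\<close>

definition degree :: "('v, 'e) mgraph \<Rightarrow> 'v \<Rightarrow> nat" where
  "degree G v = card {e \<in> edges G. v \<in> ends G e} + card {e \<in> edges G. ends G e = {v}}"

definition adjacent :: "('v, 'e) mgraph \<Rightarrow> 'v \<Rightarrow> 'v \<Rightarrow> bool" where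
  "adjacent G u v \<longleftrightarrow> (\<exists>e\<in>edges G. ends G e = {u, v})"

definition same_component :: "('v, 'e) mgraph \<Rightarrow> 'v \<Rightarrow> 'v \<Rightarrow> bool" where
  "same_component G u v \<longleftrightarrow> u \<in> verts G \<and> v \<in> verts G \<and> (adjacent G)\<^sup>*\<^sup>* u v"

definition connected_graph :: "('v, 'e) mgraph \<Rightarrow> bool" where
  "connected_graph G \<longleftrightarrow> verts G \<noteq> {} \<and> (\<forall>u\<in>verts G. \<forall>v\<in>verts G. same_component G u v)"

definition is_cycle :: "('v, 'e) mgraph \<Rightarrow> 'e set \<Rightarrow> bool" where
  "is_cycle G X \<longleftrightarrow> X \<subseteq> edges G \<and> connected_graph (G \<restriction> X) \<and>
     (\<forall>v\<in>verts (G \<restriction> X). degree (G \<restriction> X) v = 2)"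

definition two_edge_connected :: "('v, 'e) mgraph \<Rightarrow> bool" where
  "two_edge_connected G \<longleftrightarrow> (\<forall>e\<in>edges G. \<exists>C. is_cycle G C \<and> e \<in> C)"


section \<open>The bicircular lift matroid\<close>

text \<open>A matroid is given by its ground set and its set of circuits, which determine it.\<close>

record 'e matroid =
  ground :: "'e set"
  circuits :: "'e set set"

definition has_two_cycles :: "('v, 'e) mgraph \<Rightarrow> bool" where
  "has_two_cycles G \<longleftrightarrow> (\<exists>C D. is_cycle G C \<and> is_cycle G D \<and> C \<noteq> D)"

definition bicircular_lift :: "('v, 'e) mgraph \<Rightarrow> 'e matroid" where
  "bicircular_lift G = \<lparr>ground = edges G,
     circuits = {edges H | H. subgraph H G \<and> has_two_cycles H \<and>
       (\<forall>K. subgraph K H \<and> has_two_cycles K \<longrightarrow> K = H)}\<rparr>"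


section \<open>2-isomorphism\<close>

text \<open>Isomorphisms may rename vertices, but keep every edge label.\<close>

definition graph_iso :: "('v, 'e) mgraph \<Rightarrow> ('w, 'e) mgraph \<Rightarrow> bool" where
  "graph_iso G G' \<longleftrightarrow> edges G' = edges G \<and>
     (\<exists>f. bij_betw f (verts G) (verts G') \<and> (\<forall>e\<in>edges G. ends G' e = f ` ends G e))"

definition whitney_switch ::
    "('v, 'e) mgraph \<Rightarrow> 'e set \<Rightarrow> 'v \<Rightarrow> 'v \<Rightarrow> ('v, 'e) mgraph" where
  "whitney_switch G X u\<^sub>1 u\<^sub>2 =
     \<lparr>verts = verts G, edges = edges G,
      ends = (\<lambda>e. if e \<in> X then transpose u\<^sub>1 u\<^sub>2 ` ends G e else ends G e)\<rparr>"

definition identify_vertices ::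
    "('v, 'e) mgraph \<Rightarrow> 'v \<Rightarrow> 'v \<Rightarrow> ('v, 'e) mgraph" where
  "identify_vertices G u v =
     \<lparr>verts = verts G - {v}, edges = edges G,
      ends = (\<lambda>e. (\<lambda>x. if x = v then u else x) ` ends G e)\<rparr>"

text \<open>Non-separable means connected and not the union of two subgraphs, each with an edge, that
  meet in exactly one vertex. In particular every loop forms a block on its own. The blocks with at
  least one edge are represented by their edge sets; the others are the isolated vertices.\<close>

definition nonseparable :: "('v, 'e) mgraph \<Rightarrow> 'e set \<Rightarrow> bool" where
  "nonseparable G X \<longleftrightarrow> X \<subseteq> edges G \<and> connected_graph (G \<restriction> X) \<and>
     (\<nexists>X\<^sub>1 X\<^sub>2. X\<^sub>1 \<noteq> {} \<and> X\<^sub>2 \<noteq> {} \<and> X\<^sub>1 \<inter> X\<^sub>2 = {} \<and> X\<^sub>1 \<union> X\<^sub>2 = X \<and>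
        card (verts (G \<restriction> X\<^sub>1) \<inter> verts (G \<restriction> X\<^sub>2)) = 1)"

definition is_block :: "('v, 'e) mgraph \<Rightarrow> 'e set \<Rightarrow> bool" where
  "is_block G B \<longleftrightarrow> nonseparable G B \<and> (\<forall>X. nonseparable G X \<and> B \<subseteq> X \<longrightarrow> X = B)"

text \<open>The disjoint union of the blocks: the vertex \<open>(v, B)\<close> is the copy of \<open>v\<close> in the block \<open>B\<close>,
  and an isolated vertex \<open>v\<close> becomes \<open>(v, {})\<close>.\<close>

definition split_into_blocks :: "('v, 'e) mgraph \<Rightarrow> ('v \<times> 'e set, 'e) mgraph" where
  "split_into_blocks G =
     \<lparr>verts = {(v, B) | v B. is_block G B \<and> v \<in> verts (G \<restriction> B)} \<union>
              {(v, {}) | v. v \<in> verts G \<and> v \<notin> verts (G \<restriction> edges G)},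
      edges = edges G,
      ends = (\<lambda>e. (\<lambda>v. (v, THE B. is_block G B \<and> e \<in> B)) ` ends G e)\<rparr>"

definition two_iso_step :: "('v, 'e) mgraph \<Rightarrow> ('w, 'e) mgraph \<Rightarrow> bool" where
  "two_iso_step G G' \<longleftrightarrow> graph G \<and>
     ((\<exists>X\<^sub>1 X\<^sub>2 u\<^sub>1 u\<^sub>2. X\<^sub>1 \<inter> X\<^sub>2 = {} \<and> X\<^sub>1 \<union> X\<^sub>2 = edges G \<and> u\<^sub>1 \<noteq> u\<^sub>2 \<and>
         verts (G \<restriction> X\<^sub>1) \<inter> verts (G \<restriction> X\<^sub>2) = {u\<^sub>1, u\<^sub>2} \<and>
         graph_iso (whitney_switch G X\<^sub>2 u\<^sub>1 u\<^sub>2) G') \<or>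
      (\<exists>u\<in>verts G. \<exists>v\<in>verts G. \<not> same_component G u v \<and>
         graph_iso (identify_vertices G u v) G') \<or>
      graph_iso (split_into_blocks G) G')"

text \<open>The operations may need new vertices, so they are carried out on graphs with vertices in
  \<open>nat\<close>. For graphs without isolated vertices the relation generated by the operations is already
  symmetric; since the operations cannot create isolated vertices, the symmetric closure is needed
  for 2-isomorphism to disregard isolated vertices.\<close>

definition two_isomorphic :: "('v, 'e) mgraph \<Rightarrow> ('w, 'e) mgraph \<Rightarrow> bool" where
  "two_isomorphic G G' \<longleftrightarrow>
     (\<exists>(K :: (nat, 'e) mgraph) (K' :: (nat, 'e) mgraph).
        graph_iso G K \<and> equivclp two_iso_step K K' \<and> graph_iso K' G')"


section \<open>Paths, ears and subdivisions\<close>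

text \<open>\<open>P\<close> is the edge set of a path of \<open>G\<close> joining the distinct vertices \<open>u\<close> and \<open>v\<close>; the
  internal vertices of the path are those in \<open>verts (G \<restriction> P) - {u, v}\<close>.\<close>

definition is_path :: "('v, 'e) mgraph \<Rightarrow> 'v \<Rightarrow> 'v \<Rightarrow> 'e set \<Rightarrow> bool" where
  "is_path G u v P \<longleftrightarrow> u \<noteq> v \<and> P \<subseteq> edges G \<and>
     (\<exists>xs es. length xs = Suc (length es) \<and> distinct xs \<and> hd xs = u \<and> last xs = v \<and>
        set es = P \<and> (\<forall>i<length es. ends G (es ! i) = {xs ! i, xs ! Suc i}))"

definition is_ear :: "('v, 'e) mgraph \<Rightarrow> 'v \<Rightarrow> 'v \<Rightarrow> 'e set \<Rightarrow> bool" where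
  "is_ear G u v P \<longleftrightarrow> is_path G u v P \<and>
     (\<forall>w \<in> verts (G \<restriction> P) - {u, v}. degree G w = 2) \<and>
     degree G u \<ge> 3 \<and> degree G v \<ge> 3 \<and> (\<exists>C. is_cycle G C \<and> P \<subseteq> C)"

definition ear_edge_sets :: "('v, 'e) mgraph \<Rightarrow> 'e set set" where
  "ear_edge_sets G = {P. \<exists>u v. is_ear G u v P}"

text \<open>\<open>H\<close> arises from \<open>G\<close> by replacing each edge \<open>e\<close> by a path with edge set \<open>P e\<close> (by a cycle
  through the end of \<open>e\<close>, if \<open>e\<close> is a loop), where \<open>\<phi>\<close> embeds the vertices of \<open>G\<close>. An edge that
  is not subdivided is replaced by a path of length one.\<close>

definition subdivision_via ::
    "('v, 'e) mgraph \<Rightarrow> ('w, 'f) mgraph \<Rightarrow> ('w \<Rightarrow> 'v) \<Rightarrow> ('f \<Rightarrow> 'e set) \<Rightarrow> bool" where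
  "subdivision_via H G \<phi> P \<longleftrightarrow>
     inj_on \<phi> (verts G) \<and>
     verts H = \<phi> ` verts G \<union> (\<Union>e\<in>edges G. verts (H \<restriction> P e)) \<and>
     edges H = (\<Union>e\<in>edges G. P e) \<and>
     (\<forall>e\<in>edges G. \<exists>u v. \<phi> ` ends G e = {u, v} \<and>
        (if u = v then is_cycle H (P e) else is_path H u v (P e))) \<and>
     (\<forall>e\<in>edges G. verts (H \<restriction> P e) \<inter> \<phi> ` verts G = \<phi> ` ends G e) \<and>
     (\<forall>e\<in>edges G. \<forall>f\<in>edges G. e \<noteq> f \<longrightarrow>
        P e \<inter> P f = {} \<and> verts (H \<restriction> P e) \<inter> verts (H \<restriction> P f) \<subseteq> \<phi> ` verts G)"

definition is_subdivision :: "('v, 'e) mgraph \<Rightarrow> ('w, 'f) mgraph \<Rightarrow> bool" where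
  "is_subdivision H G \<longleftrightarrow> (\<exists>\<phi> P. subdivision_via H G \<phi> P)"

definition K4 :: "(nat, nat set) mgraph" where
  "K4 = \<lparr>verts = {..<4}, edges = {e. e \<subseteq> {..<4} \<and> card e = 2}, ends = (\<lambda>e. e)\<rparr>"

text \<open>The triangle on \<open>0, 1, 2\<close>; the pairs \<open>(0, j)\<close>, \<open>(1, j)\<close>, \<open>(2, j)\<close> are the \<open>k\<close>, \<open>l\<close>, \<open>m\<close>
  parallel edges replacing its edges \<open>{0, 1}\<close>, \<open>{1, 2}\<close>, \<open>{2, 0}\<close>, respectively.\<close>

definition K3_multi :: "nat \<Rightarrow> nat \<Rightarrow> nat \<Rightarrow> (nat, nat \<times> nat) mgraph" where
  "K3_multi k l m =
     \<lparr>verts = {..<3},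
      edges = {0} \<times> {..<k} \<union> {1} \<times> {..<l} \<union> {2} \<times> {..<m},
      ends = (\<lambda>(i, j). {i, (i + 1) mod 3})\<rparr>"


section \<open>Exceptional pairs\<close>

definition list_partition :: "'e set \<Rightarrow> 'e set list \<Rightarrow> bool" where
  "list_partition E Xs \<longleftrightarrow> distinct Xs \<and> partition_on E (set Xs)"

text \<open>\<open>G\<close> is the union of internally disjoint paths: a triple \<open>(u, v, P)\<close> in \<open>\<P>\<close> stands for a
  path with edge set \<open>P\<close> joining \<open>u\<close> and \<open>v\<close>. A vertex on two of the paths is an end of both.\<close>

definition path_union :: "('v, 'e) mgraph \<Rightarrow> ('v \<times> 'v \<times> 'e set) set \<Rightarrow> bool" where
  "path_union G \<P> \<longleftrightarrow>
     (\<forall>(u, v, P)\<in>\<P>. is_path G u v P) \<and>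
     (\<forall>(u, v, P)\<in>\<P>. \<forall>(u', v', P')\<in>\<P>. (u, v, P) \<noteq> (u', v', P') \<longrightarrow>
        verts (G \<restriction> P) \<inter> verts (G \<restriction> P') \<subseteq> {u, v} \<inter> {u', v'}) \<and>
     edges G = (\<Union>(u, v, P)\<in>\<P>. P) \<and>
     verts G = (\<Union>(u, v, P)\<in>\<P>. verts (G \<restriction> P))"

definition parallel_paths :: "('v, 'e) mgraph \<Rightarrow> (nat \<Rightarrow> 'e set) \<Rightarrow> nat set \<Rightarrow> bool" where
  "parallel_paths G P I \<longleftrightarrow> (\<exists>u v. u \<noteq> v \<and> path_union G {(u, v, P i) | i. i \<in> I})"

definition parallel_paths_with_cycle ::
    "('v, 'e) mgraph \<Rightarrow> (nat \<Rightarrow> 'e set) \<Rightarrow> nat set \<Rightarrow> 'e set \<Rightarrow> bool" where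
  "parallel_paths_with_cycle G P I C \<longleftrightarrow>
     edges G = (\<Union>i\<in>I. P i) \<union> C \<and> verts G = verts (G \<restriction> edges G) \<and>
     parallel_paths (G \<restriction> (\<Union>i\<in>I. P i)) P I \<and> is_cycle G C \<and>
     (\<exists>w. verts (G \<restriction> (\<Union>i\<in>I. P i)) \<inter> verts (G \<restriction> C) = {w})"

definition type_a :: "('v, 'e) mgraph \<Rightarrow> ('w, 'e) mgraph \<Rightarrow> bool" where
  "type_a H H' \<longleftrightarrow> (\<exists>n P. n \<ge> 3 \<and> edges H' = edges H \<and>
     list_partition (edges H) (map P [0..<Suc n]) \<and>
     parallel_paths H P {0..n} \<and>
     parallel_paths_with_cycle H' P {1..n} (P 0))"

definition type_b :: "('v, 'e) mgraph \<Rightarrow> ('w, 'e) mgraph \<Rightarrow> bool" where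
  "type_b H H' \<longleftrightarrow> (\<exists>n P. n \<ge> 3 \<and> edges H' = edges H \<and>
     list_partition (edges H) (map P [0..<Suc n]) \<and>
     parallel_paths_with_cycle H P {1..n} (P 0) \<and>
     parallel_paths_with_cycle H' P {0..n - 1} (P n))"

definition type_c_graph ::
    "('v, 'e) mgraph \<Rightarrow> 'e set \<Rightarrow> 'e set \<Rightarrow> 'e set \<Rightarrow> 'e set \<Rightarrow> 'e set \<Rightarrow>
     (nat \<Rightarrow> 'e set) \<Rightarrow> nat \<Rightarrow> bool" where
  "type_c_graph G A\<^sub>1 A\<^sub>2 A\<^sub>3 A\<^sub>4 A\<^sub>5 P n \<longleftrightarrow>
     (\<exists>x y a b. distinct [x, y, a, b] \<and>
        path_union G ({(x, a, A\<^sub>1), (y, a, A\<^sub>3), (x, b, A\<^sub>2), (y, b, A\<^sub>4), (a, b, A\<^sub>5)} \<union>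
                      {(x, y, P i) | i. i \<in> {1..n}}))"

definition type_c :: "('v, 'e) mgraph \<Rightarrow> ('w, 'e) mgraph \<Rightarrow> bool" where
  "type_c H H' \<longleftrightarrow> (\<exists>n A\<^sub>1 A\<^sub>2 A\<^sub>3 A\<^sub>4 A\<^sub>5 P. n \<ge> 2 \<and> edges H' = edges H \<and>
     list_partition (edges H) ([A\<^sub>1, A\<^sub>2, A\<^sub>3, A\<^sub>4, A\<^sub>5] @ map P [1..<Suc n]) \<and>
     type_c_graph H A\<^sub>1 A\<^sub>2 A\<^sub>3 A\<^sub>4 A\<^sub>5 P n \<and>
     type_c_graph H' A\<^sub>1 A\<^sub>4 A\<^sub>3 A\<^sub>2 A\<^sub>5 P n)"

definition exceptional_pair :: "('v, 'e) mgraph \<Rightarrow> ('w, 'e) mgraph \<Rightarrow> bool" where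
  "exceptional_pair H\<^sub>1 H\<^sub>2 \<longleftrightarrow>
     type_a H\<^sub>1 H\<^sub>2 \<or> type_a H\<^sub>2 H\<^sub>1 \<or>
     type_b H\<^sub>1 H\<^sub>2 \<or> type_b H\<^sub>2 H\<^sub>1 \<or>
     type_c H\<^sub>1 H\<^sub>2 \<or> type_c H\<^sub>2 H\<^sub>1"

end

theory Submission
  imports Defs
begin

text \<open>The lift matroid determines, for every set \<open>X\<close> of edges containing two cycles, the number of
  even edge sets inside \<open>X\<close>; in particular it determines the nullity \<open>k\<close> of the graph. Hence \<open>G\<^sub>1\<close>
  and \<open>G\<^sub>2\<close> have the same series classes, and every cocycle with fewer than \<open>k\<close> elements of one
  cycle space is a cocycle of the other. Keep one edge of each series class and contract the rest,
  to get connected skeletons in which all cuts have at least three edges. All vertex stars but one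
  already generate the cocycles of a skeleton; so if the two cycle spaces differ, then at least
  two stars are not cocycles of the other space. Hence two vertices have degree at least \<open>k\<close>, the
  others at least three, and counting edges leaves at most four vertices. With two vertices there
  are parallel edges and at most one loop (types (a) and (b)), with three vertices the skeleton is
  \<open>K\<^sub>3\<close> with multiplicities \<open>m, 2, n\<close>, and with four it is \<open>K\<^sub>4\<close> with one edge multiplied (type
  (c) or \<open>K\<^sub>4\<close> itself). The graphs \<open>H\<^sub>i\<close> arise by putting the series classes back as paths.

  Equal cycle spaces give 2-isomorphic graphs by Whitney's theorem, proved by induction on the
  number of edges: if deleting the star of any vertex leaves a nonseparable graph, then all stars
  are stars of the other graph too, and they determine the graph; otherwise a smallest side of a
  2-separation is nonseparable or a pair of series edges, which one switching makes adjacent in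
  the other graph, and then the induction hypothesis applies to both sides, each completed by a
  virtual edge.\<close>

section \<open>Binary spaces\<close>

text \<open>The lift matroid is blind below nullity two: a forest and an edge set with a single
  cycle are both independent in it. Counts of even subsets can therefore be compared only when they
  are at least four, and each argument has to keep the sets it compares above this threshold. The
  complement of a minimal cocycle \<open>D\<close> has nullity \<open>k - card D + 1\<close>, which
  is where the bound \<open>card D < k\<close> comes from. Two distinct circuits in a graph all of
  whose edges lie on cycles force \<open>k \<ge> 3\<close>, and this leaves room to delete one edge
  when series classes are compared. For \<open>k = 3\<close> the circuits are just the complements
  of the series classes, whatever the position of the classes in the graph; hence for
  \<open>K4\<close> the ears are all that is preserved. From \<open>k = 4\<close> on, stars with
  three edges are small enough to be transferred, and they tie the two skeletons together as in type
  (c).\<close>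

definition binary_space :: "'e set \<Rightarrow> 'e set set \<Rightarrow> bool" where
  "binary_space E \<F> \<longleftrightarrow> finite E \<and> \<F> \<subseteq> Pow E \<and> {} \<in> \<F> \<and> (\<forall>A\<in>\<F>. \<forall>B\<in>\<F>. sym_diff A B \<in> \<F>)"

definition members_in :: "'e set set \<Rightarrow> 'e set \<Rightarrow> 'e set set" where
  "members_in \<F> X = {Z \<in> \<F>. Z \<subseteq> X}"

text \<open>Orthogonality over the field with two elements. For the cycle space of a connected graph
  the orthogonal sets of edges are the cuts; in this form they can be moved between spaces without
  reference to a graph.\<close>

definition cocycle :: "'e set set \<Rightarrow> 'e set \<Rightarrow> bool" where
  "cocycle \<F> D \<longleftrightarrow> (\<forall>Z\<in>\<F>. even (card (D \<inter> Z)))"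

lemma even_card_sym_diff:
  assumes "finite A" "finite B"
  shows "even (card (sym_diff A B)) \<longleftrightarrow> (even (card A) \<longleftrightarrow> even (card B))"
proof -
  have "card (sym_diff A B) = card (A - B) + card (B - A)"
    using assms by (intro card_Un_disjoint) auto
  moreover have "card A = card (A - B) + card (A \<inter> B)"
    using assms by (metis Diff_Int_distrib2 card_Diff_subset_Int card_Int_Diff add.commute Int_commute)
  moreover have "card B = card (B - A) + card (A \<inter> B)"
    using assms by (metis Int_commute card_Int_Diff add.commute)
  ultimately show ?thesis by presburger
qed

lemma even_card_Int_sym_diff:
  assumes "finite D"
  shows "even (card (D \<inter> sym_diff A B)) \<longleftrightarrow> (even (card (D \<inter> A)) \<longleftrightarrow> even (card (D \<inter> B)))"
proof -
  have "D \<inter> sym_diff A B = sym_diff (D \<inter> A) (D \<inter> B)" by auto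
  then show ?thesis using even_card_sym_diff[of "D \<inter> A" "D \<inter> B"] assms by simp
qed

lemma cocycle_sym_diff:
  assumes "cocycle \<F> A" "cocycle \<F> B" "finite A" "finite B"
  shows "cocycle \<F> (sym_diff A B)"
  unfolding cocycle_def
proof
  fix Z assume "Z \<in> \<F>"
  have eq: "sym_diff A B \<inter> Z = sym_diff (A \<inter> Z) (B \<inter> Z)" by auto
  show "even (card (sym_diff A B \<inter> Z))"
    unfolding eq using even_card_sym_diff[of "A \<inter> Z" "B \<inter> Z"] assms \<open>Z \<in> \<F>\<close>
    by (simp add: cocycle_def)
qed

lemma cocycle_empty [simp]: "cocycle \<F> {}"
  by (simp add: cocycle_def)

lemma binary_spaceD:
  assumes "binary_space E \<F>"
  shows "finite E" "\<F> \<subseteq> Pow E" "{} \<in> \<F>" "\<And>A B. A \<in> \<F> \<Longrightarrow> B \<in> \<F> \<Longrightarrow> sym_diff A B \<in> \<F>"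
    "\<And>A. A \<in> \<F> \<Longrightarrow> A \<subseteq> E" "\<And>A. A \<in> \<F> \<Longrightarrow> finite A" "finite \<F>"
  using assms finite_subset[of \<F> "Pow E"] unfolding binary_space_def
  by (auto intro: finite_subset)

lemma finite_members_in: "binary_space E \<F> \<Longrightarrow> finite (members_in \<F> X)"
  using binary_spaceD(7)[of E \<F>] by (auto simp: members_in_def)

lemma members_in_mono: "X \<subseteq> Y \<Longrightarrow> members_in \<F> X \<subseteq> members_in \<F> Y"
  by (auto simp: members_in_def)

lemma card_members_in_mono:
  "binary_space E \<F> \<Longrightarrow> X \<subseteq> Y \<Longrightarrow> card (members_in \<F> X) \<le> card (members_in \<F> Y)"
  by (intro card_mono finite_members_in members_in_mono)

lemma card_members_in_pos: "binary_space E \<F> \<Longrightarrow> card (members_in \<F> X) \<ge> 1"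
  using finite_members_in[of E \<F> X] binary_spaceD(3)[of E \<F>]
  by (auto simp: Suc_le_eq card_gt_0_iff members_in_def)

text \<open>Adding \<open>C\<close> is a bijection between the members inside \<open>X\<close> that
  contain \<open>e\<close> and those that avoid it.\<close>

lemma card_members_in_halve:
  assumes sp: "binary_space E \<F>" and C: "C \<in> \<F>" "C \<subseteq> X" "e \<in> C"
  shows "card (members_in \<F> X) = 2 * card (members_in \<F> (X - {e}))"
proof -
  let ?A = "{Z \<in> members_in \<F> X. e \<in> Z}" and ?B = "members_in \<F> (X - {e})"
  have eq: "members_in \<F> X = ?A \<union> ?B" by (auto simp: members_in_def)
  have "bij_betw (\<lambda>Z. sym_diff Z C) ?B ?A"
  proof (rule bij_betwI[where g = "\<lambda>Z. sym_diff Z C"])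
    show "(\<lambda>Z. sym_diff Z C) \<in> ?B \<rightarrow> ?A" "(\<lambda>Z. sym_diff Z C) \<in> ?A \<rightarrow> ?B"
      using C binary_spaceD(4)[OF sp] by (auto simp: members_in_def)
  qed auto
  then have "card ?A = card ?B" by (simp add: bij_betw_same_card)
  moreover have "finite ?A" using finite_members_in[OF sp, of X] by simp
  then have "card (members_in \<F> X) = card ?A + card ?B"
    by (subst eq, intro card_Un_disjoint finite_members_in[OF sp]) (auto simp: members_in_def)
  ultimately show ?thesis by simp
qed

lemma members_in_remove:
  "\<forall>C\<in>\<F>. C \<subseteq> X \<longrightarrow> e \<notin> C \<Longrightarrow> members_in \<F> (X - {e}) = members_in \<F> X"
  by (auto simp: members_in_def)

lemma card_members_in_remove:
  assumes "binary_space E \<F>"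
  shows "card (members_in \<F> X) = 2 * card (members_in \<F> (X - {e})) \<or>
    card (members_in \<F> X) = card (members_in \<F> (X - {e}))"
  using members_in_remove[of \<F> X e] card_members_in_halve[OF assms] by metis

lemma card_members_in_power:
  assumes sp: "binary_space E \<F>"
  shows "\<exists>j. card (members_in \<F> X) = 2 ^ j"
proof -
  have "\<exists>j. card (members_in \<F> X) = 2 ^ j" if "finite X" for X
    using that
  proof (induction X rule: finite_induct)
    case empty
    have "members_in \<F> {} = {{}}" using binary_spaceD(3)[OF sp] by (auto simp: members_in_def)
    then show ?case by (intro exI[of _ 0]) simp
  next
    case (insert x X)
    then obtain j where "card (members_in \<F> X) = 2 ^ j" by auto
    with card_members_in_remove[OF sp, of "insert x X" x] insert.hyps(2) show ?case
      by (metis Diff_insert_absorb power_Suc)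
  qed
  moreover have "members_in \<F> X = members_in \<F> (X \<inter> E)"
    using binary_spaceD(5)[OF sp] by (auto simp: members_in_def)
  ultimately show ?thesis using binary_spaceD(1)[OF sp] by auto
qed

section \<open>Counts of at least four members\<close>

lemma card_members_in_ge4:
  assumes sp: "binary_space E \<F>" and "A \<in> \<F>" "B \<in> \<F>" "A \<subseteq> X" "B \<subseteq> X" "A \<noteq> {}" "B \<noteq> {}" "A \<noteq> B"
  shows "card (members_in \<F> X) \<ge> 4"
proof -
  have "{{}, A, B, sym_diff A B} \<subseteq> members_in \<F> X"
    using assms binary_spaceD(3,4)[OF sp] by (auto simp: members_in_def)
  moreover have "card {{}, A, B, sym_diff A B} = 4"
    using assms(6-8) by (subst card_insert_disjoint | force)+
  ultimately show ?thesis by (metis card_mono finite_members_in[OF sp])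
qed

text \<open>A smallest set \<open>K\<close> inside \<open>X\<close> with at least four members is
  minimal for both spaces, since they agree on the threshold. Every edge of \<open>K\<close> thus
  lies on a member inside \<open>X\<close> in either space, its removal halves both counts, and
  induction on \<open>X\<close> applies.\<close>

lemma card_members_in_agree:
  assumes sp1: "binary_space E \<F>\<^sub>1" and sp2: "binary_space E \<F>\<^sub>2"
    and iff: "\<And>X. X \<subseteq> E \<Longrightarrow> card (members_in \<F>\<^sub>1 X) \<ge> 4 \<longleftrightarrow> card (members_in \<F>\<^sub>2 X) \<ge> 4"
    and X: "X \<subseteq> E" "card (members_in \<F>\<^sub>1 X) \<ge> 4"
  shows "card (members_in \<F>\<^sub>1 X) = card (members_in \<F>\<^sub>2 X)"
proof -
  have "finite X" using X(1) binary_spaceD(1)[OF sp1] finite_subset by blast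
  then show ?thesis using X
  proof (induction X rule: finite_psubset_induct)
    case (psubset X)
    define P where "P K \<longleftrightarrow> K \<subseteq> X \<and> card (members_in \<F>\<^sub>1 K) \<ge> 4" for K
    have PX: "P X" using psubset by (simp add: P_def)
    obtain K where K: "P K" and min: "\<And>K'. P K' \<Longrightarrow> card K \<le> card K'"
      using ex_has_least_nat[of P X card, OF PX] by blast
    have finK: "finite K" using K psubset.hyps finite_subset P_def by blast
    have "K \<noteq> {}"
    proof
      assume "K = {}"
      moreover have "members_in \<F>\<^sub>1 {} \<subseteq> {{}}" by (auto simp: members_in_def)
      ultimately show False using K card_mono[of "{{}}" "members_in \<F>\<^sub>1 K"] by (simp add: P_def)
    qed
    then obtain e where e: "e \<in> K" by auto
    have lt1: "card (members_in \<F>\<^sub>1 (K - {e})) < 4"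
    proof (rule ccontr)
      assume "\<not> ?thesis"
      then have "P (K - {e})" using K by (auto simp: P_def)
      from min[OF this] show False using e finK by (metis card_Diff1_less not_le)
    qed
    have KE: "K \<subseteq> E" using K psubset.prems by (auto simp: P_def)
    then have "K - {e} \<subseteq> E" by auto
    with KE have lt2: "card (members_in \<F>\<^sub>2 (K - {e})) < 4" and K2: "card (members_in \<F>\<^sub>2 K) \<ge> 4"
      using lt1 iff[of "K - {e}"] iff[of K] K by (auto simp: P_def not_le)
    have "\<exists>C\<in>\<F>\<^sub>1. C \<subseteq> K \<and> e \<in> C" "\<exists>C\<in>\<F>\<^sub>2. C \<subseteq> K \<and> e \<in> C"
      using members_in_remove[of \<F>\<^sub>1 K e] members_in_remove[of \<F>\<^sub>2 K e] lt1 lt2 K K2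
      unfolding P_def by fastforce+
    then have h: "card (members_in \<F>\<^sub>1 X) = 2 * card (members_in \<F>\<^sub>1 (X - {e}))"
       "card (members_in \<F>\<^sub>2 X) = 2 * card (members_in \<F>\<^sub>2 (X - {e}))"
      using card_members_in_halve[OF sp1, of _ X e] card_members_in_halve[OF sp2, of _ X e] K
      unfolding P_def by blast+
    have sub: "X - {e} \<subseteq> E" "X - {e} \<subset> X" using psubset.prems e K by (auto simp: P_def)
    show ?case
    proof (cases "card (members_in \<F>\<^sub>1 (X - {e})) \<ge> 4")
      case True
      then show ?thesis using psubset.IH[OF sub(2) sub(1)] h by simp
    next
      case False
      then have F2: "card (members_in \<F>\<^sub>2 (X - {e})) < 4" using iff[OF sub(1)] by simp
      have X2: "card (members_in \<F>\<^sub>2 X) \<ge> 4" using iff[of X] psubset.prems by simp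
      \<comment> \<open>Below the threshold the hypothesis gives no equality, but a power of two
        that is less than four and whose double is at least four can only be 2.\<close>
      have two: "c = 2" if "2 * c \<ge> 4" "c < 4" "\<exists>j. c = 2 ^ j" for c :: nat
      proof -
        from that(3) obtain j where j: "c = 2 ^ j" ..
        have "j < 2" by (rule ccontr) (use j that(2) power_increasing[of 2 j "2::nat"] in auto)
        then show ?thesis using j that(1) by (cases j) auto
      qed
      have "card (members_in \<F>\<^sub>1 (X - {e})) = 2" "card (members_in \<F>\<^sub>2 (X - {e})) = 2"
        using two False F2 h psubset.prems(2) X2 card_members_in_power[OF sp1] card_members_in_power[OF sp2]
        by (auto simp: not_le)
      then show ?thesis using h by simp
    qed
  qed
qed

section \<open>Orthogonality and the transfer of small cocycles\<close>

text \<open>A vector outside a subspace is separated from it by a linear form. The proof is Gaussian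
  elimination, one coordinate \<open>d\<close> at a time, with a member through \<open>d\<close> as
  pivot.\<close>

lemma orthogonal_separation:
  assumes "finite D" "\<F> \<subseteq> Pow D" "{} \<in> \<F>" "\<And>A B. A \<in> \<F> \<Longrightarrow> B \<in> \<F> \<Longrightarrow> sym_diff A B \<in> \<F>"
    "T \<subseteq> D" "T \<notin> \<F>"
  shows "\<exists>D\<^sub>0\<subseteq>D. (\<forall>Z\<in>\<F>. even (card (D\<^sub>0 \<inter> Z))) \<and> odd (card (D\<^sub>0 \<inter> T))"
  using assms
proof (induction D arbitrary: \<F> T rule: finite_induct)
  case empty
  then show ?case by auto
next
  case (insert d D)
  show ?case
  proof (cases "\<exists>Z\<in>\<F>. d \<in> Z")
    case False
    show ?thesis
    proof (cases "d \<in> T")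
      case True
      then have "{d} \<subseteq> insert d D \<and> (\<forall>Z\<in>\<F>. even (card ({d} \<inter> Z))) \<and> odd (card ({d} \<inter> T))"
        using False by auto
      then show ?thesis by blast
    next
      case F: False
      have "\<exists>D\<^sub>0\<subseteq>D. (\<forall>Z\<in>\<F>. even (card (D\<^sub>0 \<inter> Z))) \<and> odd (card (D\<^sub>0 \<inter> T))"
        by (rule insert.IH) (use insert.prems False F in \<open>blast+\<close>)
      then show ?thesis by blast
    qed
  next
    case True
    then obtain Z\<^sub>0 where Z0: "Z\<^sub>0 \<in> \<F>" "d \<in> Z\<^sub>0" by auto
    define T' where "T' = (if d \<in> T then sym_diff T Z\<^sub>0 else T)"
    let ?F = "{Z \<in> \<F>. d \<notin> Z}"
    have Z0s: "Z\<^sub>0 \<subseteq> insert d D" using Z0 insert.prems by auto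
    have T': "T' \<notin> \<F>" "d \<notin> T'"
    proof -
      show "d \<notin> T'" using Z0 by (auto simp: T'_def)
      show "T' \<notin> \<F>"
      proof
        assume "T' \<in> \<F>"
        moreover have "sym_diff (sym_diff T Z\<^sub>0) Z\<^sub>0 = T" by auto
        ultimately have "T \<in> \<F>"
          using insert.prems(3)[of "sym_diff T Z\<^sub>0" Z\<^sub>0] Z0 by (auto simp: T'_def split: if_splits)
        then show False using insert.prems by simp
      qed
    qed
    have "\<exists>D\<^sub>0\<subseteq>D. (\<forall>Z\<in>?F. even (card (D\<^sub>0 \<inter> Z))) \<and> odd (card (D\<^sub>0 \<inter> T'))"
    proof (rule insert.IH)
      show "T' \<subseteq> D" using T'(2) insert.prems(4) Z0s by (auto simp: T'_def split: if_splits)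
    qed (use insert.prems T' in auto)
    then obtain D1 where D1: "D1 \<subseteq> D" "\<forall>Z\<in>?F. even (card (D1 \<inter> Z))" "odd (card (D1 \<inter> T'))" by blast
    have fin: "finite D1" using D1 insert.hyps finite_subset by blast
    \<comment> \<open>Membership of \<open>d\<close> is chosen so that the pivot
      \<open>Z\<^sub>0\<close> is met evenly. Members avoiding \<open>d\<close> do not notice the
      choice, and any other member differs from one of those by \<open>Z\<^sub>0\<close>.\<close>
    define D0 where "D0 = (if even (card (D1 \<inter> Z\<^sub>0)) then D1 else insert d D1)"
    have dD1: "d \<notin> D1" using D1 insert.hyps by auto
    have fin0: "finite D0" using fin by (simp add: D0_def)
    have eqn: "D0 \<inter> Z = D1 \<inter> Z" if "d \<notin> Z" for Z using that by (auto simp: D0_def)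
    have e0: "even (card (D0 \<inter> Z\<^sub>0))"
      using Z0 dD1 fin by (auto simp: D0_def)
    have ev: "even (card (D0 \<inter> Z))" if "Z \<in> \<F>" for Z
    proof (cases "d \<in> Z")
      case False
      then show ?thesis using eqn D1 that by auto
    next
      case dZ: True
      have "sym_diff Z Z\<^sub>0 \<in> ?F" using dZ Z0 insert.prems(3) that by auto
      then have "even (card (D0 \<inter> sym_diff Z Z\<^sub>0))"
        using D1(2) eqn[of "sym_diff Z Z\<^sub>0"] by (metis (mono_tags, lifting) mem_Collect_eq)
      then show ?thesis using even_card_Int_sym_diff[OF fin0] e0 by blast
    qed
    have "odd (card (D0 \<inter> T'))" using D1(3) eqn[OF T'(2)] by simp
    then have "odd (card (D0 \<inter> T))"
      using even_card_Int_sym_diff[OF fin0, of T Z\<^sub>0] e0 by (auto simp: T'_def split: if_splits)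
    moreover have "D0 \<subseteq> insert d D" using D1 by (auto simp: D0_def)
    ultimately show ?thesis using ev by blast
  qed
qed

text \<open>Otherwise the traces of the members on \<open>D\<close> form a subspace without
  \<open>{d, d'}\<close>, and some \<open>D0 \<subseteq> D\<close> separates the two. It is a
  nonempty cocycle, hence all of \<open>D\<close> by minimality; but \<open>D\<close> meets
  \<open>{d, d'}\<close> in two elements, an even number.\<close>

lemma minimal_cocycle_pair:
  assumes sp: "binary_space E \<F>" and D: "D \<subseteq> E" "cocycle \<F> D"
    and min: "\<And>D'. D' \<subset> D \<Longrightarrow> cocycle \<F> D' \<Longrightarrow> D' = {}"
    and d: "d \<in> D" "d' \<in> D" "d \<noteq> d'"
  shows "\<exists>Z\<in>\<F>. Z \<inter> D = {d, d'}"
proof (rule ccontr)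
  assume neg: "\<not> ?thesis"
  let ?F = "(\<lambda>Z. Z \<inter> D) ` \<F>"
  have "\<exists>D\<^sub>0\<subseteq>D. (\<forall>Z\<in>?F. even (card (D\<^sub>0 \<inter> Z))) \<and> odd (card (D\<^sub>0 \<inter> {d, d'}))"
  proof (rule orthogonal_separation)
    show "finite D" using D binary_spaceD(1)[OF sp] finite_subset by blast
    show "{} \<in> ?F" using binary_spaceD(3)[OF sp] by force
    show "sym_diff A B \<in> ?F" if "A \<in> ?F" "B \<in> ?F" for A B
    proof -
      from that obtain A' B' where AB: "A' \<in> \<F>" "B' \<in> \<F>" "A = A' \<inter> D" "B = B' \<inter> D" by auto
      then have "sym_diff A B = sym_diff A' B' \<inter> D" by auto
      then show ?thesis using binary_spaceD(4)[OF sp AB(1,2)] by blast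
    qed
  qed (use d neg in auto)
  then obtain D0 where D0: "D0 \<subseteq> D" "\<forall>Z\<in>?F. even (card (D0 \<inter> Z))" "odd (card (D0 \<inter> {d, d'}))" by blast
  have "D0 \<inter> (Z \<inter> D) = D0 \<inter> Z" for Z using D0(1) by auto
  then have "cocycle \<F> D0" using D0(2) by (auto simp: cocycle_def)
  moreover have "D0 \<noteq> {}" using D0(3) by auto
  ultimately have "D0 = D" using min[of D0] D0(1) by blast
  then have "D0 \<inter> {d, d'} = {d, d'}" using d by auto
  then show False using D0(3) d(3) by simp
qed

text \<open>Seen from the complement of \<open>D\<close>, adding one edge of \<open>D\<close>
  creates no new member of \<open>\<F>\<^sub>1\<close>, and adding two edges does. All counts
  involved are at least four because \<open>card D < k\<close>, so the same holds for
  \<open>\<F>\<^sub>2\<close>: no member meets \<open>D\<close> in a single edge, and every pair of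
  edges of \<open>D\<close> is the trace of a member. Subtracting such pairs reduces each trace to
  the empty one, so all traces are even.\<close>

lemma minimal_cocycle_transfer:
  assumes sp1: "binary_space E \<F>\<^sub>1" and sp2: "binary_space E \<F>\<^sub>2"
    and agree: "\<And>X. X \<subseteq> E \<Longrightarrow> card (members_in \<F>\<^sub>1 X) \<ge> 4 \<Longrightarrow>
      card (members_in \<F>\<^sub>2 X) = card (members_in \<F>\<^sub>1 X)"
    and k: "card (members_in \<F>\<^sub>1 E) = 2 ^ k"
    and D: "D \<subseteq> E" "cocycle \<F>\<^sub>1 D" "card D < k" "D \<noteq> {}"
    and min: "\<And>D'. D' \<subset> D \<Longrightarrow> cocycle \<F>\<^sub>1 D' \<Longrightarrow> D' = {}"
  shows "cocycle \<F>\<^sub>2 D"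
proof -
  have finD: "finite D" using D binary_spaceD(1)[OF sp1] finite_subset by blast
  from D obtain d where d: "d \<in> D" by blast
  \<comment> \<open>Each deleted edge at most halves the number of members.\<close>
  have lower: "2 ^ card Y * card (members_in \<F>\<^sub>1 (E - Y)) \<ge> 2 ^ k" if "finite Y" for Y
    using that
  proof (induction Y rule: finite_induct)
    case empty
    then show ?case using k by simp
  next
    case (insert y Y)
    have eq: "E - insert y Y = (E - Y) - {y}" by auto
    have "card (members_in \<F>\<^sub>1 (E - Y)) \<le> 2 * card (members_in \<F>\<^sub>1 (E - insert y Y))"
      unfolding eq using card_members_in_remove[OF sp1, of "E - Y" y] by auto
    with insert.IH have "2 ^ k \<le> 2 ^ card Y * (2 * card (members_in \<F>\<^sub>1 (E - insert y Y)))"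
      by (meson le_trans mult_le_mono2)
    then show ?case using insert.hyps by (simp add: mult.assoc mult.left_commute)
  qed
  let ?B = "E - D"
  have single: "members_in \<F>\<^sub>1 (insert x ?B) = members_in \<F>\<^sub>1 ?B" if x: "x \<in> D" for x
  proof -
    have "x \<notin> C" if "C \<in> \<F>\<^sub>1" "C \<subseteq> insert x ?B" for C
    proof
      assume "x \<in> C"
      then have "D \<inter> C = {x}" using that x by auto
      moreover have "even (card (D \<inter> C))" using D(2) that(1) unfolding cocycle_def by blast
      ultimately show False by simp
    qed
    then show ?thesis using members_in_remove[of \<F>\<^sub>1 "insert x ?B" x] x by simp
  qed
  \<comment> \<open>Only \<open>D - {d}\<close> is charged: once these edges are gone, no member
    contains \<open>d\<close>, and its deletion is free. This gains the factor of two that makes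
    \<open>card D < k\<close> sufficient.\<close>
  have "2 ^ card (D - {d}) * card (members_in \<F>\<^sub>1 (E - (D - {d}))) \<ge> 2 ^ k"
    using lower[of "D - {d}"] finD by simp
  moreover have "E - (D - {d}) = insert d ?B" using d D(1) by auto
  ultimately have "2 ^ card (D - {d}) * card (members_in \<F>\<^sub>1 ?B) \<ge> 2 ^ k"
    using single[OF d] by simp
  moreover have "card (D - {d}) + 2 \<le> k" using D(3) d finD
    by (metis Suc_leI add_2_eq_Suc' card_Suc_Diff1)
  then have "(2::nat) ^ card (D - {d}) * 4 \<le> 2 ^ k"
    using power_increasing[of "card (D - {d}) + 2" k "2::nat"] by (simp add: power_add)
  ultimately have "(2::nat) ^ card (D - {d}) * 4 \<le> 2 ^ card (D - {d}) * card (members_in \<F>\<^sub>1 ?B)"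
    by linarith
  then have ge4: "card (members_in \<F>\<^sub>1 ?B) \<ge> 4" by simp
  have agr: "card (members_in \<F>\<^sub>2 X) = card (members_in \<F>\<^sub>1 X)" if "?B \<subseteq> X" "X \<subseteq> E" for X
    using agree[OF that(2)] card_members_in_mono[OF sp1 that(1)] ge4 by linarith
  have nosingle: "Z \<inter> D \<noteq> {x}" if Z: "Z \<in> \<F>\<^sub>2" and x: "x \<in> D" for Z x
  proof
    assume eq: "Z \<inter> D = {x}"
    have sub: "Z \<subseteq> insert x ?B" using eq binary_spaceD(5)[OF sp2 Z] by auto
    have "card (members_in \<F>\<^sub>2 (insert x ?B)) = 2 * card (members_in \<F>\<^sub>2 (insert x ?B - {x}))"
      by (rule card_members_in_halve[OF sp2 Z sub]) (use eq in auto)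
    moreover have "insert x ?B - {x} = ?B" using x by auto
    ultimately have "card (members_in \<F>\<^sub>1 (insert x ?B)) = 2 * card (members_in \<F>\<^sub>1 ?B)"
      using agr[of ?B] agr[of "insert x ?B"] x D(1) by fastforce
    then show False using single[OF x] ge4 by simp
  qed
  have pair: "\<exists>Z\<in>\<F>\<^sub>2. Z \<inter> D = {x, y}" if xy: "x \<in> D" "y \<in> D" "x \<noteq> y" for x y
  proof -
    obtain Z1 where Z1: "Z1 \<in> \<F>\<^sub>1" "Z1 \<inter> D = {x, y}"
      using minimal_cocycle_pair[OF sp1 D(1,2) min xy] by blast
    let ?X = "insert x (insert y ?B)"
    have "Z1 \<in> members_in \<F>\<^sub>1 ?X" "Z1 \<notin> members_in \<F>\<^sub>1 ?B"
      using Z1 binary_spaceD(5)[OF sp1 Z1(1)] by (auto simp: members_in_def)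
    then have "members_in \<F>\<^sub>1 ?B \<subset> members_in \<F>\<^sub>1 ?X" using members_in_mono[of ?B ?X \<F>\<^sub>1] by blast
    then have "card (members_in \<F>\<^sub>1 ?B) < card (members_in \<F>\<^sub>1 ?X)"
      by (intro psubset_card_mono finite_members_in[OF sp1])
    then have "card (members_in \<F>\<^sub>2 ?B) < card (members_in \<F>\<^sub>2 ?X)"
      using agr[of ?B] agr[of ?X] D(1) xy by (metis (no_types) Diff_subset insert_subset subsetD subset_insertI2 subset_refl)
    then have "\<not> members_in \<F>\<^sub>2 ?X \<subseteq> members_in \<F>\<^sub>2 ?B"
      using card_mono[OF finite_members_in[OF sp2]] by (metis not_le)
    then obtain Z where Z: "Z \<in> \<F>\<^sub>2" "Z \<subseteq> ?X" "\<not> Z \<subseteq> ?B" by (auto simp: members_in_def)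
    then have "Z \<inter> D \<subseteq> {x, y}" "Z \<inter> D \<noteq> {}" using D(1) binary_spaceD(5)[OF sp2 Z(1)] by auto
    then have "Z \<inter> D = {x, y}" using nosingle[OF Z(1), of x] nosingle[OF Z(1), of y] xy by auto
    then show ?thesis using Z by blast
  qed
  have "even (card (Z \<inter> D))" if "Z \<in> \<F>\<^sub>2" for Z
    using that
  proof (induction "card (Z \<inter> D)" arbitrary: Z rule: less_induct)
    case less
    show ?case
    proof (cases "Z \<inter> D = {}")
      case False
      then obtain x where x: "x \<in> Z \<inter> D" by auto
      with nosingle[OF less.prems, of x] obtain y where y: "y \<in> Z \<inter> D" "y \<noteq> x" by auto
      from pair[of x y] x y obtain P where P: "P \<in> \<F>\<^sub>2" "P \<inter> D = {x, y}" by auto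
      have eq: "sym_diff Z P \<inter> D = Z \<inter> D - {x, y}" using P(2) x y by auto
      have fin: "finite (Z \<inter> D)" using finD by simp
      have c: "card (Z \<inter> D) = card (Z \<inter> D - {x, y}) + 2"
        using card_Diff_subset[of "{x, y}" "Z \<inter> D"] card_mono[OF fin, of "{x, y}"] x y by auto
      have "even (card (sym_diff Z P \<inter> D))"
        by (rule less.hyps) (use c eq binary_spaceD(4)[OF sp2 less.prems P(1)] in auto)
      then show ?thesis using c eq by simp
    qed simp
  qed
  then show ?thesis by (simp add: cocycle_def Int_commute)
qed

text \<open>A nonempty cocycle that is not minimal is the disjoint union of two smaller ones, both
  still below the bound.\<close>

lemma small_cocycle_transfer:
  assumes sp1: "binary_space E \<F>\<^sub>1" and sp2: "binary_space E \<F>\<^sub>2"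
    and agree: "\<And>X. X \<subseteq> E \<Longrightarrow> card (members_in \<F>\<^sub>1 X) \<ge> 4 \<Longrightarrow>
      card (members_in \<F>\<^sub>2 X) = card (members_in \<F>\<^sub>1 X)"
    and k: "card (members_in \<F>\<^sub>1 E) = 2 ^ k"
    and D: "D \<subseteq> E" "cocycle \<F>\<^sub>1 D" "card D < k"
  shows "cocycle \<F>\<^sub>2 D"
proof -
  have "finite D" using D binary_spaceD(1)[OF sp1] finite_subset by blast
  then show ?thesis using D
  proof (induction D rule: finite_psubset_induct)
    case (psubset D)
    show ?case
    proof (cases "\<exists>D'\<subset>D. cocycle \<F>\<^sub>1 D' \<and> D' \<noteq> {}")
      case True
      then obtain D' where D': "D' \<subset> D" "cocycle \<F>\<^sub>1 D'" "D' \<noteq> {}" by blast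
      have fin: "finite D" "finite D'" using psubset.hyps D' finite_subset by auto
      have eq: "sym_diff D D' = D - D'" and sub: "D - D' \<subset> D" using D' by auto
      have c: "cocycle \<F>\<^sub>1 (D - D')" using cocycle_sym_diff[OF psubset.prems(2) D'(2) fin] eq by simp
      have "card D' < k" "card (D - D') < k"
        using psubset_card_mono[OF fin(1) D'(1)] psubset_card_mono[OF fin(1) sub] psubset.prems by auto
      then have "cocycle \<F>\<^sub>2 D'" "cocycle \<F>\<^sub>2 (D - D')"
        using psubset.IH[OF D'(1)] psubset.IH[OF sub] psubset.prems D' c by auto
      then have "cocycle \<F>\<^sub>2 (sym_diff (D - D') D')" using cocycle_sym_diff fin by blast
      moreover have "sym_diff (D - D') D' = D" using D' by auto
      ultimately show ?thesis by simp
    next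
      case False
      show ?thesis
      proof (cases "D = {}")
        case False
        then show ?thesis
          using minimal_cocycle_transfer[OF sp1 sp2 agree k psubset.prems] \<open>\<not> (\<exists>D'\<subset>D. _ D')\<close> by blast
      qed simp
    qed
  qed
qed

lemma space_eqI:
  assumes "binary_space E \<F>\<^sub>1" "binary_space E \<F>\<^sub>2" "\<F>\<^sub>2 \<subseteq> \<F>\<^sub>1"
    "card (members_in \<F>\<^sub>1 E) = card (members_in \<F>\<^sub>2 E)"
  shows "\<F>\<^sub>1 = \<F>\<^sub>2"
proof -
  have "members_in \<F>\<^sub>1 E = \<F>\<^sub>1" "members_in \<F>\<^sub>2 E = \<F>\<^sub>2"
    using binary_spaceD(5)[OF assms(1)] binary_spaceD(5)[OF assms(2)] by (auto simp: members_in_def)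
  then show ?thesis using assms(3,4) card_subset_eq[OF binary_spaceD(7)[OF assms(1)] assms(3)] by simp
qed

section \<open>Cycle spaces of graphs\<close>

text \<open>A graph without isolated vertices is given by its edge set \<open>E\<close> and the map \<open>n\<close> that sends an
  edge to its set of ends. Loops are left out of stars because they do not affect parities.\<close>

definition vs :: "('e \<Rightarrow> 'v set) \<Rightarrow> 'e set \<Rightarrow> 'v set" where
  "vs n X = (\<Union>e\<in>X. n e)"

definition ends_ok :: "('e \<Rightarrow> 'v set) \<Rightarrow> 'e set \<Rightarrow> bool" where
  "ends_ok n E \<longleftrightarrow> finite E \<and> (\<forall>e\<in>E. card (n e) = 1 \<or> card (n e) = 2)"

definition star :: "('e \<Rightarrow> 'v set) \<Rightarrow> 'e set \<Rightarrow> 'v \<Rightarrow> 'e set" where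
  "star n E v = {e \<in> E. v \<in> n e \<and> card (n e) = 2}"

text \<open>The boundary map over the field with two elements. Its kernel \<open>evens\<close> is
  the binary cycle space, and over a connected graph its image consists of the vertex sets of even
  size.\<close>

definition bd :: "('e \<Rightarrow> 'v set) \<Rightarrow> 'e set \<Rightarrow> 'v set" where
  "bd n Y = {v. odd (card (star n Y v))}"

definition evens :: "('e \<Rightarrow> 'v set) \<Rightarrow> 'e set \<Rightarrow> 'e set set" where
  "evens n E = {Y. Y \<subseteq> E \<and> bd n Y = {}}"

definition cut :: "('e \<Rightarrow> 'v set) \<Rightarrow> 'e set \<Rightarrow> 'v set \<Rightarrow> 'e set" where
  "cut n E S = {e \<in> E. n e \<inter> S \<noteq> {} \<and> \<not> n e \<subseteq> S}"

text \<open>Connectedness in terms of edges alone, which fits a representation without isolated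
  vertices. The empty edge set counts as connected.\<close>

definition conn :: "('e \<Rightarrow> 'v set) \<Rightarrow> 'e set \<Rightarrow> bool" where
  "conn n E \<longleftrightarrow> (\<forall>X\<subseteq>E. vs n X \<inter> vs n (E - X) = {} \<longrightarrow> X = {} \<or> X = E)"

definition merge :: "'v \<Rightarrow> 'v \<Rightarrow> ('e \<Rightarrow> 'v set) \<Rightarrow> 'e \<Rightarrow> 'v set" where
  "merge u v n = (\<lambda>e. (\<lambda>x. if x = v then u else x) ` n e)"

section \<open>Boundaries, cuts and the dimension of the cycle space\<close>

lemma ends_ok_subset: "ends_ok n E \<Longrightarrow> X \<subseteq> E \<Longrightarrow> ends_ok n X"
  by (auto simp: ends_ok_def intro: finite_subset)

lemma ends_okD:
  assumes "ends_ok n E"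
  shows "finite E" "\<And>e. e \<in> E \<Longrightarrow> card (n e) = 1 \<or> card (n e) = 2" "\<And>e. e \<in> E \<Longrightarrow> finite (n e)"
    "\<And>e. e \<in> E \<Longrightarrow> n e \<noteq> {}" "finite (vs n E)"
proof -
  show "finite E" and *: "\<And>e. e \<in> E \<Longrightarrow> card (n e) = 1 \<or> card (n e) = 2"
    using assms by (auto simp: ends_ok_def)
  show f: "finite (n e)" if "e \<in> E" for e
    using *[OF that] by (metis card.infinite zero_neq_numeral zero_neq_one)
  show "n e \<noteq> {}" if "e \<in> E" for e using *[OF that] by auto
  show "finite (vs n E)" using f \<open>finite E\<close> by (auto simp: vs_def)
qed

lemma vs_mono: "X \<subseteq> Y \<Longrightarrow> vs n X \<subseteq> vs n Y"
  by (auto simp: vs_def)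

lemma vs_Un: "vs n (X \<union> Y) = vs n X \<union> vs n Y"
  by (auto simp: vs_def)

lemma vs_empty [simp]: "vs n {} = {}"
  by (simp add: vs_def)

lemma finite_star: "finite E \<Longrightarrow> finite (star n E v)"
  by (simp add: star_def)

lemma bd_empty [simp]: "bd n {} = {}"
  by (simp add: bd_def star_def)

lemma bd_single: "bd n {e} = (if card (n e) = 2 then n e else {})"
proof -
  have "star n {e} v = (if card (n e) = 2 \<and> v \<in> n e then {e} else {})" for v
    by (auto simp: star_def)
  then show ?thesis by (auto simp: bd_def)
qed

lemma bd_sym_diff:
  assumes "finite A" "finite B"
  shows "bd n (sym_diff A B) = sym_diff (bd n A) (bd n B)"
proof -
  have "star n (sym_diff A B) v = sym_diff (star n A v) (star n B v)" for v
    by (auto simp: star_def)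
  moreover have "even (card (sym_diff (star n A v) (star n B v))) \<longleftrightarrow>
      (even (card (star n A v)) \<longleftrightarrow> even (card (star n B v)))" for v
    using assms by (intro even_card_sym_diff finite_star)
  ultimately have *: "even (card (star n (sym_diff A B) v)) \<longleftrightarrow>
      (even (card (star n A v)) \<longleftrightarrow> even (card (star n B v)))" for v
    by simp
  show ?thesis
  proof (rule set_eqI)
    fix v show "v \<in> bd n (sym_diff A B) \<longleftrightarrow> v \<in> sym_diff (bd n A) (bd n B)"
      using *[of v] unfolding bd_def Un_iff Diff_iff mem_Collect_eq by blast
  qed
qed

lemma bd_subset: "bd n Y \<subseteq> vs n Y"
proof
  fix v assume "v \<in> bd n Y"
  then have "star n Y v \<noteq> {}" by (metis bd_def card.empty even_zero mem_Collect_eq)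
  then show "v \<in> vs n Y" by (auto simp: star_def vs_def)
qed

lemma bd_cong: "(\<And>e. e \<in> Y \<Longrightarrow> n e = n' e) \<Longrightarrow> bd n Y = bd n' Y"
proof -
  assume "\<And>e. e \<in> Y \<Longrightarrow> n e = n' e"
  then have "star n Y v = star n' Y v" for v by (auto simp: star_def)
  then show ?thesis by (simp add: bd_def)
qed

lemma vs_cong: "(\<And>e. e \<in> Y \<Longrightarrow> n e = n' e) \<Longrightarrow> vs n Y = vs n' Y"
  by (auto simp: vs_def)

lemma evens_cong: "(\<And>e. e \<in> E \<Longrightarrow> n e = n' e) \<Longrightarrow> evens n E = evens n' E"
  unfolding evens_def by (rule Collect_cong, rule conj_cong[OF refl], subst bd_cong[of _ n n']) auto

lemma star_eq_cut: "ends_ok n E \<Longrightarrow> star n E v = cut n E {v}"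
  using ends_okD(2)[of n E] by (fastforce simp: star_def cut_def card_1_singleton_iff card_2_iff)

lemma cut_subset: "cut n E S \<subseteq> E"
  by (auto simp: cut_def)

text \<open>Both parities are additive in \<open>Y\<close>, so a single edge suffices: it is in the
  cut exactly when one of its two ends lies in \<open>S\<close>. For \<open>S = UNIV\<close> this is
  the handshake lemma; for the vertex set of a component it shows that the component carries an even
  part of the boundary.\<close>

lemma cut_parity:
  assumes "ends_ok n E" "Y \<subseteq> E"
  shows "even (card (bd n Y \<inter> S)) \<longleftrightarrow> even (card (Y \<inter> cut n E S))"
proof -
  have "finite Y" using assms ends_okD(1) finite_subset by blast
  then show ?thesis using assms(2)
  proof (induction Y rule: finite_induct)
    case (insert e Y)
    then have e: "e \<in> E" "e \<notin> Y" by auto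
    have single: "even (card (bd n {e} \<inter> S)) \<longleftrightarrow> even (card ({e} \<inter> cut n E S))"
    proof (cases "card (n e) = 2")
      case True
      then obtain u v where uv: "n e = {u, v}" "u \<noteq> v" by (auto simp: card_2_iff)
      have "{u, v} \<inter> S = (if u \<in> S then {u} else {}) \<union> (if v \<in> S then {v} else {})" by auto
      then show ?thesis using e uv True by (auto simp: bd_single cut_def)
    next
      case False
      then obtain u where "n e = {u}" using ends_okD(2)[OF assms(1) e(1)] by (auto simp: card_1_singleton_iff)
      then show ?thesis using e by (auto simp: bd_single cut_def)
    qed
    have eq: "insert e Y = sym_diff {e} Y" using e by auto
    have fin: "finite (bd n {e} \<inter> S)" "finite (bd n Y \<inter> S)" "finite ({e} \<inter> cut n E S)" "finite (Y \<inter> cut n E S)"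
      using insert.hyps insert.prems bd_subset[of n "{e}"] bd_subset[of n Y] ends_okD(5)[OF ends_ok_subset[OF assms(1)]] 
      by (auto intro!: finite_Int intro: finite_subset)
    have eqs: "sym_diff A B \<inter> C = sym_diff (A \<inter> C) (B \<inter> C)" for A B C :: "'x set" by auto
    have "even (card (bd n (insert e Y) \<inter> S)) \<longleftrightarrow>
        (even (card (bd n {e} \<inter> S)) \<longleftrightarrow> even (card (bd n Y \<inter> S)))"
      unfolding eq bd_sym_diff[OF finite.insertI[OF finite.emptyI] insert.hyps(1)] eqs
      by (rule even_card_sym_diff[OF fin(1,2)])
    moreover have "even (card (insert e Y \<inter> cut n E S)) \<longleftrightarrow>
        (even (card ({e} \<inter> cut n E S)) \<longleftrightarrow> even (card (Y \<inter> cut n E S)))"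
      unfolding eq eqs by (rule even_card_sym_diff[OF fin(3,4)])
    ultimately show ?case using insert single by auto
  qed simp
qed

lemma even_card_bd:
  assumes "ends_ok n E" "Y \<subseteq> E"
  shows "even (card (bd n Y))"
  using cut_parity[OF assms, of UNIV] by (simp add: cut_def)

lemma evens_subset: "X \<subseteq> E \<Longrightarrow> members_in (evens n E) X = evens n X"
  by (auto simp: evens_def members_in_def)

lemma binary_space_evens:
  assumes "ends_ok n E"
  shows "binary_space E (evens n E)"
proof -
  have "finite E" using assms by (rule ends_okD)
  moreover have "sym_diff A B \<in> evens n E" if "A \<in> evens n E" "B \<in> evens n E" for A B
  proof -
    have "finite A" "finite B" using that \<open>finite E\<close> by (auto simp: evens_def intro: finite_subset)
    then have "bd n (sym_diff A B) = {}" using bd_sym_diff[of A B n] that by (simp add: evens_def)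
    then show ?thesis using that by (auto simp: evens_def)
  qed
  ultimately show ?thesis by (auto simp: binary_space_def evens_def)
qed

lemma cocycle_cut:
  assumes "ends_ok n E"
  shows "cocycle (evens n E) (cut n E S)"
  unfolding cocycle_def
proof
  fix Z assume "Z \<in> evens n E"
  then have "Z \<subseteq> E" "bd n Z = {}" by (auto simp: evens_def)
  then show "even (card (cut n E S \<inter> Z))" using cut_parity[OF assms, of Z S] by (simp add: Int_commute)
qed

text \<open>The vertices that can be joined to \<open>a\<close> are closed under adjacency. The
  boundary is written as a symmetric difference to cover \<open>a = b\<close>, where the join is
  empty.\<close>

lemma connected_join:
  assumes ok: "ends_ok n X" and c: "conn n X" and a: "a \<in> vs n X" and b: "b \<in> vs n X"
  shows "\<exists>R\<subseteq>X. bd n R = sym_diff {a} {b}"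
proof -
  define S where "S = {v \<in> vs n X. \<exists>R\<subseteq>X. bd n R = sym_diff {a} {v}}"
  have fin: "finite R" if "R \<subseteq> X" for R using that ends_okD(1)[OF ok] finite_subset by blast
  have aS: "a \<in> S" using a by (auto simp: S_def intro!: exI[of _ "{}"])
  have closed: "n e \<subseteq> S" if e: "e \<in> X" "n e \<inter> S \<noteq> {}" for e
  proof (cases "card (n e) = 2")
    case True
    then obtain x y where xy: "n e = {x, y}" "x \<noteq> y" by (auto simp: card_2_iff)
    then have "(x \<in> S \<and> n e = {x, y}) \<or> (y \<in> S \<and> n e = {y, x})" using e(2) by auto
    then obtain u v where uv: "n e = {u, v}" "u \<noteq> v" "u \<in> S" using xy(2) by blast
    then obtain R where R: "R \<subseteq> X" "bd n R = sym_diff {a} {u}" by (auto simp: S_def)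
    have "bd n (sym_diff R {e}) = sym_diff (sym_diff {a} {u}) {u, v}"
      using bd_sym_diff[OF fin[OF R(1)], of "{e}" n] R(2) True uv by (simp add: bd_single)
    also have "\<dots> = sym_diff {a} {v}" using uv by auto
    finally have "\<exists>R\<subseteq>X. bd n R = sym_diff {a} {v}" using R(1) e(1) by (intro exI[of _ "sym_diff R {e}"]) auto
    then show ?thesis using uv e(1) by (auto simp: S_def vs_def)
  next
    case False
    then obtain u where "n e = {u}" using ends_okD(2)[OF ok e(1)] by (auto simp: card_1_singleton_iff)
    then show ?thesis using e by auto
  qed
  define Y where "Y = {e \<in> X. n e \<subseteq> S}"
  have "vs n Y \<inter> vs n (X - Y) = {}" using closed by (fastforce simp: Y_def vs_def)
  moreover have "Y \<noteq> {}"
  proof -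
    from a obtain e where "e \<in> X" "a \<in> n e" by (auto simp: vs_def)
    then show ?thesis using closed[of e] aS by (auto simp: Y_def)
  qed
  moreover have "Y \<subseteq> X" by (auto simp: Y_def)
  ultimately have "Y = X" using c unfolding conn_def by blast
  then have "b \<in> S" using b by (auto simp: Y_def vs_def)
  then show ?thesis by (simp add: S_def)
qed

lemma connected_join_ne:
  assumes "ends_ok n X" "conn n X" "a \<in> vs n X" "b \<in> vs n X" "a \<noteq> b"
  shows "\<exists>R\<subseteq>X. bd n R = {a, b}"
proof -
  have "sym_diff {a} {b} = {a, b}" using assms(5) by auto
  then show ?thesis using connected_join[OF assms(1-4)] by simp
qed

text \<open>A potential argument: \<open>S\<close> collects the vertices whose joins to a base
  vertex \<open>v\<^sub>0\<close> meet \<open>D\<close> evenly. The parity is independent of the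
  join, since two joins differ by an even set, and passing along an edge changes it exactly when the
  edge belongs to \<open>D\<close>.\<close>

lemma cocycle_is_cut:
  assumes ok: "ends_ok n E" and c: "conn n E" and D: "D \<subseteq> E" "cocycle (evens n E) D"
  shows "\<exists>S\<subseteq>vs n E. D = cut n E S"
proof (cases "E = {}")
  case True
  then show ?thesis using D by (auto simp: cut_def)
next
  case False
  then obtain v\<^sub>0 where v0: "v\<^sub>0 \<in> vs n E" using ends_okD(4)[OF ok] by (fastforce simp: vs_def)
  have finD: "finite D" using D(1) ends_okD(1)[OF ok] finite_subset by blast
  have fin: "finite R" if "R \<subseteq> E" for R using that ends_okD(1)[OF ok] finite_subset by blast
  define S where "S = {v \<in> vs n E. \<exists>R\<subseteq>E. bd n R = sym_diff {v\<^sub>0} {v} \<and> even (card (D \<inter> R))}"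
  have S_iff: "v \<in> S \<longleftrightarrow> even (card (D \<inter> R))" if v: "v \<in> vs n E" and R: "R \<subseteq> E" "bd n R = sym_diff {v\<^sub>0} {v}" for v R
  proof
    assume "v \<in> S"
    then obtain R' where R': "R' \<subseteq> E" "bd n R' = sym_diff {v\<^sub>0} {v}" "even (card (D \<inter> R'))" by (auto simp: S_def)
    have "bd n (sym_diff R R') = {}" using bd_sym_diff[OF fin fin, OF R(1) R'(1), of n] R R' by auto
    then have "sym_diff R R' \<in> evens n E" using R R' by (auto simp: evens_def)
    then have "even (card (D \<inter> sym_diff R R'))" using D(2) unfolding cocycle_def by blast
    then show "even (card (D \<inter> R))" using even_card_Int_sym_diff[OF finD] R'(3) by blast
  qed (use v R in \<open>auto simp: S_def\<close>)
  have "e \<in> D \<longleftrightarrow> e \<in> cut n E S" if e: "e \<in> E" for e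
  proof (cases "card (n e) = 2")
    case True
    then obtain u v where uv: "n e = {u, v}" "u \<noteq> v" by (auto simp: card_2_iff)
    have V: "u \<in> vs n E" "v \<in> vs n E" using uv e by (auto simp: vs_def)
    obtain R where R: "R \<subseteq> E" "bd n R = sym_diff {v\<^sub>0} {u}" using connected_join[OF ok c v0 V(1)] by blast
    have "bd n (sym_diff R {e}) = sym_diff (sym_diff {v\<^sub>0} {u}) {u, v}"
      using bd_sym_diff[OF fin[OF R(1)], of "{e}" n] R(2) True uv by (simp add: bd_single)
    also have "\<dots> = sym_diff {v\<^sub>0} {v}" using uv by auto
    finally have "v \<in> S \<longleftrightarrow> even (card (D \<inter> sym_diff R {e}))"
      using S_iff[OF V(2), of "sym_diff R {e}"] R(1) e by auto
    then have "v \<in> S \<longleftrightarrow> (u \<in> S \<longleftrightarrow> even (card (D \<inter> {e})))"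
      using even_card_Int_sym_diff[OF finD] S_iff[OF V(1) R] by blast
    then show ?thesis using e uv by (cases "e \<in> D") (auto simp: cut_def)
  next
    case False
    then obtain u where u: "n e = {u}" using ends_okD(2)[OF ok e] by (auto simp: card_1_singleton_iff)
    then have "{e} \<in> evens n E" using e False by (simp add: evens_def bd_single)
    then have "even (card (D \<inter> {e}))" using D(2) unfolding cocycle_def by blast
    then show ?thesis using u by (cases "e \<in> D") (auto simp: cut_def)
  qed
  then have "D = cut n E S" using D(1) by (auto simp: cut_def)
  moreover have "S \<subseteq> vs n E" by (auto simp: S_def)
  ultimately show ?thesis by blast
qed

text \<open>Two vertices of \<open>T\<close> are joined at a time; where joins overlap they
  cancel.\<close>

lemma even_subsets_joined:
  assumes ok: "ends_ok n E" and c: "conn n E" and T: "T \<subseteq> vs n E" "even (card T)"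
  shows "\<exists>R\<subseteq>E. bd n R = T"
  using T
proof (induction "card T" arbitrary: T rule: less_induct)
  case less
  have finT: "finite T" using less.prems ends_okD(5)[OF ok] finite_subset by blast
  show ?case
  proof (cases "T = {}")
    case False
    then obtain a where a: "a \<in> T" by auto
    have "T \<noteq> {a}" using less.prems(2) by auto
    then obtain b where b: "b \<in> T" "b \<noteq> a" using a by auto
    have cT: "card T = card (T - {a, b}) + 2"
      using card_Diff_subset[of "{a, b}" T] card_mono[OF finT, of "{a, b}"] a b by auto
    obtain R where R: "R \<subseteq> E" "bd n R = T - {a, b}"
      using less.hyps[of "T - {a, b}"] cT less.prems by auto
    obtain Q where Q: "Q \<subseteq> E" "bd n Q = {a, b}"
      using connected_join_ne[OF ok c, of a b] a b less.prems(1) by auto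
    have "finite R" "finite Q" using finite_subset[OF R(1) ends_okD(1)[OF ok]] finite_subset[OF Q(1) ends_okD(1)[OF ok]] .
    then have "bd n (sym_diff R Q) = T" using bd_sym_diff[of R Q n] R(2) Q(2) a b by auto
    then show ?thesis using R(1) Q(1) by (intro exI[of _ "sym_diff R Q"]) auto
  qed (auto intro!: exI[of _ "{}"])
qed

text \<open>Membership of a fixed vertex is determined by parity, so removing it gives a bijection
  onto all subsets of the remaining vertices.\<close>

lemma card_even_subsets:
  assumes "finite V" "V \<noteq> {}"
  shows "card {T. T \<subseteq> V \<and> even (card T)} = 2 ^ (card V - 1)"
proof -
  from assms obtain v where v: "v \<in> V" by auto
  let ?A = "{T. T \<subseteq> V \<and> even (card T)}"
  have fin: "finite T" if "T \<subseteq> V" for T using that assms(1) finite_subset by blast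
  have par: "even (card (insert v T)) \<longleftrightarrow> odd (card T)" if "T \<subseteq> V - {v}" for T
    using that fin[of T] by (subst card_insert_disjoint) auto
  have "bij_betw (\<lambda>T. T - {v}) ?A (Pow (V - {v}))"
  proof (rule bij_betwI[where g = "\<lambda>T. if even (card T) then T else insert v T"])
    show "(\<lambda>T. if even (card T) then T else insert v T) \<in> Pow (V - {v}) \<rightarrow> ?A"
    proof
      fix T assume T: "T \<in> Pow (V - {v})"
      show "(if even (card T) then T else insert v T) \<in> ?A"
        using T par[of T] v by (cases "even (card T)") auto
    qed
    show "(if even (card (T - {v})) then T - {v} else insert v (T - {v})) = T" if T: "T \<in> ?A" for T
    proof (cases "v \<in> T")
      case True
      then have "insert v (T - {v}) = T" by auto
      then show ?thesis using T par[of "T - {v}"] by auto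
    qed (use T in auto)
    show "(if even (card T) then T else insert v T) - {v} = T" if "T \<in> Pow (V - {v})" for T
      using that by auto
  qed auto
  then have "card ?A = card (Pow (V - {v}))" by (rule bij_betw_same_card)
  then show ?thesis using assms v by (simp add: card_Pow)
qed

text \<open>Rank and nullity of the boundary map: every even set of vertices is a boundary, and each
  fibre is a coset of the cycle space. So the nullity is
  \<open>card E - card (vs n E) + 1\<close>.\<close>

lemma card_evens:
  assumes ok: "ends_ok n E" and c: "conn n E" and ne: "E \<noteq> {}"
  shows "card (evens n E) * 2 ^ (card (vs n E) - 1) = 2 ^ card E"
proof -
  let ?T = "{T. T \<subseteq> vs n E \<and> even (card T)}"
  have finE: "finite E" using ok by (rule ends_okD)
  have fin: "finite R" if "R \<subseteq> E" for R using that finE finite_subset by blast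
  have finV: "finite (vs n E)" using ok by (rule ends_okD)
  have fib: "card {Y. Y \<subseteq> E \<and> bd n Y = T} = card (evens n E)" if T: "T \<in> ?T" for T
  proof -
    from T obtain R where R: "R \<subseteq> E" "bd n R = T" using even_subsets_joined[OF ok c] by blast
    have shift: "bd n (sym_diff Y R) = sym_diff (bd n Y) T" if "Y \<subseteq> E" for Y
      using bd_sym_diff[OF fin[OF that] fin[OF R(1)], of n] R(2) by simp
    have "bij_betw (\<lambda>Y. sym_diff Y R) {Y. Y \<subseteq> E \<and> bd n Y = T} (evens n E)"
    proof (rule bij_betwI[where g = "\<lambda>Y. sym_diff Y R"])
      show "(\<lambda>Y. sym_diff Y R) \<in> {Y. Y \<subseteq> E \<and> bd n Y = T} \<rightarrow> evens n E"
      proof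
        fix Y assume "Y \<in> {Y. Y \<subseteq> E \<and> bd n Y = T}"
        then show "sym_diff Y R \<in> evens n E" using shift[of Y] R(1) by (auto simp: evens_def)
      qed
      show "(\<lambda>Y. sym_diff Y R) \<in> evens n E \<rightarrow> {Y. Y \<subseteq> E \<and> bd n Y = T}"
      proof
        fix Y assume "Y \<in> evens n E"
        then show "sym_diff Y R \<in> {Y. Y \<subseteq> E \<and> bd n Y = T}" using shift[of Y] R(1) by (auto simp: evens_def)
      qed
    qed auto
    then show ?thesis by (rule bij_betw_same_card)
  qed
  have "Pow E = (\<Union>T\<in>?T. {Y. Y \<subseteq> E \<and> bd n Y = T})"
  proof -
    have "bd n Y \<in> ?T" if "Y \<subseteq> E" for Y
      using even_card_bd[OF ok that] bd_subset[of n Y] vs_mono[OF that, of n] by blast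
    then show ?thesis by auto
  qed
  moreover have "card (\<Union>T\<in>?T. {Y. Y \<subseteq> E \<and> bd n Y = T}) = (\<Sum>T\<in>?T. card {Y. Y \<subseteq> E \<and> bd n Y = T})"
    by (rule card_UN_disjoint) (use finV finE in \<open>auto intro: finite_subset[of _ "Pow _"]\<close>)
  ultimately have "card (Pow E) = (\<Sum>T\<in>?T. card (evens n E))" using fib by simp
  then have "card (Pow E) = card ?T * card (evens n E)" by simp
  moreover have "vs n E \<noteq> {}" using ne ends_okD(4)[OF ok] by (auto simp: vs_def)
  ultimately show ?thesis using card_even_subsets[OF finV] finE by (simp add: card_Pow mult.commute)
qed

lemma sum_card_star:
  assumes "ends_ok n E"
  shows "(\<Sum>v\<in>vs n E. card (star n E v)) = 2 * card {e \<in> E. card (n e) = 2}"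
proof -
  let ?L = "{e \<in> E. card (n e) = 2}"
  have fin: "finite ?L" "finite (vs n E)" using ends_okD[OF assms] by auto
  have "(\<Sum>v\<in>vs n E. card (star n E v)) = (\<Sum>v\<in>vs n E. \<Sum>e\<in>{e \<in> ?L. v \<in> n e}. 1::nat)"
  proof (rule sum.cong[OF refl])
    fix v
    have "star n E v = {e \<in> ?L. v \<in> n e}" by (auto simp: star_def)
    then show "card (star n E v) = (\<Sum>e\<in>{e \<in> ?L. v \<in> n e}. 1)" by simp
  qed
  also have "\<dots> = (\<Sum>e\<in>?L. \<Sum>v\<in>{v \<in> vs n E. v \<in> n e}. 1::nat)"
    using sum.swap_restrict[OF fin(2,1), of "\<lambda>_ _. 1::nat" "\<lambda>v e. v \<in> n e"] .
  also have "\<dots> = (\<Sum>e\<in>?L. 2::nat)"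
  proof (rule sum.cong[OF refl])
    fix e assume "e \<in> ?L"
    moreover have "{v \<in> vs n E. v \<in> n e} = n e" using \<open>e \<in> ?L\<close> by (auto simp: vs_def)
    ultimately show "(\<Sum>v\<in>{v \<in> vs n E. v \<in> n e}. 1) = (2::nat)" by simp
  qed
  finally show ?thesis by simp
qed

section \<open>Identification of vertices and contraction of edges\<close>

lemma merge_ends_ok:
  assumes "ends_ok n E"
  shows "ends_ok (merge u v n) E"
proof -
  have "card (merge u v n e) = 1 \<or> card (merge u v n e) = 2" if e: "e \<in> E" for e
  proof -
    have "card (merge u v n e) \<le> card (n e)"
      unfolding merge_def by (rule card_image_le[OF ends_okD(3)[OF assms e]])
    moreover have "card (merge u v n e) \<noteq> 0"
    proof -
      have "finite (merge u v n e)" "merge u v n e \<noteq> {}"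
        using ends_okD(3,4)[OF assms e] unfolding merge_def image_is_empty by simp_all
      then show ?thesis by simp
    qed
    ultimately show ?thesis using ends_okD(2)[OF assms e] by linarith
  qed
  then show ?thesis using ends_okD(1)[OF assms] by (simp add: ends_ok_def)
qed

text \<open>Away from \<open>u\<close> and \<open>v\<close> no parity changes, an edge joining them
  turns into a loop and drops out of the stars, and the parity at the merged vertex is then forced
  by the handshake lemma.\<close>

lemma merge_bd:
  assumes ok: "ends_ok n E" and Y: "Y \<subseteq> E" and uv: "u \<noteq> v"
  shows "bd (merge u v n) Y = {} \<longleftrightarrow> bd n Y \<subseteq> {u, v}"
proof -
  let ?m = "merge u v n"
  have other: "star ?m Y w = star n Y w" if "w \<noteq> u" "w \<noteq> v" for w
  proof -
    have "w \<in> ?m e \<and> card (?m e) = 2 \<longleftrightarrow> w \<in> n e \<and> card (n e) = 2" if e: "e \<in> Y" for e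
    proof (cases "card (n e) = 2")
      case True
      then obtain a b where ab: "n e = {a, b}" "a \<noteq> b" by (auto simp: card_2_iff)
      show ?thesis
      proof (cases "w \<in> {a, b}")
        case in_ab: True
        then obtain c where c: "n e = {w, c}" "w \<noteq> c" using ab by blast
        define c' where "c' = (if c = v then u else c)"
        have "?m e = {w, c'}" unfolding merge_def c(1) c'_def using \<open>w \<noteq> v\<close> by simp
        moreover have "c' \<noteq> w" using \<open>w \<noteq> u\<close> c(2) by (simp add: c'_def)
        ultimately show ?thesis using c by simp
      next
        case False
        then have "w \<notin> ?m e" using \<open>w \<noteq> u\<close> unfolding merge_def ab(1) by auto
        then show ?thesis using False ab(1) by blast
      qed
    next
      case False
      then obtain a where "n e = {a}" using ends_okD(2)[OF ok, of e] e Y card_1_singleton_iff[of "n e"] by auto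
      then show ?thesis by (auto simp: merge_def)
    qed
    then show ?thesis by (auto simp: star_def)
  qed
  have "star ?m Y v = {}" using uv by (auto simp: star_def merge_def)
  then have "v \<notin> bd ?m Y" by (simp add: bd_def)
  then have "x \<in> bd ?m Y - {u} \<longleftrightarrow> x \<in> bd n Y - {u, v}" for x
    using other[of x] by (cases "x = v") (auto simp: bd_def)
  then have "bd ?m Y - {u} = bd n Y - {u, v}" by blast
  then have "bd n Y \<subseteq> {u, v} \<longleftrightarrow> bd ?m Y \<subseteq> {u}" by blast
  moreover have "bd ?m Y \<subseteq> {u} \<longleftrightarrow> bd ?m Y = {}"
    using even_card_bd[OF merge_ends_ok[OF ok, of u v] Y] unfolding subset_singleton_iff by fastforce
  ultimately show ?thesis by simp
qed

lemma even_pair_subset: "even (card A) \<Longrightarrow> A \<subseteq> {u, v} \<Longrightarrow> u \<noteq> v \<Longrightarrow> A = {} \<or> A = {u, v}"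
proof -
  assume *: "even (card A)" "A \<subseteq> {u, v}" "u \<noteq> v"
  then consider "A = {}" | "A = {u}" | "A = {v}" | "A = {u, v}" by blast
  then show ?thesis using * by cases auto
qed

text \<open>No boundary can equal \<open>{u, v}\<close> when the two vertices lie in different
  components, because each component contains an even part of it. Components are thus invisible to
  the cycle space.\<close>

lemma evens_merge:
  assumes ok: "ends_ok n E" and X: "X \<subseteq> E" "vs n X \<inter> vs n (E - X) = {}"
    and u: "u \<in> vs n X" and v: "v \<notin> vs n X"
  shows "evens (merge u v n) E = evens n E"
proof -
  have uv: "u \<noteq> v" using u v by auto
  have "cut n E (vs n X) = {}"
  proof -
    have "n e \<inter> vs n X \<noteq> {} \<Longrightarrow> n e \<subseteq> vs n X" if "e \<in> E" for e
      using X that by (cases "e \<in> X") (auto simp: vs_def)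
    then show ?thesis by (auto simp: cut_def)
  qed
  then have ev: "even (card (bd n Y \<inter> vs n X))" if "Y \<subseteq> E" for Y
    using cut_parity[OF ok that, of "vs n X"] by simp
  have "bd (merge u v n) Y = {} \<longleftrightarrow> bd n Y = {}" if Y: "Y \<subseteq> E" for Y
  proof -
    have "bd n Y \<noteq> {u, v}"
    proof
      assume "bd n Y = {u, v}"
      then have "bd n Y \<inter> vs n X = {u}" using u v by auto
      then show False using ev[OF Y] by simp
    qed
    then show ?thesis using merge_bd[OF ok Y uv] even_pair_subset[OF even_card_bd[OF ok Y] _ uv] by auto
  qed
  then show ?thesis by (auto simp: evens_def)
qed

text \<open>After the ends of \<open>e\<close> are identified, a set is even if it was even before
  or had just these two ends as its boundary, and in the second case \<open>e\<close> repairs it. A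
  loop is deleted instead, with the same effect, since loops do not enter boundaries. The vertex
  type is kept so that contractions can be iterated.\<close>

lemma contract_edge:
  assumes ok: "ends_ok (n :: 'e \<Rightarrow> 'v set) E" and e: "e \<in> E"
  shows "\<exists>n' :: 'e \<Rightarrow> 'v set. ends_ok n' (E - {e}) \<and> evens n' (E - {e}) = (\<lambda>Z. Z - {e}) ` evens n E"
proof (cases "card (n e) = 2")
  case True
  then obtain u v where uv: "n e = {u, v}" "u \<noteq> v" by (auto simp: card_2_iff)
  let ?m = "merge u v n"
  have ok': "ends_ok ?m (E - {e})" using merge_ends_ok[OF ends_ok_subset[OF ok]] by auto
  have "Y \<in> evens ?m (E - {e}) \<longleftrightarrow> Y \<in> (\<lambda>Z. Z - {e}) ` evens n E" if Y: "Y \<subseteq> E - {e}" for Y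
  proof -
    have YE: "Y \<subseteq> E" and eY: "e \<notin> Y" using Y by auto
    have finY: "finite Y" using YE ends_okD(1)[OF ok] finite_subset by blast
    have ins: "insert e Y = sym_diff Y {e}" using eY by auto
    have be: "bd n (insert e Y) = sym_diff (bd n Y) {u, v}"
      unfolding ins using bd_sym_diff[OF finY, of "{e}" n] uv True by (simp add: bd_single)
    have "Y \<in> (\<lambda>Z. Z - {e}) ` evens n E \<longleftrightarrow> Y \<in> evens n E \<or> insert e Y \<in> evens n E"
    proof
      assume "Y \<in> (\<lambda>Z. Z - {e}) ` evens n E"
      then obtain Z where Z: "Z \<in> evens n E" "Y = Z - {e}" by auto
      then show "Y \<in> evens n E \<or> insert e Y \<in> evens n E"
        by (cases "e \<in> Z") (auto simp: insert_absorb)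
    next
      assume "Y \<in> evens n E \<or> insert e Y \<in> evens n E"
      then show "Y \<in> (\<lambda>Z. Z - {e}) ` evens n E"
        using eY by (elim disjE) (rule image_eqI[rotated], assumption, simp)+
    qed
    also have "\<dots> \<longleftrightarrow> bd n Y = {} \<or> bd n Y = {u, v}"
      using YE e be by (auto simp: evens_def)
    also have "\<dots> \<longleftrightarrow> bd n Y \<subseteq> {u, v}" using even_pair_subset[OF even_card_bd[OF ok YE] _ uv(2)] by blast
    finally show ?thesis using merge_bd[OF ok YE uv(2)] Y by (simp add: evens_def)
  qed
  moreover have "Z \<subseteq> E - {e}" if "Z \<in> evens ?m (E - {e})" for Z using that by (simp add: evens_def)
  moreover have "Z \<subseteq> E - {e}" if "Z \<in> (\<lambda>Z. Z - {e}) ` evens n E" for Z using that by (auto simp: evens_def)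
  ultimately have "evens ?m (E - {e}) = (\<lambda>Z. Z - {e}) ` evens n E"
    by (intro set_eqI) (metis (no_types, lifting))
  then show ?thesis using ok' by blast
next
  case False
  have fin: "finite Z" if "Z \<subseteq> E" for Z using that ends_okD(1)[OF ok] finite_subset by blast
  have "bd n (Z - {e}) = bd n Z" for Z
  proof -
    have "star n (Z - {e}) v = star n Z v" for v using False by (auto simp: star_def)
    then show ?thesis by (simp add: bd_def)
  qed
  then have "Z - {e} \<in> evens n (E - {e})" if "Z \<in> evens n E" for Z
    using that by (auto simp: evens_def)
  moreover have "Z = Z - {e} \<and> Z \<in> evens n E" if "Z \<in> evens n (E - {e})" for Z
    using that by (auto simp: evens_def)
  ultimately have "evens n (E - {e}) = (\<lambda>Z. Z - {e}) ` evens n E"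
    by (intro subset_antisym subsetI image_eqI[where f = "\<lambda>Z. Z - {e}"]) (auto simp del: Diff_insert0)
  then show ?thesis by (intro exI[of _ n] conjI ends_ok_subset[OF ok]) auto
qed

lemma contract_set:
  assumes "ends_ok (n :: 'e \<Rightarrow> 'v set) E" and "R \<subseteq> E"
  shows "\<exists>n' :: 'e \<Rightarrow> 'v set. ends_ok n' R \<and> evens n' R = (\<lambda>Z. Z \<inter> R) ` evens n E"
proof -
  have "finite (E - R)" using assms ends_okD(1) by blast
  have "\<exists>n' :: 'e \<Rightarrow> 'v set. ends_ok n' (E - F) \<and> evens n' (E - F) = (\<lambda>Z. Z \<inter> (E - F)) ` evens n E"
    if "finite F" "F \<subseteq> E" for F
    using that
  proof (induction F rule: finite_induct)
    case empty
    have "Z \<inter> E = Z" if "Z \<in> evens n E" for Z using that by (auto simp: evens_def)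
    then have "(\<lambda>Z. Z \<inter> E) ` evens n E = evens n E" by simp
    then show ?case using assms by auto
  next
    case (insert f F)
    then obtain n' :: "'e \<Rightarrow> 'v set" where n': "ends_ok n' (E - F)" "evens n' (E - F) = (\<lambda>Z. Z \<inter> (E - F)) ` evens n E" by auto
    moreover have "f \<in> E - F" using insert by auto
    ultimately obtain n'' :: "'e \<Rightarrow> 'v set" where n'': "ends_ok n'' (E - F - {f})"
        "evens n'' (E - F - {f}) = (\<lambda>Z. Z - {f}) ` evens n' (E - F)"
      using contract_edge[of n' "E - F" f] by blast
    have "E - F - {f} = E - insert f F" by auto
    moreover have "(\<lambda>Z. Z - {f}) ` evens n' (E - F) = (\<lambda>Z. Z \<inter> (E - insert f F)) ` evens n E"
      unfolding n'(2) image_image by (intro image_cong) auto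
    ultimately show ?case using n'' by metis
  qed
  from this[of "E - R"] \<open>finite (E - R)\<close> have "\<exists>n' :: 'e \<Rightarrow> 'v set. ends_ok n' (E - (E - R)) \<and>
      evens n' (E - (E - R)) = (\<lambda>Z. Z \<inter> (E - (E - R))) ` evens n E" by blast
  moreover have "E - (E - R) = R" using assms(2) by auto
  ultimately show ?thesis by simp
qed

section \<open>Switchings and 2-separations\<close>

text \<open>The bound two rules out several components (no shared vertex) and cut vertices (one
  shared vertex) at once.\<close>

definition nonsep :: "('e \<Rightarrow> 'v set) \<Rightarrow> 'e set \<Rightarrow> bool" where
  "nonsep n E \<longleftrightarrow> (\<forall>X\<subseteq>E. X \<noteq> {} \<longrightarrow> X \<noteq> E \<longrightarrow> card (vs n X \<inter> vs n (E - X)) \<ge> 2)"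

text \<open>The space is the direct sum of its parts inside and outside \<open>X\<close>. A side
  with fewer than two attachment vertices leaves this trace in the cycle space, so separability can
  be recognized without the graph.\<close>

definition splits :: "'e set set \<Rightarrow> 'e set \<Rightarrow> bool" where
  "splits \<F> X \<longleftrightarrow> (\<forall>Z\<in>\<F>. Z \<inter> X \<in> \<F>)"

definition iso :: "'e set \<Rightarrow> ('e \<Rightarrow> 'v set) \<Rightarrow> ('e \<Rightarrow> 'w set) \<Rightarrow> bool" where
  "iso E n n' \<longleftrightarrow> (\<exists>f. inj_on f (vs n E) \<and> (\<forall>e\<in>E. n' e = f ` n e))"

definition switch :: "'e set \<Rightarrow> 'v \<Rightarrow> 'v \<Rightarrow> ('e \<Rightarrow> 'v set) \<Rightarrow> 'e \<Rightarrow> 'v set" where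
  "switch Y u v n = (\<lambda>e. if e \<in> Y then transpose u v ` n e else n e)"

definition switchable :: "'e set \<Rightarrow> ('e \<Rightarrow> 'v set) \<Rightarrow> 'e set \<Rightarrow> 'v \<Rightarrow> 'v \<Rightarrow> bool" where
  "switchable E n Y u v \<longleftrightarrow> Y \<subseteq> E \<and> u \<noteq> v \<and> vs n Y \<inter> vs n (E - Y) = {u, v}"

text \<open>The equivalence generated by switchings and renamings of vertices, on bare end maps over
  a fixed edge set. Symmetry follows from the generators.\<close>

inductive SW :: "'e set \<Rightarrow> ('e \<Rightarrow> 'v set) \<Rightarrow> ('e \<Rightarrow> 'v set) \<Rightarrow> bool" for E where
  SW_iso: "iso E n n' \<Longrightarrow> SW E n n'"
| SW_switch: "switchable E n Y u v \<Longrightarrow> SW E n (switch Y u v n)"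
| SW_trans: "SW E n n' \<Longrightarrow> SW E n' n'' \<Longrightarrow> SW E n n''"

lemma vs_iso: "\<forall>e\<in>E. n' e = f ` n e \<Longrightarrow> X \<subseteq> E \<Longrightarrow> vs n' X = f ` vs n X"
  by (simp add: vs_def image_UN subset_iff)

lemma iso_refl: "iso E n n"
  unfolding iso_def by (rule exI[of _ id]) auto

lemma iso_sym:
  assumes "iso E n n'"
  shows "iso E n' n"
proof -
  obtain f where f: "inj_on f (vs n E)" "\<forall>e\<in>E. n' e = f ` n e" using assms by (auto simp: iso_def)
  have eq: "vs n' E = f ` vs n E" using vs_iso[OF f(2)] by simp
  have "inj_on (inv_into (vs n E) f) (vs n' E)"
    unfolding eq by (rule inj_on_inv_into) simp
  moreover have "n e = inv_into (vs n E) f ` n' e" if "e \<in> E" for e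
  proof -
    have "n e \<subseteq> vs n E" using that by (auto simp: vs_def)
    then show ?thesis using f that by (simp add: inv_into_image_cancel)
  qed
  ultimately show ?thesis unfolding iso_def by blast
qed

lemma iso_trans:
  assumes "iso E n n'" "iso E n' n''"
  shows "iso E n n''"
proof -
  obtain f g where f: "inj_on f (vs n E)" "\<forall>e\<in>E. n' e = f ` n e"
    and g: "inj_on g (vs n' E)" "\<forall>e\<in>E. n'' e = g ` n' e" using assms by (auto simp: iso_def)
  have "inj_on (g \<circ> f) (vs n E)" using f g vs_iso[OF f(2)] by (simp add: comp_inj_on)
  moreover have "\<forall>e\<in>E. n'' e = (g \<circ> f) ` n e" using f g by (simp add: image_comp)
  ultimately show ?thesis unfolding iso_def by blast
qed

lemma iso_cong:
  assumes "iso E n m" "\<And>e. e \<in> E \<Longrightarrow> n e = n' e" "\<And>e. e \<in> E \<Longrightarrow> m e = m' e"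
  shows "iso E n' m'"
proof -
  have "vs n E = vs n' E" by (rule vs_cong) (rule assms)
  then show ?thesis using assms unfolding iso_def by metis
qed

lemma iso_bd:
  assumes "inj_on f (vs n E)" "\<forall>e\<in>E. n' e = f ` n e" "Y \<subseteq> E"
  shows "bd n' Y = f ` bd n Y"
proof -
  have sub: "n e \<subseteq> vs n E" if "e \<in> Y" for e using that assms(3) by (auto simp: vs_def)
  have c: "card (n' e) = card (n e)" if "e \<in> Y" for e
    using assms that inj_on_subset[OF assms(1) sub[OF that]] by (simp add: card_image subsetD)
  have st: "star n' Y (f v) = star n Y v" if "v \<in> vs n E" for v
    using c assms(2,3) sub inj_on_image_mem_iff[OF assms(1) that] by (auto simp: star_def subset_iff)
  have "bd n Y \<subseteq> vs n E" "bd n' Y \<subseteq> f ` vs n E"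
  proof -
    show "bd n Y \<subseteq> vs n E" using bd_subset[of n Y] vs_mono[OF assms(3), of n] by (rule subset_trans)
    have "bd n' Y \<subseteq> f ` vs n Y" using bd_subset[of n' Y] vs_iso[OF assms(2,3)] by simp
    then show "bd n' Y \<subseteq> f ` vs n E" using vs_mono[OF assms(3), of n] by (meson image_mono subset_trans)
  qed
  moreover have "f v \<in> bd n' Y \<longleftrightarrow> v \<in> bd n Y" if "v \<in> vs n E" for v
    using st[OF that] by (simp add: bd_def)
  ultimately show ?thesis by (intro subset_antisym subsetI) (auto simp: subset_iff)
qed

lemma iso_evens:
  assumes "iso E n n'"
  shows "evens n' E = evens n E"
proof -
  obtain f where "inj_on f (vs n E)" "\<forall>e\<in>E. n' e = f ` n e" using assms by (auto simp: iso_def)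
  then have "bd n' Y = f ` bd n Y" if "Y \<subseteq> E" for Y using that by (rule iso_bd)
  then show ?thesis unfolding evens_def by (intro Collect_cong conj_cong refl) simp
qed

lemma iso_ends_ok: "iso E n n' \<Longrightarrow> ends_ok n E \<Longrightarrow> ends_ok n' E"
proof -
  assume "iso E n n'" and ok: "ends_ok n E"
  then obtain f where f: "inj_on f (vs n E)" "\<forall>e\<in>E. n' e = f ` n e" by (auto simp: iso_def)
  have "card (n' e) = card (n e)" if "e \<in> E" for e
  proof -
    have "n e \<subseteq> vs n E" using that by (auto simp: vs_def)
    then show ?thesis using f that inj_on_subset[OF f(1)] by (simp add: card_image)
  qed
  then show ?thesis using ok by (simp add: ends_ok_def)
qed

lemma vs_switch:
  assumes "switchable E n Y u v"
  shows "vs (switch Y u v n) Y = vs n Y"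
proof -
  have "vs (switch Y u v n) Y = transpose u v ` vs n Y" by (auto simp: vs_def switch_def)
  moreover have "u \<in> vs n Y" "v \<in> vs n Y" using assms by (auto simp: switchable_def)
  ultimately show ?thesis by simp
qed

lemma vs_switch_disjoint: "X \<inter> Y = {} \<Longrightarrow> vs (switch Y u v n) X = vs n X"
  by (rule vs_cong) (auto simp: switch_def)

lemma switch_switch: "switch Y u v (switch Y u v n) = n"
  by (rule ext) (simp add: switch_def image_comp)

lemma switchable_switch: "switchable E n Y u v \<Longrightarrow> switchable E (switch Y u v n) Y u v"
  using vs_switch[of E n Y u v] vs_switch_disjoint[of "E - Y" Y u v n] by (auto simp: switchable_def)

lemma switch_ends_ok: "ends_ok n E \<Longrightarrow> ends_ok (switch Y u v n) E"
  by (auto simp: ends_ok_def switch_def card_image inj_on_transpose)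

lemma bd_Un_disjoint:
  assumes "finite A" "finite B" "A \<inter> B = {}"
  shows "bd n (A \<union> B) = sym_diff (bd n A) (bd n B)"
proof -
  have "A \<union> B = sym_diff A B" using assms by auto
  then show ?thesis using bd_sym_diff[OF assms(1,2), of n] by simp
qed

text \<open>The part of an even set inside \<open>Y\<close> has a boundary of even size contained in
  \<open>{u, v}\<close>; it is empty or the whole pair, and the transposition fixes it. Inclusion is
  enough because switching twice is the identity.\<close>

lemma evens_switch_subset:
  assumes ok: "ends_ok n E" and sw: "switchable E n Y u v"
  shows "evens n E \<subseteq> evens (switch Y u v n) E"
proof
  fix Z assume Z: "Z \<in> evens n E"
  let ?m = "switch Y u v n"
  have ZE: "Z \<subseteq> E" using Z by (simp add: evens_def)
  have fin: "finite (Z \<inter> Y)" "finite (Z - Y)" using finite_subset[OF ZE ends_okD(1)[OF ok]] by auto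
  have split: "bd k Z = sym_diff (bd k (Z \<inter> Y)) (bd k (Z - Y))" for k :: "'a \<Rightarrow> 'b set"
    using bd_Un_disjoint[OF fin, of k] by (simp add: Int_Diff_disjoint Int_Diff_Un)
  have "sym_diff (bd n (Z \<inter> Y)) (bd n (Z - Y)) = {}" using split[of n] Z by (simp add: evens_def)
  then have eq: "bd n (Z \<inter> Y) = bd n (Z - Y)" by auto
  have "bd n (Z \<inter> Y) \<subseteq> vs n Y" "bd n (Z - Y) \<subseteq> vs n (E - Y)"
    using subset_trans[OF bd_subset vs_mono, of "Z \<inter> Y" Y n] subset_trans[OF bd_subset vs_mono, of "Z - Y" "E - Y" n] ZE
    by auto
  moreover have "vs n Y \<inter> vs n (E - Y) = {u, v}" and uv: "u \<noteq> v" using sw unfolding switchable_def by blast+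
  ultimately have sub: "bd n (Z \<inter> Y) \<subseteq> {u, v}" unfolding eq by blast
  have "even (card (bd n (Z \<inter> Y)))" using even_card_bd[OF ok, of "Z \<inter> Y"] ZE by auto
  then have "bd n (Z \<inter> Y) = {} \<or> bd n (Z \<inter> Y) = {u, v}" using even_pair_subset[OF _ sub uv] by simp
  then have inv: "transpose u v ` bd n (Z \<inter> Y) = bd n (Z \<inter> Y)" by (elim disjE) (simp_all add: insert_commute)
  have "bd ?m (Z \<inter> Y) = transpose u v ` bd n (Z \<inter> Y)"
    by (rule iso_bd[where E = "Z \<inter> Y"]) (auto simp: switch_def)
  moreover have "bd ?m (Z - Y) = bd n (Z - Y)" by (rule bd_cong) (auto simp: switch_def)
  ultimately have "bd ?m Z = {}" using split[of ?m] inv eq by simp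
  then show "Z \<in> evens ?m E" using ZE by (simp add: evens_def)
qed

lemma evens_switch:
  assumes ok: "ends_ok n E" and sw: "switchable E n Y u v"
  shows "evens (switch Y u v n) E = evens n E"
  using evens_switch_subset[OF ok sw]
    evens_switch_subset[OF switch_ends_ok[OF ok] switchable_switch[OF sw]]
  by (simp add: switch_switch)

lemma SW_sym: "SW E n n' \<Longrightarrow> SW E n' n"
proof (induction rule: SW.induct)
  case (SW_iso n n')
  then show ?case using iso_sym SW.SW_iso by blast
next
  case (SW_switch n Y u v)
  then show ?case using SW.SW_switch[OF switchable_switch[OF SW_switch]] by (simp add: switch_switch)
next
  case (SW_trans n n' n'')
  then show ?case using SW.SW_trans by blast
qed

lemma SW_preserves: "SW E n n' \<Longrightarrow> ends_ok n E \<Longrightarrow> ends_ok n' E \<and> evens n' E = evens n E"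
proof (induction rule: SW.induct)
  case (SW_iso n n')
  then show ?case using iso_ends_ok iso_evens by blast
next
  case (SW_switch n Y u v)
  then show ?case using switch_ends_ok[of n E Y u v] evens_switch[of n E Y u v] by simp
qed auto

text \<open>The edges outside \<open>X\<^sub>1\<close>, each of which may serve as the label, become one virtual edge that
  joins the two attachment vertices.\<close>

definition cap :: "('e \<Rightarrow> 'v set) \<Rightarrow> 'e set \<Rightarrow> 'e set \<Rightarrow> 'e \<Rightarrow> 'v set" where
  "cap n X\<^sub>1 X\<^sub>2 = (\<lambda>e. if e \<in> X\<^sub>1 then n e else vs n X\<^sub>1 \<inter> vs n X\<^sub>2)"

lemma vs_cap_subset: "Y \<subseteq> X\<^sub>1 \<Longrightarrow> vs (cap n X\<^sub>1 X\<^sub>2) Y = vs n Y"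
  by (rule vs_cong) (auto simp: cap_def)

text \<open>Any switching of the side \<open>X\<^sub>1\<close> with its virtual edge can be imitated
  in the whole graph while the edges of \<open>X\<^sub>2\<close> keep their ends. The set
  \<open>F\<close> holds the label of the virtual edge; it may be empty only if the two sides are
  disjoint, when there is nothing to complete.\<close>

lemma SW_lift:
  assumes "SW (X\<^sub>1 \<union> F) m m'" and "X\<^sub>1 \<inter> X\<^sub>2 = {}" "X\<^sub>1 \<inter> F = {}"
    and "(F = {} \<and> vs n X\<^sub>1 \<inter> vs n X\<^sub>2 = {}) \<or> (\<exists>p. F = {p})"
    and "iso (X\<^sub>1 \<union> F) (cap n X\<^sub>1 X\<^sub>2) m"
  shows "\<exists>n'. SW (X\<^sub>1 \<union> X\<^sub>2) n n' \<and> (\<forall>e\<in>X\<^sub>2. n' e = n e) \<and>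
    vs n' X\<^sub>1 \<inter> vs n' X\<^sub>2 = vs n X\<^sub>1 \<inter> vs n X\<^sub>2 \<and> iso (X\<^sub>1 \<union> F) (cap n' X\<^sub>1 X\<^sub>2) m'"
  using assms(1,4,5)
proof (induction arbitrary: n rule: SW.induct)
  case (SW_iso m m')
  then have "iso (X\<^sub>1 \<union> F) (cap n X\<^sub>1 X\<^sub>2) m'" using iso_trans by blast
  moreover have "SW (X\<^sub>1 \<union> X\<^sub>2) n n" using iso_refl SW.SW_iso by blast
  ultimately show ?case by blast
next
  case (SW_trans m m' m'')
  obtain n' where n': "SW (X\<^sub>1 \<union> X\<^sub>2) n n'" "\<forall>e\<in>X\<^sub>2. n' e = n e"
    "vs n' X\<^sub>1 \<inter> vs n' X\<^sub>2 = vs n X\<^sub>1 \<inter> vs n X\<^sub>2" "iso (X\<^sub>1 \<union> F) (cap n' X\<^sub>1 X\<^sub>2) m'"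
    using SW_trans.IH(1)[OF SW_trans.prems] by blast
  have "(F = {} \<and> vs n' X\<^sub>1 \<inter> vs n' X\<^sub>2 = {}) \<or> (\<exists>p. F = {p})" using SW_trans.prems(1) n'(3) by simp
  then obtain n'' where n'': "SW (X\<^sub>1 \<union> X\<^sub>2) n' n''" "\<forall>e\<in>X\<^sub>2. n'' e = n' e"
    "vs n'' X\<^sub>1 \<inter> vs n'' X\<^sub>2 = vs n' X\<^sub>1 \<inter> vs n' X\<^sub>2" "iso (X\<^sub>1 \<union> F) (cap n'' X\<^sub>1 X\<^sub>2) m''"
    using SW_trans.IH(2)[OF _ n'(4)] by blast
  have "SW (X\<^sub>1 \<union> X\<^sub>2) n n''" using n'(1) n''(1) SW.SW_trans by blast
  moreover have "\<forall>e\<in>X\<^sub>2. n'' e = n e" "vs n'' X\<^sub>1 \<inter> vs n'' X\<^sub>2 = vs n X\<^sub>1 \<inter> vs n X\<^sub>2" using n' n'' by simp_all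
  ultimately show ?case using n''(4) by blast
next
  case (SW_switch m Y u v)
  let ?k = "cap n X\<^sub>1 X\<^sub>2" and ?E = "X\<^sub>1 \<union> F" and ?A = "vs n X\<^sub>1 \<inter> vs n X\<^sub>2"
  obtain f where f: "inj_on f (vs ?k ?E)" "\<forall>e\<in>?E. m e = f ` ?k e" using SW_switch.prems(2) by (auto simp: iso_def)
  have Y: "Y \<subseteq> ?E" "u \<noteq> v" "vs m Y \<inter> vs m (?E - Y) = {u, v}" using SW_switch.hyps by (auto simp: switchable_def)
  have Ysub: "vs ?k Y \<subseteq> vs ?k ?E" "vs ?k (?E - Y) \<subseteq> vs ?k ?E" using Y(1) by (auto intro!: vs_mono)
  have "f ` (vs ?k Y \<inter> vs ?k (?E - Y)) = {u, v}"
    using Y(3) vs_iso[OF f(2) Y(1)] vs_iso[OF f(2), of "?E - Y"] inj_on_image_Int[OF f(1) Ysub] by auto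
  then have *: "f ` (vs ?k Y \<inter> vs ?k (?E - Y)) = {u, v}" .
  have "u \<in> f ` (vs ?k Y \<inter> vs ?k (?E - Y))" "v \<in> f ` (vs ?k Y \<inter> vs ?k (?E - Y))" unfolding * by auto
  then obtain u' v' where u': "u' \<in> vs ?k Y \<inter> vs ?k (?E - Y)" "f u' = u"
    and v': "v' \<in> vs ?k Y \<inter> vs ?k (?E - Y)" "f v' = v" by (elim imageE) blast
  have uv': "u' \<noteq> v'" using u' v' Y(2) by auto
  have Aeq: "vs ?k Y \<inter> vs ?k (?E - Y) = {u', v'}"
  proof
    show "vs ?k Y \<inter> vs ?k (?E - Y) \<subseteq> {u', v'}"
    proof
      fix x assume x: "x \<in> vs ?k Y \<inter> vs ?k (?E - Y)"
      then have "f x = f u' \<or> f x = f v'" using * u'(2) v'(2) by blast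
      then show "x \<in> {u', v'}" using x u'(1) v'(1) Ysub f(1) by (auto dest!: inj_onD)
    qed
  qed (use u' v' in auto)
  \<comment> \<open>A switching that moves the virtual edge would move all of
    \<open>X\<^sub>2\<close>; the complementary set is switched instead.\<close>
  define Y' where "Y' = (if Y \<inter> F = {} then Y else ?E - Y)"
  have Y': "Y' \<subseteq> X\<^sub>1" using Y(1) SW_switch.prems(1) by (auto simp: Y'_def)
  have "?E - (?E - Y) = Y" using Y(1) by auto
  then have Aeq': "vs ?k Y' \<inter> vs ?k (?E - Y') = {u', v'}" using Aeq by (auto simp: Y'_def)
  have FA: "vs ?k F = ?A"
    using SW_switch.prems(1) assms(3) by (auto simp: vs_def cap_def)
  have EY: "?E - Y' = (X\<^sub>1 - Y') \<union> F" using Y' assms(3) by auto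
  have "vs ?k (?E - Y') = vs n (X\<^sub>1 - Y') \<union> ?A"
    unfolding EY vs_Un FA by (simp add: vs_cap_subset)
  moreover have "X\<^sub>1 \<union> X\<^sub>2 - Y' = (X\<^sub>1 - Y') \<union> X\<^sub>2" using Y' assms(2) by auto
  moreover have "vs n Y' \<subseteq> vs n X\<^sub>1" using Y' by (rule vs_mono)
  ultimately have "vs n Y' \<inter> vs n (X\<^sub>1 \<union> X\<^sub>2 - Y') = {u', v'}"
    using Aeq' vs_cap_subset[OF Y', of n X\<^sub>2] by (auto simp: vs_Un)
  then have sw: "switchable (X\<^sub>1 \<union> X\<^sub>2) n Y' u' v'" using Y' uv' by (auto simp: switchable_def)
  let ?n = "switch Y' u' v' n"
  have X2: "\<forall>e\<in>X\<^sub>2. ?n e = n e" using Y' assms(2) by (auto simp: switch_def)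
  then have vX2: "vs ?n X\<^sub>2 = vs n X\<^sub>2" by (auto simp: vs_def)
  have "X\<^sub>1 = Y' \<union> (X\<^sub>1 - Y')" using Y' by auto
  then have vX1: "vs ?n X\<^sub>1 = vs n X\<^sub>1"
    using vs_switch[OF sw] vs_switch_disjoint[of "X\<^sub>1 - Y'" Y' u' v' n] by (metis vs_Un Diff_disjoint Int_commute)
  have tr: "f ` (transpose u' v' ` S) = transpose u v ` (f ` S)" if "S \<subseteq> vs ?k ?E" for S
  proof -
    have "f (transpose u' v' x) = transpose u v (f x)" if "x \<in> vs ?k ?E" for x
    proof -
      have "u' \<in> vs ?k ?E" "v' \<in> vs ?k ?E" using u'(1) v'(1) Ysub by auto
      then have "f x = u \<longleftrightarrow> x = u'" "f x = v \<longleftrightarrow> x = v'" using f(1) that u'(2) v'(2) by (auto dest: inj_onD)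
      then show ?thesis using u'(2) v'(2) by (auto simp: transpose_def)
    qed
    then show ?thesis using that unfolding image_image by (intro image_cong) auto
  qed
  have ksub: "?k e \<subseteq> vs ?k ?E" if "e \<in> ?E" for e using that by (auto simp: vs_def)
  have kk: "cap ?n X\<^sub>1 X\<^sub>2 e = (if e \<in> Y' then transpose u' v' ` ?k e else ?k e)" if "e \<in> ?E" for e
    using Y' vX1 vX2 by (auto simp: cap_def switch_def)
  have vkk: "vs (cap ?n X\<^sub>1 X\<^sub>2) ?E \<subseteq> vs ?k ?E"
  proof -
    have "u' \<in> vs ?k ?E" "v' \<in> vs ?k ?E" using u'(1) v'(1) Ysub by auto
    then have "transpose u' v' ` vs ?k ?E = vs ?k ?E" by simp
    then have "cap ?n X\<^sub>1 X\<^sub>2 e \<subseteq> vs ?k ?E" if "e \<in> ?E" for e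
      using kk[OF that] ksub[OF that] by (auto split: if_splits)
    then show ?thesis by (auto simp: vs_def)
  qed
  have "iso ?E (cap ?n X\<^sub>1 X\<^sub>2) (switch Y u v m)"
  proof (cases "Y \<inter> F = {}")
    case True
    then have "Y' = Y" by (simp add: Y'_def)
    then have "\<forall>e\<in>?E. switch Y u v m e = f ` cap ?n X\<^sub>1 X\<^sub>2 e"
      using f(2) kk tr ksub by (simp add: switch_def)
    then show ?thesis using inj_on_subset[OF f(1) vkk] unfolding iso_def by blast
  next
    case False
    \<comment> \<open>Switching the complement gives the same graph as switching \<open>Y\<close>,
      up to a transposition of all vertices, which the isomorphism absorbs.\<close>
    let ?g = "transpose u v \<circ> f"
    have "switch Y u v m e = ?g ` cap ?n X\<^sub>1 X\<^sub>2 e" if e: "e \<in> ?E" for e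
    proof (cases "e \<in> Y")
      case True
      then have "e \<notin> Y'" using False by (simp add: Y'_def)
      then show ?thesis using True f(2) kk[OF e] e by (simp add: switch_def image_comp)
    next
      case e': False
      then have "e \<in> Y'" using False e by (simp add: Y'_def)
      then have "?g ` cap ?n X\<^sub>1 X\<^sub>2 e = transpose u v ` (f ` (transpose u' v' ` ?k e))"
        using kk[OF e] by (simp add: image_comp)
      also have "\<dots> = f ` ?k e" unfolding tr[OF ksub[OF e]] by (simp add: image_comp)
      finally show ?thesis using e' f(2) e by (simp add: switch_def)
    qed
    moreover have "inj_on ?g (vs (cap ?n X\<^sub>1 X\<^sub>2) ?E)"
      using inj_on_subset[OF f(1) vkk] by (simp add: comp_inj_on inj_on_transpose)
    ultimately show ?thesis unfolding iso_def by blast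
  qed
  then show ?case using SW.SW_switch[OF sw] X2 vX1 vX2 by blast
qed

text \<open>The last hypothesis makes the glued map injective across the two sides: images can
  coincide only where the vertices were shared already.\<close>

lemma iso_glue:
  assumes f\<^sub>1: "inj_on f\<^sub>1 (vs n X\<^sub>1)" "\<forall>e\<in>X\<^sub>1. h e = f\<^sub>1 ` n e"
    and f\<^sub>2: "inj_on f\<^sub>2 (vs n X\<^sub>2)" "\<forall>e\<in>X\<^sub>2. h e = f\<^sub>2 ` n e"
    and agree: "\<And>x. x \<in> vs n X\<^sub>1 \<inter> vs n X\<^sub>2 \<Longrightarrow> f\<^sub>1 x = f\<^sub>2 x"
    and A: "vs h X\<^sub>1 \<inter> vs h X\<^sub>2 \<subseteq> f\<^sub>2 ` (vs n X\<^sub>1 \<inter> vs n X\<^sub>2)"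
  shows "iso (X\<^sub>1 \<union> X\<^sub>2) n h"
proof -
  define f where "f x = (if x \<in> vs n X\<^sub>1 then f\<^sub>1 x else f\<^sub>2 x)" for x
  have ff2: "f x = f\<^sub>2 x" if "x \<in> vs n X\<^sub>2" for x using that agree by (auto simp: f_def)
  have cross: "x \<in> vs n X\<^sub>1" if "x \<in> vs n X\<^sub>2" "y \<in> vs n X\<^sub>1" "f\<^sub>1 y = f\<^sub>2 x" for x y
  proof -
    have "f\<^sub>2 x \<in> vs h X\<^sub>1 \<inter> vs h X\<^sub>2"
      using that vs_iso[OF f\<^sub>1(2), of X\<^sub>1] vs_iso[OF f\<^sub>2(2), of X\<^sub>2] by (metis IntI image_eqI order_refl)
    then obtain z where z: "z \<in> vs n X\<^sub>1 \<inter> vs n X\<^sub>2" "f\<^sub>2 x = f\<^sub>2 z" using A by blast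
    then have "x = z" using f\<^sub>2(1) that(1) by (auto dest: inj_onD)
    then show ?thesis using z by simp
  qed
  have "inj_on f (vs n (X\<^sub>1 \<union> X\<^sub>2))"
  proof (rule inj_onI)
    fix x y assume xy: "x \<in> vs n (X\<^sub>1 \<union> X\<^sub>2)" "y \<in> vs n (X\<^sub>1 \<union> X\<^sub>2)" "f x = f y"
    then have "x \<in> vs n X\<^sub>1 \<longleftrightarrow> y \<in> vs n X\<^sub>1"
      using cross[of x y] cross[of y x] by (auto simp: f_def vs_Un split: if_splits)
    then show "x = y" using xy f\<^sub>1(1) f\<^sub>2(1) by (auto simp: f_def vs_Un dest: inj_onD split: if_splits)
  qed
  moreover have "h e = f ` n e" if e: "e \<in> X\<^sub>1 \<union> X\<^sub>2" for e
  proof (cases "e \<in> X\<^sub>1")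
    case True
    then have "f ` n e = f\<^sub>1 ` n e" by (intro image_cong) (auto simp: f_def vs_def)
    then show ?thesis using f\<^sub>1(2) True by simp
  next
    case False
    then have "e \<in> X\<^sub>2" using e by simp
    then have "f ` n e = f\<^sub>2 ` n e" using ff2 by (intro image_cong) (auto simp: vs_def)
    then show ?thesis using f\<^sub>2(2) \<open>e \<in> X\<^sub>2\<close> by simp
  qed
  ultimately show ?thesis unfolding iso_def by blast
qed

section \<open>Attachment vertices and nonseparability\<close>

lemma finite_vs_Int: "ends_ok n E \<Longrightarrow> X \<subseteq> E \<Longrightarrow> finite (vs n X \<inter> S)"
  using ends_okD(5)[OF ends_ok_subset] by blast

lemma nonsep_conn:
  assumes "nonsep n E"
  shows "conn n E"
  unfolding conn_def
proof (intro allI impI)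
  fix X assume X: "X \<subseteq> E" "vs n X \<inter> vs n (E - X) = {}"
  show "X = {} \<or> X = E"
    using assms X unfolding nonsep_def by (metis card.empty not_numeral_le_zero)
qed

lemma star_Int: "v \<notin> vs n (X - D) \<Longrightarrow> Y \<subseteq> X \<Longrightarrow> star n (Y \<inter> D) v = star n Y v"
  by (auto simp: star_def vs_def)

text \<open>At a vertex of \<open>D\<close> all edges of \<open>X\<close> belong to
  \<open>D\<close>, so parities there are not affected by the restriction.\<close>

lemma bd_Int_component:
  assumes "vs n D \<inter> vs n (X - D) = {}" "Y \<subseteq> X"
  shows "bd n (Y \<inter> D) \<subseteq> bd n Y"
proof
  fix v assume v: "v \<in> bd n (Y \<inter> D)"
  then have "v \<in> vs n D" using bd_subset[of n "Y \<inter> D"] vs_mono[of "Y \<inter> D" D n] by auto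
  then have "v \<notin> vs n (X - D)" using assms by auto
  then show "v \<in> bd n Y" using star_Int[of v n X D Y] assms(2) v by (simp add: bd_def)
qed

text \<open>The parts of an even set inside and outside \<open>X\<close> have the same boundary,
  which therefore consists of vertices of both sides.\<close>

lemma bd_Int_subset:
  assumes ok: "ends_ok n E" and Z: "Z \<in> evens n E"
  shows "bd n (Z \<inter> X) \<subseteq> vs n X \<inter> vs n (E - X)"
proof -
  have ZE: "Z \<subseteq> E" using Z by (simp add: evens_def)
  have fin: "finite (Z \<inter> X)" "finite (Z - X)" using finite_subset[OF ZE ends_okD(1)[OF ok]] by auto
  have "bd n Z = sym_diff (bd n (Z \<inter> X)) (bd n (Z - X))"
    using bd_Un_disjoint[OF fin, of n] by (simp add: Int_Diff_disjoint Int_Diff_Un)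
  then have "bd n (Z \<inter> X) = bd n (Z - X)" using Z by (auto simp: evens_def)
  moreover have "bd n (Z - X) \<subseteq> vs n (E - X)"
    by (rule subset_trans[OF bd_subset vs_mono]) (use ZE in auto)
  moreover have "bd n (Z \<inter> X) \<subseteq> vs n X" by (rule subset_trans[OF bd_subset vs_mono]) auto
  ultimately show ?thesis by auto
qed

text \<open>Taken as a smallest edge set at \<open>a\<close> that shares no vertex with the rest of
  \<open>X\<close>.\<close>

lemma component_exists:
  assumes ok: "ends_ok n X" and a: "a \<in> vs n X"
  shows "\<exists>D\<subseteq>X. a \<in> vs n D \<and> conn n D \<and> vs n D \<inter> vs n (X - D) = {}"
proof -
  define P where "P D \<longleftrightarrow> D \<subseteq> X \<and> a \<in> vs n D \<and> vs n D \<inter> vs n (X - D) = {}" for D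
  have "P X" using a by (auto simp: P_def)
  then obtain D where D: "P D" and min: "\<And>D'. P D' \<Longrightarrow> card D \<le> card D'"
    using ex_has_least_nat[of P X card] by blast
  have finD: "finite D" using D ends_okD(1)[OF ok] finite_subset by (auto simp: P_def)
  have "conn n D"
    unfolding conn_def
  proof (intro allI impI)
    fix Y assume Y: "Y \<subseteq> D" "vs n Y \<inter> vs n (D - Y) = {}"
    have DX: "D \<subseteq> X" "vs n D \<inter> vs n (X - D) = {}" using D by (auto simp: P_def)
    have side: "W = D" if W: "W \<subseteq> D" "vs n W \<inter> vs n (D - W) = {}" "a \<in> vs n W" for W
    proof -
      have "X - W = (X - D) \<union> (D - W)" using W DX by auto
      then have "vs n (X - W) = vs n (X - D) \<union> vs n (D - W)" by (simp add: vs_Un)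
      then have "P W" using W DX vs_mono[OF W(1), of n] by (auto simp: P_def)
      then show ?thesis using card_subset_eq[OF finD W(1)] card_mono[OF finD W(1)] min[of W] by (metis le_antisym)
    qed
    have "a \<in> vs n D" using D by (simp add: P_def)
    moreover have "D = Y \<union> (D - Y)" using Y by auto
    ultimately have "a \<in> vs n Y \<or> a \<in> vs n (D - Y)" using vs_Un[of n Y "D - Y"] by auto
    then show "Y = {} \<or> Y = D"
    proof
      assume "a \<in> vs n (D - Y)"
      moreover have "D - (D - Y) = Y" using Y by auto
      ultimately have "D - Y = D" using side[of "D - Y"] Y by (simp add: Int_commute)
      then show ?thesis using Y by auto
    qed (use side Y in auto)
  qed
  then show ?thesis using D by (auto simp: P_def)
qed

text \<open>Let \<open>D1\<close> be the component of \<open>X\<close> at \<open>a\<close>, and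
  \<open>D2\<close> the component of the remaining edges \<open>E - D1\<close> at \<open>a\<close>.
  If they had another common vertex \<open>b\<close>, joins of \<open>a\<close> and \<open>b\<close>
  in both would form an even set whose part inside \<open>D1\<close> is not even, although
  \<open>X\<close> splits. So \<open>D2\<close> is attached to the rest at \<open>a\<close>
  only.\<close>

lemma splits_cutvertex:
  assumes ok: "ends_ok n E" and X: "X \<subseteq> E" "splits (evens n E) X" and a: "a \<in> vs n X" "a \<in> vs n (E - X)"
  shows "\<exists>D\<subseteq>E. D \<noteq> {} \<and> D \<noteq> E \<and> vs n D \<inter> vs n (E - D) = {a}"
proof -
  obtain D1 where D1: "D1 \<subseteq> X" "a \<in> vs n D1" "conn n D1" "vs n D1 \<inter> vs n (X - D1) = {}"
    using component_exists[OF ends_ok_subset[OF ok X(1)] a(1)] by blast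
  have D1E: "D1 \<subseteq> E" using D1 X by auto
  have sp1: "bd n (Z \<inter> D1) = {}" if "Z \<in> evens n E" for Z
  proof -
    have "Z \<inter> X \<in> evens n E" using X(2) that by (auto simp: splits_def)
    moreover have "Z \<inter> X \<inter> D1 = Z \<inter> D1" using D1 by auto
    ultimately show ?thesis using bd_Int_component[OF D1(4), of "Z \<inter> X"] by (simp add: evens_def)
  qed
  have "a \<in> vs n (E - D1)" using a(2) vs_mono[of "E - X" "E - D1" n] D1(1) by blast
  then obtain D2 where D2: "D2 \<subseteq> E - D1" "a \<in> vs n D2" "conn n D2" "vs n D2 \<inter> vs n (E - D1 - D2) = {}"
    using component_exists[OF ends_ok_subset[OF ok]] by (metis Diff_subset)
  have "D1 \<noteq> {}" using D1(2) by auto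
  then have ne: "D2 \<noteq> {}" "D2 \<noteq> E" using D1E D2(1,2) by auto
  have "E - D2 = D1 \<union> (E - D1 - D2)" using D2(1) D1E by auto
  then have "vs n (E - D2) = vs n D1 \<union> vs n (E - D1 - D2)" by (metis vs_Un)
  then have eq: "vs n D2 \<inter> vs n (E - D2) = vs n D2 \<inter> vs n D1" using D2(4) by auto
  have "b = a" if b: "b \<in> vs n D2 \<inter> vs n D1" for b
  proof (rule ccontr)
    assume "b \<noteq> a"
    then have ab: "a \<noteq> b" by simp
    obtain R1 where R1: "R1 \<subseteq> D1" "bd n R1 = {a, b}"
      using connected_join_ne[OF ends_ok_subset[OF ok D1E] D1(3,2) _ ab] b by blast
    obtain R2 where R2: "R2 \<subseteq> D2" "bd n R2 = {a, b}"
      using connected_join_ne[OF ends_ok_subset[OF ok] D2(3,2) _ ab] b D2(1) by blast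
    have dis: "R1 \<inter> R2 = {}" using R1(1) R2(1) D2(1) by auto
    have sub: "R1 \<subseteq> E" "R2 \<subseteq> E" using R1(1) R2(1) D1E D2(1) by auto
    have "bd n (R1 \<union> R2) = {}"
      using bd_Un_disjoint[of R1 R2 n] dis finite_subset[OF sub(1) ends_okD(1)[OF ok]]
        finite_subset[OF sub(2) ends_okD(1)[OF ok]] R1(2) R2(2) by simp
    then have "R1 \<union> R2 \<in> evens n E" using sub by (simp add: evens_def)
    then have "bd n ((R1 \<union> R2) \<inter> D1) = {}" by (rule sp1)
    moreover have "(R1 \<union> R2) \<inter> D1 = R1" using R1(1) R2(1) D2(1) by auto
    ultimately show False using R1(2) by simp
  qed
  then have "vs n D2 \<inter> vs n D1 \<subseteq> {a}" by (intro subsetI) simp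
  then have "vs n D2 \<inter> vs n (E - D2) = {a}" unfolding eq using D1(2) D2(2) by (intro subset_antisym) simp_all
  then show ?thesis using D2(1) ne by blast
qed

text \<open>The part of an even set inside \<open>X\<close> has a boundary of even size among the
  attachment vertices, of which there is at most one.\<close>

lemma splits_small_attachment:
  assumes ok: "ends_ok n E" and X: "X \<subseteq> E" "card (vs n X \<inter> vs n (E - X)) < 2"
  shows "splits (evens n E) X"
  unfolding splits_def
proof
  fix Z assume Z: "Z \<in> evens n E"
  have ZX: "Z \<inter> X \<subseteq> E" using X by auto
  have "card (bd n (Z \<inter> X)) \<le> card (vs n X \<inter> vs n (E - X))"
    by (rule card_mono[OF finite_vs_Int[OF ok X(1)] bd_Int_subset[OF ok Z]])
  then have "card (bd n (Z \<inter> X)) < 2" using X by simp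
  moreover have "even (card (bd n (Z \<inter> X)))" using even_card_bd[OF ok ZX] .
  ultimately have "card (bd n (Z \<inter> X)) = 0" by (auto elim!: evenE)
  moreover have "finite (bd n (Z \<inter> X))"
    using bd_Int_subset[OF ok Z, of X] finite_vs_Int[OF ok X(1)] finite_subset by blast
  ultimately show "Z \<inter> X \<in> evens n E" using ZX by (simp add: evens_def)
qed

text \<open>The right-hand side depends on the cycle space alone, so nonseparability passes between
  graphs with equal cycle spaces; mere connectedness would not.\<close>

lemma nonsep_iff:
  assumes ok: "ends_ok n E"
  shows "nonsep n E \<longleftrightarrow> (\<forall>X\<subseteq>E. splits (evens n E) X \<longrightarrow> X = {} \<or> X = E)"
proof
  assume ns: "nonsep n E"
  show "\<forall>X\<subseteq>E. splits (evens n E) X \<longrightarrow> X = {} \<or> X = E"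
  proof (intro allI impI, rule ccontr)
    fix X assume X: "X \<subseteq> E" "splits (evens n E) X" "\<not> (X = {} \<or> X = E)"
    then have "card (vs n X \<inter> vs n (E - X)) \<ge> 2" using ns by (auto simp: nonsep_def)
    then have "vs n X \<inter> vs n (E - X) \<noteq> {}" by auto
    then obtain a where "a \<in> vs n X" "a \<in> vs n (E - X)" by blast
    from splits_cutvertex[OF ok X(1,2) this] obtain D where
      D: "D \<subseteq> E" "D \<noteq> {}" "D \<noteq> E" "vs n D \<inter> vs n (E - D) = {a}" by blast
    have "2 \<le> card (vs n D \<inter> vs n (E - D))" using ns D(1-3) unfolding nonsep_def by blast
    then show False using D(4) by simp
  qed
next
  assume *: "\<forall>X\<subseteq>E. splits (evens n E) X \<longrightarrow> X = {} \<or> X = E"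
  show "nonsep n E"
    unfolding nonsep_def
  proof (intro allI impI)
    fix X assume "X \<subseteq> E" "X \<noteq> {}" "X \<noteq> E"
    then have "\<not> splits (evens n E) X" using * by blast
    then show "2 \<le> card (vs n X \<inter> vs n (E - X))"
      using splits_small_attachment[OF ok \<open>X \<subseteq> E\<close>] by (metis not_le)
  qed
qed

lemma nonsep_transfer:
  "ends_ok n E \<Longrightarrow> ends_ok h E \<Longrightarrow> evens n E = evens h E \<Longrightarrow> nonsep n E \<Longrightarrow> nonsep h E"
  by (simp add: nonsep_iff)

lemma evens_eq_subset:
  assumes "evens n E = evens h E" "X \<subseteq> E"
  shows "evens n X = evens h X"
  using evens_subset[OF assms(2), of n] evens_subset[OF assms(2), of h] assms(1) by metis

lemma nonsep_loopless:
  assumes ok: "ends_ok n E" and ns: "nonsep n E" and c: "card E \<ge> 2" and e: "e \<in> E"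
  shows "card (n e) = 2"
proof -
  have "{e} \<subseteq> E" "{e} \<noteq> E" using e c by auto
  then have "2 \<le> card (vs n {e} \<inter> vs n (E - {e}))" using ns by (auto simp: nonsep_def)
  also have "\<dots> \<le> card (vs n {e})" using finite_vs_Int[OF ok, of "{e}" UNIV] e by (intro card_mono) auto
  finally show ?thesis using ends_okD(2)[OF ok e] by (auto simp: vs_def)
qed

section \<open>Sides completed by a virtual edge\<close>

text \<open>The virtual edge stands for \<open>Z \<inter> X\<^sub>2\<close>, which joins the two
  attachment vertices on the far side. Only the cycle space of the whole graph occurs on the right,
  so two graphs with the same cycle space and a common 2-separation have completed sides with the
  same cycle space.\<close>

lemma evens_cap:
  assumes ok: "ends_ok n (X\<^sub>1 \<union> X\<^sub>2)" and dis: "X\<^sub>1 \<inter> X\<^sub>2 = {}" and A: "card (vs n X\<^sub>1 \<inter> vs n X\<^sub>2) = 2"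
    and p: "p \<notin> X\<^sub>1" and Z: "Z \<in> evens n (X\<^sub>1 \<union> X\<^sub>2)" "Z \<inter> X\<^sub>1 \<notin> evens n (X\<^sub>1 \<union> X\<^sub>2)"
    and Y: "Y \<subseteq> insert p X\<^sub>1"
  shows "Y \<in> evens (cap n X\<^sub>1 X\<^sub>2) (insert p X\<^sub>1) \<longleftrightarrow>
    (if p \<in> Y then (Y - {p}) \<union> (Z \<inter> X\<^sub>2) \<in> evens n (X\<^sub>1 \<union> X\<^sub>2) else Y \<in> evens n (X\<^sub>1 \<union> X\<^sub>2))"
proof -
  let ?k = "cap n X\<^sub>1 X\<^sub>2" and ?E = "X\<^sub>1 \<union> X\<^sub>2" and ?A = "vs n X\<^sub>1 \<inter> vs n X\<^sub>2"
  have fin: "finite W" if "W \<subseteq> ?E" for W using that ends_okD(1)[OF ok] finite_subset by blast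
  have sub: "Z \<subseteq> ?E" using Z by (simp add: evens_def)
  obtain u v where uv: "?A = {u, v}" "u \<noteq> v" using A by (auto simp: card_2_iff)
  have EX: "?E - X\<^sub>1 = X\<^sub>2" using dis by auto
  have b1: "bd n (Z \<inter> X\<^sub>1) \<subseteq> ?A" using bd_Int_subset[OF ok Z(1), of X\<^sub>1] by (simp add: EX)
  have "Z \<inter> X\<^sub>1 \<subseteq> ?E" by auto
  then have "bd n (Z \<inter> X\<^sub>1) \<noteq> {}" using Z(2) by (simp add: evens_def)
  then have bA: "bd n (Z \<inter> X\<^sub>1) = ?A"
    using even_pair_subset[OF even_card_bd[OF ok, of "Z \<inter> X\<^sub>1"], of u v] b1 uv by auto
  have ZZ: "Z = (Z \<inter> X\<^sub>1) \<union> (Z \<inter> X\<^sub>2)" using sub by auto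
  have "bd n Z = sym_diff (bd n (Z \<inter> X\<^sub>1)) (bd n (Z \<inter> X\<^sub>2))"
    by (subst ZZ, rule bd_Un_disjoint) (use fin[of "Z \<inter> X\<^sub>1"] fin[of "Z \<inter> X\<^sub>2"] dis in auto)
  then have bA2: "bd n (Z \<inter> X\<^sub>2) = ?A" using bA Z(1) by (auto simp: evens_def)
  have kX: "bd ?k W = bd n W" if "W \<subseteq> X\<^sub>1" for W using that by (intro bd_cong) (auto simp: cap_def)
  show ?thesis
  proof (cases "p \<in> Y")
    case False
    then show ?thesis using kX[of Y] Y by (auto simp: evens_def)
  next
    case True
    let ?W = "Y - {p}"
    have W: "?W \<subseteq> X\<^sub>1" using Y by auto
    have YW: "Y = ?W \<union> {p}" using True by auto
    have "bd ?k Y = sym_diff (bd ?k ?W) (bd ?k {p})"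
      by (subst YW, rule bd_Un_disjoint) (use fin[of ?W] W in auto)
    also have "bd ?k {p} = ?A" using A p by (simp add: bd_single cap_def)
    finally have 1: "bd ?k Y = sym_diff (bd n ?W) ?A" by (simp only: kX[OF W])
    have "bd n (?W \<union> (Z \<inter> X\<^sub>2)) = sym_diff (bd n ?W) (bd n (Z \<inter> X\<^sub>2))"
      by (rule bd_Un_disjoint) (use fin[of ?W] fin[of "Z \<inter> X\<^sub>2"] W dis in auto)
    then have "bd n (?W \<union> (Z \<inter> X\<^sub>2)) = bd ?k Y" using 1 bA2 by simp
    moreover have "?W \<union> (Z \<inter> X\<^sub>2) \<subseteq> ?E" using W by auto
    ultimately show ?thesis using True Y by (simp add: evens_def)
  qed
qed

lemma cap_ends_ok:
  assumes "ends_ok n (X\<^sub>1 \<union> X\<^sub>2)" "card (vs n X\<^sub>1 \<inter> vs n X\<^sub>2) = 2"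
  shows "ends_ok (cap n X\<^sub>1 X\<^sub>2) (insert p X\<^sub>1)"
  using assms by (auto simp: ends_ok_def cap_def)

text \<open>The virtual edge meets exactly the vertices at which \<open>X\<^sub>2\<close> is
  attached. A set of edges without it hence has the same attachment vertices in the completed side
  as in the whole graph; all other sets are complements of such.\<close>

lemma nonsep_cap:
  assumes ok: "ends_ok n (X\<^sub>1 \<union> X\<^sub>2)" and ns: "nonsep n (X\<^sub>1 \<union> X\<^sub>2)" and dis: "X\<^sub>1 \<inter> X\<^sub>2 = {}"
    and p: "p \<in> X\<^sub>2"
  shows "nonsep (cap n X\<^sub>1 X\<^sub>2) (insert p X\<^sub>1)"
proof -
  let ?k = "cap n X\<^sub>1 X\<^sub>2" and ?K = "insert p X\<^sub>1" and ?A = "vs n X\<^sub>1 \<inter> vs n X\<^sub>2"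
  have pX: "p \<notin> X\<^sub>1" using p dis by auto
  have *: "2 \<le> card (vs ?k Y \<inter> vs ?k (?K - Y))" if Y: "Y \<subseteq> X\<^sub>1" "Y \<noteq> {}" for Y
  proof -
    have 1: "?K - Y = (X\<^sub>1 - Y) \<union> {p}" using Y pX by auto
    have 2: "X\<^sub>1 \<union> X\<^sub>2 - Y = (X\<^sub>1 - Y) \<union> X\<^sub>2" using Y dis by auto
    have "vs ?k {p} = ?A" using pX by (simp add: vs_def cap_def)
    then have "vs ?k (?K - Y) = vs n (X\<^sub>1 - Y) \<union> ?A" unfolding 1 vs_Un by (simp add: vs_cap_subset)
    then have "vs ?k Y \<inter> vs ?k (?K - Y) = vs n Y \<inter> vs n (X\<^sub>1 \<union> X\<^sub>2 - Y)"
      unfolding 2 vs_Un vs_cap_subset[OF Y(1)] using vs_mono[OF Y(1), of n] by auto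
    moreover have "Y \<noteq> X\<^sub>1 \<union> X\<^sub>2" using Y p dis by auto
    ultimately show ?thesis using ns Y unfolding nonsep_def by auto
  qed
  show ?thesis
    unfolding nonsep_def
  proof (intro allI impI)
    fix Y assume Y: "Y \<subseteq> ?K" "Y \<noteq> {}" "Y \<noteq> ?K"
    show "2 \<le> card (vs ?k Y \<inter> vs ?k (?K - Y))"
    proof (cases "p \<in> Y")
      case True
      have "?K - (?K - Y) = Y" using Y by auto
      moreover have "?K - Y \<subseteq> X\<^sub>1" "?K - Y \<noteq> {}" using True Y by auto
      ultimately show ?thesis using *[of "?K - Y"] by (simp add: Int_commute)
    qed (use * Y in auto)
  qed
qed

text \<open>The two switching sequences are lifted one after the other, since each lift keeps the
  far side and the attachment vertices. The resulting isomorphisms of the two sides have the same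
  image of the attachment pair: either they agree on the pair, or they are crossed and one more
  switching uncrosses them.\<close>

lemma SW_glue:
  assumes dis: "X\<^sub>1 \<inter> X\<^sub>2 = {}"
    and F: "X\<^sub>1 \<inter> F\<^sub>1 = {}" "X\<^sub>2 \<inter> F\<^sub>2 = {}"
    and A: "(F\<^sub>1 = {} \<and> F\<^sub>2 = {} \<and> vs n X\<^sub>1 \<inter> vs n X\<^sub>2 = {} \<and> vs h X\<^sub>1 \<inter> vs h X\<^sub>2 = {}) \<or>
      ((\<exists>p. F\<^sub>1 = {p}) \<and> (\<exists>p. F\<^sub>2 = {p}) \<and> card (vs n X\<^sub>1 \<inter> vs n X\<^sub>2) = 2 \<and> card (vs h X\<^sub>1 \<inter> vs h X\<^sub>2) = 2)"
    and 1: "SW (X\<^sub>1 \<union> F\<^sub>1) (cap n X\<^sub>1 X\<^sub>2) (cap h X\<^sub>1 X\<^sub>2)"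
    and 2: "SW (X\<^sub>2 \<union> F\<^sub>2) (cap n X\<^sub>2 X\<^sub>1) (cap h X\<^sub>2 X\<^sub>1)"
  shows "SW (X\<^sub>1 \<union> X\<^sub>2) n h"
proof -
  let ?A = "vs n X\<^sub>1 \<inter> vs n X\<^sub>2"
  obtain n' where n': "SW (X\<^sub>1 \<union> X\<^sub>2) n n'" "\<forall>e\<in>X\<^sub>2. n' e = n e" "vs n' X\<^sub>1 \<inter> vs n' X\<^sub>2 = ?A"
      "iso (X\<^sub>1 \<union> F\<^sub>1) (cap n' X\<^sub>1 X\<^sub>2) (cap h X\<^sub>1 X\<^sub>2)"
    using SW_lift[OF 1 dis F(1), of n] A iso_refl by blast
  have ceq: "cap n' X\<^sub>2 X\<^sub>1 = cap n X\<^sub>2 X\<^sub>1"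
    using n'(2,3) by (intro ext) (auto simp: cap_def Int_commute)
  have dis': "X\<^sub>2 \<inter> X\<^sub>1 = {}" using dis by auto
  have "(F\<^sub>2 = {} \<and> vs n' X\<^sub>2 \<inter> vs n' X\<^sub>1 = {}) \<or> (\<exists>p. F\<^sub>2 = {p})"
    using A n'(3) by (auto simp: Int_commute)
  then obtain n'' where n'': "SW (X\<^sub>2 \<union> X\<^sub>1) n' n''" "\<forall>e\<in>X\<^sub>1. n'' e = n' e"
      "vs n'' X\<^sub>2 \<inter> vs n'' X\<^sub>1 = vs n' X\<^sub>2 \<inter> vs n' X\<^sub>1"
      "iso (X\<^sub>2 \<union> F\<^sub>2) (cap n'' X\<^sub>2 X\<^sub>1) (cap h X\<^sub>2 X\<^sub>1)"
    using SW_lift[OF 2 dis' F(2), of n'] iso_refl ceq by metis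
  have A'': "vs n'' X\<^sub>1 \<inter> vs n'' X\<^sub>2 = ?A" using n''(3) n'(3) by auto
  have ceq': "cap n'' X\<^sub>1 X\<^sub>2 = cap n' X\<^sub>1 X\<^sub>2"
    using n''(2,3) n'(3) by (intro ext) (auto simp: cap_def Int_commute)
  have SWn: "SW (X\<^sub>1 \<union> X\<^sub>2) n n''" using SW_trans[OF n'(1)] n''(1) by (simp add: Un_commute)
  have part: "\<exists>f. inj_on f (vs k Y\<^sub>1) \<and> (\<forall>e\<in>Y\<^sub>1. h e = f ` k e) \<and> f ` (vs k Y\<^sub>1 \<inter> vs k Y\<^sub>2) = vs h Y\<^sub>1 \<inter> vs h Y\<^sub>2"
    if i: "iso (Y\<^sub>1 \<union> F) (cap k Y\<^sub>1 Y\<^sub>2) (cap h Y\<^sub>1 Y\<^sub>2)" and FY: "Y\<^sub>1 \<inter> F = {}" 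
      and FA: "F \<noteq> {} \<or> (vs k Y\<^sub>1 \<inter> vs k Y\<^sub>2 = {} \<and> vs h Y\<^sub>1 \<inter> vs h Y\<^sub>2 = {})" for Y\<^sub>1 Y\<^sub>2 F and k :: "'a \<Rightarrow> 'b set"
  proof -
    obtain f where f: "inj_on f (vs (cap k Y\<^sub>1 Y\<^sub>2) (Y\<^sub>1 \<union> F))" "\<forall>e\<in>Y\<^sub>1 \<union> F. cap h Y\<^sub>1 Y\<^sub>2 e = f ` cap k Y\<^sub>1 Y\<^sub>2 e"
      using i unfolding iso_def by blast
    have "inj_on f (vs k Y\<^sub>1)" using inj_on_subset[OF f(1)] vs_cap_subset[of Y\<^sub>1 Y\<^sub>1 k Y\<^sub>2] by (simp add: vs_Un)
    moreover have "\<forall>e\<in>Y\<^sub>1. h e = f ` k e"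
    proof
      fix e assume "e \<in> Y\<^sub>1"
      then show "h e = f ` k e" using bspec[OF f(2), of e] by (simp add: cap_def)
    qed
    moreover have "f ` (vs k Y\<^sub>1 \<inter> vs k Y\<^sub>2) = vs h Y\<^sub>1 \<inter> vs h Y\<^sub>2"
    proof (cases "F = {}")
      case False
      then obtain p where "p \<in> F" by auto
      moreover from this have "p \<notin> Y\<^sub>1" using FY by auto
      ultimately show ?thesis using bspec[OF f(2), of p] by (simp add: cap_def)
    qed (use FA in auto)
    ultimately show ?thesis by blast
  qed
  obtain f\<^sub>1 where f1: "inj_on f\<^sub>1 (vs n'' X\<^sub>1)" "\<forall>e\<in>X\<^sub>1. h e = f\<^sub>1 ` n'' e" "f\<^sub>1 ` ?A = vs h X\<^sub>1 \<inter> vs h X\<^sub>2"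
    using part[of X\<^sub>1 F\<^sub>1 n'' X\<^sub>2] n'(4) ceq' F(1) A A'' by (auto simp: Int_commute)
  have A''': "vs n'' X\<^sub>2 \<inter> vs n'' X\<^sub>1 = ?A" using A'' by auto
  have "F\<^sub>2 \<noteq> {} \<or> (vs n'' X\<^sub>2 \<inter> vs n'' X\<^sub>1 = {} \<and> vs h X\<^sub>2 \<inter> vs h X\<^sub>1 = {})"
    using A A''' by (auto simp: Int_commute)
  from part[OF n''(4) F(2) this] obtain f\<^sub>2 where f2: "inj_on f\<^sub>2 (vs n'' X\<^sub>2)" "\<forall>e\<in>X\<^sub>2. h e = f\<^sub>2 ` n'' e"
      "f\<^sub>2 ` ?A = vs h X\<^sub>1 \<inter> vs h X\<^sub>2"
    unfolding A''' by (auto simp: Int_commute)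
  show ?thesis
  proof (cases "\<forall>x\<in>?A. f\<^sub>1 x = f\<^sub>2 x")
    case True
    have "iso (X\<^sub>1 \<union> X\<^sub>2) n'' h"
      by (rule iso_glue[OF f1(1,2) f2(1,2)]) (use True A'' f2(3) in auto)
    then show ?thesis using SWn SW_iso SW_trans by blast
  next
    case False
    then obtain a where a: "a \<in> ?A" "f\<^sub>1 a \<noteq> f\<^sub>2 a" by auto
    then have "card ?A = 2" using A by auto
    then obtain x y where "?A = {x, y}" "x \<noteq> y" by (auto simp: card_2_iff)
    then obtain b where b: "?A = {a, b}" "a \<noteq> b" using a(1) by (cases "a = x") auto
    have ab: "f\<^sub>1 a = f\<^sub>2 b" "f\<^sub>1 b = f\<^sub>2 a"
    proof -
      have "{f\<^sub>1 a, f\<^sub>1 b} = {f\<^sub>2 a, f\<^sub>2 b}" using f1(3) f2(3) b(1) by auto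
      then show "f\<^sub>1 a = f\<^sub>2 b" "f\<^sub>1 b = f\<^sub>2 a" using a(2) by (auto simp: doubleton_eq_iff)
    qed
    have "X\<^sub>1 \<union> X\<^sub>2 - X\<^sub>2 = X\<^sub>1" using dis by auto
    then have sw: "switchable (X\<^sub>1 \<union> X\<^sub>2) n'' X\<^sub>2 a b" using A''' b by (auto simp: switchable_def)
    let ?m = "switch X\<^sub>2 a b n''"
    have m1: "vs ?m X\<^sub>1 = vs n'' X\<^sub>1" using dis by (rule vs_switch_disjoint)
    have m2: "vs ?m X\<^sub>2 = vs n'' X\<^sub>2" using vs_switch[OF sw] .
    have "iso (X\<^sub>1 \<union> X\<^sub>2) ?m h"
    proof (rule iso_glue[where f\<^sub>1 = f\<^sub>1 and f\<^sub>2 = "f\<^sub>2 \<circ> transpose a b"])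
      show "inj_on f\<^sub>1 (vs ?m X\<^sub>1)" using f1(1) m1 by simp
      show "\<forall>e\<in>X\<^sub>1. h e = f\<^sub>1 ` ?m e" using f1(2) dis by (auto simp: switch_def)
      have "a \<in> vs n'' X\<^sub>2" "b \<in> vs n'' X\<^sub>2" using A'' b by auto
      then have "transpose a b ` vs n'' X\<^sub>2 = vs n'' X\<^sub>2" by simp
      then show "inj_on (f\<^sub>2 \<circ> transpose a b) (vs ?m X\<^sub>2)"
        unfolding m2 using f2(1) by (intro comp_inj_on) (simp_all add: inj_on_transpose)
      show "\<forall>e\<in>X\<^sub>2. h e = (f\<^sub>2 \<circ> transpose a b) ` ?m e"
        using f2(2) by (simp add: switch_def image_comp comp_assoc)
      show "f\<^sub>1 x = (f\<^sub>2 \<circ> transpose a b) x" if "x \<in> vs ?m X\<^sub>1 \<inter> vs ?m X\<^sub>2" for x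
        using that m1 m2 A'' b ab by auto
      have "transpose a b ` ?A = ?A" using b by (simp add: insert_commute)
      then show "vs h X\<^sub>1 \<inter> vs h X\<^sub>2 \<subseteq> (f\<^sub>2 \<circ> transpose a b) ` (vs ?m X\<^sub>1 \<inter> vs ?m X\<^sub>2)"
        unfolding m1 m2 A'' image_comp[symmetric] using f2(3) by simp
    qed
    then show ?thesis using SWn SW_switch[OF sw] SW_iso SW_trans by blast
  qed
qed

section \<open>Whitney's 2-isomorphism theorem\<close>

lemma vs_complement: "X \<subseteq> E \<Longrightarrow> vs n E = vs n X \<union> vs n (E - X)"
  by (metis Un_Diff_cancel sup.absorb_iff2 vs_Un)

lemma cut_complement:
  assumes "ends_ok n E"
  shows "cut n E (vs n E - S) = cut n E S"
proof -
  have "n e \<subseteq> vs n E" if "e \<in> E" for e using that by (auto simp: vs_def)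
  then show ?thesis by (auto simp: cut_def)
qed

section \<open>Stars of nonseparable graphs\<close>

lemma nonsep_cut_vertex:
  assumes ok: "ends_ok n E" and ns: "nonsep n E" and S: "X = {e \<in> E. n e \<inter> S \<noteq> {}}"
    and sub: "vs n X \<inter> vs n (E - X) \<subseteq> {v}"
  shows "X = {} \<or> X = E"
proof (rule ccontr)
  assume "\<not> ?thesis"
  moreover have "X \<subseteq> E" using S by auto
  ultimately have "2 \<le> card (vs n X \<inter> vs n (E - X))" using ns by (auto simp: nonsep_def)
  also have "\<dots> \<le> card {v}" using sub by (intro card_mono) auto
  finally show False by simp
qed

text \<open>A cocycle inside the star is a cut; let \<open>S\<close> be its side without
  \<open>v\<close>. Edges touching \<open>S\<close> have their ends in \<open>S\<close> and
  \<open>v\<close>, so they form a set attached at \<open>v\<close> at most, which is empty or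
  everything.\<close>

lemma star_minimal_cocycle:
  assumes ok: "ends_ok n E" and ns: "nonsep n E" and v: "v \<in> vs n E"
    and D: "D \<subseteq> star n E v" "D \<noteq> {}" "cocycle (evens n E) D"
  shows "D = star n E v"
proof -
  have DE: "D \<subseteq> E" using D(1) by (auto simp: star_def)
  obtain S0 where S0: "S0 \<subseteq> vs n E" "D = cut n E S0"
    using cocycle_is_cut[OF ok nonsep_conn[OF ns] DE D(3)] by blast
  define S where "S = (if v \<in> S0 then vs n E - S0 else S0)"
  have S: "v \<notin> S" "D = cut n E S" using S0 cut_complement[OF ok, of S0] by (auto simp: S_def)
  define X where "X = {e \<in> E. n e \<inter> S \<noteq> {}}"
  have inside: "n e \<subseteq> insert v S" if "e \<in> X" for e
  proof (cases "v \<in> n e")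
    case False
    then have "e \<notin> D" using D(1) by (auto simp: star_def)
    then show ?thesis using that S(2) by (auto simp: cut_def X_def)
  next
    case True
    have "e \<in> E" "n e \<inter> S \<noteq> {}" using that by (auto simp: X_def)
    then obtain w where w: "w \<in> n e" "w \<in> S" by auto
    then have "{v, w} \<subseteq> n e" "v \<noteq> w" using True S by auto
    moreover have "card (n e) \<le> card {v, w}" using ends_okD(2)[OF ok \<open>e \<in> E\<close>] \<open>v \<noteq> w\<close> by auto
    ultimately have "n e = {v, w}" using card_seteq[OF ends_okD(3)[OF ok \<open>e \<in> E\<close>]] by blast
    then show ?thesis using w by auto
  qed
  have "vs n X \<inter> vs n (E - X) \<subseteq> {v}" using inside by (auto simp: vs_def X_def)
  then have "X = {} \<or> X = E" using nonsep_cut_vertex[OF ok ns X_def] by blast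
  then show ?thesis
  proof
    assume "X = {}"
    then have "cut n E S = {}" by (auto simp: X_def cut_def)
    then show ?thesis using D(2) S(2) by simp
  next
    assume "X = E"
    then have "star n E v \<subseteq> cut n E S" using S(1) by (auto simp: X_def star_def cut_def)
    then show ?thesis using D(1) S(2) by auto
  qed
qed

lemma star_nonempty:
  assumes "ends_ok n E" "nonsep n E" "card E \<ge> 2" "v \<in> vs n E"
  shows "star n E v \<noteq> {}"
  using assms(4) nonsep_loopless[OF assms(1-3)] by (auto simp: star_def vs_def)

lemma bd_pair:
  assumes "card (n e) = 2" "card (n f) = 2" "e \<noteq> f"
  shows "bd n {e, f} = sym_diff (n e) (n f)"
  using bd_Un_disjoint[of "{e}" "{f}" n] assms by (simp add: bd_single insert_commute)

text \<open>The star is a cut of \<open>h\<close>. The edges left after its deletion are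
  nonseparable in \<open>h\<close> too and hence lie on one side of this cut. A vertex
  \<open>s\<close> on the other side is met by edges of the star only, and minimality of stars as
  cocycles makes its own star equal to the given one.\<close>

lemma star_transfer:
  assumes okn: "ends_ok n E" and okh: "ends_ok h E" and nsn: "nonsep n E" and nsh: "nonsep h E"
    and ev: "evens n E = evens h E" and c: "card E \<ge> 2"
    and v: "v \<in> vs n E" and nsv: "nonsep n (E - star n E v)"
  shows "\<exists>s\<in>vs h E. star h E s = star n E v"
proof -
  let ?D = "star n E v"
  have DE: "?D \<subseteq> E" by (auto simp: star_def)
  have coc: "cocycle (evens h E) ?D" using cocycle_cut[OF okn, of "{v}"] star_eq_cut[OF okn, of v] ev by simp
  obtain S where S: "S \<subseteq> vs h E" "?D = cut h E S"
    using cocycle_is_cut[OF okh nonsep_conn[OF nsh] DE coc] by blast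
  have nsh': "nonsep h (E - ?D)"
    by (rule nonsep_transfer[OF ends_ok_subset[OF okn] ends_ok_subset[OF okh] evens_eq_subset[OF ev] nsv]) auto
  define B where "B = {e \<in> E. h e \<subseteq> S}"
  have B: "B \<subseteq> E - ?D" using S(2) ends_okD(4)[OF okh] by (auto simp: B_def cut_def)
  have out: "h e \<inter> S = {}" if "e \<in> E - ?D - B" for e using that S(2) by (auto simp: B_def cut_def)
  have "vs h B \<inter> vs h (E - ?D - B) = {}" using out by (auto simp: vs_def B_def)
  then have "B = {} \<or> E - ?D - B = {}" using nsh' B nonsep_conn[OF nsh'] by (auto simp: conn_def)
  moreover obtain e0 where e0: "e0 \<in> ?D" using star_nonempty[OF okn nsn c v] by auto
  ultimately obtain T where T: "T \<subseteq> vs h E" "T \<noteq> {}" "\<And>e. e \<in> E \<Longrightarrow> h e \<inter> T \<noteq> {} \<Longrightarrow> e \<in> ?D"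
  proof (elim disjE)
    assume "B = {}"
    have *: "e \<in> ?D" if "e \<in> E" "h e \<inter> S \<noteq> {}" for e using \<open>B = {}\<close> out that by blast
    have "S \<noteq> {}" using e0 S(2) by (auto simp: cut_def)
    then show ?thesis using that[of S] S(1) * by blast
  next
    assume Bc: "E - ?D - B = {}"
    have "e \<in> ?D" if "e \<in> E" "h e \<inter> (vs h E - S) \<noteq> {}" for e using that Bc by (auto simp: B_def)
    moreover have "h e0 \<subseteq> vs h E" "\<not> h e0 \<subseteq> S" using e0 S(2) by (auto simp: cut_def vs_def)
    then have "vs h E - S \<noteq> {}" by auto
    ultimately show ?thesis using that[of "vs h E - S"] by blast
  qed
  then obtain s where s: "s \<in> T" "s \<in> vs h E" by auto
  have sub: "star h E s \<subseteq> ?D" using T(3) s by (auto simp: star_def)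
  have "cocycle (evens n E) (star h E s)"
    using cocycle_cut[OF okh, of "{s}"] star_eq_cut[OF okh, of s] ev by simp
  then have "star h E s = ?D"
    using star_minimal_cocycle[OF okn nsn v sub star_nonempty[OF okh nsh c s(2)]] by simp
  then show ?thesis using s by blast
qed

text \<open>Each vertex is sent to the vertex with the same star; this is an isomorphism because an
  edge is determined by the two stars containing it. Two vertices with the same star would carry all
  edges, whence the exception for graphs on two vertices.\<close>

lemma SW_all_stars:
  assumes okn: "ends_ok n E" and okh: "ends_ok h E" and nsn: "nonsep n E" and nsh: "nonsep h E"
    and ev: "evens n E = evens h E" and c: "card E \<ge> 2"
    and nsv: "\<And>v. v \<in> vs n E \<Longrightarrow> nonsep n (E - star n E v)" and V: "card (vs n E) \<noteq> 2"
  shows "iso E n h"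
proof -
  have "\<forall>v\<in>vs n E. \<exists>s. s \<in> vs h E \<and> star h E s = star n E v"
    using star_transfer[OF okn okh nsn nsh ev c] nsv by blast
  then obtain f where f: "\<And>v. v \<in> vs n E \<Longrightarrow> f v \<in> vs h E \<and> star h E (f v) = star n E v" by metis
  have two: "card (n e) = 2" "card (h e) = 2" if "e \<in> E" for e
    using nonsep_loopless[OF okn nsn c that] nonsep_loopless[OF okh nsh c that] by auto
  have "inj_on f (vs n E)"
  proof (rule inj_onI, rule ccontr)
    fix v w assume vw: "v \<in> vs n E" "w \<in> vs n E" "f v = f w" "v \<noteq> w"
    let ?X = "star n E v"
    have st: "star n E w = ?X" using f vw by metis
    have eq: "n e = {v, w}" if "e \<in> ?X" for e
    proof -
      have "e \<in> E" "v \<in> n e" "w \<in> n e" using that st by (auto simp: star_def)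
      then show ?thesis using two(1)[of e] vw(4) card_seteq[of "n e" "{v, w}"] ends_okD(3)[OF okn, of e] by auto
    qed
    have "v \<notin> n e \<and> w \<notin> n e" if "e \<in> E - ?X" for e using that st two(1) by (auto simp: star_def)
    then have "vs n ?X \<inter> vs n (E - ?X) = {}" using eq by (auto simp: vs_def)
    moreover have "?X \<noteq> {}" using vw(1) two by (auto simp: star_def vs_def)
    moreover have "?X \<subseteq> E" by (auto simp: star_def)
    ultimately have "?X = E" using nonsep_conn[OF nsn] by (auto simp: conn_def)
    then have "vs n E \<subseteq> {v, w}" using eq by (auto simp: vs_def)
    then have "vs n E = {v, w}" using vw by auto
    then show False using V vw(4) by simp
  qed
  moreover have "h e = f ` n e" if e: "e \<in> E" for e
  proof -
    obtain a b where ab: "n e = {a, b}" "a \<noteq> b" using two(1)[OF e] by (auto simp: card_2_iff)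
    have V: "a \<in> vs n E" "b \<in> vs n E" using ab e by (auto simp: vs_def)
    have "e \<in> star n E a" "e \<in> star n E b" using ab e two by (auto simp: star_def)
    then have "f a \<in> h e" "f b \<in> h e" using f[OF V(1)] f[OF V(2)] by (auto simp: star_def)
    moreover have "f a \<noteq> f b" using \<open>inj_on f (vs n E)\<close> V ab(2) by (auto dest: inj_onD)
    ultimately show ?thesis using card_seteq[of "h e" "{f a, f b}"] two(2)[OF e] ends_okD(3)[OF okh e] ab by auto
  qed
  ultimately show ?thesis unfolding iso_def by blast
qed

text \<open>Any two edges form a cycle in \<open>n\<close>, so they are parallel in \<open>h\<close>
  as well.\<close>

lemma iso_parallel:
  assumes okn: "ends_ok n E" and okh: "ends_ok h E" and nsn: "nonsep n E" and nsh: "nonsep h E"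
    and ev: "evens n E = evens h E" and c: "card E \<ge> 2" and V: "card (vs n E) = 2"
  shows "iso E n h"
proof -
  have two: "card (n e) = 2" "card (h e) = 2" if "e \<in> E" for e
    using nonsep_loopless[OF okn nsn c that] nonsep_loopless[OF okh nsh c that] by auto
  have nV: "n e = vs n E" if "e \<in> E" for e
    using that two(1)[OF that] V card_seteq[OF ends_okD(5)[OF okn], of "n e"] by (auto simp: vs_def)
  obtain e0 where e0: "e0 \<in> E" using c by (cases "E = {}") auto
  have heq: "h e = h e0" if e: "e \<in> E" for e
  proof (cases "e = e0")
    case False
    have "{e, e0} \<in> evens n E"
      using bd_pair[of n e e0] two(1)[OF e] two(1)[OF e0] False nV[OF e] nV[OF e0] e e0 by (simp add: evens_def)
    then have "bd h {e, e0} = {}" unfolding ev by (simp add: evens_def)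
    then have "sym_diff (h e) (h e0) = {}"
      using bd_pair[of h e e0] two(2)[OF e] two(2)[OF e0] False by simp
    then show ?thesis by auto
  qed simp
  obtain a b where ab: "vs n E = {a, b}" "a \<noteq> b" using V by (auto simp: card_2_iff)
  obtain c d where cd: "h e0 = {c, d}" "c \<noteq> d" using two(2)[OF e0] by (auto simp: card_2_iff)
  let ?f = "\<lambda>x. if x = a then c else d"
  have "inj_on ?f (vs n E)" using ab cd by auto
  moreover have "h e = ?f ` n e" if "e \<in> E" for e using nV[OF that] heq[OF that] ab cd by auto
  ultimately show ?thesis unfolding iso_def by blast
qed

section \<open>2-separations\<close>

definition sep2 :: "('e \<Rightarrow> 'v set) \<Rightarrow> 'e set \<Rightarrow> 'e set \<Rightarrow> bool" where
  "sep2 n E X \<longleftrightarrow> X \<subseteq> E \<and> card X \<ge> 2 \<and> card (E - X) \<ge> 2 \<and> card (vs n X \<inter> vs n (E - X)) = 2"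

text \<open>Deleting the star leaves a proper nonempty part \<open>Y\<close> with at most one
  attachment vertex. Together with the edges from \<open>v\<close> into \<open>Y\<close> it is
  attached at that vertex and at \<open>v\<close>.\<close>

lemma vertex_sep2:
  assumes ok: "ends_ok n E" and ns: "nonsep n E" and v: "v \<in> vs n E"
    and nv: "\<not> nonsep n (E - star n E v)" and c: "card E \<ge> 2"
  shows "\<exists>X. sep2 n E X"
proof -
  have two: "card (n e) = 2" if "e \<in> E" for e using nonsep_loopless[OF ok ns c that] by auto
  let ?E = "E - star n E v"
  obtain Y where Y: "Y \<subseteq> ?E" "Y \<noteq> {}" "Y \<noteq> ?E" "card (vs n Y \<inter> vs n (?E - Y)) < 2"
    using nv by (auto simp: nonsep_def not_le)
  have vY: "v \<notin> vs n ?E" using two by (auto simp: vs_def star_def)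
  define X where "X = Y \<union> {e \<in> star n E v. n e \<inter> vs n Y \<noteq> {}}"
  have XE: "X \<subseteq> E" using Y(1) by (auto simp: X_def star_def)
  have inX: "n e \<subseteq> insert v (vs n Y)" if "e \<in> X" for e
  proof (cases "e \<in> Y")
    case False
    then have e: "e \<in> E" "v \<in> n e" "n e \<inter> vs n Y \<noteq> {}" using that by (auto simp: X_def star_def)
    then obtain w where w: "w \<in> n e" "w \<in> vs n Y" by auto
    moreover have "v \<noteq> w" using vY w vs_mono[OF Y(1), of n] by auto
    ultimately have "n e = {v, w}" using e two[OF e(1)] card_seteq[OF ends_okD(3)[OF ok e(1)], of "{v, w}"] by auto
    then show ?thesis using w by auto
  qed (auto simp: vs_def)
  have outX: "n e \<inter> vs n Y \<subseteq> vs n (?E - Y)" if "e \<in> E - X" for e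
    using that by (cases "e \<in> star n E v") (auto simp: X_def vs_def)
  have "vs n X \<inter> vs n (E - X) \<subseteq> insert v (vs n Y \<inter> vs n (?E - Y))"
  proof
    fix x assume x: "x \<in> vs n X \<inter> vs n (E - X)"
    then have "x \<in> insert v (vs n Y)" using inX by (auto simp: vs_def)
    moreover have "x \<in> vs n (?E - Y)" if "x \<in> vs n Y" using x that outX by (auto simp: vs_def)
    ultimately show "x \<in> insert v (vs n Y \<inter> vs n (?E - Y))" by blast
  qed
  moreover have fin: "finite (vs n Y \<inter> vs n (?E - Y))" using finite_vs_Int[OF ok, of Y] Y(1) by auto
  ultimately have "card (vs n X \<inter> vs n (E - X)) \<le> card (insert v (vs n Y \<inter> vs n (?E - Y)))" by (intro card_mono) auto
  also have "\<dots> \<le> 2" using Y(4) fin by (simp add: card_insert_if)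
  finally have le: "card (vs n X \<inter> vs n (E - X)) \<le> 2" .
  have Xne: "X \<noteq> {}" "X \<noteq> E" using Y(1-3) by (auto simp: X_def)
  then have eq2: "card (vs n X \<inter> vs n (E - X)) = 2" using ns XE le unfolding nonsep_def by (simp add: le_antisym)
  have vin: "v \<in> vs n X \<inter> vs n (E - X)"
  proof (rule ccontr)
    assume "\<not> ?thesis"
    then have "vs n X \<inter> vs n (E - X) \<subseteq> vs n Y \<inter> vs n (?E - Y)"
      using \<open>vs n X \<inter> vs n (E - X) \<subseteq> insert v (vs n Y \<inter> vs n (?E - Y))\<close> by blast
    then have "card (vs n X \<inter> vs n (E - X)) \<le> card (vs n Y \<inter> vs n (?E - Y))" by (intro card_mono fin)
    then show False using eq2 Y(4) by simp
  qed
  have big: "card W \<ge> 2" if W: "W \<subseteq> E" "v \<in> vs n W" "y \<in> W" "y \<in> ?E" for W y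
  proof -
    obtain e where e: "e \<in> W" "v \<in> n e" using W(2) by (auto simp: vs_def)
    then have "e \<noteq> y" using W(4) vY by (auto simp: vs_def)
    then have "card {e, y} = 2" by simp
    moreover have "card {e, y} \<le> card W" using e W finite_subset[OF W(1) ends_okD(1)[OF ok]] by (intro card_mono) auto
    ultimately show ?thesis by simp
  qed
  obtain y where "y \<in> Y" using Y(2) by auto
  then have "card X \<ge> 2" using big[of X y] XE vin Y(1) by (auto simp: X_def)
  moreover obtain y' where "y' \<in> ?E - Y" using Y(1,3) by auto
  then have "card (E - X) \<ge> 2" using big[of "E - X" y'] vin by (auto simp: X_def)
  ultimately show ?thesis using XE eq2 by (auto simp: sep2_def)
qed

text \<open>Suppose a smallest side \<open>X\<close> breaks into \<open>Y\<close> and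
  \<open>X - Y\<close> with at most one common vertex. If one part contained both attachment
  vertices of \<open>X\<close>, the other would be attached at the common vertex only. So each part
  has exactly two attachment vertices and would be a smaller side, unless it is a single
  edge.\<close>

lemma minimal_sep2:
  assumes ok: "ends_ok n E" and ns: "nonsep n E" and X: "sep2 n E X"
    and min: "\<And>X'. sep2 n E X' \<Longrightarrow> card X \<le> card X'" and nX: "\<not> nonsep n X"
  shows "\<exists>a b. X = {a, b} \<and> a \<noteq> b \<and> cocycle (evens n E) {a, b}"
proof -
  let ?A = "vs n X \<inter> vs n (E - X)"
  have XE: "X \<subseteq> E" "card X \<ge> 2" "card (E - X) \<ge> 2" "card ?A = 2" using X by (auto simp: sep2_def)
  have finE: "finite E" using ok by (rule ends_okD)
  have finX: "finite X" using XE(1) finE finite_subset by blast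
  have finv: "finite (vs n W \<inter> S)" if "W \<subseteq> X" for W S using finite_vs_Int[OF ok] that XE(1) by (metis subset_trans)
  obtain Y where Y: "Y \<subseteq> X" "Y \<noteq> {}" "Y \<noteq> X" "card (vs n Y \<inter> vs n (X - Y)) < 2"
    using nX by (auto simp: nonsep_def not_le)
  define B where "B = vs n Y \<inter> vs n (X - Y)"
  have part: "card W = 1 \<and> card (vs n W \<inter> ?A) \<le> 1"
    if W: "W = Y \<or> W = X - Y" for W
  proof -
    have WX: "W \<subseteq> X" "W \<noteq> {}" "W \<noteq> X" using Y W by auto
    have B': "B = vs n W \<inter> vs n (X - W)"
    proof -
      have "X - (X - Y) = Y" using Y by auto
      then show ?thesis using W by (auto simp: B_def)
    qed
    have cB: "card B < 2" using Y(4) by (simp add: B_def)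
    have att: "vs n U \<inter> vs n (E - U) \<subseteq> (vs n U \<inter> ?A) \<union> B" if "U = W \<or> U = X - W" for U
    proof -
      have "U \<subseteq> X" using that WX by auto
      then have "E - U = (E - X) \<union> (X - U)" using XE by auto
      then have "vs n (E - U) = vs n (E - X) \<union> vs n (X - U)" by (metis vs_Un)
      moreover have "vs n U \<subseteq> vs n X" using \<open>U \<subseteq> X\<close> by (rule vs_mono)
      moreover have "X - (X - W) = W" using WX by auto
      then have "vs n U \<inter> vs n (X - U) = B" using that B' by (auto simp: Int_commute)
      ultimately show ?thesis by auto
    qed
    have ge2: "card (vs n U \<inter> vs n (E - U)) \<ge> 2" if "U = W \<or> U = X - W" for U
    proof -
      have "U \<subseteq> E" "U \<noteq> {}" using that WX XE by auto
      moreover have "U \<noteq> E" using that WX XE by auto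
      ultimately show ?thesis using ns by (auto simp: nonsep_def)
    qed
    have WA: "card (vs n W \<inter> ?A) \<le> 1"
    proof (rule ccontr)
      assume "\<not> ?thesis"
      then have "card ?A \<le> card (vs n W \<inter> ?A)" using XE(4) by simp
      then have AW: "?A \<subseteq> vs n W" using card_seteq[of ?A "vs n W \<inter> ?A"] finv[of X] by auto
      let ?U = "X - W"
      have "vs n ?U \<inter> ?A \<subseteq> B" using AW B' by auto
      then have "vs n ?U \<inter> vs n (E - ?U) \<subseteq> B" using att[of ?U] by auto
      moreover have "finite B" using finv[of Y] Y(1) by (simp add: B_def)
      ultimately have "card (vs n ?U \<inter> vs n (E - ?U)) \<le> card B" by (intro card_mono)
      then show False using ge2[of ?U] cB by simp
    qed
    have "card (vs n W \<inter> vs n (E - W)) \<le> card ((vs n W \<inter> ?A) \<union> B)"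
      using att[of W] finv[of W] finv[of Y] WX(1) Y(1) by (intro card_mono) (auto simp: B_def)
    also have "\<dots> \<le> card (vs n W \<inter> ?A) + card B" by (rule card_Un_le)
    finally have eq2: "card (vs n W \<inter> vs n (E - W)) = 2" using WA cB ge2[OF disjI1[OF refl]] by linarith
    have "card (E - X) \<le> card (E - W)" using WX finE by (intro card_mono) auto
    then have "card W \<ge> 2 \<Longrightarrow> sep2 n E W" using eq2 XE WX by (auto simp: sep2_def)
    moreover have "card W < card X" using WX finX by (intro psubset_card_mono) auto
    moreover have "card W \<noteq> 0" using WX finite_subset[OF WX(1) finX] by simp
    ultimately have "card W = 1" using min[of W] by (metis One_nat_def Suc_1 Suc_leI le_neq_implies_less not_le neq0_conv)
    then show ?thesis using WA by simp
  qed
  obtain a where a: "Y = {a}" using part[of Y] by (auto simp: card_1_singleton_iff)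
  obtain b where b: "X - Y = {b}" using part[of "X - Y"] by (auto simp: card_1_singleton_iff)
  have Xab: "X = {a, b}" "a \<noteq> b" using a b Y(1) by auto
  have aE: "a \<in> E" "b \<in> E" using Xab XE by auto
  have cE: "card E \<ge> 2" using XE card_mono[OF finE XE(1)] by simp
  have two: "card (n a) = 2" "card (n b) = 2" using nonsep_loopless[OF ok ns cE] aE by auto
  have "card (n a \<inter> ?A) \<le> 1" using part[of Y] a by (simp add: vs_def)
  then have "\<not> n a \<subseteq> ?A" using two(1) by (metis inf.absorb1 Suc_1 not_less_eq_eq order_refl One_nat_def)
  \<comment> \<open>An end of \<open>a\<close> that is no attachment vertex of \<open>X\<close> is
    met by edges of \<open>X\<close> only. It must also be an end of \<open>b\<close>, for otherwise
    \<open>a\<close> would be attached at one vertex.\<close>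
  then obtain c where c: "c \<in> n a" "c \<notin> vs n (E - X)" using Xab by (auto simp: vs_def)
  have "star n E c = {a} \<or> star n E c = {a, b}"
    using c two aE Xab by (auto simp: star_def vs_def)
  moreover have "star n E c \<noteq> {a}"
  proof
    assume s: "star n E c = {a}"
    have "c \<notin> vs n (E - {a})"
    proof
      assume "c \<in> vs n (E - {a})"
      then obtain e where e: "e \<in> E" "e \<noteq> a" "c \<in> n e" by (auto simp: vs_def)
      then have "e \<in> star n E c" using nonsep_loopless[OF ok ns cE] by (simp add: star_def)
      then show False using s e by simp
    qed
    then have sub: "vs n {a} \<inter> vs n (E - {a}) \<subseteq> n a - {c}" by (auto simp: vs_def)
    have fa: "finite (n a)" using ends_okD(3)[OF ok aE(1)] .
    have "card (vs n {a} \<inter> vs n (E - {a})) \<le> card (n a - {c})" by (rule card_mono[OF _ sub]) (use fa in auto)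
    also have "\<dots> = 1" using two c fa by simp
    finally have "\<not> 2 \<le> card (vs n {a} \<inter> vs n (E - {a}))" by simp
    moreover have "{a} \<noteq> E" using aE Xab by auto
    ultimately show False using ns aE unfolding nonsep_def by blast
  qed
  ultimately have "star n E c = {a, b}" by simp
  then have "cocycle (evens n E) {a, b}" using cocycle_cut[OF ok, of "{c}"] star_eq_cut[OF ok, of c] by simp
  then show ?thesis using Xab by blast
qed

text \<open>Each component of the far side in \<open>h\<close> meets \<open>X\<close> in at least
  two vertices, as \<open>h\<close> is nonseparable. Joining two of them across the far side and
  back by a join \<open>Q\<close> in \<open>X\<close> gives an even set, so in \<open>n\<close> the
  boundary of \<open>Q\<close> is the attachment pair. Any two such joins differ by an even set, and
  hence join the same two vertices of \<open>h\<close>: there is only one pair.\<close>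

lemma nonsep_attachments:
  assumes okn: "ends_ok n E" and okh: "ends_ok h E" and nsh: "nonsep h E" and ev: "evens n E = evens h E"
    and X: "X \<subseteq> E" "X \<noteq> {}" "X \<noteq> E" and A: "card (vs n X \<inter> vs n (E - X)) = 2" and c: "conn h X"
  shows "card (vs h X \<inter> vs h (E - X)) = 2"
proof -
  let ?A = "vs n X \<inter> vs n (E - X)" and ?B = "vs h X \<inter> vs h (E - X)"
  obtain u v where uv: "?A = {u, v}" "u \<noteq> v" using A by (auto simp: card_2_iff)
  have fin: "finite W" if "W \<subseteq> E" for W using that ends_okD(1)[OF okh] finite_subset by blast
  have conv: "bd n Y = {} \<longleftrightarrow> bd h Y = {}" if "Y \<subseteq> E" for Y
    using ev that by (auto simp: evens_def)
  have pair: "\<exists>Q\<subseteq>X. bd h Q = {a, b} \<and> bd n Q = ?A"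
    if D: "D \<subseteq> E - X" "conn h D" and ab: "a \<in> vs h D" "b \<in> vs h D" "a \<in> vs h X" "b \<in> vs h X" "a \<noteq> b" for D a b
  proof -
    have DE: "D \<subseteq> E" using D by auto
    obtain R where R: "R \<subseteq> D" "bd h R = {a, b}"
      using connected_join_ne[OF ends_ok_subset[OF okh DE] D(2) ab(1,2,5)] by blast
    obtain Q where Q: "Q \<subseteq> X" "bd h Q = {a, b}"
      using connected_join_ne[OF ends_ok_subset[OF okh X(1)] c ab(3,4,5)] by blast
    have sub: "R \<subseteq> E" "Q \<subseteq> E" "Q \<inter> R = {}" using R(1) Q(1) D(1) X(1) by auto
    have "bd h (Q \<union> R) = {}" using bd_Un_disjoint[OF fin[OF sub(2)] fin[OF sub(1)] sub(3), of h] R(2) Q(2) by simp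
    then have "Q \<union> R \<in> evens n E" using ev sub by (simp add: evens_def)
    then have "bd n ((Q \<union> R) \<inter> X) \<subseteq> ?A" by (rule bd_Int_subset[OF okn])
    moreover have "(Q \<union> R) \<inter> X = Q" using Q(1) R(1) D(1) by auto
    ultimately have "bd n Q \<subseteq> ?A" by simp
    moreover have "bd n Q \<noteq> {}" using conv[OF sub(2)] Q(2) by simp
    ultimately have "bd n Q = ?A" using even_pair_subset[OF even_card_bd[OF okn sub(2)], of u v] uv by auto
    then show ?thesis using Q by blast
  qed
  have uniq: "{a, b} = {a', b'}" if Q: "Q \<subseteq> X" "bd h Q = {a, b}" "bd n Q = ?A"
      and Q': "Q' \<subseteq> X" "bd h Q' = {a', b'}" "bd n Q' = ?A" for a b a' b' Q Q'
  proof -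
    have f: "finite Q" "finite Q'" using Q(1) Q'(1) X(1) fin by auto
    have "bd n (sym_diff Q Q') = {}" using bd_sym_diff[OF f, of n] Q(3) Q'(3) by simp
    moreover have "sym_diff Q Q' \<subseteq> E" using Q(1) Q'(1) X(1) by auto
    ultimately have "bd h (sym_diff Q Q') = {}" using conv by blast
    then have "sym_diff {a, b} {a', b'} = {}" using bd_sym_diff[OF f, of h] Q(2) Q'(2) by simp
    then show ?thesis by (metis Diff_eq_empty_iff Un_empty subset_antisym)
  qed
  have partner: "\<exists>b Q. a \<noteq> b \<and> b \<in> ?B \<and> Q \<subseteq> X \<and> bd h Q = {a, b} \<and> bd n Q = ?A" if a: "a \<in> ?B" for a
  proof -
    have aX: "a \<in> vs h (E - X)" using a by auto
    obtain D where D: "D \<subseteq> E - X" "a \<in> vs h D" "conn h D" "vs h D \<inter> vs h (E - X - D) = {}"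
      using component_exists[OF ends_ok_subset[OF okh Diff_subset] aX] by (elim exE conjE)
    have "D \<noteq> {}" using D(2) by auto
    moreover have "D \<noteq> E" "D \<subseteq> E" using D(1) X by auto
    ultimately have two: "2 \<le> card (vs h D \<inter> vs h (E - D))" using nsh by (auto simp: nonsep_def)
    have "E - D = X \<union> (E - X - D)" using D(1) X(1) by auto
    then have "vs h (E - D) = vs h X \<union> vs h (E - X - D)" by (metis vs_Un)
    then have eq: "vs h D \<inter> vs h (E - D) = vs h D \<inter> vs h X" using D(4) by auto
    have "\<not> vs h D \<inter> vs h X \<subseteq> {a}"
    proof
      assume "vs h D \<inter> vs h X \<subseteq> {a}"
      then have "card (vs h D \<inter> vs h X) \<le> card {a}" by (intro card_mono) auto
      then show False using two eq by simp
    qed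
    then obtain b where b: "b \<in> vs h D" "b \<in> vs h X" "a \<noteq> b" by auto
    have "b \<in> ?B" using b D(1) vs_mono[OF D(1), of h] by auto
    then show ?thesis using pair[OF D(1,3,2) b(1) _ b(2,3)] a b(3) by blast
  qed
  have "2 \<le> card ?B" using nsh X by (auto simp: nonsep_def)
  then have "?B \<noteq> {}" by auto
  then obtain a where a: "a \<in> ?B" by blast
  from partner[OF a] obtain b Q where b: "a \<noteq> b" "b \<in> ?B" "Q \<subseteq> X" "bd h Q = {a, b}" "bd n Q = ?A" by blast
  have "x \<in> {a, b}" if x: "x \<in> ?B" for x
  proof -
    from partner[OF x] obtain y Q' where y: "x \<noteq> y" "Q' \<subseteq> X" "bd h Q' = {x, y}" "bd n Q' = ?A" by blast
    then have "{x, y} = {a, b}" using uniq[OF y(2-4) b(3-5)] by simp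
    then show ?thesis by blast
  qed
  then have "?B = {a, b}" using a b(2) by blast
  then show ?thesis using b(1) by simp
qed

text \<open>Let \<open>S\<close> be the side of the cut \<open>{a, b}\<close> that contains the
  common end \<open>c\<close>. Edges inside \<open>S\<close> would be attached at \<open>c\<close>
  only, so there are none; \<open>c\<close> then has degree two, and the attachment vertices are the
  other ends of \<open>a\<close> and \<open>b\<close>.\<close>

lemma series_shared_vertex:
  assumes ok: "ends_ok h E" and ns: "nonsep h E" and ab: "a \<noteq> b" "{a, b} \<subseteq> E" "cocycle (evens h E) {a, b}"
    and c: "c \<in> h a" "c \<in> h b" and big: "{a, b} \<noteq> E"
  shows "card (vs h {a, b} \<inter> vs h (E - {a, b})) = 2"
proof -
  have cE: "card E \<ge> 2" using card_mono[OF ends_okD(1)[OF ok] ab(2)] ab(1) by simp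
  have two: "card (h e) = 2" if "e \<in> E" for e using nonsep_loopless[OF ok ns cE that] .
  obtain S0 where S0: "S0 \<subseteq> vs h E" "{a, b} = cut h E S0"
    using cocycle_is_cut[OF ok nonsep_conn[OF ns] ab(2,3)] by blast
  define S where "S = (if c \<in> S0 then S0 else vs h E - S0)"
  have "c \<in> vs h E" using c ab by (auto simp: vs_def)
  then have S: "c \<in> S" "{a, b} = cut h E S" using S0 cut_complement[OF ok, of S0] by (auto simp: S_def)
  have other: "\<exists>x. h e = {c, x} \<and> x \<notin> S" if "e = a \<or> e = b" for e
  proof -
    have e: "e \<in> E" "c \<in> h e" "e \<in> cut h E S" using that ab(2) c S(2) by auto
    then obtain x where x: "x \<in> h e" "x \<notin> S" by (auto simp: cut_def)
    then have "x \<noteq> c" using S by auto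
    then have "h e = {c, x}" using two[OF e(1)] x e(2) card_seteq[OF ends_okD(3)[OF ok e(1)], of "{c, x}"] by auto
    then show ?thesis using x by blast
  qed
  from other[of a] obtain x where x: "h a = {c, x}" "x \<notin> S" by auto
  from other[of b] obtain y where "h b = {c, y}" "y \<notin> S" by auto
  note xy = x this
  define B where "B = {e \<in> E. h e \<subseteq> S}"
  have "B = {}"
  proof (rule ccontr)
    assume "B \<noteq> {}"
    moreover have "B \<subseteq> E" "B \<noteq> E" using xy ab(2) by (auto simp: B_def)
    ultimately have "2 \<le> card (vs h B \<inter> vs h (E - B))" using ns by (auto simp: nonsep_def)
    moreover have "vs h B \<inter> vs h (E - B) \<subseteq> {c}"
    proof
      fix z assume z: "z \<in> vs h B \<inter> vs h (E - B)"
      then have "z \<in> S" by (auto simp: vs_def B_def)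
      from z obtain e where e: "e \<in> E" "e \<notin> B" "z \<in> h e" by (auto simp: vs_def)
      then have "e \<in> cut h E S" using \<open>z \<in> S\<close> by (auto simp: cut_def B_def)
      then have "e = a \<or> e = b" using S(2) by blast
      then show "z \<in> {c}" using e(3) \<open>z \<in> S\<close> xy by auto
    qed
    then have "card (vs h B \<inter> vs h (E - B)) \<le> card {c}" by (intro card_mono) auto
    ultimately show False by simp
  qed
  have "c \<notin> vs h (E - {a, b})"
  proof
    assume "c \<in> vs h (E - {a, b})"
    then obtain e where e: "e \<in> E" "e \<notin> {a, b}" "c \<in> h e" by (auto simp: vs_def)
    then have "e \<in> B \<or> e \<in> cut h E S" using S(1) by (auto simp: B_def cut_def)
    then show False using \<open>B = {}\<close> S(2) e by auto
  qed
  then have "vs h {a, b} \<inter> vs h (E - {a, b}) \<subseteq> {x, y}" using xy by (auto simp: vs_def)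
  then have "card (vs h {a, b} \<inter> vs h (E - {a, b})) \<le> card {x, y}" by (intro card_mono) auto
  also have "\<dots> \<le> 2" by (simp add: card_insert_if)
  finally show ?thesis using ns ab(2) big unfolding nonsep_def by (metis insert_not_empty le_antisym)
qed

text \<open>If \<open>a\<close> and \<open>b\<close> have no common end, they form a cut with a side
  \<open>S\<close>, and switching the edges inside \<open>S\<close> together with \<open>b\<close>
  brings an end of \<open>b\<close> to an end of \<open>a\<close>.\<close>

lemma series_make_adjacent:
  assumes ok: "ends_ok h E" and ns: "nonsep h E" and ab: "a \<noteq> b" "{a, b} \<subseteq> E" "cocycle (evens h E) {a, b}"
    and big: "{a, b} \<noteq> E"
  shows "\<exists>h'. SW E h h' \<and> card (vs h' {a, b} \<inter> vs h' (E - {a, b})) = 2"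
proof (cases "h a \<inter> h b = {}")
  case False
  then have "card (vs h {a, b} \<inter> vs h (E - {a, b})) = 2" using series_shared_vertex[OF ok ns ab _ _ big] by blast
  then show ?thesis using SW_iso[OF iso_refl] by blast
next
  case True
  have cE: "card E \<ge> 2" using card_mono[OF ends_okD(1)[OF ok] ab(2)] ab(1) by simp
  have two: "card (h e) = 2" if "e \<in> E" for e using nonsep_loopless[OF ok ns cE that] .
  obtain S where S: "S \<subseteq> vs h E" "{a, b} = cut h E S"
    using cocycle_is_cut[OF ok nonsep_conn[OF ns] ab(2,3)] by blast
  have other: "\<exists>x y. h e = {x, y} \<and> x \<in> S \<and> y \<notin> S" if "e = a \<or> e = b" for e
  proof -
    have e: "e \<in> E" "e \<in> cut h E S" using that ab(2) S(2) by auto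
    then obtain x y where xy: "x \<in> h e" "y \<in> h e" "x \<in> S" "y \<notin> S" by (auto simp: cut_def)
    then have "x \<noteq> y" by auto
    then have "h e = {x, y}" using two[OF e(1)] xy card_seteq[OF ends_okD(3)[OF ok e(1)], of "{x, y}"] by auto
    then show ?thesis using xy by blast
  qed
  obtain a1 a2 where a: "h a = {a1, a2}" "a1 \<in> S" "a2 \<notin> S" using other[of a] by blast
  obtain b1 b2 where b: "h b = {b1, b2}" "b1 \<in> S" "b2 \<notin> S" using other[of b] by blast
  have dif: "a1 \<noteq> b1" "a2 \<noteq> b2" using True a b by auto
  define B where "B = {e \<in> E. h e \<subseteq> S}"
  \<comment> \<open>With \<open>b\<close> included, the attachment vertices are the end
    \<open>a1\<close> of \<open>a\<close> in \<open>S\<close> and the end \<open>b2\<close> of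
    \<open>b\<close> outside \<open>S\<close>. Their transposition replaces \<open>b2\<close> by
    \<open>a1\<close> as an end of \<open>b\<close>.\<close>
  define Y where "Y = insert b B"
  have YE: "Y \<subseteq> E" using ab(2) by (auto simp: Y_def B_def)
  have aY: "a \<notin> Y" using ab(1) a by (auto simp: Y_def B_def)
  have sub: "vs h Y \<inter> vs h (E - Y) \<subseteq> {a1, b2}"
  proof
    fix z assume z: "z \<in> vs h Y \<inter> vs h (E - Y)"
    then have "z \<in> S \<or> z = b2" using b by (auto simp: vs_def Y_def B_def)
    moreover have "z = a1" if zS: "z \<in> S"
    proof -
      from z obtain e where e: "e \<in> E" "e \<notin> Y" "z \<in> h e" by (auto simp: vs_def)
      then have "e \<in> cut h E S" using zS by (auto simp: cut_def B_def Y_def)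
      then have "e = a" using S(2) e(2) by (auto simp: Y_def)
      then show ?thesis using e(3) a zS by auto
    qed
    ultimately show "z \<in> {a1, b2}" by auto
  qed
  have a1b2: "a1 \<noteq> b2" using a b by auto
  have "2 \<le> card (vs h Y \<inter> vs h (E - Y))"
    using ns YE aY ab(2) unfolding nonsep_def by (metis Y_def insert_not_empty insert_subset)
  then have "vs h Y \<inter> vs h (E - Y) = {a1, b2}" using card_seteq[OF _ sub] a1b2 by auto
  then have sw: "switchable E h Y a1 b2" using YE a1b2 by (simp add: switchable_def)
  let ?h = "switch Y a1 b2 h"
  have SW: "SW E h ?h" by (rule SW_switch[OF sw])
  have pres: "ends_ok ?h E" "evens ?h E = evens h E" using SW_preserves[OF SW ok] by auto
  have ns': "nonsep ?h E" by (rule nonsep_transfer[OF ok pres(1) pres(2)[symmetric] ns])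
  have "b \<in> Y" by (simp add: Y_def)
  then have "?h b = {a1, b1}" using b dif a by (auto simp: switch_def transpose_def)
  moreover have "?h a = {a1, a2}" using aY a by (simp add: switch_def)
  ultimately have "card (vs ?h {a, b} \<inter> vs ?h (E - {a, b})) = 2"
    using series_shared_vertex[OF pres(1) ns' ab(1,2), of a1] ab(3) pres(2) big by simp
  then show ?thesis using SW by blast
qed

text \<open>The induction step for a 2-separation that both graphs share; \<open>IH\<close> is the
  induction hypothesis of \<open>SW_nonsep\<close>.\<close>

lemma SW_sep2:
  fixes n h :: "'e \<Rightarrow> 'v set"
  assumes IH: "\<And>E' (n' :: 'e \<Rightarrow> 'v set) (h' :: 'e \<Rightarrow> 'v set). card E' < card E \<Longrightarrow> ends_ok n' E' \<Longrightarrow> ends_ok h' E' \<Longrightarrow>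
      nonsep n' E' \<Longrightarrow> evens n' E' = evens h' E' \<Longrightarrow> SW E' n' h'"
    and okn: "ends_ok n E" and okh: "ends_ok h E" and nsn: "nonsep n E" and ev: "evens n E = evens h E"
    and X: "sep2 n E X" "card (vs h X \<inter> vs h (E - X)) = 2"
  shows "SW E n h"
proof -
  define X2 where "X2 = E - X"
  have Xs: "X \<subseteq> E" "card X \<ge> 2" "card X2 \<ge> 2" "card (vs n X \<inter> vs n X2) = 2" "card (vs h X \<inter> vs h X2) = 2"
    using X by (auto simp: sep2_def X2_def)
  have E: "E = X \<union> X2" "X \<inter> X2 = {}" using Xs(1) by (auto simp: X2_def)
  have finE: "finite E" using okn by (rule ends_okD)
  have fin: "finite X" "finite X2" using E finE by auto
  obtain p q where p: "p \<in> X2" and q: "q \<in> X" using Xs(2,3) by fastforce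
  have nsh: "nonsep h E" by (rule nonsep_transfer[OF okn okh ev nsn])
  have part: "SW (insert p Y1) (cap n Y1 Y2) (cap h Y1 Y2)"
    if Y: "E = Y1 \<union> Y2" "Y1 \<inter> Y2 = {}" "p \<in> Y2" "card Y1 \<ge> 2" "card Y2 \<ge> 2" "finite Y1" "finite Y2"
      and A: "card (vs n Y1 \<inter> vs n Y2) = 2" "card (vs h Y1 \<inter> vs h Y2) = 2" for Y1 Y2 p
  proof -
    have pY: "p \<notin> Y1" using Y by auto
    have "Y1 \<noteq> {}" "Y1 \<noteq> E" using Y by auto
    then have "\<not> splits (evens n E) Y1" using nsn nonsep_iff[OF okn] Y(1) by blast
    \<comment> \<open>Nonseparability provides an even set that crosses the separation. The same
      \<open>Z\<close> serves both graphs, as their cycle spaces are equal.\<close>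
    then obtain Z where Z: "Z \<in> evens n E" "Z \<inter> Y1 \<notin> evens n E" by (auto simp: splits_def)
    have eqk: "evens (cap n Y1 Y2) (insert p Y1) = evens (cap h Y1 Y2) (insert p Y1)"
    proof (rule set_eqI)
      fix W
      show "W \<in> evens (cap n Y1 Y2) (insert p Y1) \<longleftrightarrow> W \<in> evens (cap h Y1 Y2) (insert p Y1)"
      proof (cases "W \<subseteq> insert p Y1")
        case True
        show ?thesis
          using evens_cap[of n Y1 Y2 p Z W] evens_cap[of h Y1 Y2 p Z W] okn okh ev Z Y(1,2) A pY True by simp
      qed (auto simp: evens_def)
    qed
    \<comment> \<open>The reason why both sides of a 2-separation are required to have at least two
      edges.\<close>
    have "card (insert p Y1) < card E" unfolding Y(1) using Y pY by (simp add: card_Un_disjoint)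
    then show ?thesis
    proof (rule IH)
      show "ends_ok (cap n Y1 Y2) (insert p Y1)" "ends_ok (cap h Y1 Y2) (insert p Y1)"
        using cap_ends_ok[of n Y1 Y2 p] cap_ends_ok[of h Y1 Y2 p] okn okh A Y(1) by auto
      show "nonsep (cap n Y1 Y2) (insert p Y1)" using nonsep_cap[of n Y1 Y2 p] okn nsn Y(1-3) by simp
    qed (rule eqk)
  qed
  have 1: "SW (X \<union> {p}) (cap n X X2) (cap h X X2)" using part[of X X2 p] E p Xs fin by simp
  have 2: "SW (X2 \<union> {q}) (cap n X2 X) (cap h X2 X)" using part[of X2 X q] E q Xs fin by (simp add: Un_commute Int_commute)
  have "SW (X \<union> X2) n h"
    by (rule SW_glue[OF E(2) _ _ _ 1 2]) (use p q E Xs in auto)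
  then show ?thesis using E by simp
qed

lemma SW_nonsep:
  fixes n h :: "'e \<Rightarrow> 'v set"
  assumes "ends_ok n E" "ends_ok h E" "nonsep n E" "evens n E = evens h E"
  shows "SW E n h"
  using assms
proof (induction "card E" arbitrary: E n h rule: less_induct)
  case less
  note okn = less.prems(1) and okh = less.prems(2) and nsn = less.prems(3) and ev = less.prems(4)
  have nsh: "nonsep h E" by (rule nonsep_transfer[OF okn okh ev nsn])
  have finE: "finite E" using okn by (rule ends_okD)
  show ?case
  proof (cases "card E \<ge> 2")
    case False
    have "iso E n h"
    proof (cases "E = {}")
      case True
      then show ?thesis by (auto simp: iso_def vs_def)
    next
      case ne: False
      then have "card E = 1" using False finE by (metis One_nat_def Suc_1 card_0_eq less_Suc_eq less_one not_le)
      then obtain e where e: "E = {e}" by (auto simp: card_1_singleton_iff)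
      \<comment> \<open>For a single edge the cycle space tells just whether it is a loop.\<close>
      have "card (n e) = 2 \<longleftrightarrow> card (h e) = 2"
      proof -
        have "bd n {e} = {} \<longleftrightarrow> bd h {e} = {}" using ev e by (auto simp: evens_def)
        then show ?thesis using ends_okD(4)[OF okn, of e] ends_okD(4)[OF okh, of e] e by (auto simp: bd_single split: if_splits)
      qed
      then have "card (n e) = card (h e)" using ends_okD(2)[OF okn, of e] ends_okD(2)[OF okh, of e] e by auto
      then obtain f where "bij_betw f (n e) (h e)"
        using finite_same_card_bij[OF ends_okD(3)[OF okn, of e] ends_okD(3)[OF okh, of e]] e by auto
      then show ?thesis using e by (auto simp: iso_def vs_def bij_betw_def)
    qed
    then show ?thesis by (rule SW_iso)
  next
    case c: True
    show ?thesis
    proof (cases "\<exists>X. sep2 n E X")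
      case False
      then have "nonsep n (E - star n E v)" if "v \<in> vs n E" for v using vertex_sep2[OF okn nsn that _ c] by blast
      then have "iso E n h"
        using SW_all_stars[OF okn okh nsn nsh ev c] iso_parallel[OF okn okh nsn nsh ev c] by blast
      then show ?thesis by (rule SW_iso)
    next
      case True
      then obtain X where X: "sep2 n E X" and min: "\<And>X'. sep2 n E X' \<Longrightarrow> card X \<le> card X'"
        using ex_has_least_nat[of "sep2 n E" _ card] by blast
      have Xs: "X \<subseteq> E" "X \<noteq> {}" "X \<noteq> E" "card (vs n X \<inter> vs n (E - X)) = 2" using X by (auto simp: sep2_def)
      show ?thesis
      proof (cases "nonsep n X")
        case True
        have "nonsep h X"
          by (rule nonsep_transfer[OF ends_ok_subset[OF okn Xs(1)] ends_ok_subset[OF okh Xs(1)] evens_eq_subset[OF ev Xs(1)] True])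
        then have "card (vs h X \<inter> vs h (E - X)) = 2"
          using nonsep_attachments[OF okn okh nsh ev Xs] nonsep_conn by blast
        then show ?thesis using SW_sep2[OF less.hyps okn okh nsn ev X] by blast
      next
        case False
        obtain a b where ab: "X = {a, b}" "a \<noteq> b" "cocycle (evens n E) {a, b}"
          using minimal_sep2[OF okn nsn X min False] by blast
        obtain h' where h': "SW E h h'" "card (vs h' {a, b} \<inter> vs h' (E - {a, b})) = 2"
          using series_make_adjacent[OF okh nsh ab(2)] ab Xs ev by auto
        have pres: "ends_ok h' E" "evens h' E = evens h E" using SW_preserves[OF h'(1) okh] by auto
        have "SW E n h'"
          by (rule SW_sep2[OF less.hyps okn pres(1) nsn _ X]) (use ev pres h' ab in auto)
        then show ?thesis using SW_sym[OF h'(1)] SW_trans by blast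
      qed
    qed
  qed
qed

section \<open>Graphs without cut vertices\<close>

text \<open>Several components are allowed; these are the graphs all of whose components are
  nonseparable.\<close>

definition no_cutvertex :: "('e \<Rightarrow> 'v set) \<Rightarrow> 'e set \<Rightarrow> bool" where
  "no_cutvertex n E \<longleftrightarrow> (\<forall>X\<subseteq>E. X \<noteq> {} \<longrightarrow> X \<noteq> E \<longrightarrow> card (vs n X \<inter> vs n (E - X)) \<noteq> 1)"

lemma no_cutvertex_component:
  assumes "no_cutvertex n E" "X \<subseteq> E" "vs n X \<inter> vs n (E - X) = {}"
  shows "no_cutvertex n X"
  unfolding no_cutvertex_def
proof (intro allI impI)
  fix Y assume Y: "Y \<subseteq> X" "Y \<noteq> {}" "Y \<noteq> X"
  have "E - Y = (E - X) \<union> (X - Y)" using Y assms(2) by auto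
  then have "vs n (E - Y) = vs n (E - X) \<union> vs n (X - Y)" by (metis vs_Un)
  then have "vs n Y \<inter> vs n (E - Y) = vs n Y \<inter> vs n (X - Y)" using vs_mono[OF Y(1), of n] assms(3) by auto
  moreover have "Y \<subseteq> E" "Y \<noteq> E" using Y assms(2) by auto
  ultimately show "card (vs n Y \<inter> vs n (X - Y)) \<noteq> 1" using assms(1) Y(2) unfolding no_cutvertex_def by metis
qed

text \<open>A set that shares no vertex with the rest in \<open>n\<close> splits the cycle space. As
  \<open>h\<close> has no cut vertex either, it shares no vertex with the rest in \<open>h\<close>.
  The two parts are treated by induction and glued without virtual edges.\<close>

theorem SW_no_cutvertex:
  fixes n h :: "'e \<Rightarrow> 'v set"
  assumes "ends_ok n E" "ends_ok h E" "no_cutvertex n E" "no_cutvertex h E" "evens n E = evens h E"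
  shows "SW E n h"
  using assms
proof (induction "card E" arbitrary: E rule: less_induct)
  case less
  note okn = less.prems(1) and okh = less.prems(2) and ncn = less.prems(3) and nch = less.prems(4) and ev = less.prems(5)
  have finE: "finite E" using okn by (rule ends_okD)
  show ?case
  proof (cases "nonsep n E")
    case True
    then show ?thesis using SW_nonsep okn okh ev by blast
  next
    case False
    then obtain X where X: "X \<subseteq> E" "X \<noteq> {}" "X \<noteq> E" "card (vs n X \<inter> vs n (E - X)) < 2"
      by (auto simp: nonsep_def not_le)
    then have "card (vs n X \<inter> vs n (E - X)) = 0" using ncn unfolding no_cutvertex_def
      by (metis One_nat_def less_2_cases)
    then have n0: "vs n X \<inter> vs n (E - X) = {}" using finite_vs_Int[OF okn X(1)] by simp
    have "splits (evens h E) X" using splits_small_attachment[OF okn X(1,4)] ev by simp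
    then have h0: "vs h X \<inter> vs h (E - X) = {}"
    proof (rule_tac ccontr)
      assume sp: "splits (evens h E) X" and "vs h X \<inter> vs h (E - X) \<noteq> {}"
      then obtain a where "a \<in> vs h X" "a \<in> vs h (E - X)" by auto
      from splits_cutvertex[OF okh X(1) sp this] show False
        using nch unfolding no_cutvertex_def by (metis card_1_singleton_iff One_nat_def)
    qed
    have EX: "E - X \<subseteq> E" "E - (E - X) = X" using X(1) by auto
    have c: "card X < card E" "card (E - X) < card E"
      using X finE by (auto intro!: psubset_card_mono)
    have cong: "SW Y (cap n Y Y') (cap h Y Y')" if "SW Y n h" for Y Y'
    proof -
      have "iso Y (cap n Y Y') n" "iso Y h (cap h Y Y')"
        by (rule iso_cong[OF iso_refl[of Y n]], simp_all add: cap_def)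
          (rule iso_cong[OF iso_refl[of Y h]], simp_all add: cap_def)
      then show ?thesis using that SW_iso SW_trans by blast
    qed
    have "SW X n h"
      by (rule less.hyps[OF c(1) ends_ok_subset[OF okn X(1)] ends_ok_subset[OF okh X(1)]
          no_cutvertex_component[OF ncn X(1) n0] no_cutvertex_component[OF nch X(1) h0] evens_eq_subset[OF ev X(1)]])
    then have 1: "SW (X \<union> {}) (cap n X (E - X)) (cap h X (E - X))" using cong by simp
    have "SW (E - X) n h"
      by (rule less.hyps[OF c(2) ends_ok_subset[OF okn EX(1)] ends_ok_subset[OF okh EX(1)]
          no_cutvertex_component[OF ncn EX(1)] no_cutvertex_component[OF nch EX(1)] evens_eq_subset[OF ev EX(1)]])
        (use n0 h0 EX in auto)
    then have 2: "SW ((E - X) \<union> {}) (cap n (E - X) X) (cap h (E - X) X)" using cong by simp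
    have "SW (X \<union> (E - X)) n h"
      by (rule SW_glue[OF _ _ _ _ 1 2]) (use n0 h0 in auto)
    moreover have "X \<union> (E - X) = E" using X(1) by auto
    ultimately show ?thesis by simp
  qed
qed

section \<open>From end maps to the relation \<open>two_isomorphic\<close>\<close>

definition mk :: "('e \<Rightarrow> 'v set) \<Rightarrow> 'e set \<Rightarrow> ('v, 'e) mgraph" where
  "mk n E = \<lparr>verts = vs n E, edges = E, ends = n\<rparr>"

abbreviation two_iso_eq :: "(nat, 'e) mgraph \<Rightarrow> (nat, 'e) mgraph \<Rightarrow> bool" where
  "two_iso_eq \<equiv> equivclp two_iso_step"

lemma mk_simps [simp]: "verts (mk n E) = vs n E" "edges (mk n E) = E" "ends (mk n E) = n"
  by (simp_all add: mk_def)

lemma restrict_simps [simp]: "verts (G \<restriction> X) = vs (ends G) X" "edges (G \<restriction> X) = X" "ends (G \<restriction> X) = ends G"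
  by (simp_all add: edge_restrict_def vs_def)

lemma graph_ends_ok: "graph G \<Longrightarrow> ends_ok (ends G) (edges G)"
  by (simp add: graph_def ends_ok_def)

lemma graph_vs: "graph G \<Longrightarrow> X \<subseteq> edges G \<Longrightarrow> vs (ends G) X \<subseteq> verts G"
  by (auto simp: graph_def vs_def)

lemma graph_mk: "ends_ok n E \<Longrightarrow> graph (mk n E)"
  using ends_okD(5)[of n E] by (auto simp: graph_def ends_ok_def vs_def)

lemma graph_iso_refl: "graph_iso G G"
  unfolding graph_iso_def by (intro conjI refl exI[of _ id]) auto

lemma two_iso_eq_step: "two_iso_step K L \<Longrightarrow> two_iso_eq K L"
  by (rule r_into_equivclp)

lemma two_iso_eq_sym: "two_iso_eq K L \<Longrightarrow> two_iso_eq L K"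
  by (rule equivclp_sym)

lemma two_iso_eq_trans: "two_iso_eq K L \<Longrightarrow> two_iso_eq L M \<Longrightarrow> two_iso_eq K M"
  by (rule equivclp_trans)

lemma same_component_closed:
  assumes "same_component G u v" "u \<in> S" "\<And>e. e \<in> edges G \<Longrightarrow> ends G e \<inter> S \<noteq> {} \<Longrightarrow> ends G e \<subseteq> S"
  shows "v \<in> S"
proof -
  have "(adjacent G)\<^sup>*\<^sup>* u v" using assms(1) by (simp add: same_component_def)
  then show ?thesis
  proof (induction rule: rtranclp_induct)
    case (step y z)
    then obtain e where e: "e \<in> edges G" "ends G e = {y, z}" by (auto simp: adjacent_def)
    then show ?case using assms(3)[OF e(1)] step.IH by auto
  qed (rule assms(2))
qed

text \<open>None of the operations is a mere renaming of vertices, so an isolated vertex is attached and then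
  identified with another vertex.\<close>

lemma two_iso_eq_iso:
  assumes G: "graph G" "verts G \<noteq> {}" and i: "graph_iso G H"
  shows "two_iso_eq G H"
proof -
  have "finite (verts G)" using G by (simp add: graph_def)
  then obtain w :: nat where w: "w \<notin> verts G" using ex_new_if_finite[OF infinite_UNIV_nat] by blast
  obtain u where u: "u \<in> verts G" using G by auto
  define L where "L = \<lparr>verts = insert w (verts G), edges = edges G, ends = ends G\<rparr>"
  have gL: "graph L" using G by (auto simp: graph_def L_def)
  have we: "w \<notin> ends G e" if "e \<in> edges G" for e using G w that by (auto simp: graph_def)
  have nc: "\<not> same_component L u w"
  proof
    assume "same_component L u w"
    from same_component_closed[OF this, of "verts G"] u G(1) w show False
      by (auto simp: L_def graph_def)
  qed
  have step: "two_iso_step L M" if M: "graph_iso G M" for M :: "(nat, 'a) mgraph"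
  proof -
    obtain f where f: "edges M = edges G" "bij_betw f (verts G) (verts M)" "\<forall>e\<in>edges G. ends M e = f ` ends G e"
      using M by (auto simp: graph_iso_def)
    have id: "(\<lambda>x. if x = w then u else x) ` ends G e = ends G e" if "e \<in> edges G" for e
      using we[OF that] by (auto simp: image_iff)
    have "verts (identify_vertices L u w) = verts G" "edges (identify_vertices L u w) = edges G"
      using w by (auto simp: identify_vertices_def L_def)
    moreover have "ends (identify_vertices L u w) e = ends G e" if "e \<in> edges G" for e
      using id[OF that] by (simp add: identify_vertices_def L_def)
    ultimately have "graph_iso (identify_vertices L u w) M"
      using f unfolding graph_iso_def by (intro conjI exI[of _ f]) auto
    moreover have "u \<in> verts L" "w \<in> verts L" using u by (auto simp: L_def)
    ultimately show ?thesis using gL nc unfolding two_iso_step_def by blast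
  qed
  have "two_iso_eq L G" "two_iso_eq L H"
    using two_iso_eq_step[OF step[OF graph_iso_refl]] two_iso_eq_step[OF step[OF i]] .
  then show ?thesis using two_iso_eq_sym two_iso_eq_trans by blast
qed

lemma vs_nonempty: "ends_ok n E \<Longrightarrow> E \<noteq> {} \<Longrightarrow> vs n E \<noteq> {}"
  using ends_okD(4)[of n E] by (fastforce simp: vs_def)

lemma SW_two_iso_eq:
  fixes n n' :: "'e \<Rightarrow> nat set"
  shows "SW E n n' \<Longrightarrow> ends_ok n E \<Longrightarrow> E \<noteq> {} \<Longrightarrow> two_iso_eq (mk n E) (mk n' E)"
proof (induction rule: SW.induct)
  case (SW_iso n n')
  then obtain f where f: "inj_on f (vs n E)" "\<forall>e\<in>E. n' e = f ` n e" by (auto simp: iso_def)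
  have "graph_iso (mk n E) (mk n' E)"
    unfolding graph_iso_def using f vs_iso[OF f(2), of E]
    by (intro conjI exI[of _ f]) (auto simp: bij_betw_def)
  then show ?case using two_iso_eq_iso[OF graph_mk[OF SW_iso(2)]] vs_nonempty[OF SW_iso(2,3)] by simp
next
  case (SW_switch n Y u v)
  have sw: "Y \<subseteq> E" "u \<noteq> v" "vs n (E - Y) \<inter> vs n Y = {u, v}"
    using SW_switch(1) by (auto simp: switchable_def)
  have "vs (switch Y u v n) E = vs n E"
    using vs_switch[OF SW_switch(1)] vs_switch_disjoint[of "E - Y" Y u v n]
      vs_complement[OF sw(1), of n] vs_complement[OF sw(1), of "switch Y u v n"] by auto
  then have "whitney_switch (mk n E) Y u v = mk (switch Y u v n) E"
    unfolding whitney_switch_def mk_simps by (simp add: mk_def switch_def)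
  then have "graph_iso (whitney_switch (mk n E) Y u v) (mk (switch Y u v n) E)" by (simp add: graph_iso_refl)
  moreover have "(E - Y) \<inter> Y = {}" "(E - Y) \<union> Y = edges (mk n E)" using sw(1) by auto
  ultimately have "two_iso_step (mk n E) (mk (switch Y u v n) E)"
    unfolding two_iso_step_def using graph_mk[OF SW_switch(2)] sw(2,3) restrict_simps(1) mk_simps(3) by metis
  then show ?case by (rule two_iso_eq_step)
next
  case (SW_trans n n' n'')
  have "ends_ok n' E" using SW_preserves[OF SW_trans(1)] SW_trans by blast
  then show ?case using SW_trans two_iso_eq_trans by blast
qed

text \<open>An isolated vertex is a component of its own, so identifying it with any other vertex
  deletes it.\<close>

lemma two_iso_eq_isolated:
  fixes G :: "(nat, 'e) mgraph"
  assumes "graph G" "edges G \<noteq> {}"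
  shows "two_iso_eq G (mk (ends G) (edges G))"
  using assms
proof (induction "card (verts G - vs (ends G) (edges G))" arbitrary: G rule: less_induct)
  case less
  have sub: "vs (ends G) (edges G) \<subseteq> verts G" using graph_vs[OF less.prems(1)] by simp
  show ?case
  proof (cases "verts G = vs (ends G) (edges G)")
    case True
    then have "mk (ends G) (edges G) = G" by (simp add: mk_def)
    then show ?thesis by simp
  next
    case False
    then obtain v where v: "v \<in> verts G" "v \<notin> vs (ends G) (edges G)" using sub by auto
    obtain u where u: "u \<in> vs (ends G) (edges G)"
      using vs_nonempty[OF graph_ends_ok[OF less.prems(1)] less.prems(2)] by auto
    define L where "L = \<lparr>verts = verts G - {v}, edges = edges G, ends = ends G\<rparr>"
    have ve: "v \<notin> ends G e" if "e \<in> edges G" for e using v(2) that by (auto simp: vs_def)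
    have gL: "graph L" using less.prems ve by (auto simp: graph_def L_def)
    have nc: "\<not> same_component G u v"
    proof
      assume "same_component G u v"
      from same_component_closed[OF this u] v(2) show False by (auto simp: vs_def)
    qed
    have id: "(\<lambda>x. if x = v then u else x) ` ends G e = ends G e" if "e \<in> edges G" for e
      using ve[OF that] by (auto simp: image_iff)
    have "graph_iso (identify_vertices G u v) L"
      unfolding graph_iso_def using id by (intro conjI exI[of _ id]) (auto simp: identify_vertices_def L_def)
    moreover have "u \<in> verts G" using u sub by auto
    ultimately have "two_iso_step G L" unfolding two_iso_step_def using less.prems v(1) nc by blast
    then have 1: "two_iso_eq G L" by (rule two_iso_eq_step)
    have "verts L - vs (ends L) (edges L) \<subset> verts G - vs (ends G) (edges G)"
      using v by (auto simp: L_def)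
    moreover have "finite (verts G)" using less.prems by (simp add: graph_def)
    ultimately have "card (verts L - vs (ends L) (edges L)) < card (verts G - vs (ends G) (edges G))"
      by (intro psubset_card_mono) auto
    then have "two_iso_eq L (mk (ends L) (edges L))"
      by (rule less.hyps) (use gL less.prems(2) in \<open>simp_all add: L_def\<close>)
    then show ?thesis using 1 two_iso_eq_trans by (simp add: L_def) blast
  qed
qed

text \<open>Outside \<open>X\<close> the vertex \<open>a\<close> is replaced by a new vertex
  \<open>w\<close>. The operation itself runs in the opposite direction: it identifies
  \<open>a\<close> and \<open>w\<close>, which lie in different components of the split graph, and
  the symmetric closure reverses it.\<close>

lemma split_cutvertex:
  fixes n :: "'e \<Rightarrow> nat set"
  assumes ok: "ends_ok n E" and X: "X \<subseteq> E" "vs n X \<inter> vs n (E - X) = {a}"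
  shows "\<exists>n'. ends_ok n' E \<and> evens n' E = evens n E \<and> two_iso_eq (mk n E) (mk n' E) \<and> card (vs n' E) > card (vs n E)"
proof -
  have finV: "finite (vs n E)" using ok by (rule ends_okD)
  then obtain w :: nat where w: "w \<notin> vs n E" using ex_new_if_finite[OF infinite_UNIV_nat] by blast
  define r where "r x = (if x = a then w else x)" for x
  define n' where "n' e = (if e \<in> E - X then r ` n e else n e)" for e
  have a: "a \<in> vs n X" "a \<in> vs n (E - X)" using X(2) by auto
  have aw: "a \<noteq> w" using a w vs_mono[OF X(1), of n] by auto
  have we: "w \<notin> n e" if "e \<in> E" for e using that w by (auto simp: vs_def)
  have inj: "inj_on r (n e)" if "e \<in> E" for e using we[OF that] by (auto simp: r_def inj_on_def)
  have ok': "ends_ok n' E" using ok inj by (auto simp: ends_ok_def n'_def card_image)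
  have vX: "vs n' X = vs n X" by (rule vs_cong) (auto simp: n'_def)
  have vX': "vs n' (E - X) = insert w (vs n (E - X) - {a})"
  proof -
    have "vs n' (E - X) = r ` vs n (E - X)" by (auto simp: vs_def n'_def)
    also have "\<dots> = insert w (vs n (E - X) - {a})" using a(2) by (auto simp: r_def image_iff)
    finally show ?thesis .
  qed
  have dis: "vs n' X \<inter> vs n' (E - X) = {}"
    unfolding vX vX' using X w vs_mono[OF X(1), of n] by auto
  have wn: "w \<notin> vs n' X" unfolding vX using w vs_mono[OF X(1), of n] by auto
  have mer: "merge a w n' e = n e" if e: "e \<in> E" for e
  proof (cases "e \<in> X")
    case True
    then have "n' e = n e" by (simp add: n'_def)
    then show ?thesis using we[OF e] by (auto simp: merge_def image_iff)
  next
    case False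
    then have "n' e = r ` n e" using e by (simp add: n'_def)
    then have "merge a w n' e = (\<lambda>x. (if r x = w then a else r x)) ` n e"
      by (simp only: merge_def image_image)
    also have "\<dots> = (\<lambda>x. x) ` n e" using we[OF e] by (intro image_cong) (auto simp: r_def)
    finally show ?thesis by simp
  qed
  have ev: "evens n' E = evens n E"
    using evens_merge[OF ok' X(1) dis, of a w] a(1) vX wn evens_cong[of E "merge a w n'" n] mer by simp
  have vE: "vs n' E = insert w (vs n E)"
    using vs_complement[OF X(1), of n'] vs_complement[OF X(1), of n] vX vX' a(1) by auto
  then have "card (vs n' E) > card (vs n E)" using w finV by simp
  have "two_iso_step (mk n' E) (mk n E)"
  proof -
    have nc: "\<not> same_component (mk n' E) a w"
    proof
      assume sc: "same_component (mk n' E) a w"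
      have "w \<in> vs n' X"
      proof (rule same_component_closed[OF sc])
        show "a \<in> vs n' X" using a vX by simp
        show "ends (mk n' E) e \<subseteq> vs n' X" if "e \<in> edges (mk n' E)" "ends (mk n' E) e \<inter> vs n' X \<noteq> {}" for e
          using that dis by (cases "e \<in> X") (auto simp: vs_def)
      qed
      then show False using wn by simp
    qed
    have "graph_iso (identify_vertices (mk n' E) a w) (mk n E)"
      unfolding graph_iso_def using mer vE w
      by (intro conjI exI[of _ id]) (auto simp: identify_vertices_def merge_def)
    moreover have "a \<in> verts (mk n' E)" "w \<in> verts (mk n' E)" using vE a vs_mono[OF X(1), of n] by auto
    ultimately show ?thesis unfolding two_iso_step_def using graph_mk[OF ok'] nc by blast
  qed
  then have "two_iso_eq (mk n E) (mk n' E)" using two_iso_eq_step two_iso_eq_sym by blast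
  then show ?thesis using ok' ev \<open>card (vs n' E) > card (vs n E)\<close> by blast
qed

lemma card_vs_le: "ends_ok n E \<Longrightarrow> card (vs n E) \<le> 2 * card E"
proof -
  assume ok: "ends_ok n E"
  have "card (vs n E) \<le> (\<Sum>e\<in>E. card (n e))"
    unfolding vs_def by (rule card_UN_le) (rule ends_okD(1)[OF ok])
  also have "\<dots> \<le> (\<Sum>e\<in>E. 2)" using ends_okD(2)[OF ok] by (intro sum_mono) force
  finally show ?thesis by simp
qed

text \<open>Every split adds a vertex, and a graph without isolated vertices has at most twice as
  many vertices as edges.\<close>

lemma two_iso_eq_no_cutvertex:
  fixes n :: "'e \<Rightarrow> nat set"
  assumes ok: "ends_ok n E" and ne: "E \<noteq> {}"
  shows "\<exists>n'. ends_ok n' E \<and> evens n' E = evens n E \<and> two_iso_eq (mk n E) (mk n' E) \<and> no_cutvertex n' E"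
  using ok
proof (induction "2 * card E - card (vs n E)" arbitrary: n rule: less_induct)
  case less
  show ?case
  proof (cases "no_cutvertex n E")
    case True
    then show ?thesis using less.prems by (intro exI[of _ n]) simp
  next
    case False
    then obtain X where X: "X \<subseteq> E" "card (vs n X \<inter> vs n (E - X)) = 1" by (auto simp: no_cutvertex_def)
    then obtain a where "vs n X \<inter> vs n (E - X) = {a}" by (auto simp: card_1_singleton_iff)
    from split_cutvertex[OF less.prems X(1) this] obtain n' where n': "ends_ok n' E" "evens n' E = evens n E"
      "two_iso_eq (mk n E) (mk n' E)" "card (vs n' E) > card (vs n E)" by blast
    have "2 * card E - card (vs n' E) < 2 * card E - card (vs n E)" using n'(4) card_vs_le[OF n'(1)] by linarith
    from less.hyps[OF this n'(1)] obtain n'' where "ends_ok n'' E" "evens n'' E = evens n' E"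
      "two_iso_eq (mk n' E) (mk n'' E)" "no_cutvertex n'' E" by blast
    then show ?thesis using n' two_iso_eq_trans by metis
  qed
qed

lemma nat_copy:
  assumes G: "graph G"
  shows "\<exists>K :: (nat, 'e) mgraph. graph K \<and> graph_iso G K \<and> graph_iso K G \<and> iso (edges G) (ends G) (ends K)"
proof -
  have "finite (verts G)" using G by (simp add: graph_def)
  then obtain f :: "'a \<Rightarrow> nat" where f: "inj_on f (verts G)" using finite_imp_inj_to_nat_seg by metis
  define K where "K = \<lparr>verts = f ` verts G, edges = edges G, ends = (\<lambda>e. f ` ends G e)\<rparr>"
  have sub: "ends G e \<subseteq> verts G" if "e \<in> edges G" for e using G that by (auto simp: graph_def)
  have c: "card (f ` ends G e) = card (ends G e)" if "e \<in> edges G" for e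
    using card_image[OF inj_on_subset[OF f sub[OF that]]] .
  have "graph K"
    using G c sub unfolding graph_def K_def by (auto intro!: image_mono)
  moreover have "graph_iso G K"
    unfolding graph_iso_def using f by (intro conjI exI[of _ f]) (auto simp: K_def bij_betw_def)
  moreover have "graph_iso K G"
    unfolding graph_iso_def
  proof (intro conjI exI[of _ "inv_into (verts G) f"] ballI)
    show "bij_betw (inv_into (verts G) f) (verts K) (verts G)"
      using bij_betw_inv_into[of f "verts G" "f ` verts G"] f by (simp add: K_def bij_betw_def)
    show "ends G e = inv_into (verts G) f ` ends K e" if "e \<in> edges K" for e
      using inv_into_image_cancel[OF f sub[of e]] that by (simp add: K_def)
  qed (simp add: K_def)
  moreover have "iso (edges G) (ends G) (ends K)"
    unfolding iso_def using inj_on_subset[OF f graph_vs[OF G order_refl]] by (auto simp: K_def)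
  ultimately show ?thesis by blast
qed

text \<open>Both graphs are copied to natural numbers as vertices, freed of isolated vertices and
  split at all cut vertices; what is left to compare differs by switchings.\<close>

theorem two_isomorphicI:
  fixes G :: "('v, 'e) mgraph" and H :: "('w, 'e) mgraph"
  assumes G: "graph G" and H: "graph H" and E: "edges G = E" "edges H = E" "E \<noteq> {}"
    and ev: "evens (ends G) E = evens (ends H) E"
  shows "two_isomorphic G H"
proof -
  obtain K :: "(nat, 'e) mgraph" where K: "graph K" "graph_iso G K" "iso E (ends G) (ends K)"
    using nat_copy[OF G] E(1) by metis
  obtain L :: "(nat, 'e) mgraph" where L: "graph L" "graph_iso L H" "iso E (ends H) (ends L)"
    using nat_copy[OF H] E(2) by metis
  have ed: "edges K = E" "edges L = E" using K(2) L(2) E by (auto simp: graph_iso_def)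
  have okK: "ends_ok (ends K) E" and okL: "ends_ok (ends L) E"
    using graph_ends_ok[OF K(1)] graph_ends_ok[OF L(1)] ed by auto
  have evs: "evens (ends K) E = evens (ends L) E"
    using iso_evens[OF K(3)] iso_evens[OF L(3)] ev by simp
  obtain k where k: "ends_ok k E" "evens k E = evens (ends K) E" "two_iso_eq (mk (ends K) E) (mk k E)" "no_cutvertex k E"
    using two_iso_eq_no_cutvertex[OF okK E(3)] by blast
  obtain l where l: "ends_ok l E" "evens l E = evens (ends L) E" "two_iso_eq (mk (ends L) E) (mk l E)" "no_cutvertex l E"
    using two_iso_eq_no_cutvertex[OF okL E(3)] by blast
  have "SW E k l" by (rule SW_no_cutvertex) (use k l evs in auto)
  then have kl: "two_iso_eq (mk k E) (mk l E)" using SW_two_iso_eq k(1) E(3) by blast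
  have "two_iso_eq K (mk (ends K) E)" "two_iso_eq L (mk (ends L) E)"
    using two_iso_eq_isolated[OF K(1)] two_iso_eq_isolated[OF L(1)] ed E(3) by auto
  then have "two_iso_eq K L" using k(3) l(3) kl two_iso_eq_sym two_iso_eq_trans by meson
  then show ?thesis unfolding two_isomorphic_def using K(2) L(2) by blast
qed

section \<open>Cycles as minimal even sets\<close>

text \<open>In \<open>degree\<close> a loop counts twice and any other edge once, so degree two
  leaves an even number of edges in the star.\<close>

lemma cycle_in_evens:
  assumes G: "graph G" and C: "is_cycle G C"
  shows "C \<in> evens (ends G) (edges G) \<and> C \<noteq> {}"
proof -
  let ?n = "ends G"
  have CE: "C \<subseteq> edges G" and d: "\<And>v. v \<in> vs ?n C \<Longrightarrow> degree (G \<restriction> C) v = 2" and ne: "vs ?n C \<noteq> {}"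
    using C by (auto simp: is_cycle_def connected_graph_def)
  have finC: "finite C" using CE G finite_subset by (auto simp: graph_def)
  have card12: "card (?n e) = 1 \<or> card (?n e) = 2" if "e \<in> C" for e using G CE that by (auto simp: graph_def)
  have "even (card (star ?n C v))" if v: "v \<in> vs ?n C" for v
  proof -
    have "?n e = {v} \<or> card (?n e) = 2" if "e \<in> C" "v \<in> ?n e" for e
      using card12[OF that(1)] that(2) by (auto simp: card_1_singleton_iff)
    then have split: "{e \<in> C. v \<in> ?n e} = star ?n C v \<union> {e \<in> C. ?n e = {v}}"
      by (auto simp: star_def)
    have "card {e \<in> C. v \<in> ?n e} = card (star ?n C v) + card {e \<in> C. ?n e = {v}}"
      unfolding split by (rule card_Un_disjoint) (use finC in \<open>auto simp: star_def\<close>)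
    then have "card (star ?n C v) + 2 * card {e \<in> C. ?n e = {v}} = 2"
      using d[OF v] by (simp add: degree_def)
    then have "even (card (star ?n C v) + 2 * card {e \<in> C. ?n e = {v}})" by simp
    then show ?thesis by simp
  qed
  then have "bd ?n C = {}" using bd_subset[of ?n C] by (auto simp: bd_def)
  then show ?thesis using CE ne by (auto simp: evens_def)
qed

lemma conn_connected_graph:
  assumes ok: "ends_ok (ends G) X" and c: "conn (ends G) X" and ne: "X \<noteq> {}"
  shows "connected_graph (G \<restriction> X)"
proof -
  let ?n = "ends G" and ?H = "G \<restriction> X"
  have "(adjacent ?H)\<^sup>*\<^sup>* u v" if u: "u \<in> vs ?n X" and v: "v \<in> vs ?n X" for u v
  proof -
    define S where "S = {w. (adjacent ?H)\<^sup>*\<^sup>* u w}"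
    have closed: "?n e \<subseteq> S" if e: "e \<in> X" "?n e \<inter> S \<noteq> {}" for e
    proof
      fix y assume y: "y \<in> ?n e"
      obtain x where x: "x \<in> ?n e" "x \<in> S" using e by auto
      show "y \<in> S"
      proof (cases "x = y")
        case False
        then have "?n e = {x, y}"
          using x(1) y ends_okD(2,3)[OF ok e(1)] card_seteq[of "?n e" "{x, y}"] by auto
        then have "adjacent ?H x y" using e(1) by (auto simp: adjacent_def)
        then show ?thesis using x(2) by (auto simp: S_def intro: rtranclp.rtrancl_into_rtrancl)
      qed (use x in simp)
    qed
    define Y where "Y = {e \<in> X. ?n e \<subseteq> S}"
    have "vs ?n Y \<inter> vs ?n (X - Y) = {}" using closed by (fastforce simp: vs_def Y_def)
    moreover have "Y \<noteq> {}"
    proof -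
      obtain e where e: "e \<in> X" "u \<in> ?n e" using u by (auto simp: vs_def)
      moreover have "u \<in> S" by (simp add: S_def)
      ultimately have "e \<in> Y" using closed[of e] by (auto simp: Y_def)
      then show ?thesis by auto
    qed
    moreover have "Y \<subseteq> X" by (auto simp: Y_def)
    ultimately have "Y = X" using c unfolding conn_def by blast
    then have "v \<in> S" using v by (auto simp: vs_def Y_def)
    then show ?thesis by (simp add: S_def)
  qed
  then show ?thesis using vs_nonempty[OF ok ne] by (simp add: connected_graph_def same_component_def)
qed

text \<open>Components of an even set are even, so a minimal one is connected. With itself and the
  empty set as its only even subsets it has as many vertices as edges, and then degrees that are
  even and positive must all be two. A loop is an even set by itself and is treated apart, since
  stars omit loops.\<close>

lemma minimal_even_is_cycle:
  assumes ok: "ends_ok (ends G) (edges G)" and X: "X \<in> evens (ends G) (edges G)" "X \<noteq> {}"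
    and min: "\<And>Y. Y \<in> evens (ends G) (edges G) \<Longrightarrow> Y \<subset> X \<Longrightarrow> Y = {}"
  shows "is_cycle G X"
proof -
  let ?n = "ends G"
  have XE: "X \<subseteq> edges G" "bd ?n X = {}" using X by (auto simp: evens_def)
  have okX: "ends_ok ?n X" using ends_ok_subset[OF ok XE(1)] .
  have finX: "finite X" and finV: "finite (vs ?n X)" using ends_okD(1,5)[OF okX] .
  have "evens ?n X = {{}, X}"
  proof -
    have "Y = {} \<or> Y = X" if "Y \<in> evens ?n X" for Y
    proof -
      have "Y \<in> evens ?n (edges G)" "Y \<subseteq> X" using that XE by (auto simp: evens_def)
      then show ?thesis using min[of Y] by blast
    qed
    then show ?thesis using XE by (auto simp: evens_def)
  qed
  then have cev: "card (evens ?n X) = 2" using X(2) by simp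
  have cn: "conn ?n X"
    unfolding conn_def
  proof (intro allI impI)
    fix Y assume Y: "Y \<subseteq> X" "vs ?n Y \<inter> vs ?n (X - Y) = {}"
    have "bd ?n (X \<inter> Y) \<subseteq> bd ?n X" by (rule bd_Int_component[OF Y(2) order_refl])
    moreover have "X \<inter> Y = Y" using Y by auto
    ultimately have "bd ?n Y = {}" using XE(2) by simp
    then have "Y \<in> evens ?n (edges G)" using Y XE by (auto simp: evens_def)
    then show "Y = {} \<or> Y = X" using min[of Y] Y by blast
  qed
  have deg: "degree (G \<restriction> X) v = 2" if v: "v \<in> vs ?n X" for v
  proof (cases "\<exists>e\<in>X. card (?n e) = 1")
    case True
    then obtain e where e: "e \<in> X" "card (?n e) = 1" by auto
    then have "bd ?n {e} = {}" by (simp add: bd_single)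
    then have "{e} \<in> evens ?n (edges G)" using e XE by (auto simp: evens_def)
    then have Xe: "X = {e}" using min[of "{e}"] e by blast
    obtain w where w: "?n e = {w}" using e by (auto simp: card_1_singleton_iff)
    then have "v = w" using v Xe by (auto simp: vs_def)
    then have "{f \<in> X. v \<in> ?n f} = {e}" "{f \<in> X. ?n f = {v}} = {e}" using Xe w by auto
    then show ?thesis by (simp add: degree_def)
  next
    case False
    then have two: "card (?n e) = 2" if "e \<in> X" for e using ends_okD(2)[OF okX that] that by auto
    have loops: "{e \<in> X. ?n e = {w}} = {}" for w
    proof -
      have "?n e \<noteq> {w}" if "e \<in> X" for e using two[OF that] by auto
      then show ?thesis by auto
    qed
    have st: "star ?n X w = {e \<in> X. w \<in> ?n e}" for w using two by (auto simp: star_def)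
    have "2 * 2 ^ (card (vs ?n X) - 1) = (2::nat) ^ card X" using card_evens[OF okX cn X(2)] cev by simp
    moreover have pos: "card (vs ?n X) \<ge> 1" using finV vs_nonempty[OF okX X(2)] by (simp add: Suc_le_eq card_gt_0_iff)
    ultimately have "(2::nat) ^ card (vs ?n X) = 2 ^ card X" by (metis Suc_diff_1 One_nat_def Suc_le_eq power_Suc)
    then have cV: "card (vs ?n X) = card X" by simp
    have ge: "2 \<le> card (star ?n X w)" if "w \<in> vs ?n X" for w
    proof -
      have "even (card (star ?n X w))" using XE(2) by (auto simp: bd_def)
      moreover have "star ?n X w \<noteq> {}" using that by (auto simp: st vs_def)
      then have "card (star ?n X w) \<noteq> 0" using finite_star[OF finX, of ?n w] by simp
      ultimately show ?thesis by (cases "card (star ?n X w) = 1") auto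
    qed
    have "{e \<in> X. card (?n e) = 2} = X" using two by auto
    then have "(\<Sum>w\<in>vs ?n X. card (star ?n X w)) = 2 * card X" using sum_card_star[OF okX] by simp
    also have "\<dots> = (\<Sum>w\<in>vs ?n X. 2)" using cV by simp
    finally have "\<forall>w\<in>vs ?n X. 2 = card (star ?n X w)"
      using sum_mono_inv[of "\<lambda>_. 2" "vs ?n X" "\<lambda>w. card (star ?n X w)"] ge finV by metis
    then have "card (star ?n X v) = 2" using v by simp
    then show ?thesis unfolding degree_def restrict_simps loops[of v] st[of v] by simp
  qed
  show ?thesis
    unfolding is_cycle_def using XE(1) conn_connected_graph[OF okX cn X(2)] deg by simp
qed

text \<open>A smallest even subset of \<open>Z\<close> through \<open>e\<close> is a minimal even
  set altogether: an even proper subset or its complement would contain \<open>e\<close>.\<close>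

lemma even_contains_cycle:
  assumes ok: "ends_ok (ends G) (edges G)" and Z: "Z \<in> evens (ends G) (edges G)" and e: "e \<in> Z"
  shows "\<exists>C. is_cycle G C \<and> C \<subseteq> Z \<and> e \<in> C"
proof -
  let ?F = "evens (ends G) (edges G)"
  have sp: "binary_space (edges G) ?F" by (rule binary_space_evens[OF ok])
  define P where "P C \<longleftrightarrow> C \<in> ?F \<and> C \<subseteq> Z \<and> e \<in> C" for C
  have "P Z" using Z e by (simp add: P_def)
  then obtain C where C: "P C" and min: "\<And>C'. P C' \<Longrightarrow> card C \<le> card C'"
    using ex_has_least_nat[of P Z card] by blast
  have CF: "C \<in> ?F" "C \<subseteq> Z" "e \<in> C" using C by (auto simp: P_def)
  have finC: "finite C" using binary_spaceD(6)[OF sp CF(1)] .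
  have "is_cycle G C"
  proof (rule minimal_even_is_cycle[OF ok CF(1)])
    show "C \<noteq> {}" using CF(3) by auto
    show "Y = {}" if Y: "Y \<in> ?F" "Y \<subset> C" for Y
    proof (rule ccontr)
      assume "Y \<noteq> {}"
      have lt: "card W < card C" if "W \<subset> C" for W using psubset_card_mono[OF finC that] .
      have notP: "\<not> P W" if "W \<subset> C" for W using min[of W] lt[OF that] by auto
      have "sym_diff C Y \<in> ?F" using binary_spaceD(4)[OF sp CF(1) Y(1)] .
      moreover have "sym_diff C Y = C - Y" using Y(2) by auto
      ultimately have "C - Y \<in> ?F" by simp
      moreover have "C - Y \<subset> C" using Y(2) \<open>Y \<noteq> {}\<close> by auto
      ultimately show False using notP[of Y] notP[of "C - Y"] Y CF by (auto simp: P_def)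
    qed
  qed
  then show ?thesis using CF by blast
qed

section \<open>Lift matroids and series classes\<close>

lemma is_cycle_subgraph:
  assumes "subgraph H G"
  shows "is_cycle H C \<longleftrightarrow> is_cycle G C \<and> C \<subseteq> edges H"
proof -
  have "H \<restriction> C = G \<restriction> C" using assms by (simp add: edge_restrict_def subgraph_def)
  moreover have "edges H \<subseteq> edges G" using assms by (simp add: subgraph_def)
  ultimately show ?thesis by (auto simp: is_cycle_def)
qed

text \<open>If \<open>C\<close> were the only cycle inside \<open>X\<close>, every nonempty even
  subset of \<open>X\<close> would contain \<open>C\<close>, and subtracting \<open>C\<close> would
  leave an even set without cycles, that is, the empty one. This allows two even subsets
  only.\<close>

lemma two_cycles_iff_card:
  assumes G: "graph G"
  shows "(\<exists>C D. is_cycle G C \<and> is_cycle G D \<and> C \<noteq> D \<and> C \<subseteq> X \<and> D \<subseteq> X) \<longleftrightarrow>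
    card (members_in (evens (ends G) (edges G)) X) \<ge> 4"
proof
  let ?F = "evens (ends G) (edges G)"
  have sp: "binary_space (edges G) ?F" by (rule binary_space_evens[OF graph_ends_ok[OF G]])
  {
    assume "\<exists>C D. is_cycle G C \<and> is_cycle G D \<and> C \<noteq> D \<and> C \<subseteq> X \<and> D \<subseteq> X"
    then show "card (members_in ?F X) \<ge> 4"
      using card_members_in_ge4[OF sp] cycle_in_evens[OF G] by metis
  }
  assume c: "card (members_in ?F X) \<ge> 4"
  show "\<exists>C D. is_cycle G C \<and> is_cycle G D \<and> C \<noteq> D \<and> C \<subseteq> X \<and> D \<subseteq> X"
  proof (rule ccontr)
    assume neg: "\<not> ?thesis"
    have cyc: "\<exists>C. is_cycle G C \<and> C \<subseteq> Z \<and> e \<in> C" if "Z \<in> ?F" "e \<in> Z" for Z e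
      using even_contains_cycle[OF graph_ends_ok[OF G]] that by blast
    have "\<not> members_in ?F X \<subseteq> {{}}"
    proof
      assume "members_in ?F X \<subseteq> {{}}"
      then have "card (members_in ?F X) \<le> card {{} :: 'b set}" by (intro card_mono) auto
      then show False using c by simp
    qed
    then obtain A where A: "A \<in> ?F" "A \<subseteq> X" "A \<noteq> {}" by (auto simp: members_in_def)
    then obtain a where "a \<in> A" by auto
    then obtain C where C: "is_cycle G C" "C \<subseteq> A" using cyc[OF A(1)] by blast
    have CF: "C \<in> ?F" "C \<noteq> {}" using cycle_in_evens[OF G C(1)] by auto
    have only: "D = C" if "is_cycle G D" "D \<subseteq> X" for D using neg that C A by blast
    have "Z = {} \<or> Z = C" if Z: "Z \<in> ?F" "Z \<subseteq> X" for Z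
    proof (rule ccontr)
      assume *: "\<not> ?thesis"
      then obtain z where "z \<in> Z" by auto
      then obtain D where D: "is_cycle G D" "D \<subseteq> Z" using cyc[OF Z(1)] by blast
      then have CZ: "C \<subseteq> Z" using only[of D] Z(2) by auto
      then have "sym_diff Z C = Z - C" by auto
      then have ZC: "Z - C \<in> ?F" using binary_spaceD(4)[OF sp Z(1) CF(1)] by simp
      obtain z' where "z' \<in> Z - C" using * CZ by auto
      then obtain D' where "is_cycle G D'" "D' \<subseteq> Z - C" "z' \<in> D'" using cyc[OF ZC] by blast
      then show False using only[of D'] Z(2) by auto
    qed
    then have "members_in ?F X \<subseteq> {{}, C}" by (auto simp: members_in_def)
    then have "card (members_in ?F X) \<le> card {{}, C}" by (intro card_mono) auto
    also have "\<dots> \<le> 2" by (simp add: card_insert_if)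
    finally show False using c by simp
  qed
qed

lemma circuit_in:
  assumes G: "graph G" and C: "C \<in> circuits (bicircular_lift G)"
  shows "C \<subseteq> edges G \<and> card (members_in (evens (ends G) (edges G)) C) \<ge> 4"
proof -
  obtain H where H: "C = edges H" "subgraph H G" "has_two_cycles H"
    using C by (auto simp: bicircular_lift_def)
  then obtain A B where "is_cycle H A" "is_cycle H B" "A \<noteq> B" by (auto simp: has_two_cycles_def)
  then have "\<exists>A B. is_cycle G A \<and> is_cycle G B \<and> A \<noteq> B \<and> A \<subseteq> C \<and> B \<subseteq> C"
    using is_cycle_subgraph[OF H(2)] H(1) by blast
  then show ?thesis using two_cycles_iff_card[OF G] H by (simp add: subgraph_def)
qed

text \<open>A smallest edge set \<open>Y\<close> with four even subsets yields the circuit, as the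
  edge set of \<open>G \<restriction> Y\<close>. Dropping isolated vertices matters here, because
  minimality of subgraphs refers to vertices as well as to edges.\<close>

lemma card_ge4_iff_circuit:
  assumes G: "graph G" and X: "X \<subseteq> edges G"
  shows "card (members_in (evens (ends G) (edges G)) X) \<ge> 4 \<longleftrightarrow> (\<exists>C\<in>circuits (bicircular_lift G). C \<subseteq> X)"
proof
  let ?F = "evens (ends G) (edges G)"
  have sp: "binary_space (edges G) ?F" by (rule binary_space_evens[OF graph_ends_ok[OF G]])
  {
    assume "\<exists>C\<in>circuits (bicircular_lift G). C \<subseteq> X"
    then show "card (members_in ?F X) \<ge> 4"
      using circuit_in[OF G] card_members_in_mono[OF sp] by (meson le_trans)
  }
  assume c: "card (members_in ?F X) \<ge> 4"
  define P where "P Y \<longleftrightarrow> Y \<subseteq> X \<and> card (members_in ?F Y) \<ge> 4" for Y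
  have "P X" using c by (simp add: P_def)
  then obtain Y where Y: "P Y" and min: "\<And>Y'. P Y' \<Longrightarrow> card Y \<le> card Y'"
    using ex_has_least_nat[of P X card] by blast
  have YE: "Y \<subseteq> edges G" "card (members_in ?F Y) \<ge> 4" using Y X by (auto simp: P_def)
  have finY: "finite Y" using YE(1) G finite_subset by (auto simp: graph_def)
  have sub: "subgraph (G \<restriction> Y) G"
    using graph_vs[OF G YE(1)] YE(1) by (auto simp: subgraph_def vs_def)
  have iff: "has_two_cycles K \<longleftrightarrow> card (members_in ?F (edges K)) \<ge> 4" if "subgraph K G" for K
    using two_cycles_iff_card[OF G, of "edges K"] is_cycle_subgraph[OF that] by (auto simp: has_two_cycles_def)
  have "K = G \<restriction> Y" if K: "subgraph K (G \<restriction> Y)" "has_two_cycles K" for K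
  proof -
    have Kf: "ends K = ends G" "edges K \<subseteq> Y" "verts K \<subseteq> vs (ends G) Y" "\<forall>e\<in>edges K. ends K e \<subseteq> verts K"
      using K(1) unfolding subgraph_def restrict_simps by blast+
    have KG: "subgraph K G"
      using K(1) sub unfolding subgraph_def by (metis (no_types, lifting) subset_trans)
    have "P (edges K)" using iff[OF KG] K(2) Y Kf(2) by (auto simp: P_def)
    then have eK: "edges K = Y" using min[of "edges K"] card_seteq[OF finY Kf(2)] by simp
    have "vs (ends G) Y \<subseteq> verts K" using Kf(1,4) eK unfolding vs_def by auto
    then show ?thesis using Kf(1,3) eK by (intro mgraph.equality) simp_all
  qed
  then have "Y \<in> circuits (bicircular_lift G)"
    unfolding bicircular_lift_def using sub iff[OF sub] YE(2) by (auto intro!: exI[of _ "G \<restriction> Y"])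
  then show "\<exists>C\<in>circuits (bicircular_lift G). C \<subseteq> X" using Y by (auto simp: P_def)
qed

definition covers :: "'e set \<Rightarrow> 'e set set \<Rightarrow> bool" where
  "covers E \<F> \<longleftrightarrow> (\<forall>e\<in>E. \<exists>Z\<in>\<F>. e \<in> Z)"

text \<open>A set of edges has at least four even subsets exactly when it contains two cycles.\<close>

definition agree :: "'e set \<Rightarrow> 'e set set \<Rightarrow> 'e set set \<Rightarrow> bool" where
  "agree E \<F>\<^sub>1 \<F>\<^sub>2 \<longleftrightarrow> (\<forall>X\<subseteq>E. card (members_in \<F>\<^sub>1 X) \<ge> 4 \<or> card (members_in \<F>\<^sub>2 X) \<ge> 4 \<longrightarrow>
      card (members_in \<F>\<^sub>1 X) = card (members_in \<F>\<^sub>2 X))"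

lemma agree_sym: "agree E \<F>\<^sub>1 \<F>\<^sub>2 \<Longrightarrow> agree E \<F>\<^sub>2 \<F>\<^sub>1"
  unfolding agree_def by metis

lemma card_members_in_half:
  assumes "binary_space E \<F>" "covers E \<F>" "e \<in> E"
  shows "card (members_in \<F> E) = 2 * card (members_in \<F> (E - {e}))"
  using assms card_members_in_halve binary_spaceD(5)[OF assms(1)] unfolding covers_def by metis

lemma lift_spaces:
  assumes G: "graph G\<^sub>1" "graph G\<^sub>2" and tec: "two_edge_connected G\<^sub>1"
    and two: "\<exists>C\<in>circuits (bicircular_lift G\<^sub>1). \<exists>D\<in>circuits (bicircular_lift G\<^sub>1). C \<noteq> D"
    and eq: "bicircular_lift G\<^sub>1 = bicircular_lift G\<^sub>2"
    and E: "E = edges G\<^sub>1" and F: "\<F>\<^sub>1 = evens (ends G\<^sub>1) E" "\<F>\<^sub>2 = evens (ends G\<^sub>2) E"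
  shows "edges G\<^sub>2 = E" "agree E \<F>\<^sub>1 \<F>\<^sub>2" "covers E \<F>\<^sub>1" "covers E \<F>\<^sub>2" "\<exists>k\<ge>3. card (members_in \<F>\<^sub>1 E) = 2 ^ k"
proof -
  have "ground (bicircular_lift G\<^sub>1) = ground (bicircular_lift G\<^sub>2)" using eq by simp
  then show E2: "edges G\<^sub>2 = E" using E by (simp add: bicircular_lift_def)
  have sp1: "binary_space E \<F>\<^sub>1" using binary_space_evens[OF graph_ends_ok[OF G(1)]] E F by simp
  have sp2: "binary_space E \<F>\<^sub>2" using binary_space_evens[OF graph_ends_ok[OF G(2)]] E2 F by simp
  have iff: "card (members_in \<F>\<^sub>1 X) \<ge> 4 \<longleftrightarrow> card (members_in \<F>\<^sub>2 X) \<ge> 4" if "X \<subseteq> E" for X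
    using card_ge4_iff_circuit[OF G(1), of X] card_ge4_iff_circuit[OF G(2), of X] that E E2 F eq by simp
  show ag: "agree E \<F>\<^sub>1 \<F>\<^sub>2"
    unfolding agree_def using card_members_in_agree[OF sp1 sp2 iff] iff by blast
  show cov1: "covers E \<F>\<^sub>1"
    using tec cycle_in_evens[OF G(1)] E F unfolding covers_def two_edge_connected_def by blast
  obtain C D where CD: "C \<in> circuits (bicircular_lift G\<^sub>1)" "D \<in> circuits (bicircular_lift G\<^sub>1)" "C \<noteq> D"
    using two by blast
  have ci: "C \<subseteq> E" "card (members_in \<F>\<^sub>1 C) \<ge> 4" "D \<subseteq> E" "card (members_in \<F>\<^sub>1 D) \<ge> 4"
    using circuit_in[OF G(1) CD(1)] circuit_in[OF G(1) CD(2)] E F by auto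
  \<comment> \<open>Of two distinct circuits one misses an edge \<open>e\<close> of the other, so
    four even sets survive the deletion of \<open>e\<close>. As \<open>e\<close> lies on a cycle,
    there are eight in all.\<close>
  then obtain W e where W: "e \<in> E" "W \<subseteq> E - {e}" "card (members_in \<F>\<^sub>1 W) \<ge> 4" using CD(3) by blast
  then have "card (members_in \<F>\<^sub>1 (E - {e})) \<ge> 4" using card_members_in_mono[OF sp1 W(2)] by linarith
  then have ge8: "card (members_in \<F>\<^sub>1 E) \<ge> 8" using card_members_in_half[OF sp1 cov1 W(1)] by simp
  obtain k where k: "card (members_in \<F>\<^sub>1 E) = 2 ^ k" using card_members_in_power[OF sp1] by blast
  have "k \<ge> 3"
  proof (rule ccontr)
    assume "\<not> k \<ge> 3"
    then have "(2::nat) ^ k \<le> 2 ^ 2" by (intro power_increasing) auto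
    then show False using ge8 k by simp
  qed
  then show "\<exists>k\<ge>3. card (members_in \<F>\<^sub>1 E) = 2 ^ k" using k by blast
  show "covers E \<F>\<^sub>2"
    unfolding covers_def
  proof (rule ballI, rule ccontr)
    fix e assume e: "e \<in> E" "\<not> (\<exists>Z\<in>\<F>\<^sub>2. e \<in> Z)"
    \<comment> \<open>Four members survive the deletion of \<open>e\<close> in the first space, so
      both spaces have equal counts with \<open>e\<close> and without it. The count halves in the
      first space, and hence in the second.\<close>
    have h: "card (members_in \<F>\<^sub>1 (E - {e})) \<ge> 4" using card_members_in_half[OF sp1 cov1 e(1)] ge8 by simp
    have "card (members_in \<F>\<^sub>1 (E - {e})) = card (members_in \<F>\<^sub>2 (E - {e}))"
      "card (members_in \<F>\<^sub>1 E) = card (members_in \<F>\<^sub>2 E)"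
      using ag[unfolded agree_def, rule_format, of "E - {e}"] ag[unfolded agree_def, rule_format, of E] h ge8 by auto
    then have "card (members_in \<F>\<^sub>2 (E - {e})) < card (members_in \<F>\<^sub>2 E)"
      using card_members_in_half[OF sp1 cov1 e(1)] h by linarith
    moreover have "members_in \<F>\<^sub>2 (E - {e}) = members_in \<F>\<^sub>2 E" using e(2) by (intro members_in_remove) blast
    ultimately show False by simp
  qed
qed

section \<open>Series classes and skeletons\<close>

definition series :: "'e set set \<Rightarrow> 'e \<Rightarrow> 'e \<Rightarrow> bool" where
  "series \<F> e f \<longleftrightarrow> (\<forall>Z\<in>\<F>. e \<in> Z \<longleftrightarrow> f \<in> Z)"

text \<open>One implication suffices: if \<open>Z\<close> contained \<open>e\<close> but not
  \<open>f\<close>, adding a member through \<open>f\<close>, which then contains \<open>e\<close>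
  as well, would produce a member through \<open>f\<close> avoiding \<open>e\<close>.\<close>

lemma series_iff:
  assumes sp: "binary_space E \<F>" and cov: "covers E \<F>" and e: "e \<in> E" "f \<in> E"
  shows "series \<F> e f \<longleftrightarrow> (\<forall>Z\<in>\<F>. f \<in> Z \<longrightarrow> e \<in> Z)"
proof
  assume *: "\<forall>Z\<in>\<F>. f \<in> Z \<longrightarrow> e \<in> Z"
  show "series \<F> e f"
    unfolding series_def
  proof (intro ballI iffI)
    fix Z assume Z: "Z \<in> \<F>" "e \<in> Z"
    obtain W where W: "W \<in> \<F>" "f \<in> W" using cov e by (auto simp: covers_def)
    then have "e \<in> W" using * by blast
    show "f \<in> Z"
    proof (rule ccontr)
      assume "f \<notin> Z"
      then have "f \<in> sym_diff Z W" "e \<notin> sym_diff Z W" using W(2) Z(2) \<open>e \<in> W\<close> by auto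
      then show False using bspec[OF *, OF binary_spaceD(4)[OF sp Z(1) W(1)]] by argo
    qed
  qed (use * in blast)
qed (auto simp: series_def)

text \<open>Being in series with \<open>e\<close> means lying on no member that avoids
  \<open>e\<close>, so deleting \<open>f\<close> after \<open>e\<close> does not change the count.
  With eight members in all, four are left after the deletion of \<open>e\<close>, and the other
  space has to show the same.\<close>

lemma series_agree:
  assumes sp: "binary_space E \<F>\<^sub>1" "binary_space E \<F>\<^sub>2" and cov: "covers E \<F>\<^sub>1" "covers E \<F>\<^sub>2"
    and ag: "agree E \<F>\<^sub>1 \<F>\<^sub>2" and c: "card (members_in \<F>\<^sub>1 E) \<ge> 8" and e: "e \<in> E" "f \<in> E" and s: "series \<F>\<^sub>1 e f"
  shows "series \<F>\<^sub>2 e f"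
proof (rule ccontr)
  assume "\<not> series \<F>\<^sub>2 e f"
  then have "\<not> (\<forall>Z\<in>\<F>\<^sub>2. f \<in> Z \<longrightarrow> e \<in> Z)" using series_iff[OF sp(2) cov(2) e] by simp
  then obtain Z where Z: "Z \<in> \<F>\<^sub>2" "f \<in> Z" "e \<notin> Z" by auto
  have c1: "card (members_in \<F>\<^sub>1 (E - {e})) \<ge> 4" using card_members_in_half[OF sp(1) cov(1) e(1)] c by simp
  have eq1: "members_in \<F>\<^sub>1 (E - {e} - {f}) = members_in \<F>\<^sub>1 (E - {e})"
    using s by (intro members_in_remove) (auto simp: series_def)
  have "card (members_in \<F>\<^sub>2 (E - {e} - {f})) = card (members_in \<F>\<^sub>2 (E - {e}))"
  proof -
    have "E - {e} \<subseteq> E" "E - {e} - {f} \<subseteq> E" by auto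
    then have "card (members_in \<F>\<^sub>1 (E - {e})) = card (members_in \<F>\<^sub>2 (E - {e}))"
      "card (members_in \<F>\<^sub>1 (E - {e} - {f})) = card (members_in \<F>\<^sub>2 (E - {e} - {f}))"
      using ag[unfolded agree_def, rule_format, of "E - {e}"] ag[unfolded agree_def, rule_format, of "E - {e} - {f}"]
        c1 eq1 by auto
    then show ?thesis using eq1 by simp
  qed
  moreover have "card (members_in \<F>\<^sub>2 (E - {e})) = 2 * card (members_in \<F>\<^sub>2 (E - {e} - {f}))"
    by (rule card_members_in_halve[OF sp(2) Z(1)]) (use Z binary_spaceD(5)[OF sp(2) Z(1)] in auto)
  ultimately show False using card_members_in_pos[OF sp(2), of "E - {e}"] by simp
qed

text \<open>Neither bridges nor series pairs: every nonempty cut has at least three edges.\<close>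

definition cosimple :: "'e set \<Rightarrow> 'e set set \<Rightarrow> bool" where
  "cosimple E \<F> \<longleftrightarrow> (\<forall>D\<subseteq>E. D \<noteq> {} \<longrightarrow> cocycle \<F> D \<longrightarrow> card D \<ge> 3)"

definition blow_up :: "('e \<Rightarrow> 'e set) \<Rightarrow> 'e set set \<Rightarrow> 'e set set" where
  "blow_up P \<G> = (\<lambda>Y. \<Union> (P ` Y)) ` \<G>"

text \<open>The elements of \<open>R\<close> represent the classes and are at the same time the
  edges of the skeleton, so skeletons use the given edge labels.\<close>

definition class_partition :: "'e set \<Rightarrow> 'e set \<Rightarrow> ('e \<Rightarrow> 'e set) \<Rightarrow> bool" where
  "class_partition E R P \<longleftrightarrow> R \<subseteq> E \<and> (\<Union>r\<in>R. P r) = E \<and> (\<forall>r\<in>R. r \<in> P r) \<and>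
     (\<forall>r\<in>R. \<forall>r'\<in>R. r \<noteq> r' \<longrightarrow> P r \<inter> P r' = {})"

lemma series_classes:
  fixes \<F> :: "'e set set"
  assumes sp: "binary_space E \<F>"
  shows "\<exists>R P. class_partition E R P \<and> (\<forall>r\<in>R. P r = {e \<in> E. series \<F> r e})"
proof -
  define P where "P r = {e \<in> E. series \<F> r e}" for r
  define rep where "rep e = (SOME f. f \<in> P e)" for e
  have refl: "e \<in> P e" if "e \<in> E" for e using that by (simp add: P_def series_def)
  have repP: "rep e \<in> P e" if "e \<in> E" for e unfolding rep_def using refl[OF that] by (rule someI)
  have Peq: "P e = P f" if "f \<in> P e" for e f using that by (auto simp: P_def series_def)
  have PE: "P e \<subseteq> E" for e by (auto simp: P_def)
  let ?R = "rep ` E"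
  have RE: "?R \<subseteq> E" using repP PE by blast
  have "(\<Union>r\<in>?R. P r) = E"
  proof
    show "E \<subseteq> (\<Union>r\<in>?R. P r)" using repP Peq refl by blast
  qed (use PE in blast)
  moreover have "\<forall>r\<in>?R. \<forall>r'\<in>?R. r \<noteq> r' \<longrightarrow> P r \<inter> P r' = {}"
  proof (intro ballI impI, rule ccontr)
    fix r r' assume r: "r \<in> ?R" "r' \<in> ?R" "r \<noteq> r'" "P r \<inter> P r' \<noteq> {}"
    then obtain e e' where e: "e \<in> E" "r = rep e" "e' \<in> E" "r' = rep e'" by auto
    have "P e = P r" "P e' = P r'" using Peq repP e by auto
    moreover have "P r = P r'" using r(4) Peq by blast
    ultimately show False using e r(3) by (simp add: rep_def)
  qed
  ultimately have "class_partition E ?R P" using RE refl by (auto simp: class_partition_def)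
  then show ?thesis using P_def by blast
qed

text \<open>Vertices of different components are merged until one component is left, which the cycle
  space does not notice. Connectedness is wanted because cocycles are then cuts and the nullity
  determines the number of vertices.\<close>

lemma connected_representation:
  assumes "ends_ok (n :: 'e \<Rightarrow> 'v set) E"
  shows "\<exists>n' :: 'e \<Rightarrow> 'v set. ends_ok n' E \<and> evens n' E = evens n E \<and> conn n' E"
  using assms
proof (induction "card (vs n E)" arbitrary: n rule: less_induct)
  case less
  show ?case
  proof (cases "conn n E")
    case True
    then show ?thesis using less.prems by blast
  next
    case False
    then obtain X where X: "X \<subseteq> E" "vs n X \<inter> vs n (E - X) = {}" "X \<noteq> {}" "X \<noteq> E" by (auto simp: conn_def)
    obtain u where u: "u \<in> vs n X" using vs_nonempty[OF ends_ok_subset[OF less.prems X(1)] X(3)] by auto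
    have "E - X \<noteq> {}" using X by auto
    then obtain v where v: "v \<in> vs n (E - X)" using vs_nonempty[OF ends_ok_subset[OF less.prems]] by blast
    have vX: "v \<notin> vs n X" using v X(2) by auto
    let ?m = "merge u v n"
    have uv: "u \<noteq> v" using u vX by auto
    have "vs ?m E \<subseteq> vs n E - {v}"
    proof
      fix x assume "x \<in> vs ?m E"
      then obtain e y where "e \<in> E" "y \<in> n e" "x = (if y = v then u else y)" by (auto simp: vs_def merge_def)
      then show "x \<in> vs n E - {v}" using uv u vs_mono[OF X(1), of n] by (auto simp: vs_def split: if_splits)
    qed
    moreover have "v \<in> vs n E" using v vs_mono[of "E - X" E n] by auto
    ultimately have "card (vs ?m E) < card (vs n E)"
      using psubset_card_mono[OF ends_okD(5)[OF less.prems], of "vs ?m E"] by blast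
    then obtain n' :: "'e \<Rightarrow> 'v set" where "ends_ok n' E" "evens n' E = evens ?m E" "conn n' E"
      using less.hyps merge_ends_ok[OF less.prems] by blast
    then show ?thesis using evens_merge[OF less.prems X(1,2) u vX] by metis
  qed
qed

lemma blow_up_trace:
  assumes cp: "class_partition E R P" and P: "\<forall>r\<in>R. P r = {e \<in> E. series \<F> r e}" and Z: "Z \<in> \<F>" "Z \<subseteq> E"
  shows "\<Union> (P ` (Z \<inter> R)) = Z"
proof
  show "\<Union> (P ` (Z \<inter> R)) \<subseteq> Z" using P Z by (auto simp: series_def)
  show "Z \<subseteq> \<Union> (P ` (Z \<inter> R))"
  proof
    fix e assume e: "e \<in> Z"
    then obtain r where r: "r \<in> R" "e \<in> P r" using cp Z by (auto simp: class_partition_def)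
    then have "r \<in> Z" using P e Z(1) by (auto simp: series_def)
    then show "e \<in> \<Union> (P ` (Z \<inter> R))" using r by auto
  qed
qed

text \<open>Members are unions of series classes, so traces on \<open>R\<close> lose nothing and
  blowing up inverts them. A cocycle with one element would be an edge on no member, and one with
  two elements a series pair from different classes.\<close>

lemma skeleton_space:
  assumes sp: "binary_space E \<F>" and cov: "covers E \<F>" and cp: "class_partition E R P"
    and P: "\<forall>r\<in>R. P r = {e \<in> E. series \<F> r e}" and G: "\<G> = (\<lambda>Z. Z \<inter> R) ` \<F>"
  shows "blow_up P \<G> = \<F>" "cosimple R \<G>"
    "\<And>X. X \<subseteq> R \<Longrightarrow> card (members_in \<G> X) = card (members_in \<F> (\<Union> (P ` X)))"
proof -
  have tr: "\<Union> (P ` (Z \<inter> R)) = Z" if "Z \<in> \<F>" for Z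
    using blow_up_trace[OF cp P that] binary_spaceD(5)[OF sp that] by simp
  show "blow_up P \<G> = \<F>" using tr by (simp add: blow_up_def G image_image)
  show "card (members_in \<G> X) = card (members_in \<F> (\<Union> (P ` X)))" if X: "X \<subseteq> R" for X
  proof -
    have iff: "Z \<subseteq> \<Union> (P ` X) \<longleftrightarrow> Z \<inter> R \<subseteq> X" if "Z \<in> \<F>" for Z
    proof
      assume *: "Z \<subseteq> \<Union> (P ` X)"
      show "Z \<inter> R \<subseteq> X"
      proof
        fix r assume r: "r \<in> Z \<inter> R"
        then obtain r' where r': "r' \<in> X" "r \<in> P r'" using * by auto
        moreover have "r \<in> P r" using r cp by (auto simp: class_partition_def)
        ultimately have "P r' \<inter> P r \<noteq> {}" "r \<in> R" "r' \<in> R" using r X by auto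
        then have "r' = r" using cp unfolding class_partition_def by metis
        then show "r \<in> X" using r'(1) by simp
      qed
    next
      assume "Z \<inter> R \<subseteq> X"
      then show "Z \<subseteq> \<Union> (P ` X)" using tr[OF that] by blast
    qed
    have "inj_on (\<lambda>Z. Z \<inter> R) \<F>" by (rule inj_onI) (metis tr)
    moreover have "members_in \<G> X = (\<lambda>Z. Z \<inter> R) ` members_in \<F> (\<Union> (P ` X))"
      using iff by (auto simp: members_in_def G)
    ultimately show ?thesis
      by (metis (no_types, lifting) card_image inj_on_subset members_in_def mem_Collect_eq subsetI)
  qed
  show "cosimple R \<G>"
    unfolding cosimple_def
  proof (intro allI impI, rule ccontr)
    fix D assume D: "D \<subseteq> R" "D \<noteq> {}" "cocycle \<G> D" "\<not> 3 \<le> card D"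
    have RE: "R \<subseteq> E" using cp by (simp add: class_partition_def)
    have finD: "finite D" using finite_subset[OF D(1) finite_subset[OF RE binary_spaceD(1)[OF sp]]] .
    have ev: "even (card (D \<inter> Z))" if "Z \<in> \<F>" for Z
    proof -
      have "Z \<inter> R \<in> \<G>" using that G by auto
      moreover have "D \<inter> (Z \<inter> R) = D \<inter> Z" using D(1) by auto
      ultimately show ?thesis using D(3) by (metis cocycle_def)
    qed
    from D(2) obtain r where r: "r \<in> D" by auto
    have "\<exists>Z\<in>\<F>. D \<inter> Z = {r} \<or> (\<exists>r'. D \<inter> Z = {r'})"
    proof (cases "D = {r}")
      case True
      have "r \<in> E" using r D(1) RE by auto
      then obtain Z where "Z \<in> \<F>" "r \<in> Z" using cov by (auto simp: covers_def)
      then show ?thesis using True by auto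
    next
      case False
      then obtain r' where r': "r' \<in> D" "r' \<noteq> r" using r by auto
      then have "card {r, r'} \<le> card D" using r finD by (intro card_mono) auto
      then have "card D \<le> card {r, r'}" using D(4) r' by simp
      then have Deq: "{r, r'} = D" using card_seteq[OF finD, of "{r, r'}"] r r' by auto
      have "r \<in> R" "r' \<in> R" using r r' D(1) by auto
      then have "r' \<in> P r'" "P r \<inter> P r' = {}" using cp r'(2) by (simp_all add: class_partition_def)
      then have "r' \<notin> P r" by auto
      then have "\<not> series \<F> r r'" using P r r' D(1) RE by auto
      then obtain Z where "Z \<in> \<F>" "(r \<in> Z) \<noteq> (r' \<in> Z)" by (auto simp: series_def)
      then show ?thesis using Deq by (intro bexI[of _ Z]) auto
    qed
    then obtain Z s where "Z \<in> \<F>" "D \<inter> Z = {s}" by blast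
    then show False using ev[of Z] by simp
  qed
qed

section \<open>Skeletons have at most four vertices\<close>

definition between :: "('e \<Rightarrow> 'v set) \<Rightarrow> 'e set \<Rightarrow> 'v \<Rightarrow> 'v \<Rightarrow> 'e set" where
  "between n R a b = {e \<in> R. n e = {a, b}}"

lemma between_commute: "between n R a b = between n R b a"
  by (simp add: between_def insert_commute)

lemma cut_nonempty:
  assumes ok: "ends_ok n E" and c: "conn n E" and S: "S \<inter> vs n E \<noteq> {}" "\<not> vs n E \<subseteq> S"
  shows "cut n E S \<noteq> {}"
proof
  assume empty: "cut n E S = {}"
  define X where "X = {e \<in> E. n e \<subseteq> S}"
  have out: "n e \<inter> S = {}" if "e \<in> E - X" for e using that empty by (auto simp: cut_def X_def)
  then have "vs n X \<inter> vs n (E - X) = {}" by (fastforce simp: vs_def X_def)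
  moreover have "X \<subseteq> E" by (auto simp: X_def)
  ultimately have "X = {} \<or> X = E" using c by (auto simp: conn_def)
  moreover have "vs n X \<subseteq> S" by (auto simp: vs_def X_def)
  moreover have "vs n (E - X) \<inter> S = {}" using out by (auto simp: vs_def)
  ultimately show False using S by (elim disjE) auto
qed

lemma cut_sym_diff:
  assumes ok: "ends_ok n E"
  shows "cut n E (sym_diff A B) = sym_diff (cut n E A) (cut n E B)"
proof -
  have "e \<in> cut n E (sym_diff A B) \<longleftrightarrow> e \<in> sym_diff (cut n E A) (cut n E B)" if e: "e \<in> E" for e
  proof (cases "card (n e) = 2")
    case True
    then obtain u v where uv: "n e = {u, v}" "u \<noteq> v" by (auto simp: card_2_iff)
    show ?thesis unfolding cut_def using e uv by (cases "u \<in> A"; cases "v \<in> A"; cases "u \<in> B"; cases "v \<in> B") simp_all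
  next
    case False
    then have "card (n e) = 1" using ends_okD(2)[OF ok e] by auto
    then obtain u where "n e = {u}" by (auto simp: card_1_singleton_iff)
    then show ?thesis using e by (auto simp: cut_def)
  qed
  moreover have "cut n E S \<subseteq> E" for S by (rule cut_subset)
  ultimately show ?thesis by blast
qed

lemma Collect_Un3:
  assumes "\<And>e. e \<in> R \<Longrightarrow> P e \<longleftrightarrow> Q\<^sub>1 e \<or> Q\<^sub>2 e \<or> Q\<^sub>3 e"
  shows "{e \<in> R. P e} = {e \<in> R. Q\<^sub>1 e} \<union> ({e \<in> R. Q\<^sub>2 e} \<union> {e \<in> R. Q\<^sub>3 e})"
  using assms by blast

lemma Collect_Un4:
  assumes "\<And>e. e \<in> R \<Longrightarrow> P e \<longleftrightarrow> Q\<^sub>1 e \<or> Q\<^sub>2 e \<or> Q\<^sub>3 e \<or> Q\<^sub>4 e"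
  shows "{e \<in> R. P e} = {e \<in> R. Q\<^sub>1 e} \<union> ({e \<in> R. Q\<^sub>2 e} \<union> ({e \<in> R. Q\<^sub>3 e} \<union> {e \<in> R. Q\<^sub>4 e}))"
  using assms by blast

text \<open>Here \<open>p\<close> and \<open>q\<close> count the edges joining \<open>x\<close>,
  \<open>y\<close> and \<open>a\<close>, \<open>b\<close>; the other variables are named after the
  ends. The hypotheses are the cuts around \<open>{x, a}\<close>, \<open>{x, b}\<close> and
  \<open>{a, b}\<close>, and the four degrees. The third cut has \<open>6 - 2 * q\<close> edges, so
  \<open>q \<le> 1\<close>. If \<open>q = 0\<close>, the first two cuts and the equal degrees of
  \<open>x\<close> and \<open>y\<close> force \<open>xa = ya\<close>, against
  \<open>xa + ya = 3\<close>.\<close>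

lemma four_vertex_counts:
  fixes p k q :: nat
  assumes "k \<le> p + xb + ya + q" "k \<le> p + xa + yb + q" "3 \<le> xa + xb + ya + yb"
    "p + xa + xb = k" "p + ya + yb = k" "xa + ya + q = 3" "xb + yb + q = 3"
  shows "xa = 1 \<and> xb = 1 \<and> ya = 1 \<and> yb = 1 \<and> q = 1"
proof -
  have "2 * q \<le> 3" using assms by linarith
  then have "q = 0 \<or> q = 1" by linarith
  then show ?thesis
  proof
    assume "q = 0"
    then have "xa = ya" using assms by linarith
    then have "2 * xa = 3" using assms(6) \<open>q = 0\<close> by linarith
    then show ?thesis by presburger
  next
    assume "q = 1"
    then have "xa \<le> ya + 1" "ya \<le> xa + 1" "xb \<le> yb + 1" "yb \<le> xb + 1" "xa + ya = 2" "xb + yb = 2"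
      using assms by linarith+
    then show ?thesis using \<open>q = 1\<close> by presburger
  qed
qed

text \<open>Here \<open>n\<close> is a skeleton of nullity \<open>k\<close>, and \<open>\<F>\<close> is the cycle space of the other skeleton.\<close>

definition competitor :: "'e set \<Rightarrow> ('e \<Rightarrow> 'v set) \<Rightarrow> nat \<Rightarrow> 'e set set \<Rightarrow> bool" where
  "competitor R n k \<F> \<longleftrightarrow> ends_ok n R \<and> conn n R \<and> cosimple R (evens n R) \<and> card (evens n R) = 2 ^ k \<and> 3 \<le> k \<and>
     binary_space R \<F> \<and> agree R (evens n R) \<F> \<and> evens n R \<noteq> \<F>"

context
  fixes R :: "'e set" and n :: "'e \<Rightarrow> 'v set" and k :: nat and \<F> :: "'e set set"
  assumes comp: "competitor R n k \<F>"
begin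

lemma competitorD:
  "ends_ok n R" "conn n R" "cosimple R (evens n R)" "card (evens n R) = 2 ^ k" "3 \<le> k"
  "binary_space R \<F>" "agree R (evens n R) \<F>" "evens n R \<noteq> \<F>"
  using comp by (auto simp: competitor_def)

lemma competitor_nonempty: "R \<noteq> {}"
proof
  assume "R = {}"
  then have "evens n R \<subseteq> {{}}" by (auto simp: evens_def)
  then have "card (evens n R) \<le> card {{} :: 'e set}" by (intro card_mono) auto
  then show False using competitorD(4,5) power_increasing[of 3 k "2::nat"] by simp
qed

lemma competitor_card: "k + card (vs n R) = card R + 1" "card (vs n R) \<ge> 1"
proof -
  have pos: "card (vs n R) \<ge> 1"
    using vs_nonempty[OF competitorD(1) competitor_nonempty] ends_okD(5)[OF competitorD(1)]
    by (simp add: Suc_le_eq card_gt_0_iff)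
  have "(2::nat) ^ (k + (card (vs n R) - 1)) = 2 ^ card R"
    using card_evens[OF competitorD(1,2) competitor_nonempty] competitorD(4) by (simp add: power_add)
  then have "k + (card (vs n R) - 1) = card R" by simp
  then show "k + card (vs n R) = card R + 1" "card (vs n R) \<ge> 1" using pos by auto
qed

lemma small_transfer:
  assumes "D \<subseteq> R" "cocycle (evens n R) D" "card D < k"
  shows "cocycle \<F> D"
proof (rule small_cocycle_transfer[OF binary_space_evens[OF competitorD(1)] competitorD(6) _ _ assms])
  show "card (members_in (evens n R) R) = 2 ^ k" using evens_subset[of R R n] competitorD(4) by simp
  show "card (members_in \<F> X) = card (members_in (evens n R) X)"
    if "X \<subseteq> R" "4 \<le> card (members_in (evens n R) X)" for X
    using competitorD(7) that unfolding agree_def by metis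
qed

text \<open>A member of \<open>\<F>\<close> that is orthogonal to all stars except the one at
  \<open>x\<close> has its boundary inside \<open>{x}\<close>, so the boundary is empty. Then
  \<open>\<F>\<close> would be contained in the cycle space of \<open>n\<close>, and equal to it by
  size.\<close>

lemma not_all_but_one:
  shows "\<exists>v\<in>vs n R. v \<noteq> x \<and> \<not> cocycle \<F> (star n R v)"
proof (rule ccontr)
  assume "\<not> ?thesis"
  then have all: "\<And>v. v \<in> vs n R \<Longrightarrow> v \<noteq> x \<Longrightarrow> cocycle \<F> (star n R v)" by blast
  have "\<F> \<subseteq> evens n R"
  proof
    fix Z assume Z: "Z \<in> \<F>"
    have ZR: "Z \<subseteq> R" using binary_spaceD(5)[OF competitorD(6) Z] .
    have "v \<notin> bd n Z" if "v \<noteq> x" for v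
    proof (cases "v \<in> vs n R")
      case True
      then have "even (card (star n R v \<inter> Z))" using all that Z by (simp add: cocycle_def)
      moreover have "star n R v \<inter> Z = star n Z v" using ZR by (auto simp: star_def)
      ultimately show ?thesis by (simp add: bd_def)
    next
      case False
      then show ?thesis using bd_subset[of n Z] vs_mono[OF ZR, of n] by auto
    qed
    then have "bd n Z \<subseteq> {x}" by auto
    moreover have "even (card (bd n Z))" using even_card_bd[OF competitorD(1) ZR] .
    ultimately have "bd n Z = {}" by (auto simp: subset_singleton_iff)
    then show "Z \<in> evens n R" using ZR by (simp add: evens_def)
  qed
  moreover have "card (members_in (evens n R) R) = card (members_in \<F> R)"
  proof -
    have "card (members_in (evens n R) R) \<ge> 4"
      using evens_subset[of R R n] competitorD(4,5) power_increasing[of 3 k "2::nat"] by simp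
    then show ?thesis using competitorD(7) unfolding agree_def by blast
  qed
  ultimately have "evens n R = \<F>"
    using space_eqI[OF binary_space_evens[OF competitorD(1)] competitorD(6)] by blast
  then show False using competitorD(8) by simp
qed

lemma star_cocycle: "cocycle (evens n R) (star n R v)"
  using cocycle_cut[OF competitorD(1), of "{v}"] star_eq_cut[OF competitorD(1)] by simp

lemma two_big_stars:
  "\<exists>x y. x \<noteq> y \<and> x \<in> vs n R \<and> y \<in> vs n R \<and> k \<le> card (star n R x) \<and> k \<le> card (star n R y)"
proof -
  have big: "k \<le> card (star n R v)" if "\<not> cocycle \<F> (star n R v)" for v
    using small_transfer[OF _ star_cocycle, of v] that by (force simp: star_def)
  obtain x where x: "x \<in> vs n R" "\<not> cocycle \<F> (star n R x)" using not_all_but_one by blast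
  obtain y where "y \<in> vs n R" "y \<noteq> x" "\<not> cocycle \<F> (star n R y)" using not_all_but_one[of x] by blast
  then show ?thesis using x big by metis
qed

lemma cut_ge3:
  assumes "S \<inter> vs n R \<noteq> {}" "\<not> vs n R \<subseteq> S"
  shows "3 \<le> card (cut n R S)"
  using cut_nonempty[OF competitorD(1,2) assms] cocycle_cut[OF competitorD(1), of S] competitorD(3) cut_subset[of n R S]
  by (simp add: cosimple_def)

lemma star_ge3:
  assumes "v \<in> vs n R" "w \<in> vs n R" "v \<noteq> w"
  shows "3 \<le> card (star n R v)"
  using cut_ge3[of "{v}"] assms star_eq_cut[OF competitorD(1), of v] by auto

text \<open>With \<open>v\<close> vertices and \<open>l\<close> loops there are
  \<open>k + v - 1\<close> edges, \<open>l\<close> of which lie in no star. Two stars have at least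
  \<open>k\<close> edges and the others at least three, so
  \<open>2 * (k + v - 1 - l) \<ge> 2 * k + 3 * (v - 2)\<close>. The same inequality bounds the
  loops.\<close>

lemma few_vertices: "card (vs n R) \<ge> 2" "card (vs n R) + 2 * card {e \<in> R. card (n e) \<noteq> 2} \<le> 4"
proof -
  let ?V = "vs n R"
  obtain x y where xy: "x \<noteq> y" "x \<in> ?V" "y \<in> ?V" "k \<le> card (star n R x)" "k \<le> card (star n R y)"
    using two_big_stars by blast
  have fin: "finite ?V" "finite R" using ends_okD[OF competitorD(1)] by auto
  have "card {x, y} \<le> card ?V" using xy fin by (intro card_mono) auto
  then show two: "card ?V \<ge> 2" using xy(1) by simp
  have "card (?V - {x, y}) = card ?V - 2" using xy by (simp add: card_Diff_subset)
  moreover have "(\<Sum>v\<in>?V - {x, y}. 3) \<le> (\<Sum>v\<in>?V - {x, y}. card (star n R v))"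
    using star_ge3 xy by (intro sum_mono) auto
  ultimately have rest: "3 * (card ?V - 2) \<le> (\<Sum>v\<in>?V - {x, y}. card (star n R v))" by simp
  have "(\<Sum>v\<in>?V. card (star n R v)) = (\<Sum>v\<in>?V - {x, y}. card (star n R v)) + (\<Sum>v\<in>{x, y}. card (star n R v))"
    using xy fin by (intro sum.subset_diff) auto
  then have "(\<Sum>v\<in>?V. card (star n R v)) \<ge> 3 * (card ?V - 2) + 2 * k" using rest xy by simp
  then have "2 * card {e \<in> R. card (n e) = 2} \<ge> 3 * (card ?V - 2) + 2 * k"
    using sum_card_star[OF competitorD(1)] by simp
  moreover have "card R = card {e \<in> R. card (n e) = 2} + card {e \<in> R. card (n e) \<noteq> 2}"
    using fin(2) by (subst card_Un_disjoint[symmetric]) (auto intro: arg_cong[where f = card])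
  ultimately show "card ?V + 2 * card {e \<in> R. card (n e) \<noteq> 2} \<le> 4" using competitor_card two by linarith
qed

lemma finite_between: "finite (between n R a b)"
  using ends_okD(1)[OF competitorD(1)] by (simp add: between_def)

lemma ends_in_vs: "e \<in> R \<Longrightarrow> n e \<subseteq> vs n R"
  by (auto simp: vs_def)

lemma case_two:
  assumes V: "card (vs n R) = 2"
  shows "\<exists>u v. u \<noteq> v \<and> card R = k + 1 \<and> ((\<forall>e\<in>R. n e = {u, v}) \<or>
    (\<exists>e\<^sub>0\<in>R. n e\<^sub>0 = {u} \<and> (\<forall>e\<in>R - {e\<^sub>0}. n e = {u, v})))"
proof -
  obtain u v where uv: "vs n R = {u, v}" "u \<noteq> v" using V by (auto simp: card_2_iff)
  let ?L = "{e \<in> R. card (n e) \<noteq> 2}"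
  have cR: "card R = k + 1" using competitor_card V by simp
  have full: "n e = {u, v}" if "e \<in> R" "card (n e) = 2" for e
    using card_seteq[of "{u, v}" "n e"] ends_in_vs[OF that(1)] that(2) uv by simp
  have "card ?L \<le> 1" using few_vertices V by simp
  moreover have "finite ?L" using ends_okD(1)[OF competitorD(1)] by simp
  ultimately have "card ?L = 0 \<or> card ?L = 1" "finite ?L" by linarith+
  then have "?L = {} \<or> (\<exists>e\<^sub>0. ?L = {e\<^sub>0})" by (metis (lifting) card_0_eq card_1_singletonE)
  then consider "?L = {}" | e\<^sub>0 where "?L = {e\<^sub>0}" by blast
  then show ?thesis
  proof cases
    case 1
    then have "\<forall>e\<in>R. n e = {u, v}" using full by blast
    then show ?thesis using uv(2) cR by blast
  next
    case 2
    then have e0: "e\<^sub>0 \<in> R" "card (n e\<^sub>0) = 1" using ends_okD(2)[OF competitorD(1), of e\<^sub>0] by auto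
    then obtain w where w: "n e\<^sub>0 = {w}" by (auto simp: card_1_singleton_iff)
    have rest: "\<forall>e\<in>R - {e\<^sub>0}. n e = {u, v}" using full 2 by blast
    have "w = u \<or> w = v" using ends_in_vs[OF e0(1)] w uv by auto
    then show ?thesis
    proof
      assume "w = u"
      then show ?thesis using e0 w rest uv(2) cR by blast
    next
      assume "w = v"
      moreover have "\<forall>e\<in>R - {e\<^sub>0}. n e = {v, u}" using rest by (simp add: insert_commute)
      ultimately show ?thesis using e0 w uv(2) cR by (intro exI[of _ v] exI[of _ u]) auto
    qed
  qed
qed

lemma loopless_case:
  assumes "card (vs n R) \<ge> 3" "e \<in> R"
  shows "card (n e) = 2"
proof (rule ccontr)
  assume "card (n e) \<noteq> 2"
  then have "card {e} \<le> card {e \<in> R. card (n e) \<noteq> 2}"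
    using assms(2) ends_okD(1)[OF competitorD(1)] by (intro card_mono) auto
  then show False using few_vertices assms(1) by simp
qed

lemma ends_pair:
  assumes "card (vs n R) \<ge> 3" "e \<in> R"
  shows "\<exists>a b. a \<in> vs n R \<and> b \<in> vs n R \<and> a \<noteq> b \<and> n e = {a, b}"
proof -
  obtain a b where "n e = {a, b}" "a \<noteq> b" using loopless_case[OF assms] by (auto simp: card_2_iff)
  then show ?thesis using ends_in_vs[OF assms(2)] by auto
qed

text \<open>Now \<open>card R = k + 2\<close>, so at most two edges avoid \<open>x\<close> and at
  most two avoid \<open>y\<close>. These are the edges at the third vertex \<open>z\<close>, whose
  degree is at least three, so one of the two groups has exactly two edges. That group is placed
  between \<open>x\<^sub>1\<close> and \<open>x\<^sub>2\<close>.\<close>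

lemma case_three:
  assumes V: "card (vs n R) = 3"
  shows "\<exists>x\<^sub>0 x\<^sub>1 x\<^sub>2. distinct [x\<^sub>0, x\<^sub>1, x\<^sub>2] \<and> vs n R = {x\<^sub>0, x\<^sub>1, x\<^sub>2} \<and>
    (\<forall>e\<in>R. n e = {x\<^sub>0, x\<^sub>1} \<or> n e = {x\<^sub>1, x\<^sub>2} \<or> n e = {x\<^sub>2, x\<^sub>0}) \<and>
    card (between n R x\<^sub>0 x\<^sub>1) \<in> {1, 2} \<and> card (between n R x\<^sub>1 x\<^sub>2) = 2 \<and> card (between n R x\<^sub>2 x\<^sub>0) \<ge> 2 \<and>
    k = card (between n R x\<^sub>0 x\<^sub>1) + card (between n R x\<^sub>2 x\<^sub>0)"
proof -
  obtain x y where xy: "x \<noteq> y" "x \<in> vs n R" "y \<in> vs n R" "k \<le> card (star n R x)" "k \<le> card (star n R y)"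
    using two_big_stars by blast
  have "card (vs n R - {x, y}) = 1" using xy V by (simp add: card_Diff_subset)
  then obtain z where "vs n R - {x, y} = {z}" by (auto simp: card_1_singleton_iff)
  then have Vz: "vs n R = {x, y, z}" and z: "z \<noteq> x" "z \<noteq> y" using xy by auto
  let ?b = "between n R"
  have ends3: "n e = {x, y} \<or> n e = {y, z} \<or> n e = {x, z}" if "e \<in> R" for e
    using ends_pair[of e] V that unfolding Vz by (auto simp: insert_commute)
  then have all: "e \<in> ?b x y \<or> e \<in> ?b y z \<or> e \<in> ?b x z" if "e \<in> R" for e
    using that by (simp add: between_def)
  have inc: "star n R w = {e \<in> R. w \<in> n e}" for w
    using loopless_case V by (auto simp: star_def)
  have R: "R = ?b x y \<union> (?b y z \<union> ?b x z)" using all by (auto simp: between_def)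
  have st: "star n R x = ?b x y \<union> ?b x z" "star n R y = ?b x y \<union> ?b y z" "star n R z = ?b y z \<union> ?b x z"
  proof -
    have "x \<in> n e \<longleftrightarrow> n e = {x, y} \<or> n e = {x, z}" "y \<in> n e \<longleftrightarrow> n e = {x, y} \<or> n e = {y, z}"
      "z \<in> n e \<longleftrightarrow> n e = {y, z} \<or> n e = {x, z}" if "e \<in> R" for e
      using ends3[OF that] xy(1) z by (auto simp: doubleton_eq_iff)
    then show "star n R x = ?b x y \<union> ?b x z" "star n R y = ?b x y \<union> ?b y z" "star n R z = ?b y z \<union> ?b x z"
      unfolding inc between_def by blast+
  qed
  have dis: "?b x y \<inter> ?b y z = {}" "?b x y \<inter> ?b x z = {}" "?b y z \<inter> ?b x z = {}"
    using xy(1) z by (auto simp: between_def doubleton_eq_iff)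
  have cs: "card (star n R x) = card (?b x y) + card (?b x z)" "card (star n R y) = card (?b x y) + card (?b y z)"
    "card (star n R z) = card (?b y z) + card (?b x z)"
    unfolding st using dis by (simp_all add: card_Un_disjoint finite_between)
  have "card (?b x y \<union> (?b y z \<union> ?b x z)) = card (?b x y) + (card (?b y z) + card (?b x z))"
    using dis by (simp add: card_Un_disjoint finite_between Int_Un_distrib)
  then have cR: "card R = card (?b x y) + card (?b y z) + card (?b x z)" using R by simp
  have k: "card R = k + 2" using competitor_card V by simp
  have "3 \<le> card (star n R x)" "3 \<le> card (star n R y)" "3 \<le> card (star n R z)"
    using star_ge3[of x y] star_ge3[of y x] star_ge3[of z x] xy z Vz by auto
  then have ar: "card (?b y z) \<le> 2" "card (?b x z) \<le> 2" "card (?b y z) + card (?b x z) \<ge> 3"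
     "card (?b x y) + card (?b x z) \<ge> 3" "card (?b x y) + card (?b y z) \<ge> 3"
    using cs xy(4,5) cR k by linarith+
  have comm: "?b y x = ?b x y" "?b z y = ?b y z" "?b z x = ?b x z" by (simp_all add: between_commute)
  have wrap: ?thesis if "distinct [p, q, r]" "vs n R = {p, q, r}"
    "\<And>e. e \<in> R \<Longrightarrow> n e = {p, q} \<or> n e = {q, r} \<or> n e = {r, p}"
    "card (?b p q) = 1 \<or> card (?b p q) = 2" "card (?b q r) = 2" "card (?b r p) \<ge> 2"
    "k = card (?b p q) + card (?b r p)" for p q r
    using that by (intro exI[of _ p] exI[of _ q] exI[of _ r] conjI) simp_all
  \<comment> \<open>If both groups at \<open>z\<close> have two edges, the edges joining
    \<open>x\<close> and \<open>y\<close> decide: a single one takes the place between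
    \<open>x\<^sub>0\<close> and \<open>x\<^sub>1\<close>, several form the class between
    \<open>x\<^sub>2\<close> and \<open>x\<^sub>0\<close>.\<close>
  from ar consider (1) "card (?b y z) = 1" "card (?b x z) = 2" | (2) "card (?b y z) = 2" "card (?b x z) = 1"
    | (3) "card (?b y z) = 2" "card (?b x z) = 2" "card (?b x y) \<ge> 2" | (4) "card (?b y z) = 2" "card (?b x z) = 2" "card (?b x y) = 1"
    by linarith
  then show ?thesis
  proof cases
    case 1
    show ?thesis
    proof (rule wrap[of y z x])
      show "distinct [y, z, x]" using xy(1) z by auto
      show "vs n R = {y, z, x}" using Vz by auto
      show "n e = {y, z} \<or> n e = {z, x} \<or> n e = {x, y}" if "e \<in> R" for e
        using ends3[OF that] by (elim disjE) (simp_all add: insert_commute)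
    qed (use 1 comm ar cR k in simp_all)
  next
    case 2
    show ?thesis
    proof (rule wrap[of x z y])
      show "distinct [x, z, y]" using xy(1) z by auto
      show "vs n R = {x, z, y}" using Vz by auto
      show "n e = {x, z} \<or> n e = {z, y} \<or> n e = {y, x}" if "e \<in> R" for e
        using ends3[OF that] by (elim disjE) (simp_all add: insert_commute)
    qed (use 2 comm ar cR k in simp_all)
  next
    case 3
    show ?thesis
    proof (rule wrap[of y z x])
      show "distinct [y, z, x]" using xy(1) z by auto
      show "vs n R = {y, z, x}" using Vz by auto
      show "n e = {y, z} \<or> n e = {z, x} \<or> n e = {x, y}" if "e \<in> R" for e
        using ends3[OF that] by (elim disjE) (simp_all add: insert_commute)
    qed (use 3 comm ar cR k in simp_all)
  next
    case 4
    show ?thesis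
    proof (rule wrap[of x y z])
      show "distinct [x, y, z]" using xy(1) z by auto
      show "vs n R = {x, y, z}" using Vz by auto
      show "n e = {x, y} \<or> n e = {y, z} \<or> n e = {z, x}" if "e \<in> R" for e
        using ends3[OF that] by (elim disjE) (simp_all add: insert_commute)
    qed (use 4 comm ar cR k in simp_all)
  qed
qed

text \<open>Now \<open>card R = k + 3\<close>, and the degree sum leaves no slack: the degrees are
  \<open>k\<close>, \<open>k\<close>, 3 and 3. Degrees alone do not fix the multiplicities; the cuts
  around two vertices do.\<close>

lemma case_four:
  assumes V: "card (vs n R) = 4"
  shows "\<exists>x y a b. distinct [x, y, a, b] \<and> vs n R = {x, y, a, b} \<and>
    (\<forall>e\<in>R. n e = {x, y} \<or> n e = {x, a} \<or> n e = {x, b} \<or> n e = {y, a} \<or> n e = {y, b} \<or> n e = {a, b}) \<and>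
    card (between n R x a) = 1 \<and> card (between n R x b) = 1 \<and> card (between n R y a) = 1 \<and>
    card (between n R y b) = 1 \<and> card (between n R a b) = 1 \<and> card (between n R x y) + 2 = k"
proof -
  obtain x y where xy: "x \<noteq> y" "x \<in> vs n R" "y \<in> vs n R" "k \<le> card (star n R x)" "k \<le> card (star n R y)"
    using two_big_stars by blast
  have "card (vs n R - {x, y}) = 2" using xy V by (simp add: card_Diff_subset)
  then obtain a b where ab: "vs n R - {x, y} = {a, b}" "a \<noteq> b" by (auto simp: card_2_iff)
  then have "a \<in> vs n R - {x, y}" "b \<in> vs n R - {x, y}" by auto
  then have dn: "a \<noteq> x" "a \<noteq> y" "b \<noteq> x" "b \<noteq> y" "a \<noteq> b" "x \<noteq> y" and abV: "a \<in> vs n R" "b \<in> vs n R"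
    using ab(2) xy(1) by auto
  have Vz: "vs n R = {x, y, a, b}" using ab(1) xy by auto
  let ?b = "between n R"
  have ends4: "n e = {x, y} \<or> n e = {x, a} \<or> n e = {x, b} \<or> n e = {y, a} \<or> n e = {y, b} \<or> n e = {a, b}"
    if e: "e \<in> R" for e
  proof -
    obtain c d where cd: "c \<in> {x, y, a, b}" "d \<in> {x, y, a, b}" "c \<noteq> d" "n e = {c, d}"
      using ends_pair[of e] V e unfolding Vz by auto
    then show ?thesis by (elim insertE emptyE) (simp_all add: insert_commute)
  qed
  then have all: "e \<in> ?b x y \<or> e \<in> ?b x a \<or> e \<in> ?b x b \<or> e \<in> ?b y a \<or> e \<in> ?b y b \<or> e \<in> ?b a b" if "e \<in> R" for e
    using that by (simp add: between_def)
  have inc: "star n R w = {e \<in> R. w \<in> n e}" for w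
    using loopless_case V by (auto simp: star_def)
  have R: "R = ?b x y \<union> (?b x a \<union> (?b x b \<union> (?b y a \<union> (?b y b \<union> ?b a b))))"
  proof (intro subset_antisym subsetI)
    fix e assume "e \<in> R"
    from all[OF this] show "e \<in> ?b x y \<union> (?b x a \<union> (?b x b \<union> (?b y a \<union> (?b y b \<union> ?b a b))))" by (simp only: Un_iff)
  qed (auto simp: between_def)
  have st: "star n R x = ?b x y \<union> (?b x a \<union> ?b x b)" "star n R y = ?b x y \<union> (?b y a \<union> ?b y b)"
    "star n R a = ?b x a \<union> (?b y a \<union> ?b a b)" "star n R b = ?b x b \<union> (?b y b \<union> ?b a b)"
  proof -
    have "x \<in> n e \<longleftrightarrow> n e = {x, y} \<or> n e = {x, a} \<or> n e = {x, b}" "y \<in> n e \<longleftrightarrow> n e = {x, y} \<or> n e = {y, a} \<or> n e = {y, b}"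
      "a \<in> n e \<longleftrightarrow> n e = {x, a} \<or> n e = {y, a} \<or> n e = {a, b}" "b \<in> n e \<longleftrightarrow> n e = {x, b} \<or> n e = {y, b} \<or> n e = {a, b}"
      if "e \<in> R" for e
      using ends4[OF that] by (elim disjE; use dn in \<open>simp add: doubleton_eq_iff\<close>)+
    note iff4 = this
    show "star n R x = ?b x y \<union> (?b x a \<union> ?b x b)" "star n R y = ?b x y \<union> (?b y a \<union> ?b y b)"
      "star n R a = ?b x a \<union> (?b y a \<union> ?b a b)" "star n R b = ?b x b \<union> (?b y b \<union> ?b a b)"
      unfolding inc between_def by (rule Collect_Un3, rule iff4, assumption)+
  qed
  have ct: "cut n R {x, a} = ?b x y \<union> (?b x b \<union> (?b y a \<union> ?b a b))"
    "cut n R {x, b} = ?b x y \<union> (?b x a \<union> (?b y b \<union> ?b a b))"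
    "cut n R {a, b} = ?b x a \<union> (?b x b \<union> (?b y a \<union> ?b y b))"
  proof -
    have "n e \<inter> {x, a} \<noteq> {} \<and> \<not> n e \<subseteq> {x, a} \<longleftrightarrow> n e = {x, y} \<or> n e = {x, b} \<or> n e = {y, a} \<or> n e = {a, b}"
      "n e \<inter> {x, b} \<noteq> {} \<and> \<not> n e \<subseteq> {x, b} \<longleftrightarrow> n e = {x, y} \<or> n e = {x, a} \<or> n e = {y, b} \<or> n e = {a, b}"
      "n e \<inter> {a, b} \<noteq> {} \<and> \<not> n e \<subseteq> {a, b} \<longleftrightarrow> n e = {x, a} \<or> n e = {x, b} \<or> n e = {y, a} \<or> n e = {y, b}"
      if "e \<in> R" for e
      using ends4[OF that] by (elim disjE; use dn in \<open>simp add: doubleton_eq_iff\<close>)+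
    note iff4 = this
    show "cut n R {x, a} = ?b x y \<union> (?b x b \<union> (?b y a \<union> ?b a b))"
      "cut n R {x, b} = ?b x y \<union> (?b x a \<union> (?b y b \<union> ?b a b))"
      "cut n R {a, b} = ?b x a \<union> (?b x b \<union> (?b y a \<union> ?b y b))"
      unfolding cut_def between_def by (rule Collect_Un4, rule iff4, assumption)+
  qed
  have dis: "?b c d \<inter> ?b c' d' = {}" if "{c, d} \<noteq> {c', d'}" for c d c' d'
    using that by (auto simp: between_def)
  have d: "?b x y \<inter> ?b x a = {}" "?b x y \<inter> ?b x b = {}" "?b x y \<inter> ?b y a = {}" "?b x y \<inter> ?b y b = {}" "?b x y \<inter> ?b a b = {}"
    "?b x a \<inter> ?b x b = {}" "?b x a \<inter> ?b y a = {}" "?b x a \<inter> ?b y b = {}" "?b x a \<inter> ?b a b = {}"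
    "?b x b \<inter> ?b y a = {}" "?b x b \<inter> ?b y b = {}" "?b x b \<inter> ?b a b = {}"
    "?b y a \<inter> ?b y b = {}" "?b y a \<inter> ?b a b = {}" "?b y b \<inter> ?b a b = {}"
    using dn by (auto intro!: dis simp: doubleton_eq_iff)
  note cu = card_Un_disjoint finite_between Int_Un_distrib d
  have cs: "card (star n R x) = card (?b x y) + card (?b x a) + card (?b x b)"
    "card (star n R y) = card (?b x y) + card (?b y a) + card (?b y b)"
    "card (star n R a) = card (?b x a) + card (?b y a) + card (?b a b)"
    "card (star n R b) = card (?b x b) + card (?b y b) + card (?b a b)"
    unfolding st by (simp_all add: cu)
  have cc: "card (cut n R {x, a}) = card (?b x y) + card (?b x b) + card (?b y a) + card (?b a b)"
    "card (cut n R {x, b}) = card (?b x y) + card (?b x a) + card (?b y b) + card (?b a b)"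
    "card (cut n R {a, b}) = card (?b x a) + card (?b x b) + card (?b y a) + card (?b y b)"
    unfolding ct by (simp_all add: cu)
  have "card (?b x y \<union> (?b x a \<union> (?b x b \<union> (?b y a \<union> (?b y b \<union> ?b a b))))) =
     card (?b x y) + (card (?b x a) + (card (?b x b) + (card (?b y a) + (card (?b y b) + card (?b a b)))))"
    by (simp add: cu)
  then have cR: "card R = card (?b x y) + card (?b x a) + card (?b x b) + card (?b y a) + card (?b y b) + card (?b a b)"
    using R by simp
  have k: "card R = k + 3" using competitor_card V by simp
  have s3: "3 \<le> card (star n R a)" "3 \<le> card (star n R b)" using star_ge3[of a x] star_ge3[of b x] dn abV xy by auto
  have c3: "3 \<le> card (cut n R S)" if "S = {x, a} \<or> S = {x, b} \<or> S = {a, b}" for S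
    using that dn by (intro cut_ge3) (auto simp: Vz)
  have eqs: "card (star n R x) = k" "card (star n R y) = k" "card (star n R a) = 3" "card (star n R b) = 3"
    using cs cR k s3 xy(4,5) by linarith+
  \<comment> \<open>A smaller cut would be a cocycle of \<open>\<F>\<close>, and together with the
    star of \<open>c\<close> it would make the star of \<open>x\<close> one. All stars but the one
    at \<open>y\<close> would then be cocycles of \<open>\<F>\<close>.\<close>
  have big: "k \<le> card (cut n R {x, c})" if c: "c = a \<or> c = b" for c
  proof (rule ccontr)
    assume neg: "\<not> ?thesis"
    have "3 \<le> card (cut n R {x, c})" using c c3 by blast
    \<comment> \<open>A cut with at least three and fewer than \<open>k\<close> edges forces
      \<open>k > 3\<close>, which is what lets the stars with three edges be transferred.\<close>
    then have k4: "3 < k" using neg by simp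
    have "cocycle \<F> (cut n R {x, c})"
      by (rule small_transfer[OF cut_subset cocycle_cut[OF competitorD(1)]]) (use neg in simp)
    moreover have stab: "cocycle \<F> (star n R a)" "cocycle \<F> (star n R b)"
      using small_transfer[OF _ star_cocycle] eqs(3,4) k4 by (auto simp: star_def)
    moreover have "star n R x = sym_diff (cut n R {x, c}) (star n R c)"
    proof -
      have "{x} = sym_diff {x, c} {c}" using c dn by auto
      then show ?thesis using cut_sym_diff[OF competitorD(1), of "{x, c}" "{c}"] star_eq_cut[OF competitorD(1)] by metis
    qed
    moreover have "finite (cut n R {x, c})" "finite (star n R c)"
      using ends_okD(1)[OF competitorD(1)] finite_subset[OF cut_subset] finite_star by auto
    ultimately have "cocycle \<F> (star n R x)" using c cocycle_sym_diff by metis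
    then show False using not_all_but_one[of y] stab unfolding Vz by blast
  qed
  have "3 \<le> card (cut n R {a, b})" using c3 by blast
  then have ar: "card (?b x a) = 1" "card (?b x b) = 1" "card (?b y a) = 1" "card (?b y b) = 1" "card (?b a b) = 1"
    using four_vertex_counts[of k "card (?b x y)" "card (?b x b)" "card (?b y a)" "card (?b a b)" "card (?b x a)" "card (?b y b)"]
      big[of a] big[of b] cc eqs cs by simp_all
  then have "card (?b x y) + 2 = k" using cs(1) eqs(1) by simp
  then show ?thesis using ar dn Vz ends4
    by (intro exI[of _ x] exI[of _ y] exI[of _ a] exI[of _ b] conjI) simp_all
qed

lemma vertex_cases: "card (vs n R) = 2 \<or> card (vs n R) = 3 \<or> card (vs n R) = 4"
  using few_vertices by linarith

end

section \<open>Subdivisions of skeletons\<close>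

text \<open>The series class \<open>P r\<close> becomes a path, or a cycle if \<open>r\<close> is a loop, with edges \<open>L r i\<close> in this
  order and vertices \<open>N r i\<close>.\<close>

locale subdivided =
  fixes s :: "'e \<Rightarrow> 'v set" and R :: "'e set" and P :: "'e \<Rightarrow> 'e set" and E :: "'e set"
    and n :: "'e \<Rightarrow> 'v set" and N :: "'e \<Rightarrow> nat \<Rightarrow> 'v" and L :: "'e \<Rightarrow> nat \<Rightarrow> 'e" and len :: "'e \<Rightarrow> nat"
  assumes s_ok: "ends_ok s R" and finE: "finite E" and cp: "class_partition E R P"
    and len_pos: "r \<in> R \<Longrightarrow> 0 < len r"
    and L_inj: "r \<in> R \<Longrightarrow> inj_on (L r) {..<len r}"
    and L_image: "r \<in> R \<Longrightarrow> L r ` {..<len r} = P r"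
    and n_L: "r \<in> R \<Longrightarrow> i < len r \<Longrightarrow> n (L r i) = {N r i, N r (Suc i)}"
    and s_N: "r \<in> R \<Longrightarrow> s r = {N r 0, N r (len r)}"
    and inner_new: "r \<in> R \<Longrightarrow> 0 < i \<Longrightarrow> i < len r \<Longrightarrow> N r i \<notin> vs s R"
    and inner_inj: "r \<in> R \<Longrightarrow> r' \<in> R \<Longrightarrow> 0 < i \<Longrightarrow> i < len r \<Longrightarrow> 0 < j \<Longrightarrow> j < len r' \<Longrightarrow>
      N r i = N r' j \<Longrightarrow> r = r' \<and> i = j"
begin

abbreviation H where "H \<equiv> mk n E"

lemma P_subset: "r \<in> R \<Longrightarrow> P r \<subseteq> E"
  using cp by (auto simp: class_partition_def)

lemma R_in_P: "r \<in> R \<Longrightarrow> r \<in> P r" and E_eq: "E = (\<Union>r\<in>R. P r)"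
  using cp by (auto simp: class_partition_def)

lemma P_disjoint: "r \<in> R \<Longrightarrow> r' \<in> R \<Longrightarrow> x \<in> P r \<Longrightarrow> x \<in> P r' \<Longrightarrow> r = r'"
  using cp unfolding class_partition_def by blast

lemma L_in_P: "r \<in> R \<Longrightarrow> i < len r \<Longrightarrow> L r i \<in> P r"
  using L_image by blast

lemma L_in_E: "r \<in> R \<Longrightarrow> i < len r \<Longrightarrow> L r i \<in> E"
  using L_in_P P_subset by blast

lemma P_cases:
  assumes "r \<in> R" "e \<in> P r"
  obtains i where "i < len r" "e = L r i"
  using assms L_image[OF assms(1)] by blast

lemma E_cases:
  assumes "e \<in> E"
  obtains r i where "r \<in> R" "i < len r" "e = L r i"
  using assms E_eq P_cases by blast

lemma L_eq: "r \<in> R \<Longrightarrow> r' \<in> R \<Longrightarrow> i < len r \<Longrightarrow> j < len r' \<Longrightarrow> L r i = L r' j \<Longrightarrow> r = r' \<and> i = j"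
  using P_disjoint[of r r' "L r i"] L_in_P[of r i] L_in_P[of r' j] L_inj[of r] by (auto dest: inj_onD)

lemma end_in_vs: "r \<in> R \<Longrightarrow> N r 0 \<in> vs s R" "r \<in> R \<Longrightarrow> N r (len r) \<in> vs s R"
  using s_N by (auto simp: vs_def)

lemma inner_of_new: "r \<in> R \<Longrightarrow> i \<le> len r \<Longrightarrow> N r i \<notin> vs s R \<Longrightarrow> 0 < i \<and> i < len r"
  using end_in_vs[of r] by (cases "i = 0"; cases "i = len r") auto

lemma edges_at_inner:
  assumes r: "r \<in> R" and i: "Suc i < len r"
  shows "{e \<in> E. N r (Suc i) \<in> n e} = {L r i, L r (Suc i)}"
proof
  have w: "N r (Suc i) \<notin> vs s R" using inner_new[OF r] i by simp
  show "{e \<in> E. N r (Suc i) \<in> n e} \<subseteq> {L r i, L r (Suc i)}"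
  proof
    fix e assume "e \<in> {e \<in> E. N r (Suc i) \<in> n e}"
    then have e: "e \<in> E" "N r (Suc i) \<in> n e" by auto
    from e(1) obtain r' j where j: "r' \<in> R" "j < len r'" "e = L r' j" by (rule E_cases)
    then have "N r (Suc i) = N r' j \<or> N r (Suc i) = N r' (Suc j)" using e(2) n_L by auto
    then obtain m where m: "m = j \<or> m = Suc j" "N r (Suc i) = N r' m" by auto
    then have "0 < m \<and> m < len r'" using inner_of_new[OF j(1), of m] w j(2) by auto
    then have "r = r' \<and> Suc i = m" using inner_inj[OF r j(1) _ i, of m] m(2) by auto
    then show "e \<in> {L r i, L r (Suc i)}" using m(1) j(3) by auto
  qed
  show "{L r i, L r (Suc i)} \<subseteq> {e \<in> E. N r (Suc i) \<in> n e}"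
    using L_in_E[OF r] n_L[OF r] i by auto
qed

lemma N_inj:
  assumes r: "r \<in> R" "N r 0 \<noteq> N r (len r)" and ij: "i \<le> len r" "j \<le> len r" "N r i = N r j"
  shows "i = j"
proof (cases "N r i \<in> vs s R")
  case False
  then have "0 < i \<and> i < len r" "0 < j \<and> j < len r"
    using inner_of_new[OF r(1) ij(1)] inner_of_new[OF r(1) ij(2)] ij(3) by auto
  then show ?thesis using inner_inj[OF r(1) r(1)] ij(3) by blast
next
  case True
  then have "\<not> (0 < i \<and> i < len r)" "\<not> (0 < j \<and> j < len r)"
    using inner_new[OF r(1), of i] inner_new[OF r(1), of j] ij(3) by auto
  then have "i = 0 \<or> i = len r" "j = 0 \<or> j = len r" using ij(1,2) by linarith+
  then show ?thesis using ij(3) r(2) by auto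
qed

text \<open>Length one is excluded because a loop of the skeleton may stay a loop; a longer class
  contains no loops even when it closes up to a cycle.\<close>

lemma consecutive_distinct:
  assumes r: "r \<in> R" and i: "i < len r" and big: "len r \<ge> 2"
  shows "N r i \<noteq> N r (Suc i)"
proof
  assume eq: "N r i = N r (Suc i)"
  show False
  proof (cases "N r i \<in> vs s R")
    case False
    then have "0 < i \<and> i < len r" "0 < Suc i \<and> Suc i < len r"
      using inner_of_new[OF r, of i] inner_of_new[OF r, of "Suc i"] eq i by auto
    then show False using inner_inj[OF r r _ _ _ _ eq] by auto
  next
    case True
    then have "\<not> (0 < i \<and> i < len r)" "\<not> (0 < Suc i \<and> Suc i < len r)"
      using inner_new[OF r, of i] inner_new[OF r, of "Suc i"] eq by auto
    then show False using i big by auto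
  qed
qed

lemma n_ok: "ends_ok n E"
  unfolding ends_ok_def
proof (intro conjI ballI finE)
  fix e assume "e \<in> E"
  then obtain r i where "r \<in> R" "i < len r" "e = L r i" by (rule E_cases)
  then show "card (n e) = 1 \<or> card (n e) = 2" using n_L[of r i] by (auto simp: card_insert_if)
qed

lemma vs_P: "r \<in> R \<Longrightarrow> vs n (P r) = N r ` {..len r}"
proof -
  assume r: "r \<in> R"
  have "vs n (P r) = (\<Union>i\<in>{..<len r}. {N r i, N r (Suc i)})"
    unfolding vs_def L_image[OF r, symmetric] using n_L[OF r] by simp
  also have "\<dots> = N r ` {..len r}"
  proof
    show "N r ` {..len r} \<subseteq> (\<Union>i\<in>{..<len r}. {N r i, N r (Suc i)})"
    proof
      fix x assume "x \<in> N r ` {..len r}"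
      then obtain i where i: "i \<le> len r" "x = N r i" by auto
      show "x \<in> (\<Union>i\<in>{..<len r}. {N r i, N r (Suc i)})"
      proof (cases "i < len r")
        case False
        then have "i = Suc (len r - 1)" "len r - 1 < len r" using i len_pos[OF r] by auto
        then show ?thesis using i by blast
      qed (use i in blast)
    qed
  qed auto
  finally show ?thesis .
qed

lemma even_step:
  assumes r: "r \<in> R" and i: "Suc i < len r" and Z: "Z \<in> evens n E"
  shows "L r i \<in> Z \<longleftrightarrow> L r (Suc i) \<in> Z"
proof -
  have ZE: "Z \<subseteq> E" using Z by (simp add: evens_def)
  have ne: "L r i \<noteq> L r (Suc i)" using L_eq[OF r r, of i "Suc i"] i by auto
  have c: "card (n (L r i)) = 2" "card (n (L r (Suc i))) = 2"
    using n_L[OF r] consecutive_distinct[OF r] i by auto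
  have "star n Z (N r (Suc i)) = {L r i, L r (Suc i)} \<inter> Z"
    using edges_at_inner[OF r i] c ZE by (auto simp: star_def)
  moreover have "even (card (star n Z (N r (Suc i))))" using Z by (auto simp: evens_def bd_def)
  ultimately have "even (card ({L r i, L r (Suc i)} \<inter> Z))" by simp
  then show ?thesis using ne by (cases "L r i \<in> Z"; cases "L r (Suc i) \<in> Z") auto
qed

text \<open>Exactly two edges meet at an inner vertex, so an even set passes from each edge of a
  class to the next.\<close>

lemma even_whole:
  assumes r: "r \<in> R" and Z: "Z \<in> evens n E" and e: "e \<in> P r" "e \<in> Z"
  shows "P r \<subseteq> Z"
proof -
  have *: "L r i \<in> Z \<longleftrightarrow> L r 0 \<in> Z" if "i < len r" for i
    using that even_step[OF r _ Z] by (induction i) auto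
  obtain i where "i < len r" "e = L r i" using P_cases[OF r e(1)] .
  then have "L r 0 \<in> Z" using * e(2) by blast
  then have "\<forall>i<len r. L r i \<in> Z" using * by blast
  then show ?thesis unfolding L_image[OF r, symmetric] by auto
qed

text \<open>Inner vertices have degree two in their class, so only the ends can be left. The first
  vertex of a path is met by its first edge alone, and parity then supplies the other end; for a
  loop both boundaries are empty.\<close>

lemma bd_P: "r \<in> R \<Longrightarrow> bd n (P r) = bd s {r}"
proof -
  assume r: "r \<in> R"
  have ev: "even (card (bd n (P r)))" using even_card_bd[OF n_ok P_subset[OF r]] .
  have inner: "N r i \<notin> bd n (P r)" if i: "0 < i" "i < len r" for i
  proof -
    obtain j where j: "i = Suc j" using i(1) by (cases i) auto
    then have jl: "Suc j < len r" using i by simp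
    have c: "card (n (L r j)) = 2" "card (n (L r (Suc j))) = 2"
      using n_L[OF r] consecutive_distinct[OF r] jl by auto
    have "star n (P r) (N r i) = {L r j, L r (Suc j)}"
      using edges_at_inner[OF r jl] c P_subset[OF r] L_in_P[OF r] jl j by (auto simp: star_def)
    moreover have "L r j \<noteq> L r (Suc j)" using L_eq[OF r r, of j "Suc j"] jl by auto
    ultimately show ?thesis by (simp add: bd_def)
  qed
  have sub: "bd n (P r) \<subseteq> {N r 0, N r (len r)}"
  proof
    fix x assume x: "x \<in> bd n (P r)"
    then obtain i where "i \<le> len r" "x = N r i" using bd_subset[of n "P r"] vs_P[OF r] by auto
    then show "x \<in> {N r 0, N r (len r)}" using inner[of i] x by (cases "i = 0"; cases "i = len r") auto
  qed
  show ?thesis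
  proof (cases "N r 0 = N r (len r)")
    case True
    then have "bd n (P r) = {}" using sub ev by (auto simp: subset_singleton_iff)
    moreover have "bd s {r} = {}" using True s_N[OF r] by (simp add: bd_single)
    ultimately show ?thesis by simp
  next
    case False
    have "star n (P r) (N r 0) = {L r 0}"
    proof
      show "star n (P r) (N r 0) \<subseteq> {L r 0}"
      proof
        fix e assume "e \<in> star n (P r) (N r 0)"
        then have e: "e \<in> P r" "N r 0 \<in> n e" by (auto simp: star_def)
        obtain i where i: "i < len r" "e = L r i" using P_cases[OF r e(1)] .
        then have "N r 0 = N r i \<or> N r 0 = N r (Suc i)" using e(2) n_L[OF r] by auto
        then have "i = 0" using N_inj[OF r False, of 0 i] N_inj[OF r False, of 0 "Suc i"] i by auto
        then show "e \<in> {L r 0}" using i by simp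
      qed
      have "N r 0 \<noteq> N r (Suc 0)" using N_inj[OF r False, of 0 "Suc 0"] len_pos[OF r] by auto
      then show "{L r 0} \<subseteq> star n (P r) (N r 0)"
        using L_in_P[OF r] n_L[OF r] len_pos[OF r] by (auto simp: star_def)
    qed
    then have "N r 0 \<in> bd n (P r)" by (simp add: bd_def)
    then have "bd n (P r) = {N r 0, N r (len r)}" using even_pair_subset[OF ev sub False] by auto
    then show ?thesis using False s_N[OF r] by (simp add: bd_single)
  qed
qed

lemma bd_blow_up:
  assumes "Y \<subseteq> R"
  shows "bd n (\<Union> (P ` Y)) = bd s Y"
proof -
  have "finite Y" using assms ends_okD(1)[OF s_ok] finite_subset by blast
  then show ?thesis using assms
  proof (induction Y rule: finite_induct)
    case (insert r Y)
    have r: "r \<in> R" and Y: "Y \<subseteq> R" using insert.prems by auto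
    have fin: "finite (P r)" "finite (\<Union> (P ` Y))"
      using finite_subset[OF P_subset[OF r] finE] finite_subset[OF P_subset finE] insert.hyps(1) Y by auto
    have dis: "P r \<inter> \<Union> (P ` Y) = {}"
      using P_disjoint[OF r] Y insert.hyps(2) by blast
    have "bd n (\<Union> (P ` insert r Y)) = bd n (P r \<union> \<Union> (P ` Y))" by simp
    also have "\<dots> = sym_diff (bd s {r}) (bd s Y)"
      using bd_Un_disjoint[OF fin dis, of n] bd_P[OF r] insert.IH[OF Y] by simp
    also have "\<dots> = bd s ({r} \<union> Y)"
      using bd_Un_disjoint[of "{r}" Y s] insert.hyps by simp
    finally show ?case by simp
  qed simp
qed

text \<open>Even sets are unions of classes, and a union of classes has the same boundary as its set
  of representatives in the skeleton.\<close>

lemma evens_blow_up: "evens n E = blow_up P (evens s R)"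
proof
  show "evens n E \<subseteq> blow_up P (evens s R)"
  proof
    fix Z assume Z: "Z \<in> evens n E"
    have "Z = \<Union> (P ` (Z \<inter> R))"
    proof
      show "Z \<subseteq> \<Union> (P ` (Z \<inter> R))"
      proof
        fix e assume e: "e \<in> Z"
        then obtain r where r: "r \<in> R" "e \<in> P r" using Z E_eq by (auto simp: evens_def)
        then have "r \<in> Z" using even_whole[OF r(1) Z r(2) e] R_in_P by auto
        then show "e \<in> \<Union> (P ` (Z \<inter> R))" using r by auto
      qed
      show "\<Union> (P ` (Z \<inter> R)) \<subseteq> Z" using even_whole[OF _ Z] R_in_P by blast
    qed
    moreover have "Z \<inter> R \<in> evens s R" using bd_blow_up[of "Z \<inter> R"] calculation Z by (auto simp: evens_def)
    ultimately show "Z \<in> blow_up P (evens s R)" unfolding blow_up_def by (rule image_eqI)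
  qed
  show "blow_up P (evens s R) \<subseteq> evens n E"
  proof
    fix Z assume "Z \<in> blow_up P (evens s R)"
    then obtain Y where Y: "Y \<in> evens s R" "Z = \<Union> (P ` Y)" by (auto simp: blow_up_def)
    then have YR: "Y \<subseteq> R" "bd s Y = {}" by (auto simp: evens_def)
    have "\<Union> (P ` Y) \<subseteq> E" using P_subset YR(1) by blast
    then show "Z \<in> evens n E" using bd_blow_up[OF YR(1)] Y(2) YR(2) by (simp add: evens_def)
  qed
qed

lemma path_P:
  assumes r: "r \<in> R" and ne: "N r 0 \<noteq> N r (len r)"
  shows "is_path H (N r 0) (N r (len r)) (P r)"
  unfolding is_path_def
proof (intro conjI exI)
  let ?xs = "map (N r) [0..<Suc (len r)]" and ?es = "map (L r) [0..<len r]"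
  show "distinct ?xs" unfolding distinct_map
    by (intro conjI distinct_upt inj_onI) (rule N_inj[OF r ne], auto)
  show "set ?es = P r" using L_image[OF r] by (simp add: atLeast0LessThan)
  show "\<forall>i<length ?es. ends H (?es ! i) = {?xs ! i, ?xs ! Suc i}"
  proof (intro allI impI)
    fix i assume "i < length ?es"
    then have i: "i < len r" by simp
    have "?xs ! i = N r i" "?xs ! Suc i = N r (Suc i)" "?es ! i = L r i"
      using i by (simp_all del: upt_Suc)
    then show "ends H (?es ! i) = {?xs ! i, ?xs ! Suc i}" using n_L[OF r i] by simp
  qed
  show "hd ?xs = N r 0" by (simp add: hd_map del: upt_Suc)
  show "last ?xs = N r (len r)" by simp
qed (use ne P_subset[OF r] in auto)

text \<open>An even set with one edge of a class contains the whole class, so a class that closes up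
  is a minimal even set.\<close>

lemma cycle_P:
  assumes r: "r \<in> R" and eq: "N r 0 = N r (len r)"
  shows "is_cycle H (P r)"
proof (rule minimal_even_is_cycle)
  show "ends_ok (ends H) (edges H)" using n_ok by simp
  have "bd n (P r) = {}" using bd_P[OF r] s_N[OF r] eq by (simp add: bd_single)
  then show "P r \<in> evens (ends H) (edges H)" using P_subset[OF r] by (simp add: evens_def)
  show "P r \<noteq> {}" using R_in_P[OF r] by auto
  show "Y = {}" if "Y \<in> evens (ends H) (edges H)" "Y \<subset> P r" for Y
    using even_whole[OF r, of Y] that by auto
qed

lemma vs_P_Int: "r \<in> R \<Longrightarrow> vs n (P r) \<inter> vs s R = s r"
proof -
  assume r: "r \<in> R"
  have "x \<in> s r" if x: "x \<in> vs n (P r)" "x \<in> vs s R" for x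
  proof -
    obtain i where i: "i \<le> len r" "x = N r i" using x(1) vs_P[OF r] by auto
    then have "\<not> (0 < i \<and> i < len r)" using inner_new[OF r, of i] x(2) by metis
    then have "i = 0 \<or> i = len r" using i(1) by linarith
    then show ?thesis using i s_N[OF r] by auto
  qed
  moreover have "s r \<subseteq> vs n (P r)" using s_N[OF r] vs_P[OF r] by auto
  moreover have "s r \<subseteq> vs s R" using r by (auto simp: vs_def)
  ultimately show ?thesis by blast
qed

lemma vs_P_disjoint:
  assumes "r \<in> R" "r' \<in> R" "r \<noteq> r'"
  shows "vs n (P r) \<inter> vs n (P r') \<subseteq> s r \<inter> s r'"
proof
  fix x assume x: "x \<in> vs n (P r) \<inter> vs n (P r')"
  have "x \<in> vs s R"
  proof (rule ccontr)
    assume nx: "x \<notin> vs s R"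
    obtain i j where ij: "i \<le> len r" "x = N r i" "j \<le> len r'" "x = N r' j"
      using x vs_P[OF assms(1)] vs_P[OF assms(2)] by auto
    then have "0 < i \<and> i < len r" "0 < j \<and> j < len r'"
      using inner_of_new[OF assms(1)] inner_of_new[OF assms(2)] nx by auto
    then show False using inner_inj[OF assms(1,2), of i j] ij assms(3) by auto
  qed
  then show "x \<in> s r \<inter> s r'" using x vs_P_Int[OF assms(1)] vs_P_Int[OF assms(2)] by blast
qed

lemma vs_n: "vs n E = (\<Union>r\<in>R. vs n (P r))"
  unfolding E_eq by (auto simp: vs_def)

lemma vs_s_subset: "vs s R \<subseteq> vs n E"
proof
  fix x assume "x \<in> vs s R"
  then obtain r where "r \<in> R" "x \<in> s r" by (auto simp: vs_def)
  then show "x \<in> vs n E" using vs_P_Int[of r] vs_n by auto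
qed

lemma subdivision_via_self: "subdivision_via H (mk s R) id P"
  unfolding subdivision_via_def mk_simps restrict_simps
proof (intro conjI ballI impI)
  show "vs n E = id ` vs s R \<union> (\<Union>e\<in>R. vs n (P e))" using vs_n vs_s_subset by auto
  show "E = (\<Union>e\<in>R. P e)" by (rule E_eq)
  fix r assume r: "r \<in> R"
  show "\<exists>u v. id ` s r = {u, v} \<and> (if u = v then is_cycle H (P r) else is_path H u v (P r))"
    using s_N[OF r] path_P[OF r] cycle_P[OF r] by (intro exI[of _ "N r 0"] exI[of _ "N r (len r)"]) auto
  show "vs n (P r) \<inter> id ` vs s R = id ` s r" using vs_P_Int[OF r] by simp
  fix r' assume r': "r' \<in> R" "r \<noteq> r'"
  show "P r \<inter> P r' = {}" using P_disjoint[OF r r'(1)] r'(2) by blast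
  have "s r \<subseteq> vs s R" using r by (auto simp: vs_def)
  then show "vs n (P r) \<inter> vs n (P r') \<subseteq> id ` vs s R" using vs_P_disjoint[OF r r'] by auto
qed simp

end

section \<open>Degrees and ears in loopless subdivisions\<close>

locale subdivided_loopless = subdivided +
  assumes s_loopless: "r \<in> R \<Longrightarrow> card (s r) = 2"
begin

lemma ends_distinct: "r \<in> R \<Longrightarrow> N r 0 \<noteq> N r (len r)"
  using s_loopless[of r] s_N[of r] by auto

lemma no_loops: "{e \<in> E. n e = {w}} = {}"
proof -
  have False if e: "e \<in> E" "n e = {w}" for e
  proof -
    obtain r i where ri: "r \<in> R" "i < len r" "e = L r i" using E_cases[OF e(1)] .
    then have "N r i = N r (Suc i)" using n_L[OF ri(1,2)] e(2) by auto
    then show False using N_inj[OF ri(1) ends_distinct[OF ri(1)], of i "Suc i"] ri(2) by auto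
  qed
  then show ?thesis by blast
qed

lemma degree_H: "degree H w = card {e \<in> E. w \<in> n e}"
  unfolding degree_def mk_simps no_loops by simp

lemma degree_inner: "r \<in> R \<Longrightarrow> 0 < i \<Longrightarrow> i < len r \<Longrightarrow> degree H (N r i) = 2"
proof -
  assume r: "r \<in> R" and i: "0 < i" "i < len r"
  then obtain j where j: "i = Suc j" by (cases i) auto
  then have "L r j \<noteq> L r (Suc j)" using L_eq[OF r r, of j "Suc j"] i by auto
  then show ?thesis using edges_at_inner[OF r, of j] i j degree_H by simp
qed

text \<open>Every skeleton edge at \<open>w\<close> contributes the first or the last edge of its
  class; not both, because it is no loop.\<close>

lemma degree_end:
  assumes w: "w \<in> vs s R"
  shows "degree H w = card (star s R w)"
proof -
  define g where "g r = (if w = N r 0 then L r 0 else L r (len r - 1))" for r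
  have "bij_betw g (star s R w) {e \<in> E. w \<in> n e}"
    unfolding bij_betw_def
  proof
    show "inj_on g (star s R w)"
    proof (rule inj_onI)
      fix r r' assume "r \<in> star s R w" "r' \<in> star s R w" "g r = g r'"
      moreover have "g r \<in> P r" if "r \<in> R" for r
        using L_in_P[OF that, of 0] L_in_P[OF that, of "len r - 1"] len_pos[OF that] by (simp add: g_def)
      ultimately show "r = r'" using P_disjoint by (metis (mono_tags, lifting) mem_Collect_eq star_def)
    qed
    show "g ` star s R w = {e \<in> E. w \<in> n e}"
    proof
      show "g ` star s R w \<subseteq> {e \<in> E. w \<in> n e}"
      proof
        fix e assume "e \<in> g ` star s R w"
        then obtain r where r: "r \<in> R" "w \<in> s r" "e = g r" by (auto simp: star_def)
        then have "w = N r 0 \<or> w = N r (len r)" using s_N by auto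
        then show "e \<in> {e \<in> E. w \<in> n e}"
          using r n_L[OF r(1), of 0] n_L[OF r(1), of "len r - 1"] L_in_E[OF r(1), of 0] L_in_E[OF r(1), of "len r - 1"]
            len_pos[OF r(1)] by (auto simp: g_def)
      qed
      show "{e \<in> E. w \<in> n e} \<subseteq> g ` star s R w"
      proof
        fix e assume "e \<in> {e \<in> E. w \<in> n e}"
        then have e: "e \<in> E" "w \<in> n e" by auto
        obtain r i where ri: "r \<in> R" "i < len r" "e = L r i" using E_cases[OF e(1)] .
        then obtain m where m: "m = i \<or> m = Suc i" "w = N r m" using e(2) n_L[OF ri(1,2)] by auto
        then have "m = 0 \<or> m = len r" using inner_new[OF ri(1), of m] w ri(2) by auto
        then have "e = g r"
        proof
          assume "m = 0"
          then show ?thesis using m ri by (auto simp: g_def)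
        next
          assume "m = len r"
          then have "w \<noteq> N r 0" "i = len r - 1" using m ends_distinct[OF ri(1)] ri(2) by auto
          then show ?thesis using ri by (simp add: g_def)
        qed
        moreover have "w \<in> s r" using \<open>m = 0 \<or> m = len r\<close> m s_N[OF ri(1)] by auto
        ultimately show "e \<in> g ` star s R w" using ri(1) s_loopless[OF ri(1)] by (auto simp: star_def)
      qed
    qed
  qed
  then show ?thesis using degree_H bij_betw_same_card by metis
qed

lemma path_P_loopless: "r \<in> R \<Longrightarrow> is_path H (N r 0) (N r (len r)) (P r)"
  using path_P ends_distinct by blast

text \<open>A cycle through the first edge of the class exists because the skeleton edge is covered;
  being an even set, it contains the whole class.\<close>

lemma ear_P:
  assumes r: "r \<in> R" and deg: "\<And>w. w \<in> vs s R \<Longrightarrow> 3 \<le> card (star s R w)" and cov: "covers R (evens s R)"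
  shows "is_ear H (N r 0) (N r (len r)) (P r)"
  unfolding is_ear_def
proof (intro conjI ballI)
  show "is_path H (N r 0) (N r (len r)) (P r)" using path_P_loopless[OF r] .
  show "degree H w = 2" if w: "w \<in> verts (H \<restriction> P r) - {N r 0, N r (len r)}" for w
  proof -
    obtain i where i: "i \<le> len r" "w = N r i" using w vs_P[OF r] by auto
    then have "0 < i" "i < len r" using w by (cases "i = 0"; cases "i = len r"; auto)+
    then show ?thesis using degree_inner[OF r] i by simp
  qed
  show "3 \<le> degree H (N r 0)" "3 \<le> degree H (N r (len r))"
    using degree_end deg end_in_vs[OF r] by auto
  obtain Y where Y: "Y \<in> evens s R" "r \<in> Y" using cov r by (auto simp: covers_def)
  have "\<Union> (P ` Y) \<in> evens (ends H) (edges H)" using Y evens_blow_up by (auto simp: blow_up_def)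
  moreover have "L r 0 \<in> \<Union> (P ` Y)" using L_in_P[OF r len_pos[OF r]] Y by auto
  ultimately have "\<exists>C. is_cycle H C \<and> C \<subseteq> \<Union> (P ` Y) \<and> L r 0 \<in> C"
    by (intro even_contains_cycle) (simp_all add: n_ok)
  then obtain C where C: "is_cycle H C" "L r 0 \<in> C" by blast
  have "C \<in> evens n E" using cycle_in_evens[OF graph_mk[OF n_ok] C(1)] by simp
  then have "P r \<subseteq> C" using even_whole[OF r _ L_in_P[OF r len_pos[OF r]] C(2)] by simp
  then show "\<exists>C. is_cycle H C \<and> P r \<subseteq> C" using C by blast
qed

text \<open>Vertices of the skeleton have degree at least three and inner vertices of classes have
  degree two. An ear therefore cannot pass through a skeleton vertex in its interior, and cannot end
  inside a class.\<close>

lemma ear_is_P: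
  assumes ear: "is_ear H u v Q" and deg: "\<And>w. w \<in> vs s R \<Longrightarrow> 3 \<le> card (star s R w)"
  shows "\<exists>r\<in>R. Q = P r"
proof -
  have path: "is_path H u v Q" and d2: "\<And>w. w \<in> vs n Q \<Longrightarrow> w \<noteq> u \<Longrightarrow> w \<noteq> v \<Longrightarrow> degree H w = 2"
    and duv: "3 \<le> degree H u" "3 \<le> degree H v"
    using ear by (auto simp: is_ear_def)
  obtain xs es where p: "length xs = Suc (length es)" "distinct xs" "hd xs = u" "last xs = v" "set es = Q"
      "\<And>i. i < length es \<Longrightarrow> n (es ! i) = {xs ! i, xs ! Suc i}" and uv: "u \<noteq> v" and QE: "Q \<subseteq> E"
    using path by (auto simp: is_path_def)
  have u0: "u = xs ! 0" using p(1,3) by (cases xs) auto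
  have vl: "v = xs ! length es" using p(1,4) by (cases xs rule: rev_cases) (auto simp: nth_append)
  have esne: "es \<noteq> []" using uv u0 vl by auto
  have inn: "\<exists>m. Suc m < length es \<and> w = xs ! Suc m" if w: "w \<in> vs n Q" "degree H w = 2" for w
  proof -
    obtain i where i: "i < length es" "w \<in> n (es ! i)" using w(1) p(5) by (auto simp: vs_def in_set_conv_nth)
    then have "w = xs ! i \<or> w = xs ! Suc i" using p(6)[OF i(1)] by simp
    then obtain j where j: "j \<le> length es" "w = xs ! j" using i(1) by (metis less_imp_le Suc_leI)
    have "w \<noteq> u" "w \<noteq> v" using w(2) duv by auto
    then have "j \<noteq> 0" "j \<noteq> length es" using j(2) u0 vl by metis+
    then show ?thesis using j by (intro exI[of _ "j - 1"]) auto
  qed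
  have deg2: "degree H (xs ! Suc m) = 2" if m: "Suc m < length es" for m
  proof (rule d2)
    have "xs ! Suc m \<in> n (es ! m)" "es ! m \<in> Q" using p(5,6) m by auto
    then show "xs ! Suc m \<in> vs n Q" by (auto simp: vs_def)
    show "xs ! Suc m \<noteq> u" "xs ! Suc m \<noteq> v" unfolding u0 vl using p(1,2) m by (auto simp: nth_eq_iff_index_eq)
  qed
  have es_ne: "es ! m \<noteq> es ! Suc m" if m: "Suc m < length es" for m
  proof
    assume eq: "es ! m = es ! Suc m"
    have "n (es ! m) = {xs ! m, xs ! Suc m}" "n (es ! Suc m) = {xs ! Suc m, xs ! Suc (Suc m)}" using p(6) m by auto
    then have "xs ! m \<in> {xs ! Suc m, xs ! Suc (Suc m)}" using eq by auto
    then show False using p(1,2) m by (auto simp: nth_eq_iff_index_eq)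
  qed
  have at: "{e \<in> E. N r (Suc i) \<in> n e} = {L r i, L r (Suc i)}" if "r \<in> R" "Suc i < len r" for r i
    using edges_at_inner[OF that] .
  \<comment> \<open>An inner vertex of a class that lies on the ear is no end of it, so two
    consecutive edges of the ear meet there, and these are the only two edges at that
    vertex.\<close>
  have both: "L r i \<in> Q \<longleftrightarrow> L r (Suc i) \<in> Q" if r: "r \<in> R" and i: "Suc i < len r" for r i
  proof -
    have "L r i \<in> Q \<and> L r (Suc i) \<in> Q" if one: "L r i \<in> Q \<or> L r (Suc i) \<in> Q"
    proof -
      have "N r (Suc i) \<in> n (L r i)" "N r (Suc i) \<in> n (L r (Suc i))" using n_L[OF r] i by auto
      then have "N r (Suc i) \<in> vs n Q" using one unfolding vs_def by blast
      then obtain m where m: "Suc m < length es" "N r (Suc i) = xs ! Suc m"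
        using inn degree_inner[OF r, of "Suc i"] i by auto
      have "N r (Suc i) \<in> n (es ! m)" "N r (Suc i) \<in> n (es ! Suc m)" "es ! m \<in> E" "es ! Suc m \<in> E"
        using p(5) p(6)[of m] p(6)[of "Suc m"] QE m by auto
      then have "es ! m \<in> {L r i, L r (Suc i)}" "es ! Suc m \<in> {L r i, L r (Suc i)}"
        unfolding at[OF r i, symmetric] by simp_all
      then have "{es ! m, es ! Suc m} = {L r i, L r (Suc i)}" using es_ne[OF m(1)] by auto
      moreover have "{es ! m, es ! Suc m} \<subseteq> Q" using p(5) m by auto
      ultimately show ?thesis by auto
    qed
    then show ?thesis by blast
  qed
  have "es ! 0 \<in> E" using esne p(5) QE by auto
  then obtain r i0 where r: "r \<in> R" "i0 < len r" "es ! 0 = L r i0" by (rule E_cases)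
  have "L r i \<in> Q \<longleftrightarrow> L r 0 \<in> Q" if "i < len r" for i
    using that both[OF r(1)] by (induction i) auto
  moreover have "L r i0 \<in> Q" using r(3) esne p(5) by (metis length_greater_0_conv nth_mem)
  ultimately have "\<forall>i<len r. L r i \<in> Q" using r(2) by blast
  then have PQ: "P r \<subseteq> Q" unfolding L_image[OF r(1), symmetric] by auto
  \<comment> \<open>Conversely, the ear never leaves the class of its first edge, since it could do
    so only at a vertex of the skeleton.\<close>
  have "es ! m \<in> P r" if "m < length es" for m
    using that
  proof (induction m)
    case 0
    then show ?case using r L_in_P by auto
  next
    case (Suc m)
    then have IH: "es ! m \<in> P r" by simp
    have "xs ! Suc m \<in> n (es ! m)" "xs ! Suc m \<in> n (es ! Suc m)" using p(6) Suc.prems by auto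
    moreover obtain j where j: "j < len r" "es ! m = L r j" using P_cases[OF r(1) IH] .
    ultimately have "xs ! Suc m = N r j \<or> xs ! Suc m = N r (Suc j)" using n_L[OF r(1) j(1)] by auto
    then obtain l where l: "l \<le> len r" "xs ! Suc m = N r l" using j(1) by (metis less_imp_le Suc_leI)
    have "xs ! Suc m \<notin> vs s R"
    proof
      assume "xs ! Suc m \<in> vs s R"
      then show False using degree_end deg deg2[OF Suc.prems] by fastforce
    qed
    then have "0 < l \<and> l < len r" using inner_of_new[OF r(1) l(1)] l(2) by simp
    then obtain l' where "l = Suc l'" "Suc l' < len r" by (cases l) auto
    note l' = this
    have "es ! Suc m \<in> E" using QE p(5) Suc.prems by auto
    then have "es ! Suc m \<in> {L r l', L r (Suc l')}"
      unfolding at[OF r(1) l'(2), symmetric] using l(2) l'(1) \<open>xs ! Suc m \<in> n (es ! Suc m)\<close> by simp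
    then show ?case using L_in_P[OF r(1)] l'(2) by auto
  qed
  then have "Q \<subseteq> P r" using p(5) by (metis in_set_conv_nth subsetI)
  then show ?thesis using PQ r(1) by blast
qed

end

section \<open>Construction of subdivisions\<close>

lemma subdivision_exists:
  fixes s :: "'e \<Rightarrow> nat set"
  assumes ok: "ends_ok s R" and finE: "finite E" and cp: "class_partition E R P"
  shows "\<exists>n N L len. subdivided s R P E n (N :: 'e \<Rightarrow> nat \<Rightarrow> nat) L len"
proof -
  have PE: "P r \<subseteq> E" if "r \<in> R" for r using cp that by (auto simp: class_partition_def)
  have Pdis: "r = r'" if "r \<in> R" "r' \<in> R" "e \<in> P r" "e \<in> P r'" for r r' e
    using cp that unfolding class_partition_def by blast
  have "\<forall>r. \<exists>l. r \<in> R \<longrightarrow> set l = P r \<and> distinct l"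
  proof
    fix r show "\<exists>l. r \<in> R \<longrightarrow> set l = P r \<and> distinct l"
      using finite_distinct_list[OF finite_subset[OF PE[of r] finE]] by (cases "r \<in> R") auto
  qed
  then obtain l where l: "\<And>r. r \<in> R \<Longrightarrow> set (l r) = P r \<and> distinct (l r)" by metis
  have "\<forall>r. \<exists>u v. r \<in> R \<longrightarrow> s r = {u, v}"
  proof (intro allI)
    fix r show "\<exists>u v. r \<in> R \<longrightarrow> s r = {u, v}"
      using ends_okD(2)[OF ok, of r] by (cases "r \<in> R") (auto simp: card_1_singleton_iff card_2_iff intro: exI)
  qed
  then obtain u v where uv: "\<And>r. r \<in> R \<Longrightarrow> s r = {u r, v r}" by metis
  obtain f :: "'e \<Rightarrow> nat" where f: "inj_on f E" using finite_imp_inj_to_nat_seg[OF finE] by metis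
  \<comment> \<open>A bound above all vertices of the skeleton; the inserted 0 keeps the maximum
    defined if there are none.\<close>
  define b where "b = Suc (Max (insert 0 (vs s R)))"
  have bnd: "x < b" if "x \<in> vs s R" for x
    using that ends_okD(5)[OF ok] by (auto simp: b_def less_Suc_eq_le)
  define L where "L r i = l r ! i" for r i
  define len where "len r = length (l r)" for r
  \<comment> \<open>An inner vertex is named after the edge that follows it. These names are new
    because they are at least \<open>b\<close>, and distinct because \<open>f\<close> is injective
    on the edges.\<close>
  define N where "N r i = (if i = 0 then u r else if i = len r then v r else b + f (L r i))" for r i
  define cl where "cl e = (THE r. r \<in> R \<and> e \<in> P r)" for e
  define ix where "ix e = (THE i. i < len (cl e) \<and> L (cl e) i = e)" for e
  define n where "n e = {N (cl e) (ix e), N (cl e) (Suc (ix e))}" for e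
  have LP: "L r i \<in> P r" if "r \<in> R" "i < len r" for r i using l[OF that(1)] that(2) nth_mem by (fastforce simp: L_def len_def)
  have Linj: "L r i = L r j \<Longrightarrow> i = j" if "r \<in> R" "i < len r" "j < len r" for r i j
    using l[OF that(1)] that(2,3) by (simp add: L_def len_def nth_eq_iff_index_eq)
  have cl: "cl (L r i) = r" if "r \<in> R" "i < len r" for r i
    unfolding cl_def using LP[OF that] that(1) Pdis by (intro the_equality) auto
  have ix: "ix (L r i) = i" if "r \<in> R" "i < len r" for r i
    unfolding ix_def cl[OF that] using that Linj by (intro the_equality) auto
  have fin: "r = r' \<and> i = j" if "r \<in> R" "r' \<in> R" "i < len r" "j < len r'" "f (L r i) = f (L r' j)" for r r' i j
  proof -
    have "L r i \<in> E" "L r' j \<in> E" using LP PE that by blast+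
    then have eq: "L r i = L r' j" using f that(5) by (auto dest: inj_onD)
    then have "r = r'" using cl that by metis
    then show ?thesis using Linj eq that by blast
  qed
  have "subdivided s R P E n N L len"
  proof
    fix r assume r: "r \<in> R"
    show "0 < len r" using l[OF r] cp r by (auto simp: len_def class_partition_def)
    show "inj_on (L r) {..<len r}" using Linj[OF r] by (auto intro: inj_onI)
    show "L r ` {..<len r} = P r"
      using l[OF r] by (auto simp: L_def len_def set_conv_nth)
    show "n (L r i) = {N r i, N r (Suc i)}" if "i < len r" for i using cl[OF r that] ix[OF r that] by (simp add: n_def)
    show "s r = {N r 0, N r (len r)}" using uv[OF r] \<open>0 < len r\<close> by (simp add: N_def)
    show "N r i \<notin> vs s R" if "0 < i" "i < len r" for i using that bnd[of "N r i"] by (auto simp: N_def)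
    show "r = r' \<and> i = j" if "r' \<in> R" "0 < i" "i < len r" "0 < j" "j < len r'" "N r i = N r' j" for r' i j
      using fin[OF r that(1,3,5)] that by (simp add: N_def)
  qed (use ok finE cp in auto)
  then show ?thesis by blast
qed

lemma is_path_sym:
  assumes "is_path G u v Q"
  shows "is_path G v u Q"
proof -
  obtain xs es where p: "length xs = Suc (length es)" "distinct xs" "hd xs = u" "last xs = v" "set es = Q"
      "\<forall>i<length es. ends G (es ! i) = {xs ! i, xs ! Suc i}" and uv: "u \<noteq> v" "Q \<subseteq> edges G"
    using assms by (auto simp: is_path_def)
  have ne: "xs \<noteq> []" using p(1) by auto
  have "ends G (rev es ! i) = {rev xs ! i, rev xs ! Suc i}" if i: "i < length es" for i
  proof -
    define j where "j = length es - Suc i"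
    have j: "j < length es" "rev es ! i = es ! j" using i by (auto simp: j_def rev_nth)
    have "rev xs ! i = xs ! Suc j" "rev xs ! Suc i = xs ! j" using i p(1) by (auto simp: j_def rev_nth Suc_diff_Suc)
    then show ?thesis using p(6) j by (simp add: insert_commute)
  qed
  then show ?thesis
    unfolding is_path_def using p uv ne by (intro conjI exI[of _ "rev xs"] exI[of _ "rev es"]) (auto simp: hd_rev last_rev)
qed

lemma is_ear_sym: "is_ear G u v Q \<Longrightarrow> is_ear G v u Q"
  unfolding is_ear_def using is_path_sym[of G u v Q] by (auto simp: insert_commute)

lemma is_path_restrict: "is_path G u v Q \<Longrightarrow> Q \<subseteq> X \<Longrightarrow> is_path (G \<restriction> X) u v Q"
  unfolding is_path_def restrict_simps by blast

lemma restrict_restrict [simp]: "(G \<restriction> X) \<restriction> Y = G \<restriction> Y"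
  by (simp add: edge_restrict_def)

lemma mk_restrict: "mk n E \<restriction> E = mk n E"
  by (simp add: edge_restrict_def mk_def vs_def)

text \<open>Passes from the skeleton to a model graph \<open>K\<close> with vertices and edges of
  other types, along the isomorphism given by \<open>\<phi>\<close> and
  \<open>\<beta>\<close>.\<close>

lemma subdivision_via_transport:
  assumes sv: "subdivision_via H (mk s R) id P" and b: "bij_betw \<beta> (edges K) R"
    and \<phi>: "inj_on \<phi> (verts K)" "\<phi> ` verts K = vs s R" and e: "\<And>e. e \<in> edges K \<Longrightarrow> \<phi> ` ends K e = s (\<beta> e)"
  shows "subdivision_via H K \<phi> (P \<circ> \<beta>)"
proof -
  have R: "R = \<beta> ` edges K" and inj: "inj_on \<beta> (edges K)" using b by (auto simp: bij_betw_def)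
  have sv': "verts H = vs s R \<union> (\<Union>e\<in>R. verts (H \<restriction> P e))" "edges H = (\<Union>e\<in>R. P e)"
    "\<forall>e\<in>R. \<exists>u v. s e = {u, v} \<and> (if u = v then is_cycle H (P e) else is_path H u v (P e))"
    "\<forall>e\<in>R. verts (H \<restriction> P e) \<inter> vs s R = s e"
    "\<forall>e\<in>R. \<forall>f\<in>R. e \<noteq> f \<longrightarrow> P e \<inter> P f = {} \<and> verts (H \<restriction> P e) \<inter> verts (H \<restriction> P f) \<subseteq> vs s R"
    using sv unfolding subdivision_via_def by simp_all
  have \<beta>R: "\<beta> e \<in> R" if "e \<in> edges K" for e using that R by auto
  show ?thesis
    unfolding subdivision_via_def
  proof (intro conjI ballI impI)
    show "inj_on \<phi> (verts K)" by (rule \<phi>(1))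
    show "verts H = \<phi> ` verts K \<union> (\<Union>e\<in>edges K. verts (H \<restriction> (P \<circ> \<beta>) e))"
      unfolding \<phi>(2) sv'(1) unfolding R by simp
    show "edges H = (\<Union>e\<in>edges K. (P \<circ> \<beta>) e)" unfolding sv'(2) R by simp
    fix f assume f: "f \<in> edges K"
    show "\<exists>u v. \<phi> ` ends K f = {u, v} \<and> (if u = v then is_cycle H ((P \<circ> \<beta>) f) else is_path H u v ((P \<circ> \<beta>) f))"
      unfolding e[OF f] comp_apply by (rule bspec[OF sv'(3) \<beta>R[OF f]])
    show "verts (H \<restriction> (P \<circ> \<beta>) f) \<inter> \<phi> ` verts K = \<phi> ` ends K f"
      using bspec[OF sv'(4) \<beta>R[OF f]] e[OF f] \<phi>(2) by simp
    fix g assume g: "g \<in> edges K" "f \<noteq> g"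
    have "\<beta> f \<noteq> \<beta> g" using inj f g by (auto dest: inj_onD)
    then show "(P \<circ> \<beta>) f \<inter> (P \<circ> \<beta>) g = {}" "verts (H \<restriction> (P \<circ> \<beta>) f) \<inter> verts (H \<restriction> (P \<circ> \<beta>) g) \<subseteq> \<phi> ` verts K"
      using bspec[OF bspec[OF sv'(5) \<beta>R[OF f]] \<beta>R[OF g(1)]] \<phi>(2) by simp_all
  qed
qed

lemma list_partition_classes:
  assumes cp: "class_partition E R P" and ys: "distinct ys" "set ys = R"
  shows "list_partition E (map P ys)"
proof -
  have dis: "P r \<inter> P r' = {}" if "r \<in> R" "r' \<in> R" "r \<noteq> r'" for r r'
    using cp that by (auto simp: class_partition_def)
  have ne: "r \<in> P r" if "r \<in> R" for r using cp that by (auto simp: class_partition_def)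
  have "inj_on P R"
    by (rule inj_onI) (use dis ne in blast)
  moreover have "partition_on E (P ` R)"
    unfolding partition_on_def
  proof (intro conjI)
    show "\<Union> (P ` R) = E" using cp by (simp add: class_partition_def)
    show "disjoint (P ` R)" unfolding disjoint_def using dis by blast
    show "{} \<notin> P ` R" using ne by blast
  qed
  ultimately show ?thesis using ys by (simp add: list_partition_def distinct_map)
qed

context subdivided
begin

lemma path_between:
  assumes "r \<in> R" "s r = {u, v}" "u \<noteq> v"
  shows "is_path H u v (P r)"
proof -
  have "{N r 0, N r (len r)} = {u, v}" using s_N[OF assms(1)] assms(2) by simp
  then have "(N r 0 = u \<and> N r (len r) = v) \<or> (N r 0 = v \<and> N r (len r) = u)" by (simp add: doubleton_eq_iff)
  then show ?thesis using path_P[OF assms(1)] assms(3) is_path_sym by auto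
qed

text \<open>The functions \<open>f\<close> and \<open>g\<close> orient the skeleton edges, since
  \<open>path_union\<close> speaks of ordered pairs of ends.\<close>

lemma path_unionI:
  assumes X: "X \<subseteq> R" and o: "\<And>r. r \<in> X \<Longrightarrow> s r = {f r, g r} \<and> f r \<noteq> g r"
  shows "path_union (H \<restriction> \<Union> (P ` X)) ((\<lambda>r. (f r, g r, P r)) ` X)"
proof -
  let ?G = "H \<restriction> \<Union> (P ` X)"
  have rs: "?G \<restriction> P r = H \<restriction> P r" for r by simp
  have path: "is_path ?G (f r) (g r) (P r)" if "r \<in> X" for r
    by (rule is_path_restrict[OF path_between]) (use X o that in auto)
  have meet: "vs n (P r) \<inter> vs n (P r') \<subseteq> {f r, g r} \<inter> {f r', g r'}" if "r \<in> X" "r' \<in> X" "r \<noteq> r'" for r r'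
    using vs_P_disjoint[of r r'] that X o[of r] o[of r'] by auto
  show ?thesis
    unfolding path_union_def restrict_restrict restrict_simps mk_simps ball_simps UN_simps prod.case
  proof (intro conjI ballI impI)
    show "is_path ?G (f r) (g r) (P r)" if "r \<in> X" for r by (rule path[OF that])
    show "vs n (P r) \<inter> vs n (P r') \<subseteq> {f r, g r} \<inter> {f r', g r'}"
      if "r \<in> X" "r' \<in> X" "(f r, g r, P r) \<noteq> (f r', g r', P r')" for r r'
      by (rule meet[OF that(1,2)]) (use that(3) in auto)
  qed (auto simp: vs_def)
qed

lemma parallel_pathsI:
  assumes I: "g ` I \<subseteq> R" and st: "\<And>i. i \<in> I \<Longrightarrow> s (g i) = {u, v}" "u \<noteq> v"
  shows "parallel_paths (H \<restriction> (\<Union>i\<in>I. P (g i))) (\<lambda>i. P (g i)) I"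
proof -
  have "path_union (H \<restriction> \<Union> (P ` (g ` I))) ((\<lambda>r. (u, v, P r)) ` (g ` I))"
    by (rule path_unionI[OF I, of "\<lambda>_. u" "\<lambda>_. v"]) (use st in auto)
  moreover have "(\<lambda>r. (u, v, P r)) ` (g ` I) = {(u, v, P (g i)) | i. i \<in> I}" by auto
  moreover have "\<Union> (P ` (g ` I)) = (\<Union>i\<in>I. P (g i))" by auto
  ultimately show ?thesis unfolding parallel_paths_def using st(2) by auto
qed

lemma parallel_paths_with_cycleI:
  assumes I: "R = insert e\<^sub>0 (g ` I)" "e\<^sub>0 \<notin> g ` I" "I \<noteq> {}" and e0: "s e\<^sub>0 = {u}"
    and st: "\<And>i. i \<in> I \<Longrightarrow> s (g i) = {u, v}" "u \<noteq> v"
  shows "parallel_paths_with_cycle H (\<lambda>i. P (g i)) I (P e\<^sub>0)"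
  unfolding parallel_paths_with_cycle_def
proof (intro conjI)
  have e0R: "e\<^sub>0 \<in> R" and gR: "g ` I \<subseteq> R" using I by auto
  show "edges H = (\<Union>i\<in>I. P (g i)) \<union> P e\<^sub>0" using E_eq I(1) by auto
  show "verts H = verts (H \<restriction> edges H)" by simp
  show "parallel_paths (H \<restriction> (\<Union>i\<in>I. P (g i))) (\<lambda>i. P (g i)) I" by (rule parallel_pathsI[OF gR st])
  have "{N e\<^sub>0 0, N e\<^sub>0 (len e\<^sub>0)} = {u}" using s_N[OF e0R] e0 by simp
  then have "N e\<^sub>0 0 = N e\<^sub>0 (len e\<^sub>0)" by auto
  then show "is_cycle H (P e\<^sub>0)" by (rule cycle_P[OF e0R])
  have "vs n (\<Union>i\<in>I. P (g i)) \<inter> vs n (P e\<^sub>0) = {u}"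
  proof
    show "vs n (\<Union>i\<in>I. P (g i)) \<inter> vs n (P e\<^sub>0) \<subseteq> {u}"
    proof
      fix x assume x: "x \<in> vs n (\<Union>i\<in>I. P (g i)) \<inter> vs n (P e\<^sub>0)"
      then obtain i where i: "i \<in> I" "x \<in> vs n (P (g i))" by (auto simp: vs_def)
      then have "g i \<in> R" "g i \<noteq> e\<^sub>0" using I by auto
      then show "x \<in> {u}" using vs_P_disjoint[OF \<open>g i \<in> R\<close> e0R] x i(2) e0 by blast
    qed
    obtain i where i: "i \<in> I" using I(3) by auto
    then have "u \<in> vs n (P (g i))" "u \<in> vs n (P e\<^sub>0)"
      using vs_P_Int[OF subsetD[OF gR imageI[OF i]]] vs_P_Int[OF e0R] st(1)[OF i] e0 by auto
    then show "{u} \<subseteq> vs n (\<Union>i\<in>I. P (g i)) \<inter> vs n (P e\<^sub>0)" using i by (auto simp: vs_def)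
  qed
  then show "\<exists>w. verts (H \<restriction> (\<Union>i\<in>I. P (g i))) \<inter> verts (H \<restriction> P e\<^sub>0) = {w}" by simp
qed

end

section \<open>Recognition of the exceptional pairs\<close>

lemma type_aI:
  assumes 1: "subdivided s R P E n N L len" and 2: "subdivided s' R P E n' N' L' len'"
    and c: "card R \<ge> 4" and uv: "u \<noteq> v" "\<And>e. e \<in> R \<Longrightarrow> s e = {u, v}"
    and e0: "e\<^sub>0 \<in> R" "s' e\<^sub>0 = {u'}" and uv': "u' \<noteq> v'" "\<And>e. e \<in> R - {e\<^sub>0} \<Longrightarrow> s' e = {u', v'}"
  shows "type_a (mk n E) (mk n' E)"
proof -
  interpret H: subdivided s R P E n N L len by (rule 1)
  interpret H': subdivided s' R P E n' N' L' len' by (rule 2)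
  have finR: "finite R" using H.s_ok ends_okD(1) by blast
  obtain xs where xs: "set xs = R - {e\<^sub>0}" "distinct xs" using finite_distinct_list[of "R - {e\<^sub>0}"] finR by auto
  \<comment> \<open>In type (a) the cycle of the second graph has index 0, so
    \<open>e\<^sub>0\<close> heads the list.\<close>
  define ys where "ys = e\<^sub>0 # xs"
  have ys: "distinct ys" "set ys = R" using xs e0 by (auto simp: ys_def)
  define m where "m = length xs"
  have "length ys = card R" using ys distinct_card by metis
  then have m: "m \<ge> 3" "length ys = Suc m" using c by (auto simp: ys_def m_def)
  let ?g = "\<lambda>i. ys ! i"
  have im: "?g ` {0..m} = R"
    using ys(2) m(2) by (auto simp: set_conv_nth less_Suc_eq_le)
  have im1: "?g ` {1..m} = R - {e\<^sub>0}"
  proof -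
    have "{0..m} = insert 0 {1..m}" by auto
    then have "R = insert e\<^sub>0 (?g ` {1..m})" using im by (simp add: ys_def)
    moreover have "e\<^sub>0 \<notin> ?g ` {1..m}"
    proof
      assume "e\<^sub>0 \<in> ?g ` {1..m}"
      then obtain i where "i \<in> {1..m}" "ys ! i = ys ! 0" by (auto simp: ys_def)
      then show False using ys(1) m(2) by (auto simp: nth_eq_iff_index_eq)
    qed
    ultimately show ?thesis by auto
  qed
  have lp: "list_partition E (map (\<lambda>i. P (?g i)) [0..<Suc m])"
  proof -
    have "map (\<lambda>i. P (?g i)) [0..<Suc m] = map P (map ((!) ys) [0..<length ys])" using m(2) by simp
    also have "\<dots> = map P ys" by (simp only: map_nth)
    finally show ?thesis using list_partition_classes[OF H.cp ys] by simp
  qed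
  have pp: "parallel_paths (mk n E) (\<lambda>i. P (?g i)) {0..m}"
  proof -
    have "(\<Union>i\<in>{0..m}. P (?g i)) = E" using H.E_eq im by blast
    then show ?thesis
      using H.parallel_pathsI[of ?g "{0..m}" u v] im uv mk_restrict[of n E] by auto
  qed
  have "parallel_paths_with_cycle (mk n' E) (\<lambda>i. P (?g i)) {1..m} (P e\<^sub>0)"
  proof (rule H'.parallel_paths_with_cycleI[where u = u' and v = v'])
    show "s' (?g i) = {u', v'}" if "i \<in> {1..m}" for i using uv'(2) im1 that by blast
  qed (use im1 e0 m uv' in auto)
  moreover have "?g 0 = e\<^sub>0" by (simp add: ys_def)
  ultimately show ?thesis
    unfolding type_a_def using m(1) lp pp by (intro exI[of _ m] exI[of _ "\<lambda>i. P (?g i)"]) simp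
qed

lemma type_bI:
  assumes 1: "subdivided s R P E n N L len" and 2: "subdivided s' R P E n' N' L' len'"
    and c: "card R \<ge> 4" and ef: "e\<^sub>0 \<noteq> f\<^sub>0"
    and e0: "e\<^sub>0 \<in> R" "s e\<^sub>0 = {u}" and uv: "u \<noteq> v" "\<And>e. e \<in> R - {e\<^sub>0} \<Longrightarrow> s e = {u, v}"
    and f0: "f\<^sub>0 \<in> R" "s' f\<^sub>0 = {u'}" and uv': "u' \<noteq> v'" "\<And>e. e \<in> R - {f\<^sub>0} \<Longrightarrow> s' e = {u', v'}"
  shows "type_b (mk n E) (mk n' E)"
proof -
  interpret H: subdivided s R P E n N L len by (rule 1)
  interpret H': subdivided s' R P E n' N' L' len' by (rule 2)
  have finR: "finite R" using H.s_ok ends_okD(1) by blast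
  obtain xs where xs: "set xs = R - {e\<^sub>0, f\<^sub>0}" "distinct xs" using finite_distinct_list[of "R - {e\<^sub>0, f\<^sub>0}"] finR by auto
  \<comment> \<open>In type (b) the classes that form cycles have the indices 0 and
    \<open>n\<close>, hence the first and the last position.\<close>
  define ys where "ys = e\<^sub>0 # xs @ [f\<^sub>0]"
  have ys: "distinct ys" "set ys = R" using xs e0 f0 ef by (auto simp: ys_def)
  define m where "m = Suc (length xs)"
  have "length ys = card R" using ys distinct_card by metis
  then have m: "m \<ge> 3" "length ys = Suc m" using c by (auto simp: ys_def m_def)
  let ?g = "\<lambda>i. ys ! i"
  have im: "?g ` {0..m} = R"
    using ys(2) m(2) by (auto simp: set_conv_nth less_Suc_eq_le)
  have inj: "ys ! i = ys ! j \<longleftrightarrow> i = j" if "i \<le> m" "j \<le> m" for i j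
    using ys(1) m(2) that by (auto simp: nth_eq_iff_index_eq)
  have g0: "?g 0 = e\<^sub>0" and gm: "?g m = f\<^sub>0" by (simp_all add: ys_def m_def nth_append)
  have im1: "?g ` {1..m} = R - {e\<^sub>0}"
  proof -
    have "{0..m} = insert 0 {1..m}" by auto
    then have "R = insert e\<^sub>0 (?g ` {1..m})" using im g0 by simp
    moreover have "e\<^sub>0 \<notin> ?g ` {1..m}" using inj[of _ 0] g0 by force
    ultimately show ?thesis by auto
  qed
  have im2: "?g ` {0..m - 1} = R - {f\<^sub>0}"
  proof -
    have "{0..m} = insert m {0..m - 1}" using m by auto
    then have "R = insert f\<^sub>0 (?g ` {0..m - 1})" using im gm by simp
    moreover have "f\<^sub>0 \<notin> ?g ` {0..m - 1}"
    proof
      assume "f\<^sub>0 \<in> ?g ` {0..m - 1}"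
      then obtain i where "i \<le> m - 1" "ys ! i = ys ! m" using gm by auto
      then show False using inj[of i m] m by auto
    qed
    ultimately show ?thesis by auto
  qed
  have lp: "list_partition E (map (\<lambda>i. P (?g i)) [0..<Suc m])"
  proof -
    have "map (\<lambda>i. P (?g i)) [0..<Suc m] = map P (map ((!) ys) [0..<length ys])" using m(2) by simp
    also have "\<dots> = map P ys" by (simp only: map_nth)
    finally show ?thesis using list_partition_classes[OF H.cp ys] by simp
  qed
  have "parallel_paths_with_cycle (mk n E) (\<lambda>i. P (?g i)) {1..m} (P e\<^sub>0)"
  proof (rule H.parallel_paths_with_cycleI[where u = u and v = v])
    show "s (?g i) = {u, v}" if "i \<in> {1..m}" for i using uv(2) im1 that by blast
  qed (use im1 e0 m uv in auto)
  moreover have "parallel_paths_with_cycle (mk n' E) (\<lambda>i. P (?g i)) {0..m - 1} (P f\<^sub>0)"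
  proof (rule H'.parallel_paths_with_cycleI[where u = u' and v = v'])
    show "s' (?g i) = {u', v'}" if "i \<in> {0..m - 1}" for i using uv'(2) im2 that by blast
  qed (use im2 f0 m uv' in auto)
  ultimately show ?thesis
    unfolding type_b_def using m(1) lp g0 gm by (intro exI[of _ m] exI[of _ "\<lambda>i. P (?g i)"]) simp
qed

text \<open>The skeleton behind type (c), with its single edges numbered as in
  \<open>type_c_graph\<close> and the parallel edges collected in \<open>B\<close>.\<close>

definition four_form :: "('e \<Rightarrow> 'v set) \<Rightarrow> 'e set \<Rightarrow> 'v \<Rightarrow> 'v \<Rightarrow> 'v \<Rightarrow> 'v \<Rightarrow> 'e \<Rightarrow> 'e \<Rightarrow> 'e \<Rightarrow> 'e \<Rightarrow> 'e \<Rightarrow> 'e set \<Rightarrow> bool" where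
  "four_form s R x y a b A\<^sub>1 A\<^sub>2 A\<^sub>3 A\<^sub>4 A\<^sub>5 B \<longleftrightarrow> distinct [x, y, a, b] \<and> distinct [A\<^sub>1, A\<^sub>2, A\<^sub>3, A\<^sub>4, A\<^sub>5] \<and>
     {A\<^sub>1, A\<^sub>2, A\<^sub>3, A\<^sub>4, A\<^sub>5} \<inter> B = {} \<and> R = {A\<^sub>1, A\<^sub>2, A\<^sub>3, A\<^sub>4, A\<^sub>5} \<union> B \<and>
     s A\<^sub>1 = {x, a} \<and> s A\<^sub>2 = {x, b} \<and> s A\<^sub>3 = {y, a} \<and> s A\<^sub>4 = {y, b} \<and> s A\<^sub>5 = {a, b} \<and> (\<forall>e\<in>B. s e = {x, y})"

text \<open>The symmetries of the configuration: exchange of \<open>a\<close> and \<open>b\<close>,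
  and exchange of \<open>x\<close> and \<open>y\<close>.\<close>

lemma four_form_swap:
  "four_form s R x y a b A\<^sub>1 A\<^sub>2 A\<^sub>3 A\<^sub>4 A\<^sub>5 B \<Longrightarrow> four_form s R x y b a A\<^sub>2 A\<^sub>1 A\<^sub>4 A\<^sub>3 A\<^sub>5 B"
  "four_form s R x y a b A\<^sub>1 A\<^sub>2 A\<^sub>3 A\<^sub>4 A\<^sub>5 B \<Longrightarrow> four_form s R y x a b A\<^sub>3 A\<^sub>4 A\<^sub>1 A\<^sub>2 A\<^sub>5 B"
  by (auto simp: four_form_def insert_commute)

lemma type_c_graphI:
  assumes 1: "subdivided s R P E n N L len" and ff: "four_form s R x y a b A\<^sub>1 A\<^sub>2 A\<^sub>3 A\<^sub>4 A\<^sub>5 B"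
    and ys: "set ys = B" "length ys = m"
  shows "type_c_graph (mk n E) (P A\<^sub>1) (P A\<^sub>2) (P A\<^sub>3) (P A\<^sub>4) (P A\<^sub>5) (\<lambda>i. P (ys ! (i - 1))) m"
proof -
  interpret H: subdivided s R P E n N L len by (rule 1)
  note f = ff[unfolded four_form_def]
  define o1 where "o1 r = (if r = A\<^sub>3 \<or> r = A\<^sub>4 then y else if r = A\<^sub>5 then a else x)" for r
  define o2 where "o2 r = (if r = A\<^sub>1 \<or> r = A\<^sub>3 then a else if r = A\<^sub>2 \<or> r = A\<^sub>4 \<or> r = A\<^sub>5 then b else y)" for r
  have R: "R = {A\<^sub>1, A\<^sub>2, A\<^sub>3, A\<^sub>4, A\<^sub>5} \<union> B" using f by blast
  have oB: "o1 r = x" "o2 r = y" if "r \<in> B" for r using that f by (auto simp: o1_def o2_def)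
  have oA: "o1 A\<^sub>1 = x" "o2 A\<^sub>1 = a" "o1 A\<^sub>2 = x" "o2 A\<^sub>2 = b" "o1 A\<^sub>3 = y" "o2 A\<^sub>3 = a" "o1 A\<^sub>4 = y" "o2 A\<^sub>4 = b"
    "o1 A\<^sub>5 = a" "o2 A\<^sub>5 = b" using f by (auto simp: o1_def o2_def)
  have "s r = {o1 r, o2 r} \<and> o1 r \<noteq> o2 r" if r: "r \<in> R" for r
  proof (cases "r \<in> B")
    case True
    then show ?thesis using oB f by auto
  next
    case False
    then have "r = A\<^sub>1 \<or> r = A\<^sub>2 \<or> r = A\<^sub>3 \<or> r = A\<^sub>4 \<or> r = A\<^sub>5" using r R by blast
    then show ?thesis using oA f by (elim disjE) simp_all
  qed
  then have pu: "path_union (mk n E \<restriction> \<Union> (P ` R)) ((\<lambda>r. (o1 r, o2 r, P r)) ` R)"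
    by (intro H.path_unionI) auto
  have "\<Union> (P ` R) = E" using H.E_eq by simp
  moreover have "(\<lambda>r. (o1 r, o2 r, P r)) ` R =
      {(x, a, P A\<^sub>1), (y, a, P A\<^sub>3), (x, b, P A\<^sub>2), (y, b, P A\<^sub>4), (a, b, P A\<^sub>5)} \<union>
      {(x, y, P (ys ! (i - 1))) | i. i \<in> {1..m}}"
  proof -
    have "(\<lambda>r. (o1 r, o2 r, P r)) ` B = (\<lambda>r. (x, y, P r)) ` B" using oB by (intro image_cong) auto
    also have "\<dots> = {(x, y, P (ys ! (i - 1))) | i. i \<in> {1..m}}"
    proof -
      \<comment> \<open>The paths are numbered from 1, the positions in the list from 0.\<close>
      have B: "B = (\<lambda>i. ys ! (i - 1)) ` {1..m}"
      proof
        show "B \<subseteq> (\<lambda>i. ys ! (i - 1)) ` {1..m}"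
        proof
          fix r assume "r \<in> B"
          then obtain i where "i < m" "r = ys ! i" using ys by (metis in_set_conv_nth)
          then show "r \<in> (\<lambda>i. ys ! (i - 1)) ` {1..m}" by (intro image_eqI[of _ _ "Suc i"]) auto
        qed
        show "(\<lambda>i. ys ! (i - 1)) ` {1..m} \<subseteq> B" using ys nth_mem by force
      qed
      show ?thesis unfolding B by blast
    qed
    finally show ?thesis unfolding R image_Un using oA by auto
  qed
  ultimately have "path_union (mk n E) ({(x, a, P A\<^sub>1), (y, a, P A\<^sub>3), (x, b, P A\<^sub>2), (y, b, P A\<^sub>4), (a, b, P A\<^sub>5)} \<union>
      {(x, y, P (ys ! (i - 1))) | i. i \<in> {1..m}})"
    using pu mk_restrict[of n E] by simp
  moreover have "distinct [x, y, a, b]" using f by blast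
  ultimately show ?thesis unfolding type_c_graph_def by blast
qed

lemma type_cI:
  assumes 1: "subdivided s R P E n N L len" and 2: "subdivided s' R P E n' N' L' len'"
    and ff: "four_form s R x y a b A\<^sub>1 A\<^sub>2 A\<^sub>3 A\<^sub>4 A\<^sub>5 B" and ff': "four_form s' R x' y' a' b' A\<^sub>1 A\<^sub>4 A\<^sub>3 A\<^sub>2 A\<^sub>5 B"
    and c: "card B \<ge> 2"
  shows "type_c (mk n E) (mk n' E)"
proof -
  interpret H: subdivided s R P E n N L len by (rule 1)
  have R: "R = {A\<^sub>1, A\<^sub>2, A\<^sub>3, A\<^sub>4, A\<^sub>5} \<union> B" and dA: "distinct [A\<^sub>1, A\<^sub>2, A\<^sub>3, A\<^sub>4, A\<^sub>5]"
    and dB: "{A\<^sub>1, A\<^sub>2, A\<^sub>3, A\<^sub>4, A\<^sub>5} \<inter> B = {}" using ff unfolding four_form_def by blast+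
  have "finite B" using finite_subset[of B R] ends_okD(1)[OF H.s_ok] R by auto
  then obtain ys where ys: "set ys = B" "distinct ys" using finite_distinct_list by blast
  define m where "m = length ys"
  have m: "m \<ge> 2" using distinct_card[OF ys(2)] ys(1) c by (simp add: m_def)
  let ?Q = "\<lambda>i. P (ys ! (i - 1))"
  have "map ?Q [1..<Suc m] = map P ys"
    by (rule nth_equalityI) (auto simp: m_def simp del: upt_Suc)
  then have eq: "[P A\<^sub>1, P A\<^sub>2, P A\<^sub>3, P A\<^sub>4, P A\<^sub>5] @ map ?Q [1..<Suc m] = map P ([A\<^sub>1, A\<^sub>2, A\<^sub>3, A\<^sub>4, A\<^sub>5] @ ys)" by simp
  have "list_partition E (map P ([A\<^sub>1, A\<^sub>2, A\<^sub>3, A\<^sub>4, A\<^sub>5] @ ys))"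
    by (rule list_partition_classes[OF H.cp]) (use ys dA dB R in auto)
  then have lp: "list_partition E ([P A\<^sub>1, P A\<^sub>2, P A\<^sub>3, P A\<^sub>4, P A\<^sub>5] @ map ?Q [1..<Suc m])" using eq by simp
  have t1: "type_c_graph (mk n E) (P A\<^sub>1) (P A\<^sub>2) (P A\<^sub>3) (P A\<^sub>4) (P A\<^sub>5) ?Q m"
    by (rule type_c_graphI[OF 1 ff ys(1)]) (simp add: m_def)
  have t2: "type_c_graph (mk n' E) (P A\<^sub>1) (P A\<^sub>4) (P A\<^sub>3) (P A\<^sub>2) (P A\<^sub>5) ?Q m"
    by (rule type_c_graphI[OF 2 ff' ys(1)]) (simp add: m_def)
  show ?thesis
    unfolding type_c_def mk_simps
    by (rule exI[of _ m], rule exI[of _ "P A\<^sub>1"], rule exI[of _ "P A\<^sub>2"], rule exI[of _ "P A\<^sub>3"],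
        rule exI[of _ "P A\<^sub>4"], rule exI[of _ "P A\<^sub>5"], rule exI[of _ ?Q]) (use m lp t1 t2 in blast)
qed

section \<open>Comparing two skeletons\<close>

text \<open>By \<open>two_isomorphicI\<close> only cycle spaces have to be compared, and both are
  the blow-up of the same skeleton space.\<close>

lemma realize:
  fixes s :: "'e \<Rightarrow> nat set"
  assumes G: "graph G" "edges G = E" "E \<noteq> {}" and ok: "ends_ok s R" and cp: "class_partition E R P"
    and ev: "evens (ends G) E = blow_up P (evens s R)"
  shows "\<exists>n (N :: 'e \<Rightarrow> nat \<Rightarrow> nat) L len. subdivided s R P E n N L len \<and> graph (mk n E) \<and> two_isomorphic G (mk n E)"
proof -
  have "finite E" using G by (auto simp: graph_def)
  then obtain n N L len where sub: "subdivided s R P E n (N :: 'e \<Rightarrow> nat \<Rightarrow> nat) L len"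
    using subdivision_exists[OF ok _ cp] by blast
  interpret subdivided s R P E n N L len by (rule sub)
  have gr: "graph (mk n E)" by (rule graph_mk[OF n_ok])
  have "two_isomorphic G (mk n E)"
    by (rule two_isomorphicI[OF G(1) gr G(2) _ G(3)]) (simp_all add: ev evens_blow_up)
  then show ?thesis using sub gr by blast
qed

lemma contracted_skeleton:
  assumes G: "graph G" "edges G = E" and RE: "R \<subseteq> E"
  shows "\<exists>s :: 'e \<Rightarrow> nat set. ends_ok s R \<and> conn s R \<and> evens s R = (\<lambda>Z. Z \<inter> R) ` evens (ends G) E"
proof -
  obtain K :: "(nat, 'e) mgraph" where K: "graph K" "graph_iso G K" "iso E (ends G) (ends K)"
    using nat_copy[OF G(1)] G(2) by metis
  have "edges K = E" using K(2) G(2) by (simp add: graph_iso_def)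
  then have "ends_ok (ends K) E" using graph_ends_ok[OF K(1)] by simp
  then obtain t :: "'e \<Rightarrow> nat set" where t: "ends_ok t R" "evens t R = (\<lambda>Z. Z \<inter> R) ` evens (ends K) E"
    using contract_set[OF _ RE] by blast
  obtain s :: "'e \<Rightarrow> nat set" where "ends_ok s R" "evens s R = evens t R" "conn s R"
    using connected_representation[OF t(1)] by blast
  then show ?thesis using t(2) iso_evens[OF K(3)] by auto
qed

text \<open>Both graphs have the same series classes, so one set \<open>R\<close> of representatives
  and one map \<open>P\<close> serve both skeletons, and each skeleton competes with the cycle space
  of the other.\<close>

lemma skeletons:
  fixes G\<^sub>1 :: "('v, 'e) mgraph" and G\<^sub>2 :: "('w, 'e) mgraph"
  assumes G: "graph G\<^sub>1" "graph G\<^sub>2" and tec: "two_edge_connected G\<^sub>1"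
    and two: "\<exists>C\<in>circuits (bicircular_lift G\<^sub>1). \<exists>D\<in>circuits (bicircular_lift G\<^sub>1). C \<noteq> D"
    and eq: "bicircular_lift G\<^sub>1 = bicircular_lift G\<^sub>2" and E: "edges G\<^sub>1 = E"
    and ne: "evens (ends G\<^sub>1) E \<noteq> evens (ends G\<^sub>2) E"
  shows "\<exists>R P k (s\<^sub>1 :: 'e \<Rightarrow> nat set) (s\<^sub>2 :: 'e \<Rightarrow> nat set). class_partition E R P \<and>
    competitor R s\<^sub>1 k (evens s\<^sub>2 R) \<and> competitor R s\<^sub>2 k (evens s\<^sub>1 R) \<and>
    covers R (evens s\<^sub>1 R) \<and> covers R (evens s\<^sub>2 R) \<and>
    evens (ends G\<^sub>1) E = blow_up P (evens s\<^sub>1 R) \<and> evens (ends G\<^sub>2) E = blow_up P (evens s\<^sub>2 R)"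
proof -
  define \<F>\<^sub>1 where "\<F>\<^sub>1 = evens (ends G\<^sub>1) E"
  define \<F>\<^sub>2 where "\<F>\<^sub>2 = evens (ends G\<^sub>2) E"
  note ls = lift_spaces[OF G tec two eq E[symmetric] \<F>\<^sub>1_def \<F>\<^sub>2_def]
  have sp: "binary_space E \<F>\<^sub>1" "binary_space E \<F>\<^sub>2"
    using binary_space_evens[OF graph_ends_ok[OF G(1)]] binary_space_evens[OF graph_ends_ok[OF G(2)]] E ls(1)
    by (simp_all add: \<F>\<^sub>1_def \<F>\<^sub>2_def)
  obtain k where k: "3 \<le> k" "card (members_in \<F>\<^sub>1 E) = 2 ^ k" using ls(5) by blast
  have ge8: "card (members_in \<F>\<^sub>1 E) \<ge> 8" using power_increasing[OF k(1), of "2::nat"] k(2) by simp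
  then have eq2: "card (members_in \<F>\<^sub>2 E) = 2 ^ k"
    using ls(2)[unfolded agree_def, rule_format, of E] k by simp
  obtain R P where cp: "class_partition E R P" and P1: "\<forall>r\<in>R. P r = {e \<in> E. series \<F>\<^sub>1 r e}"
    using series_classes[OF sp(1)] by blast
  have RE: "R \<subseteq> E" using cp by (simp add: class_partition_def)
  have P2: "\<forall>r\<in>R. P r = {e \<in> E. series \<F>\<^sub>2 r e}"
  proof
    fix r assume "r \<in> R"
    then have r: "r \<in> E" using RE by auto
    have "series \<F>\<^sub>1 r e \<longleftrightarrow> series \<F>\<^sub>2 r e" if "e \<in> E" for e
      using series_agree[OF sp ls(3,4,2) ge8 r that] series_agree[OF sp(2,1) ls(4,3) agree_sym[OF ls(2)] _ r that] eq2 k(2) ge8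
      by auto
    then show "P r = {e \<in> E. series \<F>\<^sub>2 r e}" using P1 \<open>r \<in> R\<close> by auto
  qed
  obtain s\<^sub>1 :: "'e \<Rightarrow> nat set" where s1: "ends_ok s\<^sub>1 R" "conn s\<^sub>1 R" "evens s\<^sub>1 R = (\<lambda>Z. Z \<inter> R) ` \<F>\<^sub>1"
    using contracted_skeleton[OF G(1) E RE] by (auto simp: \<F>\<^sub>1_def)
  obtain s\<^sub>2 :: "'e \<Rightarrow> nat set" where s2: "ends_ok s\<^sub>2 R" "conn s\<^sub>2 R" "evens s\<^sub>2 R = (\<lambda>Z. Z \<inter> R) ` \<F>\<^sub>2"
    using contracted_skeleton[OF G(2) ls(1) RE] by (auto simp: \<F>\<^sub>2_def)
  note k1 = skeleton_space[OF sp(1) ls(3) cp P1 s1(3)] and k2 = skeleton_space[OF sp(2) ls(4) cp P2 s2(3)]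
  have PR: "\<Union> (P ` R) = E" using cp by (simp add: class_partition_def)
  have PX: "\<Union> (P ` X) \<subseteq> E" if "X \<subseteq> R" for X using PR that by blast
  have ag: "agree R (evens s\<^sub>1 R) (evens s\<^sub>2 R)"
    unfolding agree_def
  proof (intro allI impI)
    fix X assume X: "X \<subseteq> R" and "4 \<le> card (members_in (evens s\<^sub>1 R) X) \<or> 4 \<le> card (members_in (evens s\<^sub>2 R) X)"
    then show "card (members_in (evens s\<^sub>1 R) X) = card (members_in (evens s\<^sub>2 R) X)"
      unfolding k1(3)[OF X] k2(3)[OF X] using ls(2) PX[OF X] unfolding agree_def by blast
  qed
  have c: "card (evens s\<^sub>1 R) = 2 ^ k" "card (evens s\<^sub>2 R) = 2 ^ k"
    using k1(3)[of R] k2(3)[of R] PR k(2) eq2 evens_subset[of R R s\<^sub>1] evens_subset[of R R s\<^sub>2] by auto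
  have nes: "evens s\<^sub>1 R \<noteq> evens s\<^sub>2 R" using k1(1) k2(1) ne \<F>\<^sub>1_def \<F>\<^sub>2_def by auto
  have "competitor R s\<^sub>1 k (evens s\<^sub>2 R)" "competitor R s\<^sub>2 k (evens s\<^sub>1 R)"
    unfolding competitor_def
    using s1(1,2) s2(1,2) k1(2) k2(2) c k(1) ag agree_sym[OF ag] nes binary_space_evens[OF s1(1)] binary_space_evens[OF s2(1)]
    by simp_all
  moreover have "covers R (evens s\<^sub>1 R)" "covers R (evens s\<^sub>2 R)"
  proof -
    have "covers R ((\<lambda>Z. Z \<inter> R) ` \<F>)" if "covers E \<F>" for \<F>
      using that RE unfolding covers_def by fastforce
    then show "covers R (evens s\<^sub>1 R)" "covers R (evens s\<^sub>2 R)" using ls(3,4) unfolding s1(3) s2(3) by simp_all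
  qed
  ultimately show ?thesis
    using cp k1(1) k2(1) unfolding \<F>\<^sub>1_def \<F>\<^sub>2_def
    by (intro exI[of _ R] exI[of _ P] exI[of _ k] exI[of _ s\<^sub>1] exI[of _ s\<^sub>2]) simp
qed

section \<open>Two-vertex skeletons\<close>

text \<open>If neither skeleton has a loop, or the same edge is the loop of both, the map
  \<open>?f\<close> is an isomorphism and the cycle spaces agree, which is excluded. A loop in just
  one of them gives type (a), different loops give type (b). The bound \<open>n \<ge> 3\<close> of
  these types comes from \<open>card R = k + 1\<close> and \<open>k \<ge> 3\<close>.\<close>

lemma two_vertex_exceptional:
  assumes c1: "competitor R s\<^sub>1 k (evens s\<^sub>2 R)" and c2: "competitor R s\<^sub>2 k (evens s\<^sub>1 R)"
    and V: "card (vs s\<^sub>1 R) = 2" "card (vs s\<^sub>2 R) = 2"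
    and d1: "subdivided s\<^sub>1 R P E n\<^sub>1 N\<^sub>1 L\<^sub>1 len\<^sub>1" and d2: "subdivided s\<^sub>2 R P E n\<^sub>2 N\<^sub>2 L\<^sub>2 len\<^sub>2"
  shows "exceptional_pair (mk n\<^sub>1 E) (mk n\<^sub>2 E)"
proof -
  have ne: "evens s\<^sub>1 R \<noteq> evens s\<^sub>2 R" and k: "3 \<le> k" using c1 by (auto simp: competitor_def)
  obtain u v where uv: "u \<noteq> v" "card R = k + 1" "(\<forall>e\<in>R. s\<^sub>1 e = {u, v}) \<or>
      (\<exists>e\<^sub>0\<in>R. s\<^sub>1 e\<^sub>0 = {u} \<and> (\<forall>e\<in>R - {e\<^sub>0}. s\<^sub>1 e = {u, v}))"
    using case_two[OF c1 V(1)] by blast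
  obtain u' v' where uv': "u' \<noteq> v'" "(\<forall>e\<in>R. s\<^sub>2 e = {u', v'}) \<or>
      (\<exists>e\<^sub>0\<in>R. s\<^sub>2 e\<^sub>0 = {u'} \<and> (\<forall>e\<in>R - {e\<^sub>0}. s\<^sub>2 e = {u', v'}))"
    using case_two[OF c2 V(2)] by blast
  have c: "card R \<ge> 4" using uv(2) k by simp
  let ?f = "\<lambda>x. if x = u then u' else v'"
  have noiso: "\<not> (\<forall>e\<in>R. s\<^sub>2 e = ?f ` s\<^sub>1 e \<and> s\<^sub>1 e \<subseteq> {u, v})"
  proof
    assume *: "\<forall>e\<in>R. s\<^sub>2 e = ?f ` s\<^sub>1 e \<and> s\<^sub>1 e \<subseteq> {u, v}"
    then have "vs s\<^sub>1 R \<subseteq> {u, v}" by (auto simp: vs_def)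
    moreover have "inj_on ?f {u, v}" using uv(1) uv'(1) by auto
    ultimately have "inj_on ?f (vs s\<^sub>1 R)" by (rule inj_on_subset[rotated])
    then have "iso R s\<^sub>1 s\<^sub>2" using * unfolding iso_def by blast
    then show False using iso_evens ne by metis
  qed
  consider (aa) "\<forall>e\<in>R. s\<^sub>1 e = {u, v}" "\<forall>e\<in>R. s\<^sub>2 e = {u', v'}"
    | (ab) f\<^sub>0 where "\<forall>e\<in>R. s\<^sub>1 e = {u, v}" "f\<^sub>0 \<in> R" "s\<^sub>2 f\<^sub>0 = {u'}" "\<forall>e\<in>R - {f\<^sub>0}. s\<^sub>2 e = {u', v'}"
    | (ba) e\<^sub>0 where "\<forall>e\<in>R. s\<^sub>2 e = {u', v'}" "e\<^sub>0 \<in> R" "s\<^sub>1 e\<^sub>0 = {u}" "\<forall>e\<in>R - {e\<^sub>0}. s\<^sub>1 e = {u, v}"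
    | (bb) e\<^sub>0 f\<^sub>0 where "e\<^sub>0 \<in> R" "s\<^sub>1 e\<^sub>0 = {u}" "\<forall>e\<in>R - {e\<^sub>0}. s\<^sub>1 e = {u, v}"
        "f\<^sub>0 \<in> R" "s\<^sub>2 f\<^sub>0 = {u'}" "\<forall>e\<in>R - {f\<^sub>0}. s\<^sub>2 e = {u', v'}"
    using uv(3) uv'(2) by blast
  then show ?thesis
  proof cases
    case aa
    then have "\<forall>e\<in>R. s\<^sub>2 e = ?f ` s\<^sub>1 e \<and> s\<^sub>1 e \<subseteq> {u, v}" using uv(1) by auto
    then show ?thesis using noiso by contradiction
  next
    case ab
    have "type_a (mk n\<^sub>1 E) (mk n\<^sub>2 E)"
      by (rule type_aI[OF d1 d2 c uv(1) _ ab(2,3) uv'(1)]) (use ab in auto)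
    then show ?thesis by (simp add: exceptional_pair_def)
  next
    case ba
    have "type_a (mk n\<^sub>2 E) (mk n\<^sub>1 E)"
      by (rule type_aI[OF d2 d1 c uv'(1) _ ba(2,3) uv(1)]) (use ba in auto)
    then show ?thesis by (simp add: exceptional_pair_def)
  next
    case bb
    have "e\<^sub>0 \<noteq> f\<^sub>0"
    proof
      assume eq: "e\<^sub>0 = f\<^sub>0"
      have "s\<^sub>2 e = ?f ` s\<^sub>1 e \<and> s\<^sub>1 e \<subseteq> {u, v}" if "e \<in> R" for e
        using bb eq that uv(1) by (cases "e = e\<^sub>0") auto
      then show False using noiso by blast
    qed
    then have "type_b (mk n\<^sub>1 E) (mk n\<^sub>2 E)"
      by (rule type_bI[OF d1 d2 c _ bb(1,2) uv(1) _ bb(4,5) uv'(1)]) (use bb in auto)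
    then show ?thesis by (simp add: exceptional_pair_def)
  qed
qed

section \<open>Three-vertex skeletons\<close>

definition three_form :: "('e \<Rightarrow> 'v set) \<Rightarrow> 'e set \<Rightarrow> 'v \<Rightarrow> 'v \<Rightarrow> 'v \<Rightarrow> nat \<Rightarrow> nat \<Rightarrow> bool" where
  "three_form s R x\<^sub>0 x\<^sub>1 x\<^sub>2 m q \<longleftrightarrow> distinct [x\<^sub>0, x\<^sub>1, x\<^sub>2] \<and> vs s R = {x\<^sub>0, x\<^sub>1, x\<^sub>2} \<and>
    (\<forall>e\<in>R. s e = {x\<^sub>0, x\<^sub>1} \<or> s e = {x\<^sub>1, x\<^sub>2} \<or> s e = {x\<^sub>2, x\<^sub>0}) \<and>
    card (between s R x\<^sub>0 x\<^sub>1) = m \<and> card (between s R x\<^sub>1 x\<^sub>2) = 2 \<and> card (between s R x\<^sub>2 x\<^sub>0) = q"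

lemma three_form_exists:
  assumes c: "competitor R s k \<F>" and V: "card (vs s R) = 3"
  shows "\<exists>x\<^sub>0 x\<^sub>1 x\<^sub>2 m q. three_form s R x\<^sub>0 x\<^sub>1 x\<^sub>2 m q \<and> m \<in> {1, 2} \<and> 2 \<le> q \<and> k = m + q"
  using case_three[OF c V] unfolding three_form_def by blast

text \<open>Among three vertices, a nonempty proper subset or its complement is a single
  vertex.\<close>

lemma cut_three:
  assumes ok: "ends_ok s R" and V: "card (vs s R) = 3" and S: "S \<subseteq> vs s R" "cut s R S \<noteq> {}"
  shows "\<exists>y\<in>vs s R. cut s R S = star s R y"
proof -
  have fin: "finite (vs s R)" using ok by (rule ends_okD)
  have "S \<noteq> {}" using S(2) by (auto simp: cut_def)
  moreover have "S \<noteq> vs s R" using S(2) by (auto simp: cut_def vs_def)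
  ultimately have "card S \<noteq> 0" and "S \<subset> vs s R" using finite_subset[OF S(1) fin] S(1) by simp_all
  moreover from this have "card S < 3" using psubset_card_mono[OF fin, of S] V by simp
  ultimately have "card S = 1 \<or> card S = 2" by linarith
  then show ?thesis
  proof
    assume "card S = 1"
    then obtain y where "S = {y}" by (auto simp: card_1_singleton_iff)
    then show ?thesis using S(1) star_eq_cut[OF ok, of y] by auto
  next
    assume "card S = 2"
    then have "card (vs s R - S) = 1" using V S(1) finite_subset[OF S(1) fin] by (simp add: card_Diff_subset)
    then obtain y where "vs s R - S = {y}" by (auto simp: card_1_singleton_iff)
    then show ?thesis using cut_complement[OF ok, of S] star_eq_cut[OF ok, of y] by auto
  qed
qed

lemma three_form_stars:
  assumes ok: "ends_ok s R" and tf: "three_form s R x\<^sub>0 x\<^sub>1 x\<^sub>2 m q"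
  shows "card (star s R x\<^sub>0) = m + q" "card (star s R x\<^sub>1) = m + 2" "card (star s R x\<^sub>2) = 2 + q"
    "R - star s R x\<^sub>1 = between s R x\<^sub>2 x\<^sub>0"
proof -
  note f = tf[unfolded three_form_def]
  let ?b = "between s R"
  have d: "x\<^sub>0 \<noteq> x\<^sub>1" "x\<^sub>1 \<noteq> x\<^sub>2" "x\<^sub>0 \<noteq> x\<^sub>2" and ends3: "\<And>e. e \<in> R \<Longrightarrow> s e = {x\<^sub>0, x\<^sub>1} \<or> s e = {x\<^sub>1, x\<^sub>2} \<or> s e = {x\<^sub>2, x\<^sub>0}"
    using f by auto
  have two: "card (s e) = 2" if "e \<in> R" for e using ends3[OF that] d by (elim disjE) simp_all
  have inc: "star s R w = {e \<in> R. w \<in> s e}" for w using two by (auto simp: star_def)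
  have mem: "x\<^sub>0 \<in> s e \<longleftrightarrow> s e = {x\<^sub>0, x\<^sub>1} \<or> s e = {x\<^sub>2, x\<^sub>0}" "x\<^sub>1 \<in> s e \<longleftrightarrow> s e = {x\<^sub>0, x\<^sub>1} \<or> s e = {x\<^sub>1, x\<^sub>2}"
    "x\<^sub>2 \<in> s e \<longleftrightarrow> s e = {x\<^sub>1, x\<^sub>2} \<or> s e = {x\<^sub>2, x\<^sub>0}" if "e \<in> R" for e
    using ends3[OF that] d by (auto simp: doubleton_eq_iff)
  have st: "star s R x\<^sub>0 = ?b x\<^sub>0 x\<^sub>1 \<union> ?b x\<^sub>2 x\<^sub>0" "star s R x\<^sub>1 = ?b x\<^sub>0 x\<^sub>1 \<union> ?b x\<^sub>1 x\<^sub>2" "star s R x\<^sub>2 = ?b x\<^sub>1 x\<^sub>2 \<union> ?b x\<^sub>2 x\<^sub>0"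
    unfolding inc between_def using mem by blast+
  have dis: "?b x\<^sub>0 x\<^sub>1 \<inter> ?b x\<^sub>2 x\<^sub>0 = {}" "?b x\<^sub>0 x\<^sub>1 \<inter> ?b x\<^sub>1 x\<^sub>2 = {}" "?b x\<^sub>1 x\<^sub>2 \<inter> ?b x\<^sub>2 x\<^sub>0 = {}"
    using d by (auto simp: between_def doubleton_eq_iff)
  have fin: "finite (?b u v)" for u v using ends_okD(1)[OF ok] by (simp add: between_def)
  show "card (star s R x\<^sub>0) = m + q" "card (star s R x\<^sub>1) = m + 2" "card (star s R x\<^sub>2) = 2 + q"
    unfolding st using dis fin f by (simp_all add: card_Un_disjoint)
  have "R = ?b x\<^sub>0 x\<^sub>1 \<union> ?b x\<^sub>1 x\<^sub>2 \<union> ?b x\<^sub>2 x\<^sub>0" using ends3 by (auto simp: between_def)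
  then show "R - star s R x\<^sub>1 = ?b x\<^sub>2 x\<^sub>0" unfolding st using dis by blast
qed

text \<open>The star of \<open>x\<^sub>1\<close> has \<open>m + 2 < k\<close> edges, so it is a
  cocycle of the other skeleton and hence a star there. Only \<open>y\<^sub>1\<close> can have fewer
  than \<open>k\<close> edges in its star: the star of \<open>y\<^sub>0\<close> has \<open>k\<close>
  edges, and that of \<open>y\<^sub>2\<close> has \<open>2 + q' \<ge> k\<close>. The complement of
  the common star is the class of edges to be matched.\<close>

lemma three_form_match:
  assumes c1: "competitor R s\<^sub>1 k (evens s\<^sub>2 R)" and c2: "competitor R s\<^sub>2 k (evens s\<^sub>1 R)"
    and f1: "three_form s\<^sub>1 R x\<^sub>0 x\<^sub>1 x\<^sub>2 m q" "k = m + q" and f2: "three_form s\<^sub>2 R y\<^sub>0 y\<^sub>1 y\<^sub>2 m' q'" "m' \<le> 2" "k = m' + q'"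
    and q: "3 \<le> q"
  shows "m = m' \<and> q = q' \<and> between s\<^sub>1 R x\<^sub>2 x\<^sub>0 = between s\<^sub>2 R y\<^sub>2 y\<^sub>0"
proof -
  let ?D = "star s\<^sub>1 R x\<^sub>1"
  note ok1 = competitorD(1)[OF c1] and ok2 = competitorD(1)[OF c2]
  note st1 = three_form_stars[OF ok1 f1(1)] and st2 = three_form_stars[OF ok2 f2(1)]
  have DR: "?D \<subseteq> R" by (auto simp: star_def)
  have "cocycle (evens s\<^sub>2 R) ?D"
    by (rule small_transfer[OF c1 DR star_cocycle[OF c1]]) (use st1(2) f1(2) q in simp)
  then obtain S where S: "S \<subseteq> vs s\<^sub>2 R" "?D = cut s\<^sub>2 R S"
    using cocycle_is_cut[OF ok2 competitorD(2)[OF c2] DR] by blast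
  have "?D \<noteq> {}" using st1(2) by auto
  moreover have V: "vs s\<^sub>2 R = {y\<^sub>0, y\<^sub>1, y\<^sub>2}" "card (vs s\<^sub>2 R) = 3" using f2(1) by (auto simp: three_form_def)
  ultimately obtain y where y: "y \<in> {y\<^sub>0, y\<^sub>1, y\<^sub>2}" "?D = star s\<^sub>2 R y"
    using cut_three[OF ok2 V(2) S(1)] S(2) by auto
  have "card (star s\<^sub>2 R y) < k" using y(2) st1(2) f1(2) q by simp
  then have "y = y\<^sub>1" using y(1) st2 f2(2,3) by auto
  then have "m + 2 = m' + 2" "R - star s\<^sub>2 R y\<^sub>1 = R - ?D" using y(2) st1(2) st2(2) by auto
  then show ?thesis using st1(4) st2(4) f1(2) f2(3) by simp
qed

text \<open>The second conclusion tells which skeleton edges receive the labels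
  \<open>(2, j)\<close>; the ends of these ears are later compared in the two graphs.\<close>

lemma K3_subdivision:
  assumes d: "subdivided s R P E n N L len" and tf: "three_form s R x\<^sub>0 x\<^sub>1 x\<^sub>2 m q"
  shows "\<exists>\<phi> \<beta>. subdivision_via (mk n E) (K3_multi m 2 q) \<phi> (P \<circ> \<beta>) \<and> (\<lambda>j. \<beta> (2, j)) ` {..<q} = between s R x\<^sub>2 x\<^sub>0"
proof -
  interpret subdivided s R P E n N L len by (rule d)
  note f = tf[unfolded three_form_def]
  let ?b = "between s R"
  have finR: "finite R" using ends_okD(1)[OF s_ok] .
  have fin: "finite (?b u v)" for u v using finR by (simp add: between_def)
  have enum: "\<exists>h. bij_betw h {..<card M} M" if "finite M" for M :: "'a set"
    using ex_bij_betw_nat_finite[OF that] by (simp add: atLeast0LessThan)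
  obtain b0 where b0: "bij_betw b0 {..<m} (?b x\<^sub>0 x\<^sub>1)" using enum[OF fin[of x\<^sub>0 x\<^sub>1]] f by auto
  obtain b1 where b1: "bij_betw b1 {..<2 :: nat} (?b x\<^sub>1 x\<^sub>2)" using enum[OF fin[of x\<^sub>1 x\<^sub>2]] f by auto
  obtain b2 where b2: "bij_betw b2 {..<q} (?b x\<^sub>2 x\<^sub>0)" using enum[OF fin[of x\<^sub>2 x\<^sub>0]] f by auto
  define \<beta> where "\<beta> = (\<lambda>(i :: nat, j). if i = 0 then b0 j else if i = 1 then b1 j else b2 j)"
  define \<phi> where "\<phi> i = (if i = 0 then x\<^sub>0 else if i = 1 then x\<^sub>1 else x\<^sub>2)" for i :: nat
  let ?K = "K3_multi m 2 q"
  have edK: "edges ?K = {0} \<times> {..<m} \<union> {1} \<times> {..<2} \<union> {2} \<times> {..<q}" by (simp add: K3_multi_def)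
  have Runion: "R = ?b x\<^sub>0 x\<^sub>1 \<union> ?b x\<^sub>1 x\<^sub>2 \<union> ?b x\<^sub>2 x\<^sub>0" using f by (auto simp: between_def)
  have img: "\<beta> ` edges ?K = R"
  proof -
    have "\<beta> ` ({0} \<times> {..<m}) = b0 ` {..<m}" "\<beta> ` ({1} \<times> {..<2}) = b1 ` {..<2}" "\<beta> ` ({2} \<times> {..<q}) = b2 ` {..<q}"
      by (auto simp: \<beta>_def image_iff)
    then show ?thesis unfolding edK image_Un using b0 b1 b2 Runion by (simp add: bij_betw_def)
  qed
  have d3: "x\<^sub>0 \<noteq> x\<^sub>1" "x\<^sub>1 \<noteq> x\<^sub>2" "x\<^sub>0 \<noteq> x\<^sub>2" using f by auto
  have bij: "bij_betw \<beta> (edges ?K) R"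
  proof -
    have dis: "?b x\<^sub>0 x\<^sub>1 \<inter> ?b x\<^sub>1 x\<^sub>2 = {}" "(?b x\<^sub>0 x\<^sub>1 \<union> ?b x\<^sub>1 x\<^sub>2) \<inter> ?b x\<^sub>2 x\<^sub>0 = {}"
      using d3 by (auto simp: between_def doubleton_eq_iff)
    have "card (?b x\<^sub>0 x\<^sub>1 \<union> ?b x\<^sub>1 x\<^sub>2 \<union> ?b x\<^sub>2 x\<^sub>0) = m + 2 + q"
      using card_Un_disjoint[OF _ _ dis(1)] card_Un_disjoint[OF _ _ dis(2)] fin f by simp
    then have "card R = m + 2 + q" using Runion by simp
    moreover have "card (edges ?K) = m + 2 + q"
    proof -
      have "card (({0} \<times> {..<m} \<union> {1} \<times> {..<2}) \<union> {2} \<times> {..<q} :: (nat \<times> nat) set) =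
          card ({0} \<times> {..<m} \<union> {1} \<times> {..<2} :: (nat \<times> nat) set) + card ({2} \<times> {..<q} :: (nat \<times> nat) set)"
        by (rule card_Un_disjoint) auto
      also have "card ({0} \<times> {..<m} \<union> {1} \<times> {..<2} :: (nat \<times> nat) set) =
          card ({0} \<times> {..<m} :: (nat \<times> nat) set) + card ({1} \<times> {..<2} :: (nat \<times> nat) set)"
        by (rule card_Un_disjoint) auto
      finally show ?thesis unfolding edK by (simp add: card_cartesian_product)
    qed
    ultimately have "inj_on \<beta> (edges ?K)" using eq_card_imp_inj_on[of "edges ?K" \<beta>] img edK by simp
    then show ?thesis using img by (simp add: bij_betw_def)
  qed
  have vK: "verts ?K = {0, 1, 2}" by (auto simp: K3_multi_def)
  have "subdivision_via (mk n E) ?K \<phi> (P \<circ> \<beta>)"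
  proof (rule subdivision_via_transport[OF subdivision_via_self bij])
    show "inj_on \<phi> (verts ?K)" unfolding vK using d3 by (auto simp: \<phi>_def inj_on_def)
    show "\<phi> ` verts ?K = vs s R" unfolding vK using f by (auto simp: \<phi>_def)
    fix e assume e: "e \<in> edges ?K"
    obtain i j where ij: "e = (i, j)" by (cases e)
    from e have "(i = 0 \<and> j < m) \<or> (i = 1 \<and> j < 2) \<or> (i = 2 \<and> j < q)" unfolding edK ij by auto
    then show "\<phi> ` ends ?K e = s (\<beta> e)"
    proof (elim disjE conjE)
      assume "i = 0" "j < m"
      then have "\<beta> e \<in> ?b x\<^sub>0 x\<^sub>1" using b0 ij by (auto simp: \<beta>_def bij_betw_def)
      then show ?thesis using ij \<open>i = 0\<close> by (simp add: K3_multi_def \<phi>_def between_def insert_commute)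
    next
      assume "i = 1" "j < 2"
      then have "\<beta> e \<in> ?b x\<^sub>1 x\<^sub>2" using b1 ij by (auto simp: \<beta>_def bij_betw_def)
      then show ?thesis using ij \<open>i = 1\<close> by (simp add: K3_multi_def \<phi>_def between_def insert_commute)
    next
      assume "i = 2" "j < q"
      then have "\<beta> e \<in> ?b x\<^sub>2 x\<^sub>0" using b2 ij by (auto simp: \<beta>_def bij_betw_def)
      then show ?thesis using ij \<open>i = 2\<close> by (simp add: K3_multi_def \<phi>_def between_def)
    qed
  qed
  moreover have "(\<lambda>j. \<beta> (2, j)) ` {..<q} = ?b x\<^sub>2 x\<^sub>0" using b2 by (simp add: \<beta>_def bij_betw_def)
  ultimately show ?thesis by blast
qed

lemma competitor_loopless:
  assumes c: "competitor R s k \<F>" and V: "card (vs s R) \<ge> 3" and d: "subdivided s R P E n N L len"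
  shows "subdivided_loopless s R P E n N L len"
  using d loopless_case[OF c V] by (simp add: subdivided_loopless_def subdivided_loopless_axioms_def)

lemma competitor_degrees:
  assumes c: "competitor R s k \<F>" and V: "card (vs s R) \<ge> 2" and w: "w \<in> vs s R"
  shows "3 \<le> card (star s R w)"
proof -
  have "vs s R \<noteq> {w}" using V by auto
  then obtain x where "x \<in> vs s R" "x \<noteq> w" using w by auto
  then show ?thesis using star_ge3[OF c w] by metis
qed

text \<open>An ear of the first graph is a series class, and in the second graph every series class
  is an ear.\<close>

lemma ears_subset:
  assumes c1: "competitor R s\<^sub>1 k (evens s\<^sub>2 R)" and c2: "competitor R s\<^sub>2 k (evens s\<^sub>1 R)"
    and V: "card (vs s\<^sub>1 R) \<ge> 3" "card (vs s\<^sub>2 R) \<ge> 3" and cov: "covers R (evens s\<^sub>2 R)"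
    and d1: "subdivided s\<^sub>1 R P E n\<^sub>1 N\<^sub>1 L\<^sub>1 len\<^sub>1" and d2: "subdivided s\<^sub>2 R P E n\<^sub>2 N\<^sub>2 L\<^sub>2 len\<^sub>2"
  shows "ear_edge_sets (mk n\<^sub>1 E) \<subseteq> ear_edge_sets (mk n\<^sub>2 E)"
proof
  interpret H1: subdivided_loopless s\<^sub>1 R P E n\<^sub>1 N\<^sub>1 L\<^sub>1 len\<^sub>1 by (rule competitor_loopless[OF c1 V(1) d1])
  interpret H2: subdivided_loopless s\<^sub>2 R P E n\<^sub>2 N\<^sub>2 L\<^sub>2 len\<^sub>2 by (rule competitor_loopless[OF c2 V(2) d2])
  fix Q assume "Q \<in> ear_edge_sets (mk n\<^sub>1 E)"
  then obtain u v where "is_ear (mk n\<^sub>1 E) u v Q" by (auto simp: ear_edge_sets_def)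
  then obtain r where "r \<in> R" "Q = P r" using H1.ear_is_P competitor_degrees[OF c1] V(1) by (metis Suc_leD numeral_2_eq_2 numeral_3_eq_3)
  then show "Q \<in> ear_edge_sets (mk n\<^sub>2 E)"
    using H2.ear_P[of r] competitor_degrees[OF c2] V(2) cov by (auto simp: ear_edge_sets_def)
qed

section \<open>Four-vertex skeletons\<close>

lemma K4_subdivision:
  assumes d: "subdivided s R P E n N L len" and V: "vs s R = {x, y, a, b}" "distinct [x, y, a, b]"
    and two: "\<And>r. r \<in> R \<Longrightarrow> card (s r) = 2"
    and uniq: "\<And>c d. c \<in> vs s R \<Longrightarrow> d \<in> vs s R \<Longrightarrow> c \<noteq> d \<Longrightarrow> card (between s R c d) = 1"
  shows "is_subdivision (mk n E) K4"
proof -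
  interpret subdivided s R P E n N L len by (rule d)
  define \<phi> where "\<phi> i = [x, y, a, b] ! i" for i
  have inj: "inj_on \<phi> {..<4}"
    unfolding \<phi>_def using V(2) by (intro inj_on_nth) auto
  have img: "\<phi> ` {..<4} = vs s R"
  proof -
    have "{..<4::nat} = {0, 1, 2, 3}" by auto
    then show ?thesis unfolding V(1) by (simp add: \<phi>_def)
  qed
  define \<beta> where "\<beta> e = (THE r. r \<in> R \<and> s r = \<phi> ` e)" for e
  have edK: "edges K4 = {e. e \<subseteq> {..<4} \<and> card e = 2}" and enK: "ends K4 = (\<lambda>e. e)" and vK: "verts K4 = {..<4}"
    by (simp_all add: K4_def)
  have ex1: "\<exists>!r. r \<in> R \<and> s r = \<phi> ` e" if e: "e \<in> edges K4" for e
  proof -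
    obtain i j where ij: "e = {i, j}" "i \<noteq> j" using e unfolding edK by (auto simp: card_2_iff)
    then have "i < 4" "j < 4" using e unfolding edK by auto
    then have "\<phi> i \<in> vs s R" "\<phi> j \<in> vs s R" "\<phi> i \<noteq> \<phi> j" using img inj ij(2) by (auto dest: inj_onD)
    then have "card (between s R (\<phi> i) (\<phi> j)) = 1" using uniq by blast
    then obtain r where "between s R (\<phi> i) (\<phi> j) = {r}" by (auto simp: card_1_singleton_iff)
    then have "{r' \<in> R. s r' = \<phi> ` e} = {r}" using ij(1) by (simp add: between_def)
    then show ?thesis by (intro ex1I[of _ r]) auto
  qed
  have \<beta>: "\<beta> e \<in> R \<and> s (\<beta> e) = \<phi> ` e" if "e \<in> edges K4" for e
    unfolding \<beta>_def using theI'[OF ex1[OF that]] .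
  have "bij_betw \<beta> (edges K4) R"
    unfolding bij_betw_def
  proof
    show "inj_on \<beta> (edges K4)"
    proof (rule inj_onI)
      fix e e' assume e: "e \<in> edges K4" "e' \<in> edges K4" "\<beta> e = \<beta> e'"
      then have "\<phi> ` e = \<phi> ` e'" using \<beta> by metis
      moreover have "e \<subseteq> {..<4}" "e' \<subseteq> {..<4}" using e edK by auto
      ultimately show "e = e'" using inj_on_image_eq_iff[OF inj] by blast
    qed
    show "\<beta> ` edges K4 = R"
    proof
      show "\<beta> ` edges K4 \<subseteq> R" using \<beta> by blast
      show "R \<subseteq> \<beta> ` edges K4"
      proof
        fix r assume r: "r \<in> R"
        obtain c d where cd: "s r = {c, d}" "c \<noteq> d" using two[OF r] by (auto simp: card_2_iff)
        have "{c, d} \<subseteq> vs s R" using r cd by (auto simp: vs_def)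
        then obtain i j where ij: "i < 4" "j < 4" "c = \<phi> i" "d = \<phi> j" unfolding img[symmetric] by auto
        then have "i \<noteq> j" using cd(2) by auto
        then have "{i, j} \<in> edges K4" unfolding edK using ij(1,2) by simp
        moreover have "s r = \<phi> ` {i, j}" using ij cd by auto
        ultimately have "\<beta> {i, j} = r" unfolding \<beta>_def by (intro the1_equality[OF ex1]) (use r in auto)
        then show "r \<in> \<beta> ` edges K4" using \<open>{i, j} \<in> edges K4\<close> by blast
      qed
    qed
  qed
  then have "subdivision_via (mk n E) K4 \<phi> (P \<circ> \<beta>)"
    by (rule subdivision_via_transport[OF subdivision_via_self]) (use inj img vK enK \<beta> in auto)
  then show ?thesis unfolding is_subdivision_def by blast
qed

lemma four_form_exists:
  assumes c: "competitor R s k \<F>" and V: "card (vs s R) = 4"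
  shows "\<exists>x y a b A\<^sub>1 A\<^sub>2 A\<^sub>3 A\<^sub>4 A\<^sub>5 B. four_form s R x y a b A\<^sub>1 A\<^sub>2 A\<^sub>3 A\<^sub>4 A\<^sub>5 B \<and> vs s R = {x, y, a, b} \<and>
    B = between s R x y \<and> card B + 2 = k"
proof -
  obtain x y a b where f: "distinct [x, y, a, b]" "vs s R = {x, y, a, b}"
    "\<forall>e\<in>R. s e = {x, y} \<or> s e = {x, a} \<or> s e = {x, b} \<or> s e = {y, a} \<or> s e = {y, b} \<or> s e = {a, b}"
    "card (between s R x a) = 1" "card (between s R x b) = 1" "card (between s R y a) = 1"
    "card (between s R y b) = 1" "card (between s R a b) = 1" "card (between s R x y) + 2 = k"
    using case_four[OF c V] by blast
  obtain A1 A2 A3 A4 A5 where A: "between s R x a = {A1}" "between s R x b = {A2}" "between s R y a = {A3}"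
    "between s R y b = {A4}" "between s R a b = {A5}" using f(4-8) by (auto simp: card_1_singleton_iff)
  have sA: "s A1 = {x, a}" "s A2 = {x, b}" "s A3 = {y, a}" "s A4 = {y, b}" "s A5 = {a, b}"
    and RA: "A1 \<in> R" "A2 \<in> R" "A3 \<in> R" "A4 \<in> R" "A5 \<in> R"
  proof -
    have "A1 \<in> between s R x a" "A2 \<in> between s R x b" "A3 \<in> between s R y a" "A4 \<in> between s R y b" "A5 \<in> between s R a b"
      unfolding A by simp_all
    then show "s A1 = {x, a}" "s A2 = {x, b}" "s A3 = {y, a}" "s A4 = {y, b}" "s A5 = {a, b}"
      "A1 \<in> R" "A2 \<in> R" "A3 \<in> R" "A4 \<in> R" "A5 \<in> R" by (simp_all add: between_def)
  qed
  let ?B = "between s R x y"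
  have "R = {A1, A2, A3, A4, A5} \<union> ?B"
  proof
    show "R \<subseteq> {A1, A2, A3, A4, A5} \<union> ?B"
    proof
      fix e assume e: "e \<in> R"
      then have "e \<in> ?B \<or> e \<in> between s R x a \<or> e \<in> between s R x b \<or> e \<in> between s R y a \<or> e \<in> between s R y b \<or> e \<in> between s R a b"
        using f(3) by (simp add: between_def)
      then show "e \<in> {A1, A2, A3, A4, A5} \<union> ?B" unfolding A by blast
    qed
  qed (use RA in \<open>auto simp: between_def\<close>)
  moreover have "distinct [A1, A2, A3, A4, A5]" "{A1, A2, A3, A4, A5} \<inter> ?B = {}"
    using sA f(1) by (auto simp: between_def doubleton_eq_iff)
  ultimately have "four_form s R x y a b A1 A2 A3 A4 A5 ?B"
    unfolding four_form_def using f(1) sA by (simp add: between_def)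
  then show ?thesis using f(2,9) by blast
qed

lemma four_form_stars:
  assumes ff: "four_form s R x y a b A\<^sub>1 A\<^sub>2 A\<^sub>3 A\<^sub>4 A\<^sub>5 B"
  shows "star s R a = {A\<^sub>1, A\<^sub>3, A\<^sub>5}" "star s R b = {A\<^sub>2, A\<^sub>4, A\<^sub>5}"
proof -
  note f = ff[unfolded four_form_def]
  have R: "R = {A\<^sub>1, A\<^sub>2, A\<^sub>3, A\<^sub>4, A\<^sub>5} \<union> B" using f by blast
  have B: "e \<notin> star s R a" "e \<notin> star s R b" if "e \<in> B" for e using f that by (auto simp: star_def)
  have A: "A\<^sub>1 \<in> star s R a" "A\<^sub>3 \<in> star s R a" "A\<^sub>5 \<in> star s R a" "A\<^sub>2 \<notin> star s R a" "A\<^sub>4 \<notin> star s R a"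
    "A\<^sub>2 \<in> star s R b" "A\<^sub>4 \<in> star s R b" "A\<^sub>5 \<in> star s R b" "A\<^sub>1 \<notin> star s R b" "A\<^sub>3 \<notin> star s R b"
    using f by (auto simp: star_def)
  have "star s R v \<subseteq> R" for v by (auto simp: star_def)
  then show "star s R a = {A\<^sub>1, A\<^sub>3, A\<^sub>5}" "star s R b = {A\<^sub>2, A\<^sub>4, A\<^sub>5}"
    using A B R by blast+
qed

text \<open>Up to complement, \<open>x\<close> lies outside the side \<open>T\<close>. If
  \<open>y\<close> were inside, the cut would contain \<open>B\<close>, one of
  \<open>A\<^sub>1\<close>, \<open>A\<^sub>3\<close> and one of \<open>A\<^sub>2\<close>,
  \<open>A\<^sub>4\<close>, which are at least four edges. So \<open>T\<close> is contained in
  \<open>{a, b}\<close>, and both vertices together give four edges again.\<close>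

lemma four_form_small_cut:
  assumes ok: "ends_ok s R" and ff: "four_form s R x y a b A\<^sub>1 A\<^sub>2 A\<^sub>3 A\<^sub>4 A\<^sub>5 B" and V: "vs s R = {x, y, a, b}"
    and B: "card B \<ge> 2" and S: "S \<subseteq> vs s R" "card (cut s R S) = 3"
  shows "cut s R S = {A\<^sub>1, A\<^sub>3, A\<^sub>5} \<or> cut s R S = {A\<^sub>2, A\<^sub>4, A\<^sub>5}"
proof -
  note f = ff[unfolded four_form_def]
  have d: "x \<noteq> y" "x \<noteq> a" "x \<noteq> b" "y \<noteq> a" "y \<noteq> b" "a \<noteq> b" using f by auto
  have R: "A\<^sub>1 \<in> R" "A\<^sub>2 \<in> R" "A\<^sub>3 \<in> R" "A\<^sub>4 \<in> R" "A\<^sub>5 \<in> R" "B \<subseteq> R" using f by auto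
  have fin: "finite R" "finite B" using ends_okD(1)[OF ok] R(6) finite_subset by auto
  have fincut: "finite (cut s R S)" for S using fin(1) cut_subset finite_subset by metis
  define T where "T = (if x \<in> S then vs s R - S else S)"
  have T: "x \<notin> T" "cut s R T = cut s R S" "T \<subseteq> {x, y, a, b}"
    using cut_complement[OF ok, of S] S(1) V by (auto simp: T_def)
  have memA: "A\<^sub>1 \<in> cut s R T \<longleftrightarrow> a \<in> T" "A\<^sub>2 \<in> cut s R T \<longleftrightarrow> b \<in> T"
    using f R T(1) by (auto simp: cut_def)
  have memA': "A\<^sub>3 \<in> cut s R T \<longleftrightarrow> (y \<in> T) \<noteq> (a \<in> T)" "A\<^sub>4 \<in> cut s R T \<longleftrightarrow> (y \<in> T) \<noteq> (b \<in> T)"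
    using f R by (auto simp: cut_def)
  have "y \<notin> T"
  proof
    assume y: "y \<in> T"
    have Bc: "B \<subseteq> cut s R T" using f R(6) y T(1) by (auto simp: cut_def)
    obtain X where X: "X = A\<^sub>1 \<or> X = A\<^sub>3" "X \<in> cut s R T" using memA memA' y by blast
    obtain Y where Y: "Y = A\<^sub>2 \<or> Y = A\<^sub>4" "Y \<in> cut s R T" using memA memA' y by blast
    have "X \<noteq> Y" "X \<notin> B" "Y \<notin> B" using X(1) Y(1) f by auto
    then have "card (insert X (insert Y B)) = card B + 2" using fin by simp
    moreover have "card (insert X (insert Y B)) \<le> card (cut s R T)"
      using X Y Bc fincut by (intro card_mono) auto
    ultimately show False using B S(2) T(2) by simp
  qed
  then have Bn: "e \<notin> cut s R T" if "e \<in> B" for e using f that T(1) by (auto simp: cut_def)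
  have A5: "A\<^sub>5 \<in> cut s R T \<longleftrightarrow> (a \<in> T) \<noteq> (b \<in> T)" using f R by (auto simp: cut_def)
  have mem3: "A\<^sub>3 \<in> cut s R T \<longleftrightarrow> a \<in> T" "A\<^sub>4 \<in> cut s R T \<longleftrightarrow> b \<in> T" using memA' \<open>y \<notin> T\<close> by auto
  have sub: "cut s R T \<subseteq> {A\<^sub>1, A\<^sub>2, A\<^sub>3, A\<^sub>4, A\<^sub>5}" using cut_subset[of s R T] Bn f by blast
  consider "a \<in> T" "b \<in> T" | "a \<in> T" "b \<notin> T" | "a \<notin> T" "b \<in> T" | "a \<notin> T" "b \<notin> T" by blast
  then show ?thesis
  proof cases
    case 1
    then have "cut s R T = {A\<^sub>1, A\<^sub>2, A\<^sub>3, A\<^sub>4}" using sub memA mem3 A5 by blast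
    then have "card (cut s R T) = 4" using f by simp
    then show ?thesis using S(2) T(2) by simp
  next
    case 2
    then have "cut s R T = {A\<^sub>1, A\<^sub>3, A\<^sub>5}" using sub memA mem3 A5 by blast
    then show ?thesis using T(2) by simp
  next
    case 3
    then have "cut s R T = {A\<^sub>2, A\<^sub>4, A\<^sub>5}" using sub memA mem3 A5 by blast
    then show ?thesis using T(2) by simp
  next
    case 4
    then have "cut s R T = {}" using sub memA mem3 A5 by blast
    then show ?thesis using S(2) T(2) by simp
  qed
qed

lemma four_form_rest:
  assumes "four_form s R x y a b A\<^sub>1 A\<^sub>2 A\<^sub>3 A\<^sub>4 A\<^sub>5 B"
  shows "B = R - {A\<^sub>1, A\<^sub>2, A\<^sub>3, A\<^sub>4, A\<^sub>5}"
proof -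
  have "R = {A\<^sub>1, A\<^sub>2, A\<^sub>3, A\<^sub>4, A\<^sub>5} \<union> B" "{A\<^sub>1, A\<^sub>2, A\<^sub>3, A\<^sub>4, A\<^sub>5} \<inter> B = {}"
    using assms by (simp_all only: four_form_def)
  then show ?thesis by blast
qed

lemma four_form_iso:
  assumes ff: "four_form s R x y a b A\<^sub>1 A\<^sub>2 A\<^sub>3 A\<^sub>4 A\<^sub>5 B" and ff': "four_form s' R x' y' a' b' A\<^sub>1 A\<^sub>2 A\<^sub>3 A\<^sub>4 A\<^sub>5 B"
  shows "iso R s s'"
proof -
  note f = ff[unfolded four_form_def] and f' = ff'[unfolded four_form_def]
  define g where "g v = (if v = x then x' else if v = y then y' else if v = a then a' else b')" for v
  have d: "distinct [x, y, a, b]" "distinct [x', y', a', b']" using f f' by blast+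
  have g: "g x = x'" "g y = y'" "g a = a'" "g b = b'" using d by (auto simp: g_def)
  have R: "R = {A\<^sub>1, A\<^sub>2, A\<^sub>3, A\<^sub>4, A\<^sub>5} \<union> B" using f by blast
  have e: "s' e = g ` s e \<and> s e \<subseteq> {x, y, a, b}" if "e \<in> R" for e
  proof (cases "e \<in> B")
    case True
    then have "s e = {x, y}" "s' e = {x', y'}" using f f' by blast+
    then show ?thesis using g by auto
  next
    case False
    then have "e = A\<^sub>1 \<or> e = A\<^sub>2 \<or> e = A\<^sub>3 \<or> e = A\<^sub>4 \<or> e = A\<^sub>5" using that R by blast
    then show ?thesis using f f' g by (elim disjE) simp_all
  qed
  have "inj_on g {x, y, a, b}" using d g by (auto simp: inj_on_def)
  moreover have "vs s R \<subseteq> {x, y, a, b}" using e by (auto simp: vs_def)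
  ultimately have "inj_on g (vs s R)" by (rule inj_on_subset)
  then show ?thesis unfolding iso_def using e by blast
qed

text \<open>As \<open>k \<ge> 4\<close>, the stars of \<open>a\<close> and \<open>b\<close>, with
  three edges each, are cuts of the second skeleton, and by size the stars of its vertices
  \<open>a'\<close> and \<open>b'\<close>. Their common edge fixes \<open>A\<^sub>5\<close>; open is
  only the order within \<open>{A\<^sub>1, A\<^sub>3}\<close> and within
  \<open>{A\<^sub>2, A\<^sub>4}\<close>. Up to exchanging the two vertices of large degree, either
  both orders are kept and the skeletons are isomorphic, which is excluded, or
  \<open>A\<^sub>2\<close> and \<open>A\<^sub>4\<close> are exchanged.\<close>

lemma four_form_match:
  assumes c1: "competitor R s\<^sub>1 k (evens s\<^sub>2 R)" and c2: "competitor R s\<^sub>2 k (evens s\<^sub>1 R)" and k: "k \<ge> 4"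
    and f1: "four_form s\<^sub>1 R x y a b A\<^sub>1 A\<^sub>2 A\<^sub>3 A\<^sub>4 A\<^sub>5 B" "card B + 2 = k"
    and f2: "four_form s\<^sub>2 R x' y' a' b' B\<^sub>1 B\<^sub>2 B\<^sub>3 B\<^sub>4 B\<^sub>5 B'" "vs s\<^sub>2 R = {x', y', a', b'}" "card B' + 2 = k"
  shows "\<exists>u v c d. four_form s\<^sub>2 R u v c d A\<^sub>1 A\<^sub>4 A\<^sub>3 A\<^sub>2 A\<^sub>5 B"
proof -
  note ok2 = competitorD(1)[OF c2]
  have ne: "evens s\<^sub>1 R \<noteq> evens s\<^sub>2 R" using c1 by (auto simp: competitor_def)
  have dA: "distinct [A\<^sub>1, A\<^sub>2, A\<^sub>3, A\<^sub>4, A\<^sub>5]" and dB: "distinct [B\<^sub>1, B\<^sub>2, B\<^sub>3, B\<^sub>4, B\<^sub>5]"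
    using f1(1) f2(1) by (auto simp: four_form_def)
  have transfer: "D = {B\<^sub>1, B\<^sub>3, B\<^sub>5} \<or> D = {B\<^sub>2, B\<^sub>4, B\<^sub>5}" if D: "D = star s\<^sub>1 R v" "card D = 3" for D v
  proof -
    have DR: "D \<subseteq> R" using D by (auto simp: star_def)
    have "cocycle (evens s\<^sub>2 R) D"
      by (rule small_transfer[OF c1 DR]) (use star_cocycle[OF c1] D k in auto)
    then obtain S where "S \<subseteq> vs s\<^sub>2 R" "D = cut s\<^sub>2 R S"
      using cocycle_is_cut[OF ok2 competitorD(2)[OF c2] DR] by blast
    then show ?thesis using four_form_small_cut[OF ok2 f2(1,2)] f2(3) k D(2) by auto
  qed
  have sa: "{A\<^sub>1, A\<^sub>3, A\<^sub>5} = {B\<^sub>1, B\<^sub>3, B\<^sub>5} \<or> {A\<^sub>1, A\<^sub>3, A\<^sub>5} = {B\<^sub>2, B\<^sub>4, B\<^sub>5}"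
    by (rule transfer[OF four_form_stars(1)[OF f1(1), symmetric]]) (use dA in simp)
  have sb: "{A\<^sub>2, A\<^sub>4, A\<^sub>5} = {B\<^sub>1, B\<^sub>3, B\<^sub>5} \<or> {A\<^sub>2, A\<^sub>4, A\<^sub>5} = {B\<^sub>2, B\<^sub>4, B\<^sub>5}"
    by (rule transfer[OF four_form_stars(2)[OF f1(1), symmetric]]) (use dA in simp)
  have dif: "{A\<^sub>1, A\<^sub>3, A\<^sub>5} \<noteq> {A\<^sub>2, A\<^sub>4, A\<^sub>5}" using dA by auto
  have main: ?thesis
    if g: "four_form s\<^sub>2 R u v c d C\<^sub>1 C\<^sub>2 C\<^sub>3 C\<^sub>4 C\<^sub>5 B'" and e1: "{A\<^sub>1, A\<^sub>3, A\<^sub>5} = {C\<^sub>1, C\<^sub>3, C\<^sub>5}"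
      and e2: "{A\<^sub>2, A\<^sub>4, A\<^sub>5} = {C\<^sub>2, C\<^sub>4, C\<^sub>5}" for u v c d C\<^sub>1 C\<^sub>2 C\<^sub>3 C\<^sub>4 C\<^sub>5
  proof -
    have dC: "distinct [C\<^sub>1, C\<^sub>2, C\<^sub>3, C\<^sub>4, C\<^sub>5]" using g by (auto simp: four_form_def)
    have "{A\<^sub>5} = {A\<^sub>1, A\<^sub>3, A\<^sub>5} \<inter> {A\<^sub>2, A\<^sub>4, A\<^sub>5}" using dA by auto
    also have "\<dots> = {C\<^sub>5}" unfolding e1 e2 using dC by auto
    finally have A5: "C\<^sub>5 = A\<^sub>5" by simp
    have "{A\<^sub>1, A\<^sub>3} = {A\<^sub>1, A\<^sub>3, A\<^sub>5} - {A\<^sub>5}" using dA by auto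
    also have "\<dots> = {C\<^sub>1, C\<^sub>3}" unfolding e1 using A5 dC by auto
    finally have p1: "(C\<^sub>1 = A\<^sub>1 \<and> C\<^sub>3 = A\<^sub>3) \<or> (C\<^sub>1 = A\<^sub>3 \<and> C\<^sub>3 = A\<^sub>1)" by (auto simp: doubleton_eq_iff)
    have "{A\<^sub>2, A\<^sub>4} = {A\<^sub>2, A\<^sub>4, A\<^sub>5} - {A\<^sub>5}" using dA by auto
    also have "\<dots> = {C\<^sub>2, C\<^sub>4}" unfolding e2 using A5 dC by auto
    finally have p2: "(C\<^sub>2 = A\<^sub>2 \<and> C\<^sub>4 = A\<^sub>4) \<or> (C\<^sub>2 = A\<^sub>4 \<and> C\<^sub>4 = A\<^sub>2)" by (auto simp: doubleton_eq_iff)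
    have "B = R - {A\<^sub>1, A\<^sub>2, A\<^sub>3, A\<^sub>4, A\<^sub>5}" "B' = R - {C\<^sub>1, C\<^sub>2, C\<^sub>3, C\<^sub>4, C\<^sub>5}"
      using four_form_rest[OF f1(1)] four_form_rest[OF g] .
    moreover have "{A\<^sub>1, A\<^sub>2, A\<^sub>3, A\<^sub>4, A\<^sub>5} = {C\<^sub>1, C\<^sub>2, C\<^sub>3, C\<^sub>4, C\<^sub>5}" using p1 p2 A5 by auto
    ultimately have BB: "B' = B" by simp
    note g' = four_form_swap(2)[OF g]
    from p1 p2 consider (1) "C\<^sub>1 = A\<^sub>1" "C\<^sub>3 = A\<^sub>3" "C\<^sub>2 = A\<^sub>2" "C\<^sub>4 = A\<^sub>4" | (2) "C\<^sub>1 = A\<^sub>1" "C\<^sub>3 = A\<^sub>3" "C\<^sub>2 = A\<^sub>4" "C\<^sub>4 = A\<^sub>2"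
      | (3) "C\<^sub>1 = A\<^sub>3" "C\<^sub>3 = A\<^sub>1" "C\<^sub>2 = A\<^sub>2" "C\<^sub>4 = A\<^sub>4" | (4) "C\<^sub>1 = A\<^sub>3" "C\<^sub>3 = A\<^sub>1" "C\<^sub>2 = A\<^sub>4" "C\<^sub>4 = A\<^sub>2"
      by blast
    then show ?thesis
    proof cases
      case 1
      then have "iso R s\<^sub>1 s\<^sub>2" using four_form_iso[OF f1(1)] g A5 BB by simp
      then show ?thesis using iso_evens ne by metis
    next
      case 2
      then show ?thesis using g A5 BB by blast
    next
      case 3
      then show ?thesis using g' A5 BB by blast
    next
      case 4
      then have "iso R s\<^sub>1 s\<^sub>2" using four_form_iso[OF f1(1)] g' A5 BB by simp
      then show ?thesis using iso_evens ne by metis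
    qed
  qed
  from sa sb dif consider "{A\<^sub>1, A\<^sub>3, A\<^sub>5} = {B\<^sub>1, B\<^sub>3, B\<^sub>5}" "{A\<^sub>2, A\<^sub>4, A\<^sub>5} = {B\<^sub>2, B\<^sub>4, B\<^sub>5}"
    | "{A\<^sub>1, A\<^sub>3, A\<^sub>5} = {B\<^sub>2, B\<^sub>4, B\<^sub>5}" "{A\<^sub>2, A\<^sub>4, A\<^sub>5} = {B\<^sub>1, B\<^sub>3, B\<^sub>5}" by metis
  then show ?thesis
  proof cases
    case 1
    then show ?thesis using main[OF f2(1)] by blast
  next
    case 2
    then show ?thesis using main[OF four_form_swap(1)[OF f2(1)]] by blast
  qed
qed

text \<open>For \<open>k = 3\<close> a single edge joins \<open>x\<close> and \<open>y\<close>, so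
  each of the six pairs of vertices is joined exactly once.\<close>

lemma four_vertex_K4:
  assumes c: "competitor R s 3 \<F>" and V: "card (vs s R) = 4" and d: "subdivided s R P E n N L len"
  shows "is_subdivision (mk n E) K4"
proof -
  obtain x y a b where f: "distinct [x, y, a, b]" "vs s R = {x, y, a, b}"
    "card (between s R x a) = 1" "card (between s R x b) = 1" "card (between s R y a) = 1"
    "card (between s R y b) = 1" "card (between s R a b) = 1" "card (between s R x y) + 2 = 3"
    using case_four[OF c V] by blast
  have "card (between s R u v) = 1" if "u \<in> vs s R" "v \<in> vs s R" "u \<noteq> v" for u v
    using that f unfolding f(2)
    by (elim insertE emptyE) (simp_all add: between_commute[of s R y x] between_commute[of s R a x]
      between_commute[of s R b x] between_commute[of s R a y] between_commute[of s R b y] between_commute[of s R b a])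
  then show ?thesis using K4_subdivision[OF d f(2,1)] loopless_case[OF c] V by auto
qed

lemma (in subdivided_loopless) ear_between:
  assumes r: "r \<in> R" "s r = {u, v}" and deg: "\<And>w. w \<in> vs s R \<Longrightarrow> 3 \<le> card (star s R w)" and cov: "covers R (evens s R)"
  shows "is_ear H u v (P r)"
proof -
  have "{N r 0, N r (len r)} = {u, v}" using s_N[OF r(1)] r(2) by simp
  then have "(N r 0 = u \<and> N r (len r) = v) \<or> (N r 0 = v \<and> N r (len r) = u)" by (simp add: doubleton_eq_iff)
  then show ?thesis using ear_P[OF r(1) deg cov] is_ear_sym by auto
qed

lemma three_vertex_conclusion:
  fixes s\<^sub>1 s\<^sub>2 :: "'e \<Rightarrow> nat set"
  assumes c1: "competitor R s\<^sub>1 k (evens s\<^sub>2 R)" and c2: "competitor R s\<^sub>2 k (evens s\<^sub>1 R)"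
    and V: "card (vs s\<^sub>1 R) = 3" "card (vs s\<^sub>2 R) = 3" and cov: "covers R (evens s\<^sub>2 R)"
    and d1: "subdivided s\<^sub>1 R P E n\<^sub>1 N\<^sub>1 L\<^sub>1 len\<^sub>1" and d2: "subdivided s\<^sub>2 R P E n\<^sub>2 N\<^sub>2 L\<^sub>2 len\<^sub>2"
  shows "\<exists>m\<in>{1, 2}. \<exists>q\<ge>2. \<exists>\<phi> Q. subdivision_via (mk n\<^sub>1 E) (K3_multi m 2 q) \<phi> Q \<and>
    is_subdivision (mk n\<^sub>2 E) (K3_multi m 2 q) \<and> ear_edge_sets (mk n\<^sub>1 E) \<subseteq> ear_edge_sets (mk n\<^sub>2 E) \<and>
    (3 \<le> q \<longrightarrow> (\<exists>u v. \<forall>j<q. is_ear (mk n\<^sub>2 E) u v (Q (2, j))))"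
proof -
  obtain x\<^sub>0 x\<^sub>1 x\<^sub>2 m q where f1: "three_form s\<^sub>1 R x\<^sub>0 x\<^sub>1 x\<^sub>2 m q" "m \<in> {1, 2}" "2 \<le> q" "k = m + q"
    using three_form_exists[OF c1 V(1)] by blast
  obtain y\<^sub>0 y\<^sub>1 y\<^sub>2 m' q' where f2: "three_form s\<^sub>2 R y\<^sub>0 y\<^sub>1 y\<^sub>2 m' q'" "m' \<in> {1, 2}" "2 \<le> q'" "k = m' + q'"
    using three_form_exists[OF c2 V(2)] by blast
  have le2: "m \<le> 2" "m' \<le> 2" using f1(2) f2(2) by auto
  note match1 = three_form_match[OF c1 c2 f1(1,4) f2(1) le2(2) f2(4)]
  note match2 = three_form_match[OF c2 c1 f2(1,4) f1(1) le2(1) f1(4)]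
  \<comment> \<open>If neither \<open>q\<close> nor \<open>q'\<close> exceeds two, both equal two,
    and \<open>k = m + q\<close> settles \<open>m\<close>; otherwise the larger one starts the
    matching.\<close>
  have eq: "m' = m" "q' = q"
  proof -
    have "m = m' \<and> q = q'"
    proof (cases "3 \<le> q \<or> 3 \<le> q'")
      case True
      then show ?thesis using match1 match2 by auto
    next
      case False
      then show ?thesis using f1(3,4) f2(3,4) by auto
    qed
    then show "m' = m" "q' = q" by auto
  qed
  obtain \<phi> \<beta> where sv: "subdivision_via (mk n\<^sub>1 E) (K3_multi m 2 q) \<phi> (P \<circ> \<beta>)"
    and \<beta>: "(\<lambda>j. \<beta> (2, j)) ` {..<q} = between s\<^sub>1 R x\<^sub>2 x\<^sub>0" using K3_subdivision[OF d1 f1(1)] by blast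
  have "is_subdivision (mk n\<^sub>2 E) (K3_multi m 2 q)"
    using K3_subdivision[OF d2 f2(1)] eq unfolding is_subdivision_def by blast
  moreover have "ear_edge_sets (mk n\<^sub>1 E) \<subseteq> ear_edge_sets (mk n\<^sub>2 E)"
    using ears_subset[OF c1 c2 _ _ cov d1 d2] V by simp
  moreover have "\<exists>u v. \<forall>j<q. is_ear (mk n\<^sub>2 E) u v ((P \<circ> \<beta>) (2, j))" if q: "3 \<le> q"
  proof -
    interpret H: subdivided_loopless s\<^sub>2 R P E n\<^sub>2 N\<^sub>2 L\<^sub>2 len\<^sub>2 by (rule competitor_loopless[OF c2 _ d2]) (simp add: V)
    have "is_ear (mk n\<^sub>2 E) y\<^sub>2 y\<^sub>0 (P (\<beta> (2, j)))" if j: "j < q" for j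
    proof -
      have "\<beta> (2, j) \<in> between s\<^sub>1 R x\<^sub>2 x\<^sub>0" using \<beta> j by blast
      then have "\<beta> (2, j) \<in> R" "s\<^sub>2 (\<beta> (2, j)) = {y\<^sub>2, y\<^sub>0}" using match1[OF q] by (auto simp: between_def)
      then show ?thesis using H.ear_between competitor_degrees[OF c2] V cov by simp
    qed
    then show ?thesis by auto
  qed
  ultimately show ?thesis using sv f1(2,3) by blast
qed

lemma four_vertex_type_c:
  assumes c1: "competitor R s\<^sub>1 k (evens s\<^sub>2 R)" and c2: "competitor R s\<^sub>2 k (evens s\<^sub>1 R)" and k: "k \<ge> 4"
    and V: "card (vs s\<^sub>1 R) = 4" "card (vs s\<^sub>2 R) = 4"
    and d1: "subdivided s\<^sub>1 R P E n\<^sub>1 N\<^sub>1 L\<^sub>1 len\<^sub>1" and d2: "subdivided s\<^sub>2 R P E n\<^sub>2 N\<^sub>2 L\<^sub>2 len\<^sub>2"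
  shows "exceptional_pair (mk n\<^sub>1 E) (mk n\<^sub>2 E)"
proof -
  obtain x y a b A\<^sub>1 A\<^sub>2 A\<^sub>3 A\<^sub>4 A\<^sub>5 B where f1: "four_form s\<^sub>1 R x y a b A\<^sub>1 A\<^sub>2 A\<^sub>3 A\<^sub>4 A\<^sub>5 B" "card B + 2 = k"
    using four_form_exists[OF c1 V(1)] by metis
  obtain x' y' a' b' B\<^sub>1 B\<^sub>2 B\<^sub>3 B\<^sub>4 B\<^sub>5 B' where f2: "four_form s\<^sub>2 R x' y' a' b' B\<^sub>1 B\<^sub>2 B\<^sub>3 B\<^sub>4 B\<^sub>5 B'"
    "vs s\<^sub>2 R = {x', y', a', b'}" "card B' + 2 = k"
    using four_form_exists[OF c2 V(2)] by metis
  obtain u v c d where "four_form s\<^sub>2 R u v c d A\<^sub>1 A\<^sub>4 A\<^sub>3 A\<^sub>2 A\<^sub>5 B"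
    using four_form_match[OF c1 c2 k f1 f2] by blast
  then have "type_c (mk n\<^sub>1 E) (mk n\<^sub>2 E)"
    using type_cI[OF d1 d2 f1(1)] f1(2) k by simp
  then show ?thesis by (simp add: exceptional_pair_def)
qed

theorem theorem1p2:
  fixes G\<^sub>1 :: "('v, 'e) mgraph" and G\<^sub>2 :: "('w, 'e) mgraph"
  assumes "graph G\<^sub>1" and "graph G\<^sub>2"
    and "two_edge_connected G\<^sub>1"
    and "\<exists>C\<in>circuits (bicircular_lift G\<^sub>1). \<exists>D\<in>circuits (bicircular_lift G\<^sub>1). C \<noteq> D"
    and "bicircular_lift G\<^sub>1 = bicircular_lift G\<^sub>2"
  shows "two_isomorphic G\<^sub>1 G\<^sub>2
    \<or> (\<exists>(H\<^sub>1 :: (nat, 'e) mgraph) (H\<^sub>2 :: (nat, 'e) mgraph).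
        graph H\<^sub>1 \<and> graph H\<^sub>2 \<and>
        is_subdivision H\<^sub>1 K4 \<and> is_subdivision H\<^sub>2 K4 \<and>
        two_isomorphic G\<^sub>1 H\<^sub>1 \<and> two_isomorphic G\<^sub>2 H\<^sub>2 \<and>
        ear_edge_sets H\<^sub>1 \<subseteq> ear_edge_sets H\<^sub>2)
    \<or> (\<exists>m\<in>{1, 2}. \<exists>n\<ge>2. \<exists>(H\<^sub>1 :: (nat, 'e) mgraph) (H\<^sub>2 :: (nat, 'e) mgraph). \<exists>\<phi> P.
        graph H\<^sub>1 \<and> graph H\<^sub>2 \<and>
        subdivision_via H\<^sub>1 (K3_multi m 2 n) \<phi> P \<and> is_subdivision H\<^sub>2 (K3_multi m 2 n) \<and>
        two_isomorphic G\<^sub>1 H\<^sub>1 \<and> two_isomorphic G\<^sub>2 H\<^sub>2 \<and>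
        ear_edge_sets H\<^sub>1 \<subseteq> ear_edge_sets H\<^sub>2 \<and>
        (n \<ge> 3 \<longrightarrow> (\<exists>u v. \<forall>j<n. is_ear H\<^sub>2 u v (P (2, j)))))
    \<or> (\<exists>(H\<^sub>1 :: (nat, 'e) mgraph) (H\<^sub>2 :: (nat, 'e) mgraph).
        graph H\<^sub>1 \<and> graph H\<^sub>2 \<and> exceptional_pair H\<^sub>1 H\<^sub>2 \<and>
        two_isomorphic G\<^sub>1 H\<^sub>1 \<and> two_isomorphic G\<^sub>2 H\<^sub>2)"
proof -
  define E where "E = edges G\<^sub>1"
  note ls = lift_spaces[OF assms E_def refl refl]
  have E: "edges G\<^sub>1 = E" "edges G\<^sub>2 = E" using ls(1) by (simp_all add: E_def)
  have ne: "E \<noteq> {}"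
  proof
    obtain C D where "C \<in> circuits (bicircular_lift G\<^sub>1)" "D \<in> circuits (bicircular_lift G\<^sub>1)" "C \<noteq> D"
      using assms(4) by blast
    moreover assume "E = {}"
    ultimately show False using circuit_in[OF assms(1), of C] circuit_in[OF assms(1), of D] E(1) by auto
  qed
  show ?thesis
  proof (cases "evens (ends G\<^sub>1) E = evens (ends G\<^sub>2) E")
    case True
    then show ?thesis using two_isomorphicI[OF assms(1,2) E ne] by blast
  next
    case False
    obtain R P k and s\<^sub>1 :: "'e \<Rightarrow> nat set" and s\<^sub>2 :: "'e \<Rightarrow> nat set" where cp: "class_partition E R P"
      and c1: "competitor R s\<^sub>1 k (evens s\<^sub>2 R)" and c2: "competitor R s\<^sub>2 k (evens s\<^sub>1 R)"
      and cov: "covers R (evens s\<^sub>2 R)"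
      and ev: "evens (ends G\<^sub>1) E = blow_up P (evens s\<^sub>1 R)" "evens (ends G\<^sub>2) E = blow_up P (evens s\<^sub>2 R)"
      using skeletons[OF assms E(1) False] by blast
    obtain n\<^sub>1 L\<^sub>1 len\<^sub>1 and N\<^sub>1 :: "'e \<Rightarrow> nat \<Rightarrow> nat" where d1: "subdivided s\<^sub>1 R P E n\<^sub>1 N\<^sub>1 L\<^sub>1 len\<^sub>1"
      and H1: "graph (mk n\<^sub>1 E)" "two_isomorphic G\<^sub>1 (mk n\<^sub>1 E)"
      using realize[OF assms(1) E(1) ne competitorD(1)[OF c1] cp ev(1)] by blast
    obtain n\<^sub>2 L\<^sub>2 len\<^sub>2 and N\<^sub>2 :: "'e \<Rightarrow> nat \<Rightarrow> nat" where d2: "subdivided s\<^sub>2 R P E n\<^sub>2 N\<^sub>2 L\<^sub>2 len\<^sub>2"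
      and H2: "graph (mk n\<^sub>2 E)" "two_isomorphic G\<^sub>2 (mk n\<^sub>2 E)"
      using realize[OF assms(2) E(2) ne competitorD(1)[OF c2] cp ev(2)] by blast
    \<comment> \<open>The skeletons are connected with the same edges and the same nullity.\<close>
    have same: "card (vs s\<^sub>2 R) = card (vs s\<^sub>1 R)"
      using competitor_card(1)[OF c1] competitor_card(1)[OF c2] by simp
    from vertex_cases[OF c1] consider "card (vs s\<^sub>1 R) = 2" | "card (vs s\<^sub>1 R) = 3" | "card (vs s\<^sub>1 R) = 4" by blast
    then show ?thesis
    proof cases
      case 1
      then have "exceptional_pair (mk n\<^sub>1 E) (mk n\<^sub>2 E)"
        using two_vertex_exceptional[OF c1 c2 _ _ d1 d2] same by simp
      then show ?thesis using H1 H2 by blast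
    next
      case 2
      have V2: "card (vs s\<^sub>2 R) = 3" using same 2 by simp
      obtain m q \<phi> Q where
        "m \<in> {1, 2}" "2 \<le> q" "subdivision_via (mk n\<^sub>1 E) (K3_multi m 2 q) \<phi> Q"
        "is_subdivision (mk n\<^sub>2 E) (K3_multi m 2 q)" "ear_edge_sets (mk n\<^sub>1 E) \<subseteq> ear_edge_sets (mk n\<^sub>2 E)"
        "3 \<le> q \<longrightarrow> (\<exists>u v. \<forall>j<q. is_ear (mk n\<^sub>2 E) u v (Q (2, j)))"
        using three_vertex_conclusion[OF c1 c2 2 V2 cov d1 d2] by blast
      then show ?thesis using H1 H2 by blast
    next
      case 3
      show ?thesis
      \<comment> \<open>The stars with three edges are cocycles of the other skeleton by size only
        if \<open>k > 3\<close>.\<close>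
      proof (cases "k = 3")
        case True
        have "is_subdivision (mk n\<^sub>1 E) K4" "is_subdivision (mk n\<^sub>2 E) K4"
          using four_vertex_K4 c1 c2 d1 d2 True 3 same by metis+
        moreover have "ear_edge_sets (mk n\<^sub>1 E) \<subseteq> ear_edge_sets (mk n\<^sub>2 E)"
          using ears_subset[OF c1 c2 _ _ cov d1 d2] 3 same by simp
        ultimately show ?thesis using H1 H2 by blast
      next
        case False
        then have "exceptional_pair (mk n\<^sub>1 E) (mk n\<^sub>2 E)"
          using four_vertex_type_c[OF c1 c2 _ _ _ d1 d2] competitorD(5)[OF c1] 3 same by simp
        then show ?thesis using H1 H2 by blast
      qed
    qed
  qed
qed

end
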